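(* Let $n\ge3$, let $\Omega\subset\mathbb{R}^n$ be a ring-shaped domain with smooth boundary, with inner boundary component $\Gamma_1$ and outer boundary component $\Gamma_2$, and let $u$ solve $\Delta u=-n$ in $\Omega$, $u=0$ on $\partial\Omega$. Assume $\mathcal{H}^{n-1}(\mathrm{MAX}(u))>0$. Then the expected core radii $R_1=R(u,\Gamma_1)$ and $R_2=R(u,\Gamma_2)$ are both well-defined. If $\tau(u,\Gamma_2)<\sqrt n$, then $$R_2\ge R_1>0.$$ Moreover, $R_1=R_2=:R$ if and only if $(\Omega,u)$ is equivalent to the ring-shaped model solution $(\Omega_R,u_R)$.
   Context: A ring-shaped domain is a bounded domain whose boundary consists of exactly two connected components; $\Gamma_1$ (inner) is the one enclosed by $\Gamma_2$ (outer). Notation: $u_{\max}=\max_\Omega u$, $\mathrm{MAX}(u)=\{x\in\Omega:u(x)=u_{\max}\}$. Two solutions $(\Omega,u),(\bar\Omega,\bar u)$ are equivalent if $\bar\Omega=\{\lambda x+c:x\in\Omega\}$ and $\bar u(y)=\lambda^2u((y-c)/\lambda)$ for some $\lambda>0$, $c\in\mathbb{R}^n$. NWSS: for a connected component $S$ of $\partial\Omega$, $\tau(u,S)=\max_S|\nabla u|/\sqrt{2u_{\max}}$. Model solutions: $R_{\max}=\sqrt{(n-2)/n}$; for $R\in(0,R_{\max})$, $r_1(R)<R<r_2(R)$ are the two positive zeros of $f_R(r)=1-r^2-\frac{2R^n}{(n-2)r^{n-2}}$, $\Omega_R=\{r_1<|x|<r_2\}$, $u_R(x)=\frac{1-|x|^2}{2}-\frac{R^n}{(n-2)|x|^{n-2}}$,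 $(u_R)_{\max}=\frac12(1-\frac{n}{n-2}R^2)$. For $R=0$: $u_0=(1-|x|^2)/2$ on $B_1(0)$, $r_2(0)=1$. $\tau_1:(0,R_{\max}]\to[\sqrt n,\infty)$, $\tau_1(R)=\frac{r_1(R^n/r_1^n-1)}{\sqrt{1-nR^2/(n-2)}}$ ($R<R_{\max}$), $\tau_1(R_{\max})=\sqrt n$, continuous strictly decreasing; $\tau_2:[0,R_{\max})\to[1,\sqrt n)$, $\tau_2(0)=1$, $\tau_2(R)=\frac{r_2(1-R^n/r_2^n)}{\sqrt{1-nR^2/(n-2)}}$, continuous strictly increasing. Expected core radius: $R(u,S)=\tau_2^{-1}(\tau(u,S))$ if $\tau(u,S)\in[1,\sqrt n)$, and $R(u,S)=\tau_1^{-1}(\tau(u,S))$ if $\tau(u,S)\ge\sqrt n$. *)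

theory Defs
  imports "HOL-Analysis.Analysis"
begin

fun Ck_on :: "nat \<Rightarrow> 'a::euclidean_space set \<Rightarrow> ('a \<Rightarrow> real) \<Rightarrow> bool" where
  "Ck_on 0 U f = continuous_on U f"
| "Ck_on (Suc k) U f =
     (f differentiable_on U \<and> (\<forall>v. Ck_on k U (\<lambda>x. frechet_derivative f (at x) v)))"

definition smooth_on :: "'a::euclidean_space set \<Rightarrow> ('a \<Rightarrow> real) \<Rightarrow> bool" where
  "smooth_on U f \<longleftrightarrow> (\<forall>k. Ck_on k U f)"

definition grad :: "('a::euclidean_space \<Rightarrow> real) \<Rightarrow> 'a \<Rightarrow> 'a" where
  "grad f x = (\<Sum>b\<in>Basis. frechet_derivative f (at x) b *\<^sub>R b)"

definition laplacian :: "('a::euclidean_space \<Rightarrow> real) \<Rightarrow> 'a \<Rightarrow> real" where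
  "laplacian f x =
     (\<Sum>b\<in>Basis. frechet_derivative (\<lambda>y. frechet_derivative f (at y) b) (at x) b)"

definition hausdorff_const :: "real \<Rightarrow> real" where
  "hausdorff_const s = pi powr (s / 2) / Gamma (s / 2 + 1)"

definition hausdorff_pre :: "real \<Rightarrow> real \<Rightarrow> 'a::metric_space set \<Rightarrow> ennreal" where
  "hausdorff_pre s \<delta> A =
     (INF C \<in> {C :: nat \<Rightarrow> 'a set. A \<subseteq> (\<Union>i. C i) \<and> (\<forall>i. bounded (C i) \<and> diameter (C i) \<le> \<delta>)}.
        (\<Sum>i. ennreal (hausdorff_const s * (diameter (C i) / 2) powr s)))"

definition hausdorff_measure :: "real \<Rightarrow> 'a::metric_space set \<Rightarrow> ennreal" where
  "hausdorff_measure s A = (SUP \<delta> \<in> {0<..}. hausdorff_pre s \<delta> A)"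

definition ring_shaped :: "'a::euclidean_space set \<Rightarrow> 'a set \<Rightarrow> 'a set \<Rightarrow> bool" where
  "ring_shaped \<Omega> \<Gamma>1 \<Gamma>2 \<longleftrightarrow>
     open \<Omega> \<and> connected \<Omega> \<and> bounded \<Omega> \<and> \<Omega> \<noteq> {} \<and>
     components (frontier \<Omega>) = {\<Gamma>1, \<Gamma>2} \<and> \<Gamma>1 \<noteq> \<Gamma>2 \<and>
     \<Gamma>1 \<subseteq> \<Union>{C \<in> components (- \<Gamma>2). bounded C}"

definition smooth_boundary :: "'a::euclidean_space set \<Rightarrow> bool" where
  "smooth_boundary \<Omega> \<longleftrightarrow>
     (\<forall>p\<in>frontier \<Omega>. \<exists>U \<phi>. open U \<and> p \<in> U \<and> smooth_on U \<phi> \<and>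
        frechet_derivative \<phi> (at p) \<noteq> (\<lambda>_. 0) \<and> \<Omega> \<inter> U = {x \<in> U. \<phi> x < 0})"

definition umax :: "'a set \<Rightarrow> ('a \<Rightarrow> real) \<Rightarrow> real" where
  "umax \<Omega> u = Sup (u ` \<Omega>)"

definition MAXset :: "'a set \<Rightarrow> ('a \<Rightarrow> real) \<Rightarrow> 'a set" where
  "MAXset \<Omega> u = {x \<in> \<Omega>. u x = umax \<Omega> u}"

definition bdry_grad_norm :: "'a::euclidean_space set \<Rightarrow> ('a \<Rightarrow> real) \<Rightarrow> 'a \<Rightarrow> real" where
  "bdry_grad_norm \<Omega> u x = Lim (at x within \<Omega>) (\<lambda>y. norm (grad u y))"

definition nwss :: "'a::euclidean_space set \<Rightarrow> ('a \<Rightarrow> real) \<Rightarrow> 'a set \<Rightarrow> real" where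
  "nwss \<Omega> u S = Sup (bdry_grad_norm \<Omega> u ` S) / sqrt (2 * umax \<Omega> u)"

definition Rmax :: "nat \<Rightarrow> real" where
  "Rmax n = sqrt ((real n - 2) / real n)"

definition fR :: "nat \<Rightarrow> real \<Rightarrow> real \<Rightarrow> real" where
  "fR n R r = 1 - r\<^sup>2 - 2 * R ^ n / ((real n - 2) * r ^ (n - 2))"

definition r1 :: "nat \<Rightarrow> real \<Rightarrow> real" where
  "r1 n R = (THE r. 0 < r \<and> r < R \<and> fR n R r = 0)"

definition r2 :: "nat \<Rightarrow> real \<Rightarrow> real" where
  "r2 n R = (if R = 0 then 1 else (THE r. R < r \<and> fR n R r = 0))"

definition Omega_model :: "nat \<Rightarrow> real \<Rightarrow> 'a::euclidean_space set" where
  "Omega_model n R = {x. r1 n R < norm x \<and> norm x < r2 n R}"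

definition u_model :: "nat \<Rightarrow> real \<Rightarrow> 'a::euclidean_space \<Rightarrow> real" where
  "u_model n R x = (1 - (norm x)\<^sup>2) / 2 - R ^ n / ((real n - 2) * norm x ^ (n - 2))"

definition tau1 :: "nat \<Rightarrow> real \<Rightarrow> real" where
  "tau1 n R = (if R = Rmax n then sqrt (real n)
     else r1 n R * (R ^ n / r1 n R ^ n - 1) / sqrt (1 - real n * R\<^sup>2 / (real n - 2)))"

definition tau2 :: "nat \<Rightarrow> real \<Rightarrow> real" where
  "tau2 n R = (if R = 0 then 1
     else r2 n R * (1 - R ^ n / r2 n R ^ n) / sqrt (1 - real n * R\<^sup>2 / (real n - 2)))"

definition core_radius_rel :: "nat \<Rightarrow> real \<Rightarrow> real \<Rightarrow> bool" where
  "core_radius_rel n t R \<longleftrightarrow>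
     (1 \<le> t \<and> t < sqrt (real n) \<and> 0 \<le> R \<and> R < Rmax n \<and> tau2 n R = t) \<or>
     (sqrt (real n) \<le> t \<and> 0 < R \<and> R \<le> Rmax n \<and> tau1 n R = t)"

definition core_radius :: "nat \<Rightarrow> real \<Rightarrow> real" where
  "core_radius n t = (THE R. core_radius_rel n t R)"

definition equiv_sol :: "'a::euclidean_space set \<Rightarrow> ('a \<Rightarrow> real) \<Rightarrow> 'a set \<Rightarrow> ('a \<Rightarrow> real) \<Rightarrow> bool" where
  "equiv_sol \<Omega> u \<Omega>' u' \<longleftrightarrow>
     (\<exists>k>0. \<exists>c. \<Omega>' = (\<lambda>x. k *\<^sub>R x + c) ` \<Omega> \<and>
        (\<forall>y\<in>\<Omega>'. u' y = k\<^sup>2 * u ((1 / k) *\<^sub>R (y - c))))"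

end

theory Submission
 imports Defs "HOL-Complex_Analysis.Complex_Analysis"
begin

text \<open>Both sides of the inequality are read off from the third-order expansion of \<open>u\<close> at the core.
 Since \<open>u\<close> is real analytic, a maximum set of positive measure contains a closed two-sided hypersurface
 piece \<open>E\<close>, along which the Hessian is $-n \nu \otimes \nu$; the orientation of this line field splits
 $\Omega - E$ into two open sides, each reaching one boundary component. On each side $W = |\nabla u|^2$ is
 compared, by a maximum principle, with the model profile $F(u_{\max} - u)$ of the expected core radius.
 At a point of \<open>E\<close> the comparisons bound the same third-order coefficient from both sides, which orders
 the two radii. Equality at a single point propagates by the strong maximum principle and forces \<open>u\<close>
 to be radial.\<close>

text \<open>Why the third order: near the core the models agree to second order, with depth n s^2/2
  and squared gradient 2n times the depth. The radius rho first enters through the cubic term, where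
  the third normal derivative equals n(n-1)/rho. Both comparisons bound this one derivative of u at
  one common point, so no curvature of the core is needed. Three obstacles shape the proof. Measure
  alone gives no surface: in a direction b of strict concavity the maximum set lies in the analytic
  graph where the b-derivative of u vanishes, and constancy of u on a piece of positive measure
  spreads over that graph. The core may be disconnected and its normal unoriented: adding the
  squared distance to the core as an extra coordinate to the gradient gives a line field on a whole
  ball, where it can be oriented. Finally the equation for the squared gradient has a zero-order
  term whose sign is wrong inside the core; the excess over the model is therefore divided by a
  suitable function of the depth before the maximum principle is applied.\<close>

notation scaleR (infixr "*R" 75)

abbreviation pd :: "'a::euclidean_space => ('a => real) => 'a => real" where
 "pd v f \<equiv> %x. frechet_derivative f (at x) v"

section \<open>Calculus of C^k functions on open sets\<close>

lemma frechet_derivative_eqI: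
 "(f has_derivative D) (at x) ==> frechet_derivative f (at x) = D"
 by (rule frechet_derivative_at[symmetric])

lemma differentiable_on_openD:
 assumes "open S" "f differentiable_on S" "x \<in> S"
 shows "f differentiable (at x)"
 using assms at_within_open[of x S] by (auto simp: differentiable_on_def)

lemma has_derivative_frechet:
 "f differentiable (at x) ==> (f has_derivative frechet_derivative f (at x)) (at x)"
 by (simp add: frechet_derivative_works[symmetric])

lemma frechet_derivative_cong_open:
 assumes "open S" "x \<in> S" "!!y. y \<in> S ==> f y = g y"
 shows "frechet_derivative f (at x) = frechet_derivative g (at x)"
proof -
 have "(f has_derivative D) (at x) \<longleftrightarrow> (g has_derivative D) (at x)" for D
  using has_derivative_transform_within_open[of f D x UNIV S g]
   has_derivative_transform_within_open[of g D x UNIV S f] assms by auto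
 then show ?thesis unfolding frechet_derivative_def by simp
qed

lemma Ck_on_Suc_iff:
 assumes "open S"
 shows "Ck_on (Suc k) S f \<longleftrightarrow> (\<forall>x\<in>S. f differentiable (at x)) & (\<forall>v. Ck_on k S (pd v f))"
proof -
 have "f differentiable_on S \<longleftrightarrow> (\<forall>x\<in>S. f differentiable (at x))"
  unfolding differentiable_on_def using at_within_open[OF _ assms] by (metis (no_types, lifting))
 then show ?thesis by simp
qed

lemma Ck_on_Suc_diff: "open S ==> Ck_on (Suc k) S f ==> x \<in> S ==> f differentiable (at x)"
 by (simp add: differentiable_on_openD)

lemma Ck_on_Suc_pd: "Ck_on (Suc k) S f ==> Ck_on k S (pd v f)"
 by simp

lemma Ck_on_cong:
 assumes "open S" "!!x. x \<in> S ==> f x = g x" "Ck_on k S f"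
 shows "Ck_on k S g"
 using assms(2,3)
proof (induction k arbitrary: f g)
 case 0 then show ?case using continuous_on_cong[OF refl, of S f g] by simp
next
 case (Suc k)
 have "g differentiable (at x)" if "x \<in> S" for x
 proof -
  have "(f has_derivative frechet_derivative f (at x)) (at x)"
   by (rule has_derivative_frechet[OF Ck_on_Suc_diff[OF assms(1) Suc.prems(2) that]])
  then have "(g has_derivative frechet_derivative f (at x)) (at x)"
   by (rule has_derivative_transform_within_open[OF _ assms(1) that Suc.prems(1)])
  then show ?thesis unfolding differentiable_def by blast
 qed
 moreover have "Ck_on k S (pd v g)" for v
 proof -
  have 1: "Ck_on k S (pd v f)" by (rule Ck_on_Suc_pd[OF Suc.prems(2)])
  have "pd v f x = pd v g x" if "x \<in> S" for x
   using frechet_derivative_cong_open[of S x f g, OF assms(1) that Suc.prems(1)] by metis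
  from Suc.IH[OF this 1] show ?thesis .
 qed
 ultimately show ?case unfolding Ck_on_Suc_iff[OF assms(1)] by simp
qed

lemma Ck_on_SucI:
 assumes "open S" "!!x. x \<in> S ==> (f has_derivative D x) (at x)"
  and "!!v. Ck_on k S (%x. D x v)"
 shows "Ck_on (Suc k) S f"
 unfolding Ck_on_Suc_iff[OF assms(1)]
proof (intro conjI ballI allI)
 show "f differentiable at x" if "x \<in> S" for x
  using assms(2)[OF that] unfolding differentiable_def by blast
 fix v show "Ck_on k S (pd v f)"
  by (rule Ck_on_cong[OF assms(1) _ assms(3)[of v]]) (simp add: frechet_derivative_eqI[OF assms(2)])
qed

lemma Ck_on_SucD:
 assumes "open S" "Ck_on (Suc k) S f"
 shows "Ck_on k S f"
 using assms(2)
proof (induction k arbitrary: f)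
 case 0 then show ?case by (simp add: differentiable_imp_continuous_on)
next
 case (Suc k)
 have "Ck_on k S (pd v f)" for v
 proof -
  have "Ck_on (Suc k) S (pd v f)" by (rule Ck_on_Suc_pd[OF Suc.prems])
  then show ?thesis by (rule Suc.IH)
 qed
 moreover have "\<forall>x\<in>S. f differentiable at x"
  using Ck_on_Suc_diff[OF assms(1) Suc.prems] by simp
 ultimately show ?case unfolding Ck_on_Suc_iff[OF assms(1)] by simp
qed

lemma Ck_on_le:
 assumes "open S" "Ck_on k S f" "j <= k"
 shows "Ck_on j S f"
 using assms(3,2)
proof (induction k rule: dec_induct)
 case (step n) then show ?case using Ck_on_SucD[OF assms(1)] by blast
qed

lemma Ck_on_subset:
 assumes "open S" "open T" "T \<subseteq> S" "Ck_on k S f"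
 shows "Ck_on k T f"
 using assms(4)
proof (induction k arbitrary: f)
 case 0 then show ?case using continuous_on_subset[OF _ assms(3), of f] by simp
next
 case (Suc k)
 then have "Ck_on k T (pd v f)" for v by (intro Suc.IH Ck_on_Suc_pd)
 then show ?case
  using Ck_on_Suc_diff[OF assms(1) Suc.prems] assms(3) unfolding Ck_on_Suc_iff[OF assms(2)] by (simp add: subset_eq)
qed

lemma Ck_on_localI:
 assumes "open S" "!!x. x \<in> S ==> \<exists>T. open T & x \<in> T & T \<subseteq> S & Ck_on k T f"
 shows "Ck_on k S f"
 using assms(2)
proof (induction k arbitrary: f)
 case 0
 have "isCont f x" if "x \<in> S" for x
 proof -
  from 0[OF that] obtain T where "open T" "x \<in> T" "continuous_on T f" by auto
  then show ?thesis using continuous_on_eq_continuous_at by blast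
 qed
 then show ?case using assms(1) by (simp add: continuous_on_eq_continuous_at)
next
 case (Suc k)
 have d: "f differentiable at x" if "x \<in> S" for x
 proof -
  from Suc.prems[OF that] obtain T where T: "open T" "x \<in> T" "T \<subseteq> S" "Ck_on (Suc k) T f" by blast
  show ?thesis by (rule Ck_on_Suc_diff[OF T(1,4,2)])
 qed
 have "Ck_on k S (pd v f)" for v
 proof (rule Suc.IH)
  fix x assume "x \<in> S"
  from Suc.prems[OF this] obtain T where T: "open T" "x \<in> T" "T \<subseteq> S" "Ck_on (Suc k) T f" by blast
  then show "\<exists>T. open T & x \<in> T & T \<subseteq> S & Ck_on k T (pd v f)" by (intro exI[of _ T] conjI T Ck_on_Suc_pd[OF T(4)])
 qed
 with d show ?case unfolding Ck_on_Suc_iff[OF assms(1)] by simp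
qed

lemma Ck_on_const: "open S ==> Ck_on k S (%x. c)"
proof (induction k arbitrary: c)
 case (Suc k) show ?case
  by (rule Ck_on_SucI[where D="%x v. 0", OF Suc.prems has_derivative_const Suc.IH[OF Suc.prems]])
qed simp

lemma Ck_on_linear:
 assumes "open S" "bounded_linear f" shows "Ck_on k S f"
proof (cases k)
 case 0 then show ?thesis using assms by (simp add: linear_continuous_on)
next
 case (Suc j) show ?thesis unfolding Suc
  by (rule Ck_on_SucI[where D="%x. f", OF assms(1) bounded_linear_imp_has_derivative[OF assms(2)] Ck_on_const[OF assms(1)]])
qed

lemma Ck_on_add:
 assumes "open S" "Ck_on k S f" "Ck_on k S g"
 shows "Ck_on k S (%x. f x+g x)"
 using assms(2,3)
proof (induction k arbitrary: f g)
 case 0 then show ?case by (simp add: continuous_on_add)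
next
 case (Suc k)
 have "f differentiable at x" "g differentiable at x" if "x \<in> S" for x
  using Suc.prems Ck_on_Suc_diff[OF assms(1)] that by auto
 moreover have "Ck_on k S (pd v f)" "Ck_on k S (pd v g)" for v
  using Suc.prems by auto
 ultimately show ?case
  by (intro Ck_on_SucI[where D="%x v. pd v f x+pd v g x", OF assms(1)] has_derivative_add has_derivative_frechet Suc.IH)
qed

lemma Ck_on_mult:
 assumes "open S" "Ck_on k S f" "Ck_on k S g"
 shows "Ck_on k S (%x. f x*g x)"
 using assms(2,3)
proof (induction k arbitrary: f g)
 case 0 then show ?case by (simp add: continuous_on_mult)
next
 case (Suc k) show ?case
 proof (rule Ck_on_SucI[where D="%x v. f x*pd v g x+pd v f x*g x"])
  fix x assume "x \<in> S"
  then have "f differentiable at x" "g differentiable at x"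
   using Suc.prems Ck_on_Suc_diff[OF assms(1)] by auto
  then show "((%x. f x*g x) has_derivative (%v. f x*pd v g x+pd v f x*g x)) (at x)"
   by (intro has_derivative_mult has_derivative_frechet)
 next
  fix v
  have "Ck_on k S (pd v f)" "Ck_on k S (pd v g)" "Ck_on k S f" "Ck_on k S g"
   using Suc.prems Ck_on_SucD[OF assms(1)] by auto
  then show "Ck_on k S (%x. f x*pd v g x+pd v f x*g x)"
   by (intro Ck_on_add assms(1) Suc.IH)
 qed (rule assms)
qed

lemma Ck_on_cmult: "open S ==> Ck_on k S f ==> Ck_on k S (%x. c*f x)"
 using Ck_on_mult Ck_on_const by blast

lemma Ck_on_diff:
 "open S ==> Ck_on k S f ==> Ck_on k S g ==> Ck_on k S (%x. f x-g x)"
 using Ck_on_add[of S k f "%x. -1*g x"] Ck_on_cmult[of S k g "-1"] by simp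

lemma Ck_on_sum:
 assumes "open S" "!!i. i \<in> I ==> Ck_on k S (f i)"
 shows "Ck_on k S (%x. \<Sum>i\<in>I. f i x)"
 using assms(2)
 by (induction I rule: infinite_finite_induct) (simp_all add: Ck_on_add Ck_on_const assms(1))

text \<open>The outer function is given with the sequence of its derivatives, so that the induction
  passes from \<open>F\<close> to the shifted sequence and the chain rule is used only once per
  order.\<close>

lemma Ck_on_compose_real:
 assumes "open S" "Ck_on k S h" "h ` S \<subseteq> T"
  and "!!j t. j < k ==> t \<in> T ==> DERIV (F j) t :> F (Suc j) t"
  and "continuous_on T (F k)"
 shows "Ck_on k S (%x. F 0 (h x))"
 using assms(2,4,5)
proof (induction k arbitrary: F)
 case 0 then show ?case using assms(3) by (auto intro: continuous_on_compose2)
next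
 case (Suc k) 
 show ?case
 proof (rule Ck_on_SucI[where D="%x v. F 1 (h x)*pd v h x"])
  fix x assume x: "x \<in> S"
  then have "(h has_derivative frechet_derivative h (at x)) (at x)"
   using Suc.prems(1) Ck_on_Suc_diff[OF assms(1)] has_derivative_frechet by blast
  moreover have "(F 0 has_derivative (%t. F 1 (h x)*t)) (at (h x))"
   using Suc.prems(2)[of 0 "h x"] x assms(3) by (auto simp: has_field_derivative_def)
  ultimately show "((%x. F 0 (h x)) has_derivative (%v. F 1 (h x)*pd v h x)) (at x)"
   by (rule has_derivative_compose)
 next
  fix v
  have "Ck_on k S (%x. (%j. F (Suc j)) 0 (h x))"
   by (rule Suc.IH[OF Ck_on_SucD[OF assms(1) Suc.prems(1)]]) (use Suc.prems(2,3) in auto)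
  moreover have "Ck_on k S (pd v h)" using Suc.prems(1) by simp
  ultimately show "Ck_on k S (%x. F 1 (h x)*pd v h x)"
   using Ck_on_mult[OF assms(1), of k "%x. F 1 (h x)" "pd v h"] by simp
 qed (rule assms)
qed

lemma has_real_derivative_along:
 assumes "f differentiable at (x+t *R a)"
 shows "DERIV (%t. f (x+t *R a)) t :> pd a f (x+t *R a)"
proof -
 have "((%t. x+t *R a) has_derivative (%s. s *R a)) (at t)"
  by (auto intro!: derivative_eq_intros)
 from has_derivative_compose[OF this has_derivative_frechet[OF assms]]
 have "((%t. f (x+t *R a)) has_derivative (%s. frechet_derivative f (at (x+t *R a)) (s *R a))) (at t)" .
 moreover have "(%s. frechet_derivative f (at (x+t *R a)) (s *R a)) = (%s. pd a f (x+t *R a) * s)"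
  using linear_frechet_derivative[OF assms] by (auto simp: linear_cmul)
 ultimately show ?thesis by (simp add: has_field_derivative_def)
qed

text \<open>Both mixed derivatives are realised by the same second difference quotient.\<close>
lemma second_difference_mvt:
 assumes S: "open S" and C: "Ck_on 2 S f" and h: "h > 0" and sub: "ball x r \<subseteq> S" and hr: "h*(norm a+norm b) < r"
 shows "\<exists>y. dist x y <= h*(norm a+norm b) & 
  f (x+h *R a+h *R b)-f (x+h *R a)-f (x+h *R b)+f x = h^2*pd b (pd a f) y"
proof -
 have mem: "dist x (x+t *R a+s *R b) <= h*(norm a+norm b)" "x+t *R a+s *R b \<in> S" if "0 <= t" "t <= h" "0 <= s" "s <= h" for t s
 proof -
  have "norm (t *R a+s *R b) <= t*norm a+s*norm b"
   using that norm_triangle_ineq[of "t *R a" "s *R b"] by simp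
  also have "... <= h*(norm a+norm b)"
   unfolding distrib_left using that by (intro add_mono mult_right_mono) auto
  also have "norm (t *R a+s *R b) = norm (x+t *R a+s *R b-x)" by simp
  finally show d: "dist x (x+t *R a+s *R b) <= h*(norm a+norm b)"
   by (simp only: dist_norm norm_minus_commute)
  have "x+t *R a+s *R b \<in> ball x r" using order.strict_trans1[OF d hr] by (simp only: mem_ball)
  then show "x+t *R a+s *R b \<in> S" by (rule subsetD[OF sub])
 qed
 have f1: "f differentiable (at y)" if "y \<in> S" for y
  using Ck_on_Suc_diff[OF S C[unfolded numeral_2_eq_2] that] .
 have C1: "Ck_on (Suc 0) S (pd a f)" using C[unfolded numeral_2_eq_2] by (rule Ck_on_Suc_pd)
 have f2: "pd a f differentiable (at y)" if "y \<in> S" for y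
  using Ck_on_Suc_diff[OF S C1 that] .
 \<comment> \<open>The first difference in direction b. The mean value theorem in direction a
   applied to \<open>K\<close>, and then in direction b to the a-derivative of f, evaluates the full
   second difference.\<close>
 define K where "K t = f (x+h *R b+t *R a)-f (x+t *R a)" for t
 have dK: "DERIV K t :> (pd a f (x+h *R b+t *R a)-pd a f (x+t *R a))"
  if t: "0 <= t" "t <= h" for t
 proof -
  have "x+t *R a+h *R b \<in> S" by (rule mem(2)) (use t h in auto)
  then have 1: "x+h *R b+t *R a \<in> S" by (simp add: add.commute add.left_commute)
  have "x+t *R a+0 *R b \<in> S" by (rule mem(2)) (use t h in auto)
  then have 2: "x+t *R a \<in> S" by simp
  show ?thesis unfolding K_def
   by (rule DERIV_diff[OF has_real_derivative_along[OF f1[OF 1]] has_real_derivative_along[OF f1[OF 2]]])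
 qed
 from MVT2[OF h, of K, OF dK] obtain z where z: "0 < z" "z < h"
  "K h-K 0 = h*(pd a f (x+h *R b+z *R a)-pd a f (x+z *R a))" by auto
 have "DERIV (%s. pd a f (x+z *R a+s *R b)) s :> pd b (pd a f) (x+z *R a+s *R b)"
  if "0 <= s" "s <= h" for s
  by (rule has_real_derivative_along[OF f2[OF mem(2)]]) (use that z in auto)
 from MVT2[OF h this] obtain w where w: "0 < w" "w < h"
  "pd a f (x+z *R a+h *R b)-pd a f (x+z *R a+0 *R b) = h*pd b (pd a f) (x+z *R a+w *R b)" by auto
 have "f (x+h *R a+h *R b)-f (x+h *R a)-f (x+h *R b)+f x = K h-K 0"
  unfolding K_def by (simp add: add.commute add.left_commute)
 also have "... = h^2*pd b (pd a f) (x+z *R a+w *R b)"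
  using z w by (simp add: algebra_simps power2_eq_square)
 finally show ?thesis using mem(1)[of z w] z w by auto
qed

text \<open>If the mixed derivatives differed at x, continuity would keep their values apart near x.
  A small second difference over a parallelogram is symmetric in a and b, and it is a value of each
  of them.\<close>

lemma pd_commute:
 assumes S: "open S" and C: "Ck_on 2 S f" and x: "x \<in> S"
 shows "pd a (pd b f) x = pd b (pd a f) x"
proof (rule ccontr)
 let ?P = "pd a (pd b f)" and ?Q = "pd b (pd a f)"
 assume ne: "?P x ~= ?Q x"
 have c: "continuous_on S ?P" "continuous_on S ?Q" using C by (simp_all add: numeral_2_eq_2)
 define e where "e = \<bar>?P x-?Q x\<bar>/2"
 have e: "e > 0" using ne by (simp add: e_def)
 obtain r0 where r0: "r0 > 0" "ball x r0 \<subseteq> S" using S x open_contains_ball by blast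
 from c(1) x e obtain r1 where r1: "r1 > 0" "!!y. dist y x < r1 ==> dist (?P y) (?P x) < e"
  unfolding continuous_on_eq_continuous_at[OF S] continuous_at_eps_delta by metis
 from c(2) x e obtain r2 where r2: "r2 > 0" "!!y. dist y x < r2 ==> dist (?Q y) (?Q x) < e"
  unfolding continuous_on_eq_continuous_at[OF S] continuous_at_eps_delta by metis
 define r where "r = min r0 (min r1 r2)"
 define N where "N = norm a+norm b"
 \<comment> \<open>Small enough for the parallelogram with edges h a and h b to fit in the ball of
   radius r; the added 1 covers the case that both directions vanish.\<close>
 define h where "h = r/(2*(N+1))"
 have N: "N >= 0" by (simp add: N_def)
 have r: "r > 0" using r0 r1 r2 by (simp add: r_def)
 have h: "h > 0" unfolding h_def using r N by (intro divide_pos_pos) auto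
 have "h*(2*(N+1)) = r" unfolding h_def using N by (intro nonzero_eq_divide_eq[THEN iffD1]) auto
 then have "h*N+h = r/2" by (simp add: distrib_left)
 then have "h*N < r" using h r by linarith
 then have hr: "h*(norm a+norm b) < r" by (simp only: N_def)
 have "ball x r \<subseteq> ball x r0" by (rule subset_ball) (simp add: r_def)
 then have sub: "ball x r \<subseteq> S" using r0(2) by (rule subset_trans)
 from second_difference_mvt[OF S C h sub hr] obtain y where y: "dist x y <= h*(norm a+norm b)"
  "f (x+h *R a+h *R b)-f (x+h *R a)-f (x+h *R b)+f x = h^2*?Q y" by (elim exE conjE)
 have hr': "h*(norm b+norm a) < r" using hr by (simp only: add.commute)
 from second_difference_mvt[OF S C h sub hr'] obtain z where z: "dist x z <= h*(norm b+norm a)"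
  "f (x+h *R b+h *R a)-f (x+h *R b)-f (x+h *R a)+f x = h^2*?P z"
  by (elim exE conjE)
 have "h^2*?Q y = h^2*?P z" unfolding y(2)[symmetric] z(2)[symmetric] by (simp add: add.commute add.left_commute)
 then have eq: "?Q y = ?P z" using h by simp
 have "dist (?Q y) (?Q x) < e" "dist (?P z) (?P x) < e"
 proof -
  have "dist y x < r2" using y(1) hr by (simp add: dist_commute r_def)
  then show "dist (?Q y) (?Q x) < e" by (rule r2(2))
  have "dist z x < r1" using z(1) hr' by (simp add: dist_commute r_def)
  then show "dist (?P z) (?P x) < e" by (rule r1(2))
 qed
 then have "\<bar>?P z-?Q x\<bar> < e" "\<bar>?P z-?P x\<bar> < e" by (simp_all only: eq dist_real_def)
 then have "\<bar>?P x-?Q x\<bar> < 2*e" by linarith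
 then show False unfolding e_def by simp
qed

section \<open>Cutoff functions and the truncated fundamental solution\<close>

lemma DERIV_if_split:
 fixes f g :: "real => real"
 assumes "DERIV f c :> D" "DERIV g c :> D" "f c = g c"
 shows "DERIV (%s. if c <= s then f s else g s) c :> D"
 unfolding DERIV_def tendsto_iff
proof (intro allI impI)
 fix r :: real assume r: "r > 0"
 have "\<forall>\<^sub>F h in at 0. dist ((f (c+h)-f c)/h) D < r" "\<forall>\<^sub>F h in at 0. dist ((g (c+h)-g c)/h) D < r"
  using assms(1,2) r unfolding DERIV_def tendsto_iff by blast+
 then show "\<forall>\<^sub>F h in at 0. dist (((if c <= c+h then f (c+h) else g (c+h))-(if c <= c then f c else g c))/h) D < r"
  by eventually_elim (simp add: assms(3))
qed

lemma DERIV_if: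
 fixes f g :: "real => real"
 assumes "c <= s ==> DERIV f s :> f' s" "s <= c ==> DERIV g s :> g' s"
  and "s = c ==> f c = g c" "s = c ==> f' c = g' c"
 shows "DERIV (%s. if c <= s then f s else g s) s :> (if c <= s then f' s else g' s)"
proof (cases "s = c")
 case True then show ?thesis using DERIV_if_split[of f "f' c" c g] assms by simp
next
 case False
 show ?thesis
 proof (cases "c < s")
  case True
  then have "DERIV (%s. if c <= s then f s else g s) s :> f' s"
   using has_field_derivative_transform_within_open[of f "f' s" s "{c<..}" "%s. if c <= s then f s else g s"] assms(1) by auto
  then show ?thesis using True by simp
 next
  case False
  with \<open>s ~= c\<close> have s: "s < c" by simp
  then have "DERIV (%s. if c <= s then f s else g s) s :> g' s"
   using has_field_derivative_transform_within_open[of g "g' s" s "{..<c}" "%s. if c <= s then f s else g s"] assms(2) by auto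
  then show ?thesis using s by simp
 qed
qed

text \<open>The derivatives of order 0, 1 and 2 of the cube of the positive part. It is of class
  C^2, which is all that Green's identity needs from a cutoff; the last clause is read only at order
  2.\<close>

fun cubic_pos :: "nat => real => real" where
 "cubic_pos 0 x = (if 0 <= x then x ^ 3 else 0)"
| "cubic_pos (Suc 0) x = (if 0 <= x then 3*x ^ 2 else 0)"
| "cubic_pos (Suc (Suc _)) x = (if 0 <= x then 6*x else 0)"

lemma cubic_pos_deriv:
 assumes "j < 2" shows "DERIV (cubic_pos j) t :> cubic_pos (Suc j) t"
proof -
 have "DERIV (%s. if 0 <= s then s ^ 3 else (0::real)) t :> (if 0 <= t then 3*t ^ 2 else 0)"
  by (rule DERIV_if) (auto intro!: derivative_eq_intros)
 moreover have "DERIV (%s. if 0 <= s then 3 * s ^ 2 else (0::real)) t :> (if 0 <= t then 6*t else 0)"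
  by (rule DERIV_if) (auto intro!: derivative_eq_intros)
 moreover have "cubic_pos 0 = (%s. if 0 <= s then s ^ 3 else 0)" "cubic_pos (Suc 0) = (%s. if 0 <= s then 3 * s ^ 2 else 0)"
  by auto
 moreover have "j = 0 \<or> j = Suc 0" using assms by auto
 ultimately show ?thesis by auto
qed

lemma Ck_on_cubic_pos:
 assumes "open S" "Ck_on 2 S h" shows "Ck_on 2 S (%x. cubic_pos 0 (h x))"
proof (rule Ck_on_compose_real[OF assms, of UNIV cubic_pos])
 have "cubic_pos 2 = (%x. 6*max 0 x)" by (auto simp: numeral_2_eq_2 max_def)
 then show "continuous_on UNIV (cubic_pos 2)" by (simp add: continuous_intros)
qed (use cubic_pos_deriv in auto)

lemma Ck_on_dist_square:
 fixes p :: "'a::euclidean_space"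
 assumes "open S" shows "Ck_on k S (%y. (y-p) \<bullet> (y-p))"
proof -
 have "Ck_on k S (%y. (y-p) \<bullet> b)" for b
  using Ck_on_add[OF assms Ck_on_linear[OF assms bounded_linear_inner_left[of b], of k] Ck_on_const[OF assms, of k "- (p \<bullet> b)"]]
  by (simp add: inner_diff_left)
 then have "Ck_on k S (%y. \<Sum>b\<in>Basis. ((y-p) \<bullet> b)*((y-p) \<bullet> b))"
  by (intro Ck_on_sum Ck_on_mult assms)
 moreover have "(%y. (y-p) \<bullet> (y-p)) = (%y. \<Sum>b\<in>Basis. ((y-p) \<bullet> b)*((y-p) \<bullet> b))"
  by (rule ext, subst euclidean_inner) simp
 ultimately show ?thesis by simp
qed

lemma C2_cutoff:
 fixes p :: "'a::euclidean_space"
 assumes "0 < s1" "s1 < s2"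
 obtains cut :: "'a => real" where "Ck_on 2 UNIV cut" "!!y. (y-p) \<bullet> (y-p) <= s1 ==> cut y = 1"
  "!!y. (y-p) \<bullet> (y-p) >= s2 ==> cut y = 0"
proof
 \<comment> \<open>Affine in the squared distance, with value 0 at s1 and 1 at s2. Up to s1 the
   inner truncated cube is 0 and the outer one is 1; from s2 on the inner one is at least 1 and the
   outer one is 0.\<close>
 let ?h = "%y. (((y-p) \<bullet> (y-p))+(- s1))*(1/(s2-s1))"
 let ?c = "%y. cubic_pos 0 (1-cubic_pos 0 (?h y))"
 show "Ck_on 2 UNIV ?c"
  by (intro Ck_on_cubic_pos Ck_on_diff Ck_on_const Ck_on_mult Ck_on_add Ck_on_dist_square open_UNIV)
 show "?c y = 1" if "(y-p) \<bullet> (y-p) <= s1" for y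
 proof -
  have "?h y <= 0" using that assms by (intro mult_nonpos_nonneg) auto
  then have "cubic_pos 0 (?h y) = 0" by (cases "?h y = 0") auto
  then show ?thesis by simp
 qed
 show "?c y = 0" if "(y-p) \<bullet> (y-p) >= s2" for y
 proof -
  have "?h y >= 1" using that assms by simp
  then have "cubic_pos 0 (?h y) >= 1" using one_le_power[of "?h y" 3] by simp
  then show ?thesis by (cases "cubic_pos 0 (?h y) = 1") auto
 qed
qed

text \<open>$s^{-m}$ and its derivatives of order \<open>j\<close>, continued below \<open>e\<close> by the second-order Taylor polynomial.\<close>
definition trunc_powr :: "real => real => nat => real => real" where
 "trunc_powr m e j s =
  (if e <= s then (if j = 0 then s powr (-m) else if j = 1 then -m * s powr (-m-1) else m*(m+1) * s powr (-m-2))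
  else if j = 0 then e powr (-m)*(1+m*(m+2)-m*(m+1)/2-m*(m+2)*(s/e)+m*(m+1)/2*(s/e)^2)
  else if j = 1 then e powr (-m-1)*(- m*(m+2)+m*(m+1)*(s/e)) else e powr (-m-2)*(m*(m+1)))"

lemma powr_pred: "0 < (x::real) ==> b = a-1 ==> x powr a = x*x powr b"
 by (simp add: powr_diff)

lemma trunc_powr_deriv:
 assumes "e > 0" "j < 2" shows "DERIV (trunc_powr m e j) s :> trunc_powr m e (Suc j) s"
proof -
 have e1: "e powr (-m) = e*e powr (-m-1)" "e powr (-m-1) = e*e powr (-m-2)"
  by (rule powr_pred[OF assms(1)], simp)+
 have 0: "DERIV (%s. if e <= s then s powr (-m) else e powr (-m)*(1+m*(m+2)-m*(m+1)/2-m*(m+2)*(s/e)+m*(m+1)/2*(s/e)^2))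
  s :> (if e <= s then -m * s powr (-m-1) else e powr (-m-1)*(- m*(m+2)+m*(m+1)*(s/e)))"
 proof (rule DERIV_if)
  show "DERIV (%s. s powr (-m)) s :> -m * s powr (-m-1)" if "e <= s"
   using assms(1) that by (auto intro!: derivative_eq_intros)
  show "((%s. e powr (-m)*(1+m*(m+2)-m*(m+1)/2-m*(m+2)*(s/e)+m*(m+1)/2*(s/e)^2)) has_real_derivative
   e powr (-m-1)*(- m*(m+2)+m*(m+1)*(s/e))) (at s)"
   using assms(1) by (auto intro!: derivative_eq_intros simp: e1(1) power2_eq_square field_simps)
 qed (use assms(1) in \<open>auto simp: field_simps\<close>)
 have 1: "DERIV (%s. if e <= s then -m * s powr (-m-1) else e powr (-m-1)*(- m*(m+2)+m*(m+1)*(s/e)))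
  s :> (if e <= s then m*(m+1) * s powr (-m-2) else e powr (-m-2)*(m*(m+1)))"
 proof (rule DERIV_if)
  show "DERIV (%s. - m * s powr (-m-1)) s :> m*(m+1) * s powr (-m-2)" if "e <= s"
   using assms(1) that by (auto intro!: derivative_eq_intros simp: algebra_simps)
  show "((%s. e powr (-m-1)*(- m*(m+2)+m*(m+1)*(s/e))) has_real_derivative
   e powr (-m-2)*(m*(m+1))) (at s)"
   using assms(1) by (auto intro!: derivative_eq_intros simp: e1(2) field_simps)
 qed (use assms(1) in \<open>auto simp: field_simps\<close>)
 have "j = 0 \<or> j = 1" using assms(2) by auto
 then show ?thesis
 proof
  assume "j = 0" then show ?thesis using 0 by (simp only: trunc_powr_def[abs_def] One_nat_def simp_thms if_True if_False nat.simps zero_neq_one)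
 next
  assume "j = 1" then show ?thesis using 1 by (simp only: trunc_powr_def[abs_def] One_nat_def simp_thms if_True if_False nat.simps zero_neq_one)
 qed
qed

lemma trunc_powr_2_continuous:
 assumes "e > 0" shows "continuous_on UNIV (trunc_powr m e 2)"
proof -
 have "trunc_powr m e 2 = (%s. m*(m+1)*(max e s) powr (-m-2))"
  by (auto simp: trunc_powr_def max_def)
 then show ?thesis using assms by (auto intro!: continuous_intros)
qed

text \<open>With s the squared distance, the left side is the Laplacian of the radial function.
  Above e it vanishes, because n = 2m+2 makes s^(-m) the fundamental solution; below e the Taylor
  polynomial leaves a hat that vanishes at s = e.\<close>

lemma trunc_powr_laplace:
 assumes "e > 0" "n = 2*m+2"
 shows "2*n*trunc_powr m e 1 s+4 * s*trunc_powr m e 2 s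
  = - (4*m*(m+1)*(m+2))*(e powr (-m-1)*max 0 (1-s/e))"
proof -
 have e1: "e powr (-m-1) = e*e powr (-m-2)"
  by (rule powr_pred[OF assms(1)], simp)+
 show ?thesis
 proof (cases "e <= s")
  case True
  then have "s powr (-m-1) = s * s powr (-m-2)" using assms(1) by (intro powr_pred) auto
  then show ?thesis using True assms by (simp add: trunc_powr_def max_def algebra_simps)
 next
  case False
  then show ?thesis using assms by (simp add: trunc_powr_def max_def e1 field_simps)
 qed
qed

lemma sum_Basis_inner_square: "(\<Sum>b\<in>Basis. (x \<bullet> b)^2) = x \<bullet> (x::'a::euclidean_space)"
 by (subst euclidean_inner) (simp add: power2_eq_square)

lemma has_derivative_dist_square:
 fixes p :: "'a::euclidean_space"
 shows "((%y. (y-p) \<bullet> (y-p)) has_derivative (%v. 2*((y-p) \<bullet> v))) (at y)"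
 by (auto intro!: derivative_eq_intros simp: inner_commute)

text \<open>Profiles are functions of the squared distance, so nothing special happens at the
  centre; the set \<open>T\<close> admits profiles that are singular at 0.\<close>

lemma laplacian_radial:
 fixes p :: "'a::euclidean_space" and F :: "nat => real => real"
 assumes T: "open T" and F: "!!j s. j < 2 ==> s \<in> T ==> DERIV (F j) s :> F (Suc j) s"
  and y: "(y-p) \<bullet> (y-p) \<in> T"
 shows "frechet_derivative (%y. F 0 ((y-p) \<bullet> (y-p))) (at y) = (%v. 2*((y-p) \<bullet> v)*F 1 ((y-p) \<bullet> (y-p)))"
  "laplacian (%y. F 0 ((y-p) \<bullet> (y-p))) y
  = 2*real DIM('a)*F 1 ((y-p) \<bullet> (y-p))+4*((y-p) \<bullet> (y-p))*F 2 ((y-p) \<bullet> (y-p))"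
proof -
 define R where "R = (%j y. F j ((y-p) \<bullet> (y-p)))"
 define S where "S = {y. (y-p) \<bullet> (y-p) \<in> T}"
 have S: "open S" using T open_vimage[of T "%y. (y-p) \<bullet> (y-p)"] by (simp add: S_def vimage_def continuous_intros)
 have D: "(R j has_derivative (%v. 2*((y-p) \<bullet> v) * R (Suc j) y)) (at y)" if "j < 2" "y \<in> S" for j y
 proof -
  have "(F j has_derivative (%t. F (Suc j) ((y-p) \<bullet> (y-p))*t)) (at ((y-p) \<bullet> (y-p)))"
   using F that by (simp add: has_field_derivative_def S_def)
  from has_derivative_compose[OF has_derivative_dist_square[of p y] this]
  show ?thesis unfolding R_def by (simp add: mult.commute mult.left_commute)
 qed
 have p0: "frechet_derivative (R 0) (at x) = (%v. 2*((x-p) \<bullet> v) * R 1 x)" if "x \<in> S" for x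
  using frechet_derivative_eqI[OF D[of 0 x]] that by simp
 have yS: "y \<in> S" using y by (simp add: S_def)
 from p0[OF this] show "frechet_derivative (%y. F 0 ((y-p) \<bullet> (y-p))) (at y) = (%v. 2*((y-p) \<bullet> v)*F 1 ((y-p) \<bullet> (y-p)))"
  by (simp add: R_def)
 have "pd b (pd b (R 0)) y = 2 * R 1 y+4*((y-p) \<bullet> b)^2 * R 2 y" if "b \<in> Basis" for b
 proof -
  have 1: "(R 1 has_derivative (%v. 2*((y-p) \<bullet> v) * R 2 y)) (at y)" using D[of 1 y] yS by (simp add: numeral_2_eq_2)
  have 2: "((%y. 2*((y-p) \<bullet> b)) has_derivative (%w. 2*(w \<bullet> b))) (at y)"
   by (auto intro!: derivative_eq_intros)
  have "frechet_derivative (pd b (R 0)) (at y) = frechet_derivative (%y. 2*((y-p) \<bullet> b) * R 1 y) (at y)"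
   by (rule frechet_derivative_cong_open[OF S yS]) (simp add: p0)
  also have "... = (%w. 2*((y-p) \<bullet> b)*(2*((y-p) \<bullet> w) * R 2 y)+2*(w \<bullet> b) * R 1 y)"
   by (rule frechet_derivative_eqI) (rule has_derivative_mult[OF 2 1])
  finally show ?thesis using that by (simp add: power2_eq_square)
 qed
 then have "laplacian (R 0) y = (\<Sum>b\<in>(Basis::'a set). 2 * R 1 y+4*((y-p) \<bullet> b)^2 * R 2 y)"
  unfolding laplacian_def by (intro sum.cong refl) auto
 also have "... = 2*real DIM('a) * R 1 y+4*((y-p) \<bullet> (y-p)) * R 2 y"
  unfolding sum_Basis_inner_square[symmetric, of "y-p"]
  by (simp add: sum.distrib sum_distrib_left sum_distrib_right algebra_simps)
 finally show "laplacian (%y. F 0 ((y-p) \<bullet> (y-p))) y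
  = 2*real DIM('a)*F 1 ((y-p) \<bullet> (y-p))+4*((y-p) \<bullet> (y-p))*F 2 ((y-p) \<bullet> (y-p))" by (simp add: R_def)
qed

section \<open>Integration by parts for compactly supported functions\<close>

lemma continuous_zero_outside_integral:
 fixes f :: "'a::euclidean_space => real"
 assumes "continuous_on UNIV f" "!!x. x \<notin> cbox a b ==> f x = 0"
 shows "(f has_integral integral (cbox a b) f) UNIV" 
 using integrable_integral[OF integrable_continuous[OF continuous_on_subset[OF assms(1) subset_UNIV]]]
  has_integral_on_superset assms(2) by blast

lemma integral_cbox_indep:
 fixes f :: "'a::euclidean_space => real"
 assumes "continuous_on UNIV f" "!!x. x \<notin> cbox a b ==> f x = 0" "!!x. x \<notin> cbox c d ==> f x = 0"
 shows "integral (cbox a b) f = integral (cbox c d) f"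
 using continuous_zero_outside_integral[OF assms(1,2)] continuous_zero_outside_integral[OF assms(1,3)]
 by (rule has_integral_unique)

text \<open>The integral of all translates of a function is the same number, so its derivative vanishes.\<close>
lemma integral_pd_zero:
 fixes f :: "'a::euclidean_space => real"
 assumes C: "Ck_on 1 UNIV f" and z: "!!x. x \<notin> cbox a b ==> f x = 0" and v: "v \<in> Basis"
 shows "integral (cbox (a-One) (b+One)) (pd v f) = 0"
proof -
 have c: "continuous_on UNIV f" using Ck_on_SucD[of UNIV 0 f] C by simp
 have cp: "continuous_on UNIV (pd v f)" using C by simp
 have d: "f differentiable (at x)" for x using Ck_on_Suc_diff[of UNIV 0 f] C by simp
 \<comment> \<open>One unit of room on each side: translates by less than 1 keep the support inside,
   so their integrals over this fixed box all agree.\<close>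
 let ?B = "cbox (a-One) (b+One)"
 define G where "G t = integral ?B (%y. f (y+t *R v))" for t :: real
 have "(G has_vector_derivative integral ?B (%y. pd v f (y+0 *R v))) (at 0 within {-1<..<1})"
  unfolding G_def
 proof (rule leibniz_rule_vector_derivative)
  fix t :: real and y assume "t \<in> {-1<..<1}" "y \<in> ?B"
  show "((%t. f (y+t *R v)) has_vector_derivative pd v f (y+t *R v)) (at t within {-1<..<1})"
   using has_real_derivative_along[OF d, of y v t]
   by (simp add: has_real_derivative_iff_has_vector_derivative has_vector_derivative_at_within)
 next
  show "(%y. f (y+t *R v)) integrable_on ?B" for t
   by (intro integrable_continuous continuous_on_compose2[OF c] continuous_intros) auto
  show "continuous_on ({-1<..<1} \<times> ?B) (%(t, y). pd v f (y+t *R v))"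
   unfolding split_beta by (intro continuous_on_compose2[OF cp] continuous_intros) auto
 qed auto
 moreover have "G t = integral ?B f" if t: "t \<in> {-1<..<1}" for t
 proof -
  have "G t = integral ?B (f \<circ> ((+) (t *R v)))" by (simp add: G_def o_def add.commute)
  also have "... = integral (cbox (a-One+t *R v) (b+One+t *R v)) f"
   by (rule integral_shift_cbox_plus)
  also have "... = integral ?B f"
  proof (rule integral_cbox_indep[OF c])
   fix x
   have sub: "x \<in> cbox (a-One+s *R v) (b+One+s *R v)" if "x \<in> cbox a b" "\<bar>s\<bar> < 1" for x :: 'a and s :: real
    unfolding mem_box
   proof (intro ballI conjI)
    fix i :: 'a assume i: "i \<in> Basis"
    have "\<bar>s*(v \<bullet> i)\<bar> <= 1" using that(2) i v by (auto simp: inner_Basis)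
    then show "(a-One+s *R v) \<bullet> i <= x \<bullet> i" "x \<bullet> i <= (b+One+s *R v) \<bullet> i"
     using that(1) i by (auto simp: mem_box inner_simps)
   qed
   show "f x = 0" if "x \<notin> cbox (a-One+t *R v) (b+One+t *R v)"
    using sub[of x t] that t z[of x] by (cases "x \<in> cbox a b") (auto simp: abs_less_iff)
   show "f x = 0" if "x \<notin> ?B" using sub[of x 0] that z[of x] by auto
  qed
  finally show ?thesis .
 qed
 then have "(G has_vector_derivative 0) (at 0 within {-1<..<1})"
  using has_vector_derivative_transform[of 0 "{-1<..<1}" G "%t. integral ?B f" 0] by auto
 ultimately have "integral ?B (%y. pd v f (y+0 *R v)) = 0"
  using vector_derivative_unique_within[of 0 "{-1<..<1}"] trivial_limit_within[of "0::real"]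
  by (metis (no_types, lifting) at_within_open greaterThanLessThan_iff neg_less_0_iff_less open_greaterThanLessThan trivial_limit_at zero_less_one)
 then show ?thesis by simp
qed

lemma continuous_on_laplacian:
 assumes "Ck_on 2 S f" shows "continuous_on S (laplacian f)"
 unfolding laplacian_def[abs_def] using assms by (intro continuous_on_sum) (auto simp: numeral_2_eq_2)

lemma pd_eq_0_outside:
 fixes f :: "'a::euclidean_space => real"
 assumes "!!x. x \<notin> cbox a b ==> f x = 0" "x \<notin> cbox a b"
 shows "pd v f x = 0"
proof -
 have "frechet_derivative f (at x) = frechet_derivative (%_. 0) (at x)"
  by (rule frechet_derivative_cong_open[of "- cbox a b"]) (use assms in \<open>auto simp: closed_cbox\<close>)
 then show ?thesis by simp
qed

text \<open>The difference of the integrands is the divergence of f grad g - g grad f. This field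
  vanishes where g does, so compact support is required of g only, and each component integrates to
  zero.\<close>

lemma green_identity:
 fixes f g :: "'a::euclidean_space => real"
 assumes f: "Ck_on 2 UNIV f" and g: "Ck_on 2 UNIV g" and z: "!!x. x \<notin> cbox a b ==> g x = 0"
 shows "integral (cbox (a-One) (b+One)) (%y. f y*laplacian g y)
  = integral (cbox (a-One) (b+One)) (%y. laplacian f y*g y)"
proof -
 let ?B = "cbox (a-One) (b+One)"
 note O = open_UNIV[where 'a='a]
 have C1: "Ck_on 1 UNIV f" "Ck_on 1 UNIV g" by (rule Ck_on_le[OF O f] Ck_on_le[OF O g], simp)+
 have C1': "Ck_on 1 UNIV (pd v f)" "Ck_on 1 UNIV (pd v g)" for v
  using f g by (simp_all add: numeral_2_eq_2)
 have d: "f differentiable at x" "g differentiable at x" "pd v f differentiable at x" "pd v g differentiable at x" for x v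
  using Ck_on_Suc_diff[OF O, of 0] C1 C1' by simp_all
 have cont: "continuous_on UNIV f" "continuous_on UNIV g" "continuous_on UNIV (pd v (pd v f))" "continuous_on UNIV (pd v (pd v g))" for v
  using Ck_on_SucD[OF O, of 0] C1 f g by (simp_all add: numeral_2_eq_2)
 define h where "h b = (%y. f y*pd b g y-pd b f y*g y)" for b
 have h1: "Ck_on 1 UNIV (h b)" for b unfolding h_def by (intro Ck_on_diff Ck_on_mult O C1 C1')
 have pz: "pd v g x = 0" if "x \<notin> cbox a b" for x v
  by (rule pd_eq_0_outside[OF _ that]) (rule z)
 have h0: "h v x = 0" if "x \<notin> cbox a b" for x v
  by (simp add: h_def z[OF that] pz[OF that])
 have hb: "pd v (h v) y = f y*pd v (pd v g) y-pd v (pd v f) y*g y" for v y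
 proof -
  have "(h v has_derivative (%w. (f y*pd w (pd v g) y+pd w f y*pd v g y)-(pd v f y*pd w g y+pd w (pd v f) y*g y))) (at y)"
   unfolding h_def by (intro has_derivative_diff has_derivative_mult has_derivative_frechet d)
  from frechet_derivative_eqI[OF this] show ?thesis by simp
 qed
 have "0 = (\<Sum>v\<in>(Basis::'a set). integral ?B (pd v (h v)))"
  by (rule sum.neutral[symmetric]) (auto intro!: integral_pd_zero[OF h1] h0)
 also have "... = integral ?B (%y. \<Sum>v\<in>Basis. pd v (h v) y)"
  using h1 by (intro integral_sum[symmetric] finite_Basis integrable_continuous) (auto intro: continuous_on_subset)
 also have "(%y. \<Sum>v\<in>Basis. pd v (h v) y) = (%y. f y*laplacian g y-laplacian f y*g y)"
  by (rule ext) (simp add: hb laplacian_def sum_subtractf sum_distrib_left sum_distrib_right)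
 also have "integral ?B ... = integral ?B (%y. f y*laplacian g y)-integral ?B (%y. laplacian f y*g y)"
  by (intro integral_diff integrable_continuous continuous_on_mult continuous_on_subset[OF cont(1) subset_UNIV] 
   continuous_on_subset[OF cont(2) subset_UNIV] continuous_on_subset[OF continuous_on_laplacian[OF f] subset_UNIV]
   continuous_on_subset[OF continuous_on_laplacian[OF g] subset_UNIV])
 finally show ?thesis by simp
qed

lemma laplacian_cong_open:
 assumes "open S" "x \<in> S" "!!y. y \<in> S ==> f y = g y"
 shows "laplacian f x = laplacian g x"
proof -
 have "pd b (pd b f) x = pd b (pd b g) x" for b
 proof -
  have "frechet_derivative (pd b f) (at x) = frechet_derivative (pd b g) (at x)"
   by (rule frechet_derivative_cong_open[OF assms(1,2)]) (simp add: frechet_derivative_cong_open[OF assms(1) _ assms(3)])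
  then show ?thesis by simp
 qed
 then show ?thesis unfolding laplacian_def by simp
qed

section \<open>Smoothness and analyticity\<close>

text \<open>Up to a constant, the Laplacian of the truncated fundamental solution. It acts as a
  mollifier supported in the ball of radius sqrt e.\<close>

definition cone_kernel :: "real => 'a::euclidean_space => real" where
 "cone_kernel e y = max 0 (1-(y \<bullet> y)/e)"

lemma cone_kernel_integral:
 fixes x :: "'a::euclidean_space"
 assumes e: "e > 0" and sub: "cball x (sqrt e) \<subseteq> cbox A B"
 shows "integral (cbox A B) (%y. cone_kernel e (y-x)) = sqrt e ^ DIM('a)*integral (cbox (-One) One) (cone_kernel 1 :: 'a::euclidean_space => real)"
proof -
 have c: "continuous_on UNIV (%y. cone_kernel d (y-z))" if "d > 0" for d :: real and z :: 'a
  unfolding cone_kernel_def using that by (intro continuous_intros) auto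
 have "((cone_kernel 1 :: 'a => real) has_integral integral (cbox (-One) One) (cone_kernel 1 :: 'a => real)) (cbox (-One) One)"
 proof -
  have "continuous_on UNIV (cone_kernel 1 :: 'a => real)" using c[of 1 0] by simp
  from integrable_integral[OF integrable_continuous[OF continuous_on_subset[OF this subset_UNIV]]]
  show ?thesis .
 qed
 from has_integral_affinity'[OF this, of "1/sqrt e" "- (1/sqrt e) *R x"] e
 have 1: "((%y. cone_kernel 1 ((1/sqrt e) *R y-(1/sqrt e) *R x)) has_integral
   (sqrt e ^ DIM('a)*integral (cbox (-One) One) (cone_kernel 1 :: 'a => real)))
  (cbox (sqrt e *R (- One+(1/sqrt e) *R x)) (sqrt e *R (One+(1/sqrt e) *R x)))"
  by (simp add: power_one_over field_simps)
 have eq: "cone_kernel 1 ((1/sqrt e) *R y-(1/sqrt e) *R x) = cone_kernel e (y-x)" for y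
 proof -
  have "(1/sqrt e) *R y-(1/sqrt e) *R x = (1/sqrt e) *R (y-x)" by (simp add: algebra_simps)
  moreover have "((1/sqrt e) *R (y-x)) \<bullet> ((1/sqrt e) *R (y-x)) = ((y-x) \<bullet> (y-x))/e"
   using e by simp
  ultimately show ?thesis unfolding cone_kernel_def by (simp only: div_by_1)
 qed
 let ?a = "sqrt e *R (- One+(1/sqrt e) *R x)" and ?b = "sqrt e *R (One+(1/sqrt e) *R x)"
 have z: "cone_kernel e (y-x) = 0" if "y \<notin> cball x (sqrt e)" for y
 proof -
  have "sqrt e < norm (y-x)" using that by (simp add: dist_norm norm_minus_commute)
  then have "sqrt e ^ 2 < norm (y-x) ^ 2" using e by (intro power_strict_mono) auto
  then have "e < (y-x) \<bullet> (y-x)" using e by (simp add: power2_norm_eq_inner)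
  then show ?thesis using e by (simp add: cone_kernel_def)
 qed
 have sub2: "cball x (sqrt e) \<subseteq> cbox ?a ?b"
 proof
  fix y assume "y \<in> cball x (sqrt e)"
  then have "\<bar>(y-x) \<bullet> i\<bar> <= sqrt e" if "i \<in> Basis" for i
   using Basis_le_norm[OF that, of "y-x"] by (simp add: dist_norm norm_minus_commute)
  then show "y \<in> cbox ?a ?b" using e unfolding mem_box
   by (auto simp: algebra_simps inner_simps abs_le_iff) 
 qed
 have "integral (cbox A B) (%y. cone_kernel e (y-x)) = integral (cbox ?a ?b) (%y. cone_kernel e (y-x))"
  by (rule integral_cbox_indep[OF c[OF e, of x]]) (use z sub sub2 in blast)+
 also have "... = sqrt e ^ DIM('a)*integral (cbox (-One) One) (cone_kernel 1 :: 'a => real)"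
  using 1 unfolding eq by (rule integral_unique)
 finally show ?thesis .
qed

lemma cone_kernel_pos: "integral (cbox (-One) One) (cone_kernel 1 :: 'a::euclidean_space => real) > 0"
proof -
 have c: "continuous_on (cbox (-One) One) (cone_kernel 1 :: 'a => real)"
  unfolding cone_kernel_def[abs_def] by (intro continuous_intros) auto
 have ge: "cone_kernel 1 y >= 0" for y :: 'a by (simp add: cone_kernel_def)
 have "integral (cbox (-One) One) (cone_kernel 1 :: 'a => real) >= 0"
  by (rule integral_nonneg[OF integrable_continuous[OF c]]) (rule ge)
 moreover have "integral (cbox (-One) One) (cone_kernel 1 :: 'a => real) ~= 0"
 proof
  assume "integral (cbox (-One) One) (cone_kernel 1 :: 'a => real) = 0"
  moreover have "box (-One) (One::'a) ~= {}" by (simp add: box_ne_empty inner_Basis)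
  ultimately have "\<forall>x\<in>cbox (-One) (One::'a). cone_kernel 1 x = 0"
   using integral_cbox_eq_0_iff[OF c _ ge] by blast
  moreover have "(0::'a) \<in> cbox (-One) One" by (simp add: mem_box)
  ultimately have "cone_kernel 1 (0::'a) = 0" by blast
  then show False by (simp add: cone_kernel_def)
 qed
 ultimately show ?thesis by simp
qed

lemma inner_diff_commute: "(x-y) \<bullet> (x-y) = (y-x) \<bullet> (y-(x::'a::real_inner))"
 by (metis inner_minus_left inner_minus_right minus_diff_eq minus_minus)

text \<open>Since w is harmonic within distance sqrt e of x, truncating the kernel there does not
  change its product with the Laplacian of w. After Green's identity the Laplacian falls on the
  truncated kernel and becomes the hat.\<close>

lemma green_trunc_powr:
 fixes w :: "'a::euclidean_space => real" and x :: 'a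
 assumes w: "Ck_on 2 UNIV w" and z: "!!y. y \<notin> cbox a b ==> w y = 0" and e: "e > 0"
  and m: "real DIM('a) = 2*m+2"
  and far: "!!y. laplacian w y ~= 0 ==> e <= (y-x) \<bullet> (y-x)"
 shows "integral (cbox (a-One) (b+One)) (%y. ((x-y) \<bullet> (x-y)) powr (-m)*laplacian w y)
  = - (4*m*(m+1)*(m+2))*e powr (-m-1)*integral (cbox (a-One) (b+One)) (%y. cone_kernel e (y-x)*w y)"
proof -
 let ?B = "cbox (a-One) (b+One)"
 define f where "f y = trunc_powr m e 0 ((y-x) \<bullet> (y-x))" for y
 have td: "!!j s. j < 2 ==> DERIV (trunc_powr m e j) s :> trunc_powr m e (Suc j) s"
  by (rule trunc_powr_deriv[OF e])
 have f: "Ck_on 2 UNIV f" unfolding f_def[abs_def]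
  by (rule Ck_on_compose_real[OF open_UNIV Ck_on_dist_square[OF open_UNIV], where T=UNIV and F="trunc_powr m e"])
   (use td trunc_powr_2_continuous[OF e] in \<open>auto simp: numeral_2_eq_2\<close>)
 have lap: "laplacian f y = - (4*m*(m+1)*(m+2))*(e powr (-m-1)*cone_kernel e (y-x))" for y
  unfolding f_def[abs_def] cone_kernel_def trunc_powr_laplace[OF e m, symmetric]
  by (rule laplacian_radial(2)[where T=UNIV]) (use td in auto)
 have "integral ?B (%y. ((x-y) \<bullet> (x-y)) powr (-m)*laplacian w y) = integral ?B (%y. f y*laplacian w y)"
 proof (rule integral_cong)
  fix y
  show "((x-y) \<bullet> (x-y)) powr (-m)*laplacian w y = f y*laplacian w y"
   using far[of y] by (cases "laplacian w y = 0") (auto simp: f_def trunc_powr_def inner_diff_commute[of x y])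
 qed
 also have "... = integral ?B (%y. laplacian f y*w y)"
  by (rule green_identity[OF f w z])
 also have "... = integral ?B (%y. (- (4*m*(m+1)*(m+2))*e powr (-m-1))*(cone_kernel e (y-x)*w y))"
  by (simp add: lap mult.assoc)
 also have "... = - (4*m*(m+1)*(m+2))*e powr (-m-1)*integral ?B (%y. cone_kernel e (y-x)*w y)"
  by (rule integral_mult_right)
 finally show ?thesis .
qed

lemma cone_kernel_zero: 
 assumes "e > 0" "y \<notin> cball x (sqrt e)" shows "cone_kernel e (y-x) = 0"
proof -
 have "sqrt e < norm (y-x)" using assms(2) by (simp add: dist_norm norm_minus_commute)
 then have "sqrt e ^ 2 < norm (y-x) ^ 2" using assms(1) by (intro power_strict_mono) auto
 then have "e < (y-x) \<bullet> (y-x)" using assms(1) by (simp add: power2_norm_eq_inner)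
 then show ?thesis using assms(1) by (simp add: cone_kernel_def)
qed

text \<open>The hat is nonnegative with mass \<open>sqrt e ^ DIM('a) * \<kappa>\<close>, so a
  weighted average of w differs from w x by at most the oscillation of w on the support.\<close>

lemma cone_kernel_average:
 fixes w :: "'a::euclidean_space => real" and x :: 'a
 assumes w: "continuous_on UNIV w" and e: "e > 0" and sub: "cball x (sqrt e) \<subseteq> cbox A B"
  and close: "!!y. y \<in> cball x (sqrt e) ==> \<bar>w y-w x\<bar> <= \<eta>"
 defines "\<kappa> \<equiv> integral (cbox (-One) One) (cone_kernel 1 :: 'a::euclidean_space => real)"
 shows "\<bar>integral (cbox A B) (%y. cone_kernel e (y-x)*w y)-sqrt e ^ DIM('a)*\<kappa>*w x\<bar> <= sqrt e ^ DIM('a)*\<kappa>*\<eta>"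
proof -
 have c: "continuous_on (cbox A B) (%y. cone_kernel e (y-x))"
  unfolding cone_kernel_def using e by (intro continuous_intros) auto
 have cw: "continuous_on (cbox A B) w" using w by (rule continuous_on_subset) simp
 note I = cone_kernel_integral[OF e sub, folded \<kappa>_def]
 have "integral (cbox A B) (%y. cone_kernel e (y-x)*w y)-sqrt e ^ DIM('a)*\<kappa>*w x
  = integral (cbox A B) (%y. cone_kernel e (y-x)*w y)-integral (cbox A B) (%y. cone_kernel e (y-x)*w x)"
  by (simp add: I)
 also have "... = integral (cbox A B) (%y. cone_kernel e (y-x)*w y-cone_kernel e (y-x)*w x)"
  by (intro integral_diff[symmetric] integrable_continuous continuous_intros c cw)
 finally have eq: "integral (cbox A B) (%y. cone_kernel e (y-x)*w y)-sqrt e ^ DIM('a)*\<kappa>*w x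
  = integral (cbox A B) (%y. cone_kernel e (y-x)*w y-cone_kernel e (y-x)*w x)" .
 have "norm (integral (cbox A B) (%y. cone_kernel e (y-x)*w y-cone_kernel e (y-x)*w x))
  <= integral (cbox A B) (%y. cone_kernel e (y-x)*\<eta>)"
 proof (rule integral_norm_bound_integral)
  fix y
  have ge: "cone_kernel e (y-x) >= 0" by (simp add: cone_kernel_def)
  show "norm (cone_kernel e (y-x)*w y-cone_kernel e (y-x)*w x) <= cone_kernel e (y-x)*\<eta>"
  proof (cases "y \<in> cball x (sqrt e)")
   case True
   have "norm (cone_kernel e (y-x)*w y-cone_kernel e (y-x)*w x) = cone_kernel e (y-x)*\<bar>w y-w x\<bar>"
    using ge by (simp add: right_diff_distrib[symmetric] abs_mult)
   then show ?thesis using mult_left_mono[OF close[OF True] ge] by simp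
  next
   case False
   have "cone_kernel e (y-x) = 0" by (rule cone_kernel_zero[OF e False])
   then show ?thesis by simp
  qed
 qed (intro integrable_continuous continuous_intros c cw)+
 also have "... = sqrt e ^ DIM('a)*\<kappa>*\<eta>" by (simp add: I)
 finally show ?thesis unfolding eq by simp
qed

text \<open>Multiplying v by a cutoff produces w with compact support whose Laplacian lives away
  from the inner ball. Its Newtonian potential reproduces v near p, with a kernel that is evaluated
  only away from its singularity; this is the source of all smoothness and analyticity
  below.\<close>

lemma harmonic_representation:
 fixes v :: "'a::euclidean_space => real" and p :: 'a
 assumes dim: "DIM('a) >= 3" and r: "r > 0" and C2: "Ck_on 2 (ball p r) v"
  and harm: "!!x. x \<in> ball p r ==> laplacian v x = 0"
 obtains \<rho> :: "'a => real" and A B d where "d > 0" "continuous_on UNIV \<rho>" "!!y. y \<in> ball p (2*d) ==> \<rho> y = 0"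
  "!!x. x \<in> ball p d ==>
   v x = integral (cbox A B) (%y. ((x-y) \<bullet> (x-y)) powr (-((DIM('a)-2)/2))*\<rho> y)"
proof -
 define m where "m = (real DIM('a)-2)/2"
 have m: "real DIM('a) = 2*m+2" "m > 0"
  by (simp add: m_def field_simps) (use dim in \<open>simp add: m_def\<close>)
 \<comment> \<open>Nested radii: v is represented on the ball of radius d, the cutoff is 1 up to 2d
   and 0 from 3d on, and v is defined up to 4d.\<close>
 define d where "d = r/4"
 have d: "d > 0" "r = 4*d" using r by (auto simp: d_def)
 obtain cut :: "'a => real" where cut: "Ck_on 2 UNIV cut" "!!y. (y-p) \<bullet> (y-p) <= (2*d)^2 ==> cut y = 1"
  "!!y. (y-p) \<bullet> (y-p) >= (3*d)^2 ==> cut y = 0"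
 proof -
  have "0 < (2*d)^2" "(2*d)^2 < (3*d)^2" using d by (auto simp: power2_eq_square)
  then show ?thesis using C2_cutoff[of "(2*d)^2" "(3*d)^2" p] that by blast
 qed
 have nrm: "(y-p) \<bullet> (y-p) = (dist p y)^2" for y by (simp add: dist_norm power2_norm_eq_inner inner_diff_commute[of y p])
 have cut1: "cut y = 1" if "y \<in> ball p (2*d)" for y
  using cut(2)[of y] that power_mono[of "dist p y" "2*d" 2] by (simp add: nrm)
 have cut0: "cut y = 0" if "y \<notin> ball p (3*d)" for y
  using cut(3)[of y] that d power_mono[of "3*d" "dist p y" 2] by (simp add: nrm)
 define w where "w y = (if y \<in> ball p r then cut y * v y else 0)" for y
 have w: "Ck_on 2 UNIV w"
 proof (rule Ck_on_localI[OF open_UNIV])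
  fix x :: 'a
  show "\<exists>T. open T & x \<in> T & T \<subseteq> UNIV & Ck_on 2 T w"
  proof (cases "x \<in> ball p r")
   case True
   have "Ck_on 2 (ball p r) (%y. cut y * v y)"
    by (intro Ck_on_mult open_ball C2 Ck_on_subset[OF open_UNIV _ _ cut(1)]) auto
   then have "Ck_on 2 (ball p r) w" by (rule Ck_on_cong[OF open_ball, rotated]) (simp add: w_def)
   then show ?thesis using True by blast
  next
   case False
   have o: "open (- cball p (3*d))" by (simp add: open_Compl)
   have "w y = 0" if "y \<in>-cball p (3*d)" for y using that cut0[of y] by (simp add: w_def)
   then have "Ck_on 2 (- cball p (3*d)) w" using Ck_on_cong[OF o _ Ck_on_const[OF o]] by metis
   moreover have "x \<in>-cball p (3*d)" using False d by auto
   ultimately show ?thesis using o by blast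
  qed
 qed
 have wv: "w y = v y" if "y \<in> ball p (2*d)" for y using that d cut1[OF that] by (simp add: w_def)
 obtain a where a: "ball p r \<subseteq> cbox (-a) a" using bounded_subset_cbox_symmetric[OF bounded_ball] by blast
 have z: "w y = 0" if "y \<notin> cbox (-a) a" for y using that a by (auto simp: w_def)
 have lap0: "laplacian w y = 0" if "y \<in> ball p (2*d)" for y
  using laplacian_cong_open[OF open_ball that wv] harm[of y] that d by simp
 have cw: "continuous_on UNIV w" using Ck_on_le[OF open_UNIV w, of 0] by simp
 define \<kappa> where "\<kappa> = integral (cbox (-One) One) (cone_kernel 1 :: 'a => real)"
 have \<kappa>: "\<kappa> > 0" unfolding \<kappa>_def by (rule cone_kernel_pos)
 \<comment> \<open>The normalising constant of the fundamental solution, expressed by the mass of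
   the hat, so that no surface area of the sphere has to be computed.\<close>
 define c where "c = 4*m*(m+1)*(m+2)*\<kappa>"
 have c: "c > 0" using m \<kappa> by (simp add: c_def)
 let ?B = "cbox (-a-One) (a+One)"
 define I where "I x = integral ?B (%y. ((x-y) \<bullet> (x-y)) powr (-m)*laplacian w y)" for x
 have main: "I x = - c*w x" if x: "x \<in> ball p d" for x
 proof -
  have "\<bar>I x+c*w x\<bar> <= c*\<eta>" if \<eta>: "\<eta> > 0" for \<eta>
  proof -
   from cw \<eta> obtain \<delta> where \<delta>: "\<delta> > 0" "!!y. dist y x < \<delta> ==> dist (w y) (w x) < \<eta>"
    unfolding continuous_on_eq_continuous_at[OF open_UNIV] continuous_at_eps_delta by (metis UNIV_I)
   define s where "s = min (\<delta>/2) d"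
   define e where "e = s^2"
   have s: "s > 0" "s < \<delta>" "s <= d" using \<delta> d by (auto simp: s_def min_def)
   have e: "e > 0" "sqrt e = s" using s by (auto simp: e_def)
   have far: "e <= (y-x) \<bullet> (y-x)" if "laplacian w y ~= 0" for y
   proof -
    have "y \<notin> ball p (2*d)" using lap0 that by blast
    then have "s <= dist x y" using x s dist_triangle[of p y x] by (simp add: dist_commute)
    then have "s^2 <= (dist x y)^2" using s by (intro power_mono) auto
    then show ?thesis by (simp add: e_def dist_norm power2_norm_eq_inner inner_diff_commute[of y x])
   qed
   have I1: "I x = - (4*m*(m+1)*(m+2))*e powr (-m-1)*integral ?B (%y. cone_kernel e (y-x)*w y)"
    unfolding I_def by (rule green_trunc_powr[OF w z e(1) m(1) far])
   have "cball x s \<subseteq> ball p r"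
   proof
    fix y assume "y \<in> cball x s"
    then show "y \<in> ball p r" using x s d dist_triangle[of p y x] by simp
   qed
   also have "ball p r \<subseteq> ?B"
   proof -
    have "cbox (-a) a \<subseteq> ?B" by (auto simp: subset_box inner_simps)
    with a show ?thesis by blast
   qed
   finally have sub: "cball x (sqrt e) \<subseteq> ?B" by (simp add: e)
   have "\<bar>integral ?B (%y. cone_kernel e (y-x)*w y)-sqrt e ^ DIM('a)*\<kappa>*w x\<bar> <= sqrt e ^ DIM('a)*\<kappa>*\<eta>"
    unfolding \<kappa>_def
   proof (rule cone_kernel_average[OF cw e(1) sub])
    fix y assume "y \<in> cball x (sqrt e)"
    then have "dist y x < \<delta>" using s by (simp add: e dist_commute)
    then show "\<bar>w y-w x\<bar> <= \<eta>" using \<delta>(2)[of y] by (simp add: dist_real_def)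
   qed
   then have 2: "\<bar>integral ?B (%y. cone_kernel e (y-x)*w y)-s ^ DIM('a)*\<kappa>*w x\<bar> <= s ^ DIM('a)*\<kappa>*\<eta>"
    by (simp add: e)
   \<comment> \<open>As -m-1 = -n/2, this power cancels the mass of the hat exactly, and the limit
     of small e is governed by the continuity of w alone.\<close>
   have "e powr (-m-1) = (s powr 2) powr (-m-1)" using s by (simp add: e_def)
   also have "... = s powr (2*(-m-1))" by (rule powr_powr)
   also have "2*(-m-1) = - real DIM('a)" using m by simp
   also have "s powr (- real DIM('a)) = 1/s ^ DIM('a)" using s by (simp add: powr_minus powr_realpow divide_inverse)
   finally have ep: "e powr (-m-1) * s ^ DIM('a) = 1" using s by simp
   let ?J = "integral ?B (%y. cone_kernel e (y-x)*w y)" and ?C = "4*m*(m+1)*(m+2)*e powr (-m-1)"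
   have C: "?C >= 0" using m by simp
   have cC: "c = ?C*(s ^ DIM('a)*\<kappa>)" using ep by (simp add: c_def algebra_simps)
   have "I x+c*w x = - ?C*(?J-s ^ DIM('a)*\<kappa>*w x)"
    unfolding I1 cC by (simp add: algebra_simps)
   then have "\<bar>I x+c*w x\<bar> = \<bar>?C\<bar>*\<bar>?J-s ^ DIM('a)*\<kappa>*w x\<bar>"
    by (simp only: abs_mult abs_minus_cancel)
   then have "\<bar>I x+c*w x\<bar> = ?C*\<bar>?J-s ^ DIM('a)*\<kappa>*w x\<bar>"
    unfolding abs_of_nonneg[OF C] .
   also have "... <= ?C*(s ^ DIM('a)*\<kappa>*\<eta>)" by (rule mult_left_mono[OF 2 C])
   also have "... = c*\<eta>" unfolding cC by simp
   finally show ?thesis .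
  qed
  then have "\<bar>I x+c*w x\<bar>/c <= \<eta>" if "\<eta> > 0" for \<eta> using that c by (simp add: divide_le_eq mult.commute)
  then have "\<bar>I x+c*w x\<bar>/c <= 0" by (rule field_le_epsilon[of _ 0, simplified])
  then have "\<bar>I x+c*w x\<bar> <= 0" using c by (simp add: divide_le_0_iff)
  then show ?thesis by simp
 qed
 show ?thesis
 proof (rule that[of d "%y. - laplacian w y/c" "-a-One" "a+One"])
  show "continuous_on UNIV (%y. - laplacian w y/c)"
   using c by (intro continuous_intros continuous_on_laplacian[OF w]) auto
  show "- laplacian w y/c = 0" if "y \<in> ball p (2*d)" for y using lap0[OF that] by simp
  fix x assume x: "x \<in> ball p d"
  have "v x = w x" using wv[of x] x d by simp
  also have "... = - (1/c)*I x" using main[OF x] c by simp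
  also have "... = integral ?B (%y. - (1/c)*(((x-y) \<bullet> (x-y)) powr (-m)*laplacian w y))"
   unfolding I_def by (rule integral_mult_right[symmetric])
  also have "... = integral ?B (%y. ((x-y) \<bullet> (x-y)) powr (-m)*(- laplacian w y/c))"
   by (rule integral_cong) simp
  also have "-m = - (real (DIM('a)-2)/2)" using dim by (simp add: m_def of_nat_diff)
  finally show "v x = integral ?B (%y. ((x-y) \<bullet> (x-y)) powr (- (real (DIM('a)-2)/2))*(- laplacian w y/c))" .
 qed (rule d)
qed

section \<open>Regularity and complexification of Newtonian potentials\<close>

lemma has_derivative_Basis_expand:
 fixes f :: "'a::euclidean_space => real"
 assumes "f differentiable at x"
 shows "frechet_derivative f (at x) v = (\<Sum>b\<in>Basis. pd b f x*(v \<bullet> b))"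
proof -
 have l: "linear (frechet_derivative f (at x))" using linear_frechet_derivative[OF assms] .
 have "frechet_derivative f (at x) v = frechet_derivative f (at x) (\<Sum>b\<in>Basis. (v \<bullet> b) *R b)"
  by (simp add: euclidean_representation)
 also have "... = (\<Sum>b\<in>Basis. (v \<bullet> b) *R frechet_derivative f (at x) b)"
  by (simp add: linear_sum[OF l] linear_cmul[OF l])
 finally show ?thesis by (simp add: mult.commute)
qed

text \<open>The singularity x = y is never met: for x within d of p, either y lies within 2d, where
  the density vanishes, or y lies outside the closed ball of radius d, where x and y differ. These
  two open regions cover the product.\<close>

lemma potential_joint_continuous:
 fixes \<rho> L :: "'a::euclidean_space => real"
 assumes d: "d > 0" and \<rho>: "continuous_on UNIV \<rho>" "!!y. y \<in> ball p (2*d) ==> \<rho> y = 0"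
  and L: "continuous_on (-{0}) L"
 shows "continuous_on (ball p d \<times> UNIV) (%(x, y). L (x-y)*\<rho> y)"
proof -
 have eq: "ball p d \<times> UNIV = ball p d \<times> ball p (2*d) \<union> ball p d \<times> (- cball p d)"
  using d by auto
 have 1: "continuous_on (ball p d \<times> ball p (2*d)) (%(x, y). L (x-y)*\<rho> y)"
 proof -
  have "continuous_on (ball p d \<times> ball p (2*d)) (%_. 0::real)" by simp
  then show ?thesis by (rule continuous_on_eq) (auto simp: \<rho>(2))
 qed
 have 2: "continuous_on (ball p d \<times> (- cball p d)) (%(x, y). L (x-y)*\<rho> y)"
  unfolding split_beta
  by (intro continuous_intros continuous_on_compose2[OF L] continuous_on_compose2[OF \<rho>(1)]) auto
 show ?thesis unfolding eq
  by (rule continuous_on_open_Un[OF _ _ 1 2]) (auto intro!: open_Times simp: open_Compl)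
qed

lemma potential_has_derivative:
 fixes \<rho> K :: "'a::euclidean_space => real"
 assumes d: "d > 0" and \<rho>: "continuous_on UNIV \<rho>" "!!y. y \<in> ball p (2*d) ==> \<rho> y = 0"
  and K: "Ck_on 1 (-{0}) K" and x0: "x0 \<in> ball p d"
 shows "((%x. integral (cbox A B) (%y. K (x-y)*\<rho> y)) has_derivative
  (%v. integral (cbox A B) (%y. pd v K (x0-y)*\<rho> y))) (at x0)"
proof -
 have o: "open (- {0::'a})" by (simp add: open_Compl)
 have dK: "K differentiable at z" if "z ~= 0" for z using Ck_on_Suc_diff[OF o, of 0 K z] K that by simp
 have cK: "continuous_on (-{0}) K" "continuous_on (-{0}) (pd v K)" for v
  using Ck_on_SucD[OF o, of 0 K] K by simp_all
 \<comment> \<open>The Leibniz rule asks for a derivative that is continuous as a bounded linear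
   functional, so it is assembled from the partial derivatives.\<close>
 define F where "F x y = (\<Sum>b\<in>Basis. (pd b K (x-y)*\<rho> y) *R blinfun_inner_left b)" for x y :: 'a
 have F: "blinfun_apply (F x y) v = pd v K (x-y)*\<rho> y" if "x \<in> ball p d" for x y v
 proof (cases "y \<in> ball p (2*d)")
  case True then show ?thesis by (simp add: F_def blinfun.sum_left blinfun.scaleR_left \<rho>(2))
 next
  case False
  then have "x-y ~= 0" using that d by auto
  then show ?thesis using has_derivative_Basis_expand[OF dK, of "x-y" v]
   by (simp add: F_def blinfun.sum_left blinfun.scaleR_left sum_distrib_left algebra_simps)
 qed
 have cF: "continuous_on (ball p d \<times> cbox A B) (%(x, y). F x y)"
 proof -
  have "continuous_on (ball p d \<times> cbox A B) (%z. pd b K (fst z-snd z)*\<rho> (snd z))" for b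
  proof -
   have "continuous_on (ball p d \<times> cbox A B) (%(x, y). pd b K (x-y)*\<rho> y)"
    by (rule continuous_on_subset[OF potential_joint_continuous[OF d \<rho> cK(2)[of b]]]) auto
   then show ?thesis by (simp add: split_beta)
  qed
  then show ?thesis unfolding F_def split_beta
   by (intro continuous_on_sum continuous_on_scaleR continuous_on_const)
 qed
 have "((%x. integral (cbox A B) (%y. K (x-y)*\<rho> y)) has_derivative
  blinfun_apply (integral (cbox A B) (F x0))) (at x0 within ball p d)"
 proof (rule leibniz_rule[OF _ _ cF x0 convex_ball])
  fix x y assume x: "x \<in> ball p d"
  show "((%x. K (x-y)*\<rho> y) has_derivative blinfun_apply (F x y)) (at x within ball p d)"
  proof (cases "y \<in> ball p (2*d)")
   case True
   then have "blinfun_apply (F x y) = (%v. 0)" using F[OF x] \<rho>(2) by auto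
   then show ?thesis using \<rho>(2)[OF True] by simp
  next
   case False
   then have "x-y ~= 0" using x d by auto
   note dKx = has_derivative_frechet[OF dK[OF this]]
   have "((%x. x-y) has_derivative (%v. v)) (at x)" by (auto intro!: derivative_eq_intros)
   from has_derivative_compose[OF this dKx]
   have "((%x. K (x-y)*\<rho> y) has_derivative (%v. pd v K (x-y)*\<rho> y)) (at x)"
    by (rule has_derivative_mult_left)
   moreover have "blinfun_apply (F x y) = (%v. pd v K (x-y)*\<rho> y)" using F[OF x] by auto
   ultimately show ?thesis by (simp add: has_derivative_at_withinI)
  qed
 next
  fix x assume x: "x \<in> ball p d"
  have "continuous_on (cbox A B) (%y. (%(x, y). K (x-y)*\<rho> y) (x, y))"
   by (rule continuous_on_compose2[OF potential_joint_continuous[OF d \<rho> cK(1)]]) (use x in \<open>auto intro!: continuous_intros\<close>)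
  then show "(%y. K (x-y)*\<rho> y) integrable_on cbox A B" by (intro integrable_continuous) simp
 qed
 moreover have "blinfun_apply (integral (cbox A B) (F x0)) v = integral (cbox A B) (%y. pd v K (x0-y)*\<rho> y)" for v
 proof -
  have "continuous_on (cbox A B) (%y. (%(x, y). F x y) (x0, y))"
   by (rule continuous_on_compose2[OF cF]) (use x0 in \<open>auto intro!: continuous_intros\<close>)
  then have "F x0 integrable_on cbox A B" by (intro integrable_continuous) simp
  from integral_linear[OF this blinfun.bounded_linear_left[of v]]
  show ?thesis using F[OF x0] by (simp add: o_def)
 qed
 then have "blinfun_apply (integral (cbox A B) (F x0)) = (%v. integral (cbox A B) (%y. pd v K (x0-y)*\<rho> y))" by auto
 ultimately show ?thesis unfolding at_within_open[OF x0 open_ball] by simp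
qed

text \<open>One order of smoothness of the kernel is spent to obtain continuity from
  differentiability at the bottom of the induction. This is harmless, as the kernel has all orders
  off the origin.\<close>

lemma potential_Ck:
 fixes \<rho> K :: "'a::euclidean_space => real"
 assumes d: "d > 0" and \<rho>: "continuous_on UNIV \<rho>" "!!y. y \<in> ball p (2*d) ==> \<rho> y = 0"
  and K: "Ck_on (Suc k) (-{0}) K"
 shows "Ck_on k (ball p d) (%x. integral (cbox A B) (%y. K (x-y)*\<rho> y))"
 using K
proof (induction k arbitrary: K)
 case 0
 have H: "((%x. integral (cbox A B) (%y. K (x-y)*\<rho> y)) has_derivative
  (%v. integral (cbox A B) (%y. pd v K (x0-y)*\<rho> y))) (at x0)" if "x0 \<in> ball p d" for x0
 proof -
  have "Ck_on 1 (-{0}) K" using 0 by (simp only: One_nat_def)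
  from potential_has_derivative[OF d \<rho> this that] show ?thesis .
 qed
 have "isCont (%x. integral (cbox A B) (%y. K (x-y)*\<rho> y)) x0" if "x0 \<in> ball p d" for x0
  by (rule has_derivative_continuous[OF H[OF that]])
 then show ?case by (simp add: continuous_on_eq_continuous_at[OF open_ball])
next
 case (Suc k)
 have "Ck_on 1 (-{0}) K" by (rule Ck_on_le[OF _ Suc.prems]) auto
 then show ?case
  by (intro Ck_on_SucI[OF open_ball potential_has_derivative[OF d \<rho>]] Suc.IH Ck_on_Suc_pd[OF Suc.prems])
qed

lemma Ck_on_inner_powr:
 "Ck_on k (-{0::'a::euclidean_space}) (%z. (z \<bullet> z) powr a)"
proof -
 define F where "F j s = (\<Prod>i<j. a-real i) * s powr (a-real j)" for j :: nat and s :: real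
 have "Ck_on k (-{0::'a}) (%z. F 0 ((z-0) \<bullet> (z-0)))"
 proof (rule Ck_on_compose_real[where T="{0<..}" and F=F])
  show "Ck_on k (- {0::'a}) (%z. (z-0) \<bullet> (z-0))" by (rule Ck_on_dist_square) (simp add: open_Compl)
  show "DERIV (F j) t :> F (Suc j) t" if "t \<in> {0<..}" for j t
   unfolding F_def using that by (auto intro!: derivative_eq_intros simp: algebra_simps)
  show "continuous_on {0<..} (F k)" unfolding F_def by (intro continuous_intros) auto
 qed (auto simp: open_Compl)
 then show ?thesis by (simp add: F_def)
qed

lemma harmonic_Ck:
 fixes v :: "'a::euclidean_space => real"
 assumes dim: "DIM('a) >= 3" and S: "open S" and C2: "Ck_on 2 S v"
  and harm: "!!x. x \<in> S ==> laplacian v x = 0"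
 shows "Ck_on k S v"
proof (rule Ck_on_localI[OF S])
 fix x assume "x \<in> S"
 then obtain r where r: "r > 0" "ball x r \<subseteq> S" using S open_contains_ball by blast
 obtain \<rho> A B d where *: "d > 0" "continuous_on UNIV \<rho>" "!!y. y \<in> ball x (2*d) ==> \<rho> y = 0"
  "!!z. z \<in> ball x d ==>
   v z = integral (cbox A B) (%y. ((z-y) \<bullet> (z-y)) powr (-((DIM('a)-2)/2))*\<rho> y)"
  by (rule harmonic_representation[OF dim r(1) Ck_on_subset[OF S open_ball r(2) C2] harm[OF subsetD[OF r(2)]]])
   (assumption, rule that, assumption+)
 have sub: "ball x (min d r) \<subseteq> ball x d" by auto
 have "Ck_on k (ball x d) (%z. integral (cbox A B) (%y. ((z-y) \<bullet> (z-y)) powr (-((DIM('a)-2)/2))*\<rho> y))"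
  by (rule potential_Ck[OF *(1-3), where k=k and K="%z. (z \<bullet> z) powr (-((DIM('a)-2)/2))"]) (simp_all only: Ck_on_inner_powr)
 from Ck_on_subset[OF open_ball open_ball sub this]
 have "Ck_on k (ball x (min d r)) v" by (rule Ck_on_cong[OF open_ball, rotated]) (use *(4) in simp)
 then show "\<exists>T. open T & x \<in> T & T \<subseteq> S & Ck_on k T v" 
  by (intro exI[of _ "ball x (min d r)"]) (use r *(1) in auto)
qed

text \<open>In the potential of v the squared distance from x0 + t theta + s e to y is a polynomial
  in t and s, so complex values can be inserted as long as it stays off the branch cut of the
  logarithm. Holomorphy in two variables is expressed by substituting holomorphic functions of one
  variable, which is the form in which it is used.\<close>

lemma harmonic_complexify:
 fixes v :: "'a::euclidean_space => real" and x0 \<theta> e :: 'a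
 assumes dim: "DIM('a) >= 3" and S: "open S" and C2: "Ck_on 2 S v"
  and harm: "!!x. x \<in> S ==> laplacian v x = 0" and x0: "x0 \<in> S"
 obtains \<delta> and V :: "complex => complex => complex" where "\<delta> > 0"
  "!!t s. \<bar>t\<bar> < \<delta> ==> \<bar>s\<bar> < \<delta> ==> x0+t *R \<theta>+s *R e \<in> S &
    V (of_real t) (of_real s) = of_real (v (x0+t *R \<theta>+s *R e))"
  "continuous_on (ball 0 \<delta> \<times> ball 0 \<delta>) (%z. V (fst z) (snd z))"
  "!!U g h. open U ==> g holomorphic_on U ==> h holomorphic_on U ==> g ` U \<subseteq> ball 0 \<delta> ==> h ` U \<subseteq> ball 0 \<delta>
   ==> (%\<tau>. V (g \<tau>) (h \<tau>)) holomorphic_on U"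
proof -
 obtain r where r: "r > 0" "ball x0 r \<subseteq> S" using S x0 open_contains_ball by blast
 obtain \<rho> A B d where *: "d > 0" "continuous_on UNIV \<rho>" "!!y. y \<in> ball x0 (2*d) ==> \<rho> y = 0"
  "!!z. z \<in> ball x0 d ==>
   v z = integral (cbox A B) (%y. ((z-y) \<bullet> (z-y)) powr (-((DIM('a)-2)/2))*\<rho> y)"
  by (rule harmonic_representation[OF dim r(1) Ck_on_subset[OF S open_ball r(2) C2] harm[OF subsetD[OF r(2)]]])
   (assumption, rule that, assumption+)
 define m where "m = - (real (DIM('a)-2)/2)"
 note * = *[folded m_def]
 obtain M where M: "!!y. y \<in> cbox A B ==> norm (x0-y) <= M" "M >= 0"
 proof -
  have "bounded ((%y. x0-y) ` cbox A B)"
   by (intro compact_imp_bounded compact_continuous_image continuous_intros compact_cbox)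
  then obtain M where "!!y. y \<in> cbox A B ==> norm (x0-y) <= M" unfolding bounded_iff by auto
  then have "!!y. y \<in> cbox A B ==> norm (x0-y) <= max M 0" by fastforce
  then show ?thesis using that[of "max M 0"] by simp
 qed
 define N where "N = norm \<theta>+norm e+1"
 have N: "N >= 1" by (simp add: N_def)
 \<comment> \<open>Bounds the non-constant part P of the squared distance: for parameters below
   delta <= 1 it is at most delta W. The choice of delta then makes this at most d^2/2, half of the
   least constant part.\<close>
 define W where "W = 2*M*N+N^2"
 have W: "W > 0" using M(2) N by (simp add: W_def add_nonneg_pos)
 define \<delta> where "\<delta> = min 1 (min (d^2/(2*W)) (min d r/N))"
 have \<delta>: "\<delta> > 0" "\<delta> <= 1" "\<delta>*W <= d^2/2" "\<delta>*N <= d" "\<delta>*N <= r"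
 proof -
  show "\<delta> > 0" using *(1) W r N by (simp add: \<delta>_def)
  show "\<delta> <= 1" by (simp add: \<delta>_def)
  have "\<delta> <= d^2/(2*W)" by (simp add: \<delta>_def)
  then have "\<delta>*W <= d^2/(2*W)*W" using W by (intro mult_right_mono) auto
  then show "\<delta>*W <= d^2/2" using W by simp
  have "\<delta> <= min d r/N" by (simp add: \<delta>_def)
  then have "\<delta>*N <= min d r" using N by (simp add: pos_le_divide_eq)
  then show "\<delta>*N <= d" "\<delta>*N <= r" by auto
 qed
 define P where "P \<tau> \<sigma> y = 2*\<tau> * of_real ((x0-y) \<bullet> \<theta>)+2*\<sigma> * of_real ((x0-y) \<bullet> e)
  + \<tau>^2 * of_real (\<theta> \<bullet> \<theta>)+2*\<tau>*\<sigma> * of_real (\<theta> \<bullet> e)+\<sigma>^2 * of_real (e \<bullet> e)" for \<tau> \<sigma> :: complex and y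
 \<comment> \<open>The maximum with d^2 keeps the real part of Q positive even for y near x0. It
   changes nothing in the integral, because the density vanishes within 2d of x0.\<close>
 define Q where "Q \<tau> \<sigma> y = complex_of_real (max ((x0-y) \<bullet> (x0-y)) (d^2))+P \<tau> \<sigma> y" for \<tau> \<sigma> y
 have Pn: "norm (P \<tau> \<sigma> y) <= d^2/2" if ts: "norm \<tau> < \<delta>" "norm \<sigma> < \<delta>" and y: "y \<in> cbox A B" for \<tau> \<sigma> y
 proof -
  have a: "\<bar>(x0-y) \<bullet> z\<bar> <= M*norm z" for z
   using Cauchy_Schwarz_ineq2[of "x0-y" z] mult_right_mono[OF M(1)[OF y], of "norm z"] by simp
  have 1: "norm (2*\<tau> * of_real ((x0-y) \<bullet> \<theta>)) <= 2*\<delta>*(M*norm \<theta>)"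
   unfolding norm_mult norm_of_real using ts a[of \<theta>] M(2) \<delta>(1) by (intro mult_mono) auto
  have 2: "norm (2*\<sigma> * of_real ((x0-y) \<bullet> e)) <= 2*\<delta>*(M*norm e)"
   unfolding norm_mult norm_of_real using ts a[of e] M(2) \<delta>(1) by (intro mult_mono) auto
  have 3: "norm (\<tau>^2 * of_real (\<theta> \<bullet> \<theta>)) <= \<delta>^2*(norm \<theta>*norm \<theta>)"
   unfolding norm_mult norm_of_real norm_power using ts by (intro mult_mono power_mono) (auto simp: norm_eq_sqrt_inner)
  have 4: "norm (2*\<tau>*\<sigma> * of_real (\<theta> \<bullet> e)) <= 2*\<delta>*\<delta>*(norm \<theta>*norm e)"
   unfolding norm_mult norm_of_real using ts Cauchy_Schwarz_ineq2[of \<theta> e] \<delta>(1) by (intro mult_mono) auto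
  have 5: "norm (\<sigma>^2 * of_real (e \<bullet> e)) <= \<delta>^2*(norm e*norm e)"
   unfolding norm_mult norm_of_real norm_power using ts by (intro mult_mono power_mono) (auto simp: norm_eq_sqrt_inner)
  have "norm (P \<tau> \<sigma> y) <= 2*\<delta>*(M*norm \<theta>)+2*\<delta>*(M*norm e)+\<delta>^2*(norm \<theta>*norm \<theta>)
   + 2*\<delta>*\<delta>*(norm \<theta>*norm e)+\<delta>^2*(norm e*norm e)"
   unfolding P_def by (intro norm_triangle_le add_mono 1 2 3 4 5)
  also have "... = 2*\<delta>*M*(N-1)+\<delta>*(\<delta>*(N-1)^2)"
   by (simp add: N_def power2_eq_square algebra_simps)
  also have "... <= 2*\<delta>*M*N+\<delta>*(1*N^2)"
   using \<delta> M(2) N by (intro add_mono mult_left_mono mult_mono power_mono) auto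
  also have "... = \<delta>*W" by (simp add: W_def algebra_simps)
  finally show ?thesis using \<delta> by simp
 qed
 have Qn: "Q \<tau> \<sigma> y \<notin> \<real>\<^sub>\<le>\<^sub>0" if ts: "norm \<tau> < \<delta>" "norm \<sigma> < \<delta>" and y: "y \<in> cbox A B" for \<tau> \<sigma> y
 proof -
  have "Re (P \<tau> \<sigma> y) >=-(d^2/2)" using Pn[OF that] abs_Re_le_cmod[of "P \<tau> \<sigma> y"] by linarith
  moreover have "d^2 <= max ((x0-y) \<bullet> (x0-y)) (d^2)" by simp
  moreover have "d^2 > 0" using *(1) by simp
  ultimately have "Re (Q \<tau> \<sigma> y) > 0" unfolding Q_def plus_complex.sel Re_complex_of_real by linarith
  then show ?thesis by (auto simp: complex_nonpos_Reals_iff)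
 qed
 define V where "V \<tau> \<sigma> = integral (cbox A B) (%y. exp (of_real m*Ln (Q \<tau> \<sigma> y)) * of_real (\<rho> y))" for \<tau> \<sigma>
 have cQ: "continuous_on X (%z. Q (f z) (g z) (k z))" if "continuous_on X f" "continuous_on X g" "continuous_on X k" 
  for X :: "'b::topological_space set" and f g k
  unfolding Q_def P_def by (intro continuous_intros that)
 have c\<rho>: "continuous_on X (%z. complex_of_real (\<rho> (k z)))" if "continuous_on X k" for X :: "'b::topological_space set" and k
  by (intro continuous_intros continuous_on_compose2[OF *(2) that]) auto
 show ?thesis
 proof (rule that[OF \<delta>(1), of V])
  fix t s :: real assume ts: "\<bar>t\<bar> < \<delta>" "\<bar>s\<bar> < \<delta>"
  define z where "z = x0+t *R \<theta>+s *R e"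
  have "norm (t *R \<theta>+s *R e) <= \<bar>t\<bar>*norm \<theta>+\<bar>s\<bar>*norm e"
   using norm_triangle_ineq[of "t *R \<theta>" "s *R e"] by simp
  also have "... <= \<delta>*norm \<theta>+\<delta>*norm e" using ts by (intro add_mono mult_right_mono) auto
  also have "... < \<delta>*N" using \<delta> by (simp add: N_def algebra_simps)
  also have "norm (t *R \<theta>+s *R e) = dist x0 z" unfolding dist_norm z_def
   by (subst norm_minus_commute) (simp add: add.assoc)
  finally have "dist x0 z < \<delta>*N" .
  then have zz: "z \<in> ball x0 d" "z \<in> S" using \<delta> r by auto
  have "V (of_real t) (of_real s) = integral (cbox A B) (%y. complex_of_real (((z-y) \<bullet> (z-y)) powr m*\<rho> y))"
   unfolding V_def
  proof (rule integral_cong)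
   fix y
   show "exp (of_real m*Ln (Q (of_real t) (of_real s) y)) * of_real (\<rho> y) = complex_of_real (((z-y) \<bullet> (z-y)) powr m*\<rho> y)"
   proof (cases "\<rho> y = 0")
    case False
    then have y: "y \<notin> ball x0 (2*d)" using *(3) by blast
    then have "d <= norm (x0-y)" using *(1) by (simp add: dist_norm)
    then have "d^2 <= (x0-y) \<bullet> (x0-y)" using *(1) by (simp add: power2_norm_eq_inner[symmetric] power_mono)
    then have "Q (of_real t) (of_real s) y = of_real ((x0-y) \<bullet> (x0-y))+P (of_real t) (of_real s) y"
     by (simp add: Q_def max_def)
    also have "... = of_real ((z-y) \<bullet> (z-y))"
     unfolding P_def z_def
     by (simp add: inner_simps inner_commute power2_eq_square algebra_simps)
    finally have Q: "Q (of_real t) (of_real s) y = of_real ((z-y) \<bullet> (z-y))" .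
    have "z ~= y" using zz(1) y *(1) by auto
    then have "(z-y) \<bullet> (z-y) > 0" by simp
    then show ?thesis unfolding Q by (simp add: Ln_of_real powr_def exp_of_real[symmetric] del: exp_of_real)
   qed simp
  qed
  also have "... = of_real (v z)"
  proof -
   have "((%y. ((z-y) \<bullet> (z-y)) powr m*\<rho> y) has_integral v z) (cbox A B)"
   proof -
    have "continuous_on (cbox A B) (%y. (%(x, y). (%u. (u \<bullet> u) powr m) (x-y)*\<rho> y) (z, y))"
     by (rule continuous_on_compose2[OF potential_joint_continuous[OF *(1-3)]])
      (use zz in \<open>auto intro!: continuous_intros\<close>)
    then have "(%y. ((z-y) \<bullet> (z-y)) powr m*\<rho> y) integrable_on cbox A B" by (intro integrable_continuous) simp
    then show ?thesis using *(4)[OF zz(1)] by (simp add: has_integral_iff)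
   qed
   then show ?thesis by (intro integral_unique has_integral_of_real)
  qed
  finally show "x0+t *R \<theta>+s *R e \<in> S & V (of_real t) (of_real s) = of_real (v (x0+t *R \<theta>+s *R e))"
   using zz by (simp add: z_def)
 next
  show "continuous_on (ball 0 \<delta> \<times> ball 0 \<delta>) (%z. V (fst z) (snd z))"
   unfolding V_def
   by (rule integral_continuous_on_param, unfold split_beta)
    (auto intro!: continuous_intros cQ c\<rho> dest: Qn)
 next
  fix U g h assume U: "open U" and g: "g holomorphic_on U" and h: "h holomorphic_on U"
   and gU: "g ` U \<subseteq> ball 0 \<delta>" and hU: "h ` U \<subseteq> ball 0 \<delta>"
  show "(%\<tau>. V (g \<tau>) (h \<tau>)) holomorphic_on U"
   unfolding holomorphic_on_open[OF U]
  proof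
   fix \<tau>0 assume "\<tau>0 \<in> U"
   then obtain r' where r': "r' > 0" "ball \<tau>0 r' \<subseteq> U" using U open_contains_ball by blast
   let ?U = "ball \<tau>0 r'"
   have nr: "norm (g \<tau>) < \<delta>" "norm (h \<tau>) < \<delta>" if "\<tau> \<in> ?U" for \<tau>
   proof -
    have "g \<tau> \<in> ball 0 \<delta>" "h \<tau> \<in> ball 0 \<delta>" using that r' gU hU by blast+
    then show "norm (g \<tau>) < \<delta>" "norm (h \<tau>) < \<delta>" by simp_all
   qed
   have dg: "(g has_field_derivative deriv g \<tau>) (at \<tau>)" "(h has_field_derivative deriv h \<tau>) (at \<tau>)" if "\<tau> \<in> ?U" for \<tau>
    using that r' g h U by (auto intro: holomorphic_derivI)
   have cg: "continuous_on ?U g" "continuous_on ?U h" "continuous_on ?U (deriv g)" "continuous_on ?U (deriv h)"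
    using g h r' U by (auto intro!: holomorphic_on_imp_continuous_on intro: holomorphic_on_subset holomorphic_deriv)
   define Q' where "Q' \<tau> y = 2*deriv g \<tau> * of_real ((x0-y) \<bullet> \<theta>)+2*deriv h \<tau> * of_real ((x0-y) \<bullet> e)
    + 2*g \<tau>*deriv g \<tau> * of_real (\<theta> \<bullet> \<theta>)+2*(deriv g \<tau>*h \<tau>+g \<tau>*deriv h \<tau>) * of_real (\<theta> \<bullet> e)
    + 2*h \<tau>*deriv h \<tau> * of_real (e \<bullet> e)" for \<tau> y
   have dQ: "((%\<tau>. Q (g \<tau>) (h \<tau>) y) has_field_derivative Q' \<tau> y) (at \<tau>)" if "\<tau> \<in> ?U" for \<tau> y
    unfolding Q_def P_def Q'_def
    by (auto intro!: derivative_eq_intros dg[OF that] simp: algebra_simps)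
   define f where "f \<tau> y = exp (of_real m*Ln (Q (g \<tau>) (h \<tau>) y)) * of_real (\<rho> y)" for \<tau> y
   define f' where "f' \<tau> y = exp (of_real m*Ln (Q (g \<tau>) (h \<tau>) y))*(of_real m*(inverse (Q (g \<tau>) (h \<tau>) y)*Q' \<tau> y)) * of_real (\<rho> y)" for \<tau> y
   have c1: "continuous_on (?U \<times> cbox A B) (%z. Q (g (fst z)) (h (fst z)) (snd z))"
    by (intro cQ continuous_intros continuous_on_compose2[OF cg(1)] continuous_on_compose2[OF cg(2)]) auto
   have "((%\<tau>. integral (cbox A B) (f \<tau>)) has_field_derivative integral (cbox A B) (f' \<tau>0)) (at \<tau>0 within ?U)"
   proof (rule leibniz_rule_field_derivative)
    fix \<tau> y assume t: "\<tau> \<in> ?U" and y: "y \<in> cbox A B"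
    show "((%\<tau>. f \<tau> y) has_field_derivative f' \<tau> y) (at \<tau> within ?U)"
     unfolding f_def f'_def
     by (rule has_field_derivative_at_within)
      (use Qn[OF nr[OF t] y] in \<open>auto intro!: derivative_eq_intros dQ[OF t] simp: field_simps\<close>)
   next
    fix \<tau> assume t: "\<tau> \<in> ?U"
    show "f \<tau> integrable_on cbox A B" unfolding f_def
     by (intro integrable_continuous continuous_intros cQ c\<rho>) (use Qn[OF nr[OF t]] in auto)
   next
    show "continuous_on (?U \<times> cbox A B) (%(\<tau>, y). f' \<tau> y)"
    proof -
     have q0: "Q (g (fst z)) (h (fst z)) (snd z) \<notin> \<real>\<^sub>\<le>\<^sub>0" if "z \<in> ?U \<times> cbox A B" for z
      using Qn[OF nr(1) nr(2), of "fst z" "fst z" "snd z"] that by auto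
     then have q1: "\<forall>z\<in>?U \<times> cbox A B. Q (g (fst z)) (h (fst z)) (snd z) ~= 0" by fastforce
     have cf: "continuous_on (?U \<times> cbox A B) (%z. k (fst z))" if "continuous_on ?U k" for k :: "complex => complex"
      by (rule continuous_on_compose2[OF that]) (auto intro!: continuous_intros)
     have c2: "continuous_on (?U \<times> cbox A B) (%z. Ln (Q (g (fst z)) (h (fst z)) (snd z)))"
      by (rule continuous_on_Ln'[OF c1 q0])
     have c3: "continuous_on (?U \<times> cbox A B) (%z. Q' (fst z) (snd z))"
      unfolding Q'_def by (intro continuous_intros cf cg)
     show ?thesis unfolding f'_def split_beta
      by (intro continuous_on_mult continuous_on_exp continuous_on_const c2 c3 continuous_on_inverse c1 q1 c\<rho> continuous_on_snd continuous_on_id)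
    qed
   qed (use r' in auto)
   then show "\<exists>f'. ((%\<tau>. V (g \<tau>) (h \<tau>)) has_field_derivative f') (at \<tau>0)"
    using at_within_open[OF _ open_ball, of \<tau>0 \<tau>0 r'] r' unfolding V_def f_def by auto
  qed
 qed
qed

lemma laplacian_add:
 fixes f g :: "'a::euclidean_space => real"
 assumes "open S" "Ck_on 2 S f" "Ck_on 2 S g" "x \<in> S"
 shows "laplacian (%x. f x+g x) x = laplacian f x+laplacian g x"
proof -
 have 1: "pd b (%x. f x+g x) y = pd b f y+pd b g y" if "f differentiable at y" "g differentiable at y" for b y and f g :: "'a => real"
  using frechet_derivative_eqI[OF has_derivative_add[OF has_derivative_frechet[OF that(1)] has_derivative_frechet[OF that(2)]]] by simp
 have d: "f differentiable at y" "g differentiable at y" "pd b f differentiable at y" "pd b g differentiable at y" if "y \<in> S" for y b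
  using that assms Ck_on_Suc_diff[OF assms(1), of 1] Ck_on_Suc_diff[OF assms(1), of 0]
  by (simp_all add: numeral_2_eq_2 differentiable_on_openD)
 have "pd b (pd b (%x. f x+g x)) x = pd b (pd b f) x+pd b (pd b g) x" for b
 proof -
  have "frechet_derivative (pd b (%x. f x+g x)) (at x) = frechet_derivative (%x. pd b f x+pd b g x) (at x)"
   by (rule frechet_derivative_cong_open[OF assms(1,4)]) (simp add: 1 d)
  then show ?thesis using 1[OF d(3,4)[OF assms(4)]] by simp
 qed
 then show ?thesis unfolding laplacian_def by (simp add: sum.distrib)
qed

lemma laplacian_cmult_norm2:
 fixes x :: "'a::euclidean_space"
 shows "laplacian (%y. c*(y \<bullet> y)) x = 2*real DIM('a)*c"
proof -
 define F where "F j s = (if j = 0 then c * s else if j = 1 then c else 0)" for j :: nat and s :: real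
 have "DERIV (F j) s :> F (Suc j) s" if "j < 2" for j s
  using that unfolding F_def by (auto intro!: derivative_eq_intros simp: less_2_cases_iff)
 then show ?thesis using laplacian_radial(2)[of UNIV F x 0] by (simp add: F_def)
qed

text \<open>A quadratic polynomial absorbs the constant Laplacian. It is smooth and has an obvious
  complexification, so the results for harmonic functions carry over to the equation of u.\<close>

lemma lap_const_shift:
 fixes f :: "'a::euclidean_space => real"
 assumes S: "open S" and C2: "Ck_on 2 S f" and lap: "!!x. x \<in> S ==> laplacian f x = \<kappa>"
 defines "c \<equiv>-\<kappa>/(2*real DIM('a))"
 shows "Ck_on k UNIV (%y::'a. c*(y \<bullet> y))" "Ck_on 2 S (%y. f y+c*(y \<bullet> y))" 
  "!!x. x \<in> S ==> laplacian (%y. f y+c*(y \<bullet> y)) x = 0"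
proof -
 have q: "Ck_on k T (%y::'a. c*(y \<bullet> y))" if "open T" for k T
  using Ck_on_cmult[OF that Ck_on_dist_square[OF that, of k 0]] by simp
 then show "Ck_on k UNIV (%y::'a. c*(y \<bullet> y))" "Ck_on 2 S (%y. f y+c*(y \<bullet> y))"
  using Ck_on_add[OF S C2] S by auto
 show "laplacian (%y. f y+c*(y \<bullet> y)) x = 0" if "x \<in> S" for x
  using laplacian_add[OF S C2 q[OF S] that] lap[OF that] laplacian_cmult_norm2[of c x] by (simp add: c_def)
qed

lemma lap_const_Ck:
 fixes f :: "'a::euclidean_space => real"
 assumes dim: "DIM('a) >= 3" and S: "open S" and C2: "Ck_on 2 S f" and lap: "!!x. x \<in> S ==> laplacian f x = \<kappa>"
 shows "Ck_on k S f"
proof -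
 note A = lap_const_shift[OF S C2 lap]
 have "Ck_on k S (%y. f y + - \<kappa>/(2*real DIM('a))*(y \<bullet> y))"
  by (rule harmonic_Ck[OF dim S A(2,3)])
 from Ck_on_diff[OF S this Ck_on_subset[OF open_UNIV S subset_UNIV A(1)]]
 show ?thesis by simp
qed

lemma laplacian_pd:
 fixes f :: "'a::euclidean_space => real"
 assumes S: "open S" and C: "Ck_on 3 S f" and lap: "!!x. x \<in> S ==> laplacian f x = \<kappa>" and x: "x \<in> S"
 shows "laplacian (pd e f) x = 0"
proof -
 have C2: "Ck_on 2 S f" by (rule Ck_on_le[OF S C]) simp
 have C2': "Ck_on 2 S (pd b f)" for b using C by (simp add: numeral_2_eq_2 numeral_3_eq_3)
 have d2: "pd b (pd b f) differentiable at x" for b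
 proof -
  have "Ck_on 1 S (pd b (pd b f))" using C by (simp add: numeral_3_eq_3)
  then show ?thesis using Ck_on_Suc_diff[OF S, of 0] x by simp
 qed
 have "pd b (pd b (pd e f)) x = pd e (pd b (pd b f)) x" for b
 proof -
  have "frechet_derivative (pd b (pd e f)) (at x) = frechet_derivative (pd e (pd b f)) (at x)"
   by (rule frechet_derivative_cong_open[OF S x]) (rule pd_commute[OF S C2])
  then have "pd b (pd b (pd e f)) x = pd b (pd e (pd b f)) x" by simp
  also have "... = pd e (pd b (pd b f)) x" by (rule pd_commute[OF S C2' x])
  finally show ?thesis .
 qed
 then have "laplacian (pd e f) x = (\<Sum>b\<in>Basis. pd e (pd b (pd b f)) x)" unfolding laplacian_def by simp
 also have "... = pd e (laplacian f) x"
 proof -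
  have "(laplacian f has_derivative (%v. \<Sum>b\<in>Basis. pd v (pd b (pd b f)) x)) (at x)"
   unfolding laplacian_def[abs_def] by (intro has_derivative_sum has_derivative_frechet d2)
  from frechet_derivative_eqI[OF this] show ?thesis by simp
 qed
 also have "... = pd e (%_. \<kappa>) x"
  using frechet_derivative_cong_open[OF S x, of "laplacian f" "%_. \<kappa>"] lap by simp
 finally show ?thesis by simp
qed

lemma lap_const_complexify:
 fixes f :: "'a::euclidean_space => real" and x0 \<theta> e :: 'a
 assumes dim: "DIM('a) >= 3" and S: "open S" and C2: "Ck_on 2 S f" and lap: "!!x. x \<in> S ==> laplacian f x = \<kappa>" and x0: "x0 \<in> S"
 obtains \<delta> and V :: "complex => complex => complex" where "\<delta> > 0"
  "!!t s. \<bar>t\<bar> < \<delta> ==> \<bar>s\<bar> < \<delta> ==> x0+t *R \<theta>+s *R e \<in> S &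
    V (of_real t) (of_real s) = of_real (f (x0+t *R \<theta>+s *R e))"
  "continuous_on (ball 0 \<delta> \<times> ball 0 \<delta>) (%z. V (fst z) (snd z))"
  "!!U g h. open U ==> g holomorphic_on U ==> h holomorphic_on U ==> g ` U \<subseteq> ball 0 \<delta> ==> h ` U \<subseteq> ball 0 \<delta>
   ==> (%\<tau>. V (g \<tau>) (h \<tau>)) holomorphic_on U"
proof -
 define c where "c = - \<kappa>/(2*real DIM('a))"
 note A = lap_const_shift[OF S C2 lap, folded c_def]
 obtain \<delta> V where V: "\<delta> > 0"
  "!!t s. \<bar>t\<bar> < \<delta> ==> \<bar>s\<bar> < \<delta> ==> x0+t *R \<theta>+s *R e \<in> S &
    V (of_real t) (of_real s) = of_real (f (x0+t *R \<theta>+s *R e)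
     + c*((x0+t *R \<theta>+s *R e) \<bullet> (x0+t *R \<theta>+s *R e)))"
  "continuous_on (ball 0 \<delta> \<times> ball 0 \<delta>) (%z. V (fst z) (snd z))"
  "!!U g h. open U ==> g holomorphic_on U ==> h holomorphic_on U ==> g ` U \<subseteq> ball 0 \<delta> ==> h ` U \<subseteq> ball 0 \<delta>
   ==> (%\<tau>. V (g \<tau>) (h \<tau>)) holomorphic_on U"
  by (rule harmonic_complexify[OF dim S A(2,3) x0, of \<theta> e]) (assumption+, rule that, assumption+)
 define P where "P \<tau> \<sigma> = of_real c*(of_real (x0 \<bullet> x0)+2*\<tau> * of_real (x0 \<bullet> \<theta>)+2*\<sigma> * of_real (x0 \<bullet> e)
  + \<tau>^2 * of_real (\<theta> \<bullet> \<theta>)+2*\<tau>*\<sigma> * of_real (\<theta> \<bullet> e)+\<sigma>^2 * of_real (e \<bullet> e))" for \<tau> \<sigma> :: complex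
 show ?thesis
 proof (rule that[OF V(1), of "%\<tau> \<sigma>. V \<tau> \<sigma>-P \<tau> \<sigma>"])
  fix t s :: real assume ts: "\<bar>t\<bar> < \<delta>" "\<bar>s\<bar> < \<delta>"
  have "P (of_real t) (of_real s) = of_real (c*((x0+t *R \<theta>+s *R e) \<bullet> (x0+t *R \<theta>+s *R e)))"
   unfolding P_def by (simp add: inner_simps inner_commute power2_eq_square algebra_simps)
  then show "x0+t *R \<theta>+s *R e \<in> S &
   V (of_real t) (of_real s)-P (of_real t) (of_real s) = of_real (f (x0+t *R \<theta>+s *R e))"
   using V(2)[OF ts] by simp
 next
  show "continuous_on (ball 0 \<delta> \<times> ball 0 \<delta>) (%z. V (fst z) (snd z)-P (fst z) (snd z))"
   unfolding P_def by (intro continuous_intros V(3))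
 next
  fix U g h assume "open U" "g holomorphic_on U" "h holomorphic_on U" "g ` U \<subseteq> ball 0 \<delta>" "h ` U \<subseteq> ball 0 \<delta>"
  then show "(%\<tau>. V (g \<tau>) (h \<tau>)-P (g \<tau>) (h \<tau>)) holomorphic_on U"
   unfolding P_def by (intro holomorphic_intros V(4))
 qed
qed

text \<open>Newton's map $\sigma \mapsto \sigma - V(\tau,\sigma)/A$ is a contraction depending holomorphically on $\tau$.\<close>
lemma complex_implicit_function:
 fixes V :: "complex => complex => complex" and A :: real
 assumes \<delta>: "\<delta> > 0" and c: "continuous_on (ball 0 \<delta> \<times> ball 0 \<delta>) (%z. V (fst z) (snd z))"
  and hol: "!!U g h. open U ==> g holomorphic_on U ==> h holomorphic_on U ==> g ` U \<subseteq> ball 0 \<delta> ==> h ` U \<subseteq> ball 0 \<delta>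
   ==> (%\<tau>. V (g \<tau>) (h \<tau>)) holomorphic_on U"
  and re: "!!t s. \<bar>t\<bar> < \<delta> ==> \<bar>s\<bar> < \<delta> ==> V (of_real t) (of_real s) \<in> \<real>"
  and V0: "V 0 0 = 0" and A: "A ~= 0" and dV: "(V 0 has_field_derivative of_real A) (at 0)"
 obtains \<epsilon> G where "\<epsilon> > 0" "\<epsilon> < \<delta>" "G holomorphic_on ball 0 \<epsilon>" "G ` ball 0 \<epsilon> \<subseteq> ball 0 \<delta>"
  "!!\<tau>. \<tau> \<in> ball 0 \<epsilon> ==> V \<tau> (G \<tau>) = 0" "!!t. \<bar>t\<bar> < \<epsilon> ==> G (of_real t) \<in> \<real>"
proof -
 have hs: "V \<tau> holomorphic_on ball 0 \<delta>" if "\<tau> \<in> ball 0 \<delta>" for \<tau>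
  using hol[of "ball 0 \<delta>" "%_. \<tau>" "%z. z"] that by (auto intro: holomorphic_intros simp: image_subset_iff)
 have z0: "(0::complex) \<in> ball 0 \<delta>" using \<delta> by simp
 have cd: "continuous_on (ball 0 \<delta>) (deriv (V 0))"
  by (intro holomorphic_on_imp_continuous_on holomorphic_deriv hs z0 open_ball)
 have d0: "deriv (V 0) 0 = of_real A" by (rule DERIV_imp_deriv[OF dV])
 obtain r1 where r1: "r1 > 0" "!!\<sigma>. norm \<sigma> < r1 ==> norm (deriv (V 0) \<sigma>-of_real A) < \<bar>A\<bar>/4"
 proof -
  have "isCont (deriv (V 0)) 0" using cd z0 continuous_on_eq_continuous_at open_ball by blast
  then obtain r1 where "r1 > 0" "!!\<sigma>. dist \<sigma> 0 < r1 ==> dist (deriv (V 0) \<sigma>) (deriv (V 0) 0) < \<bar>A\<bar>/4"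
   using A unfolding continuous_at_eps_delta by (metis zero_less_abs_iff divide_pos_pos zero_less_numeral)
  then show ?thesis using that by (auto simp: dist_norm d0)
 qed
 define R where "R = min (\<delta>/4) (r1/2)"
 have R: "R > 0" "4 * R <= \<delta>" "R < r1" "R < \<delta>" using \<delta> r1 by (auto simp: R_def)
 \<comment> \<open>Serves two purposes. By Cauchy's inequality on discs of radius R, the derivatives
   of V at tau and at 0 differ by at most |A|/4, which makes the map a contraction with constant
   1/2; and the image of 0 has norm at most R/4, so the disc of radius R is mapped into
   itself.\<close>
 define \<eta> where "\<eta> = \<bar>A\<bar> * R/4"
 have \<eta>: "\<eta> > 0" using A R by (simp add: \<eta>_def)
 define C where "C = cball (0::complex) (\<delta>/2) \<times> cball (0::complex) (\<delta>/2)"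
 have C: "compact C" "C \<subseteq> ball 0 \<delta> \<times> ball 0 \<delta>" unfolding C_def using \<delta> by (auto intro!: compact_Times)
 have uc: "uniformly_continuous_on C (%z. V (fst z) (snd z))"
  by (rule compact_uniformly_continuous[OF continuous_on_subset[OF c C(2)] C(1)])
 obtain \<epsilon>' where \<epsilon>': "\<epsilon>' > 0" "!!z z'. z \<in> C ==> z' \<in> C ==> dist z' z < \<epsilon>' ==> dist (V (fst z') (snd z')) (V (fst z) (snd z)) < \<eta>"
  using uc \<eta> unfolding uniformly_continuous_on_def by metis
 define \<epsilon> where "\<epsilon> = min \<epsilon>' (\<delta>/2)"
 have \<epsilon>: "\<epsilon> > 0" "\<epsilon> <= \<epsilon>'" "\<epsilon> <= \<delta>/2" "\<epsilon> < \<delta>" using \<epsilon>' \<delta> by (auto simp: \<epsilon>_def)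
 have diff: "norm (V \<tau> \<sigma>-V 0 \<sigma>) <= \<eta>" if "norm \<tau> < \<epsilon>" "norm \<sigma> <= \<delta>/2" for \<tau> \<sigma>
 proof -
  have "dist (\<tau>, \<sigma>) (0, \<sigma>) < \<epsilon>'" using that \<epsilon> by (simp add: dist_Pair_Pair)
  moreover have "(\<tau>, \<sigma>) \<in> C" "(0, \<sigma>) \<in> C" using that \<epsilon> \<delta> by (auto simp: C_def)
  ultimately have "dist (V \<tau> \<sigma>) (V 0 \<sigma>) < \<eta>" using \<epsilon>'(2)[of "(0,\<sigma>)" "(\<tau>,\<sigma>)"] by simp
  then show ?thesis by (simp add: dist_norm)
 qed
 define \<Phi> where "\<Phi> \<tau> \<sigma> = \<sigma>-V \<tau> \<sigma>/of_real A" for \<tau> \<sigma>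
 have lip: "norm (\<Phi> \<tau> \<sigma>-\<Phi> \<tau> \<sigma>') <= (1/2)*norm (\<sigma>-\<sigma>')"
  if \<tau>: "norm \<tau> < \<epsilon>" and s: "norm \<sigma> <= R" "norm \<sigma>' <= R" for \<tau> \<sigma> \<sigma>'
 proof (rule field_differentiable_bound[of "cball 0 R" _ "%\<sigma>. 1-deriv (V \<tau>) \<sigma>/of_real A"])
  have \<tau>\<delta>: "\<tau> \<in> ball 0 \<delta>" using \<tau> \<epsilon> by simp
  fix z :: complex assume z: "z \<in> cball 0 R"
  then have z\<delta>: "z \<in> ball 0 \<delta>" using R by simp
  have dz: "(V \<tau> has_field_derivative deriv (V \<tau>) z) (at z)" "(V 0 has_field_derivative deriv (V 0) z) (at z)"
   by (rule holomorphic_derivI[OF hs open_ball z\<delta>], fact \<tau>\<delta>, rule holomorphic_derivI[OF hs open_ball z\<delta>], fact z0)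
  show "(\<Phi> \<tau> has_field_derivative 1-deriv (V \<tau>) z/of_real A) (at z within cball 0 R)"
   unfolding \<Phi>_def[abs_def] by (rule has_field_derivative_at_within) (use A in \<open>auto intro!: derivative_eq_intros dz\<close>)
  have "(deriv ^^ 1) (%\<sigma>. V \<tau> \<sigma>-V 0 \<sigma>) z = deriv (V \<tau>) z-deriv (V 0) z"
   using DERIV_imp_deriv[OF DERIV_diff[OF dz]] by simp
  moreover have "norm ((deriv ^^ 1) (%\<sigma>. V \<tau> \<sigma>-V 0 \<sigma>) z) <= fact 1*\<eta>/R ^ 1"
  proof (rule Cauchy_inequality)
   have sub: "cball z R \<subseteq> ball 0 \<delta>"
   proof
    fix w assume "w \<in> cball z R"
    then have "norm w <= norm z+R" using norm_triangle_ineq2[of w z] by (simp add: dist_norm norm_minus_commute)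
    then show "w \<in> ball 0 \<delta>" using z R by simp
   qed
   have h: "(%\<sigma>. V \<tau> \<sigma>-V 0 \<sigma>) holomorphic_on ball 0 \<delta>" by (intro holomorphic_on_diff hs \<tau>\<delta> z0)
   show "(%\<sigma>. V \<tau> \<sigma>-V 0 \<sigma>) holomorphic_on ball z R"
    using holomorphic_on_subset[OF h] sub ball_subset_cball by blast
   show "continuous_on (cball z R) (%\<sigma>. V \<tau> \<sigma>-V 0 \<sigma>)"
    using continuous_on_subset[OF holomorphic_on_imp_continuous_on[OF h] sub] .
   show "norm (V \<tau> x-V 0 x) <= \<eta>" if "norm (z-x) = R" for x
   proof (rule diff[OF \<tau>])
    have "norm x <= norm z+norm (z-x)" by (metis add.commute diff_add_cancel norm_minus_commute norm_triangle_ineq)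
    then show "norm x <= \<delta>/2" using that z R by simp
   qed
  qed (rule R)
  ultimately have 1: "norm (deriv (V \<tau>) z-deriv (V 0) z) <= \<bar>A\<bar>/4" using R by (simp add: \<eta>_def)
  have 2: "norm (deriv (V 0) z-of_real A) < \<bar>A\<bar>/4" using r1(2)[of z] z R by simp
  have "norm (deriv (V \<tau>) z-of_real A) <= \<bar>A\<bar>/2"
   using norm_triangle_ineq[of "deriv (V \<tau>) z-deriv (V 0) z" "deriv (V 0) z-of_real A"] 1 2 by simp
  moreover have "1-deriv (V \<tau>) z/of_real A = - (deriv (V \<tau>) z-of_real A)/of_real A"
   using A by (simp add: diff_divide_distrib minus_divide_left[symmetric] del: minus_diff_eq)
  ultimately have "norm (1-deriv (V \<tau>) z/of_real A) <= \<bar>A\<bar>/2/\<bar>A\<bar>"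
   by (simp only: norm_divide norm_minus_cancel norm_of_real) (rule divide_right_mono, auto)
  then show "norm (1-deriv (V \<tau>) z/of_real A) <= 1/2" using A by simp
 qed (use s in auto)
 have \<Phi>0: "norm (\<Phi> \<tau> 0) <= R/4" if "norm \<tau> < \<epsilon>" for \<tau>
  using diff[OF that, of 0] \<delta> A by (simp add: \<Phi>_def V0 \<eta>_def norm_divide field_simps)
 have \<Phi>R: "norm (\<Phi> \<tau> \<sigma>) <= R" if "norm \<tau> < \<epsilon>" "norm \<sigma> <= R" for \<tau> \<sigma>
 proof -
  have "norm (\<Phi> \<tau> \<sigma>) <= norm (\<Phi> \<tau> \<sigma>-\<Phi> \<tau> 0)+norm (\<Phi> \<tau> 0)" by (metis diff_add_cancel norm_triangle_ineq)
  then show ?thesis using lip[OF that, of 0] \<Phi>0[OF that(1)] that R by simp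
 qed
 have "\<exists>\<sigma>. norm \<sigma> <= R & \<Phi> \<tau> \<sigma> = \<sigma>" if "norm \<tau> < \<epsilon>" for \<tau>
 proof -
  have "\<exists>!x. x \<in> cball 0 R & \<Phi> \<tau> x = x"
   by (rule Banach_fix[of _ "1/2"]) (use R \<Phi>R[OF that] lip[OF that] in \<open>auto simp: dist_norm complete_eq_closed\<close>)
  then show ?thesis by auto
 qed
 then obtain G where G: "!!\<tau>. norm \<tau> < \<epsilon> ==> norm (G \<tau>) <= R & \<Phi> \<tau> (G \<tau>) = G \<tau>" by metis
 \<comment> \<open>The iterates from 0 are holomorphic in tau, and real for real tau because V is
   real there. Both properties pass to their uniform limit, the fixed point G.\<close>
 define g where "g k \<tau> = (\<Phi> \<tau> ^^ k) 0" for k \<tau>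
 have gR: "norm (g k \<tau>) <= R" if "norm \<tau> < \<epsilon>" for k \<tau>
  by (induction k) (use that R \<Phi>R in \<open>auto simp: g_def\<close>)
 have gG: "norm (g k \<tau>-G \<tau>) <= (1/2)^k * R" if "norm \<tau> < \<epsilon>" for k \<tau>
 proof (induction k)
  case 0 then show ?case using G[OF that] by (simp add: g_def)
 next
  case (Suc k)
  have "norm (g (Suc k) \<tau>-G \<tau>) = norm (\<Phi> \<tau> (g k \<tau>)-\<Phi> \<tau> (G \<tau>))" using G[OF that] by (simp add: g_def)
  also have "... <= (1/2)*norm (g k \<tau>-G \<tau>)" using lip[OF that gR[OF that, of k], of "G \<tau>"] G[OF that] by linarith
  finally show ?case using Suc by simp
 qed
 have ghol: "g k holomorphic_on ball 0 \<epsilon>" for k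
 proof (induction k)
  case 0 then show ?case by (simp add: g_def[abs_def])
 next
  case (Suc k)
  have "g k ` ball 0 \<epsilon> \<subseteq> ball 0 \<delta>"
  proof (rule image_subsetI)
   fix \<tau> :: complex assume "\<tau> \<in> ball 0 \<epsilon>"
   then show "g k \<tau> \<in> ball 0 \<delta>" using gR[of \<tau> k] R by simp
  qed
  then have "(%\<tau>. V \<tau> (g k \<tau>)) holomorphic_on ball 0 \<epsilon>"
   using hol[OF open_ball holomorphic_on_ident Suc] subset_ball[of \<epsilon> \<delta> "0::complex"] \<epsilon> by simp
  then have "(%\<tau>. g k \<tau>-V \<tau> (g k \<tau>)/of_real A) holomorphic_on ball 0 \<epsilon>"
   using A by (intro holomorphic_intros Suc) auto
  moreover have "g (Suc k) = (%\<tau>. g k \<tau>-V \<tau> (g k \<tau>)/of_real A)" by (auto simp: g_def \<Phi>_def)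
  ultimately show ?case by simp
 qed
 have ul: "uniform_limit (ball 0 \<epsilon>) g G sequentially"
  unfolding uniform_limit_iff
 proof (intro allI impI)
  fix e :: real assume e: "e > 0"
  have "(%k. (1/2)^k * R) \<longlonglongrightarrow> 0 * R" by (intro tendsto_intros LIMSEQ_power_zero) simp
  then have "\<forall>\<^sub>F k in sequentially. (1/2)^k * R < e" using e by (intro order_tendstoD(2)[of _ 0]) auto
  then show "\<forall>\<^sub>F k in sequentially. \<forall>x\<in>ball 0 \<epsilon>. dist (g k x) (G x) < e"
  proof eventually_elim
   case (elim k) then show ?case using gG[of _ k] by (fastforce simp: dist_norm)
  qed
 qed
 have Ghol: "G holomorphic_on ball 0 \<epsilon>"
 proof (rule holomorphic_uniform_sequence[OF open_ball ghol])
  fix x :: complex assume "x \<in> ball 0 \<epsilon>"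
  then obtain d where "d > 0" "cball x d \<subseteq> ball 0 \<epsilon>" using open_contains_cball open_ball by blast
  then show "\<exists>d. 0 < d & cball x d \<subseteq> ball 0 \<epsilon> & uniform_limit (cball x d) g G sequentially"
   using uniform_limit_on_subset[OF ul] by blast
 qed
 show ?thesis
 proof (rule that[OF \<epsilon>(1,4) Ghol])
  show "G ` ball 0 \<epsilon> \<subseteq> ball 0 \<delta>" using G R by fastforce
  show "V \<tau> (G \<tau>) = 0" if "\<tau> \<in> ball 0 \<epsilon>" for \<tau> using G[of \<tau>] that A by (simp add: \<Phi>_def)
  show "G (of_real t) \<in> \<real>" if t: "\<bar>t\<bar> < \<epsilon>" for t
  proof -
   have nt: "norm (complex_of_real t) < \<epsilon>" using t by simp
   have "g k (of_real t) \<in> \<real>" for k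
   proof (induction k)
    case 0 then show ?case by (simp add: g_def)
   next
    case (Suc k)
    then obtain s where s: "g k (of_real t) = of_real s" by (auto elim: Reals_cases)
    have "\<bar>s\<bar> < \<delta>" using gR[OF nt, of k] R by (simp add: s)
    then have "V (of_real t) (of_real s) \<in> \<real>" using re t \<epsilon> by simp
    then show ?case using s by (simp add: g_def \<Phi>_def)
   qed
   moreover have "(%k. g k (of_real t)) \<longlonglongrightarrow> G (of_real t)"
    using tendsto_uniform_limitI[OF ul] nt by simp
   ultimately show ?thesis by (rule closed_sequentially[OF closed_complex_Reals])
  qed
 qed
qed

text \<open>The accumulation points of the level set in [0,1] form a closed set, which is open by
  the identity theorem for the local holomorphic extensions. Connectedness of [0,1] does the
  rest.\<close>

lemma real_analytic_identity:
 fixes h :: "real => real"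
 assumes an: "!!t0. t0 \<in> {0..1} ==> \<exists>\<rho>>0. \<exists>F. F holomorphic_on ball 0 \<rho> & (\<forall>t. \<bar>t\<bar> < \<rho> --> F (of_real t) = of_real (h (t0+t)))"
  and acc: "t1 \<in> {0..1}" "t1 islimpt {t. h t = c}" and t: "t \<in> {0..1}"
 shows "h t = c"
proof -
 define Z where "Z = {t. h t = c}"
 define J where "J = {t \<in> {0..1}. t islimpt Z}"
 have nbhd: "\<exists>\<rho>>0. \<forall>s. \<bar>s-t0\<bar> < \<rho> --> h s = c" if "t0 \<in> J" for t0
 proof -
  from that have t0: "t0 \<in> {0..1}" "t0 islimpt Z" by (auto simp: J_def)
  from an[OF t0(1)] obtain \<rho> F where F: "\<rho> > 0" "F holomorphic_on ball 0 \<rho>" "!!t. \<bar>t\<bar> < \<rho> ==> F (of_real t) = of_real (h (t0+t))" by blast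
  define U where "U = {w. \<exists>t. w = complex_of_real t & \<bar>t\<bar> < \<rho> & h (t0+t) = c}"
  have lim: "0 islimpt U"
   unfolding islimpt_approachable
  proof (intro allI impI)
   fix e :: real assume "e > 0"
   then have "min e \<rho> > 0" using F by simp
   with t0(2) obtain s where s: "s \<in> Z" "s ~= t0" "dist s t0 < min e \<rho>" unfolding islimpt_approachable by blast
   then show "\<exists>x'\<in>U. x' ~= 0 & dist x' 0 < e"
    by (intro bexI[of _ "complex_of_real (s-t0)"]) (auto simp: U_def Z_def dist_real_def simp del: of_real_diff)
  qed
  have "F w-of_real c = 0" if "w \<in> ball 0 \<rho>" for w
   by (rule analytic_continuation[of "%w. F w-of_real c" "ball 0 \<rho>" U 0])
    (use F lim that in \<open>auto intro!: holomorphic_intros simp: U_def\<close>)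
  then have "h (t0+s) = c" if "\<bar>s\<bar> < \<rho>" for s using F(3)[OF that] that by (metis eq_iff_diff_eq_0 mem_ball_0 norm_of_real of_real_eq_iff)
  then have "\<forall>s. \<bar>s-t0\<bar> < \<rho> --> h s = c" by (metis add.commute diff_add_cancel)
  then show ?thesis using F by blast
 qed
 have "closedin (top_of_set {0..1}) J"
  using closedin_closed_Int[OF closed_limpts[of Z], of "{0..1}"] by (simp add: J_def Int_def conj_commute)
 moreover have "openin (top_of_set {0..1}) J"
  unfolding openin_contains_ball
 proof (intro conjI ballI)
  fix t0 assume t0: "t0 \<in> J"
  from nbhd[OF t0] obtain \<rho> where r: "\<rho> > 0" "!!s. \<bar>s-t0\<bar> < \<rho> ==> h s = c" by blast
  have "s \<in> J" if "s \<in> ball t0 \<rho> \<inter> {0..1}" for s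
  proof -
   have "ball t0 \<rho> \<subseteq> Z" using r by (auto simp: Z_def dist_real_def abs_minus_commute)
   moreover have "s islimpt ball t0 \<rho>" using that r(1) by (auto simp: islimpt_ball)
   ultimately show ?thesis using that islimpt_subset unfolding J_def by blast
  qed
  then show "\<exists>e>0. ball t0 e \<inter> {0..1} \<subseteq> J" using r(1) by blast
 qed (auto simp: J_def)
 ultimately have "J = {} \<or> J = {0..1}" using connected_clopen[of "{0..1::real}"] by auto
 moreover have "t1 \<in> J" using acc by (simp add: J_def Z_def)
 ultimately have "t \<in> J" using t by auto
 from nbhd[OF this] show ?thesis by auto
qed

text \<open>Infinitely many dilates of a set of positive measure share a point.\<close>
lemma dilation_accumulation:
 fixes A :: "'a::euclidean_space set" and x :: 'a
 assumes A: "compact A" "\<not> negligible A"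
 obtains y where "1 islimpt {t::real. x+t *R (y-x) \<in> A}"
proof -
 \<comment> \<open>Factors that decrease to 1 and never fall below it: no dilate loses measure, and
   all lie in one ball. Hence the set of points in infinitely many dilates still has at least the
   measure of A, and for such a y the parameters 1/\<open>l k\<close> accumulate at 1.\<close>
 define l where "l k = 1+1/(real k+1)" for k :: nat
 have l: "1 < l k" "l k <= 2" for k by (simp_all add: l_def)
 define T where "T k = (%z. (x-l k *R x)+l k *R z) ` A" for k
 have mem: "y \<in> T k \<longleftrightarrow> x+(1/l k) *R (y-x) \<in> A" for y k
 proof
  assume "y \<in> T k"
  then obtain z where z: "z \<in> A" "y = (x-l k *R x)+l k *R z" by (auto simp: T_def)
  have "x+(1/l k) *R (y-x) = z" using l(1)[of k] by (simp add: z(2) algebra_simps)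
  then show "x+(1/l k) *R (y-x) \<in> A" using z by simp
 next
  assume "x+(1/l k) *R (y-x) \<in> A"
  moreover have "y = (x-l k *R x)+l k *R (x+(1/l k) *R (y-x))" using l(1)[of k] by (simp add: algebra_simps)
  ultimately show "y \<in> T k" unfolding T_def by blast
 qed
 have cT: "compact (T k)" for k unfolding T_def
  by (intro compact_continuous_image continuous_intros A)
 have As: "A \<in> sets lebesgue" using A(1) by (simp add: borel_compact)
 have eA: "emeasure lebesgue A > 0"
 proof (rule ccontr)
  assume "\<not> emeasure lebesgue A > 0"
  then have "A \<in> null_sets lebesgue" using As by (intro null_setsI) auto
  then show False using A(2) negligible_iff_null_sets by blast
 qed
 have eT: "emeasure lebesgue (T k) >= emeasure lebesgue A" for k
 proof -
  have "emeasure lebesgue (T k) = ennreal (\<bar>l k\<bar> ^ DIM('a))*emeasure lebesgue A"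
   using emeasure_lebesgue_affine[of "l k" "x-l k *R x" A] by (simp add: T_def add.commute)
  moreover have "1 <= \<bar>l k\<bar> ^ DIM('a)" using l(1)[of k] by (intro one_le_power) auto
  then have "1 <= ennreal (\<bar>l k\<bar> ^ DIM('a))" by (metis ennreal_1 ennreal_leI)
  ultimately show ?thesis using mult_right_mono[of 1 "ennreal (\<bar>l k\<bar> ^ DIM('a))" "emeasure lebesgue A"] by simp
 qed
 obtain b where b: "!!z. z \<in> A ==> norm (z-x) <= b"
 proof -
  have "bounded ((%z. z-x) ` A)" by (intro compact_imp_bounded compact_continuous_image continuous_intros A)
  then show ?thesis using that unfolding bounded_iff by auto
 qed
 have Tb: "T k \<subseteq> cball x (2*b)" for k
 proof
  fix y assume "y \<in> T k"
  then have "norm ((1/l k) *R (y-x)) <= b" using mem[of y k] b by force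
  then have "norm (y-x) <= b*l k" using l(1)[of k] by (simp add: divide_le_eq)
  moreover have "0 <= b" using \<open>norm ((1 / l k) *R (y - x)) <= b\<close> norm_ge_zero order_trans by blast
  ultimately have "norm (y-x) <= 2*b" using mult_left_mono[OF l(2)[of k], of b] by simp
  then show "y \<in> cball x (2*b)" by (simp add: dist_norm norm_minus_commute)
 qed
 define D where "D N = (\<Union>k\<in>{N..}. T k)" for N
 have Ds: "D N \<in> sets lebesgue" for N unfolding D_def
 proof (rule sets.countable_UN'')
  show "T k \<in> sets lebesgue" for k using borel_compact[OF cT[of k]] by simp
 qed auto
 have "(%N. emeasure lebesgue (D N)) \<longlonglongrightarrow> emeasure lebesgue (\<Inter>N. D N)"
 proof (rule Lim_emeasure_decseq)
  show "range D \<subseteq> sets lebesgue" using Ds by auto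
  show "decseq D" unfolding decseq_def D_def by (auto intro: order_trans)
  show "emeasure lebesgue (D N) ~= \<infinity>" for N
  proof -
   have "emeasure lebesgue (D N) <= emeasure lebesgue (cball x (2*b))"
    by (rule emeasure_mono) (use Tb in \<open>auto simp: D_def\<close>)
   also have "... < \<infinity>" using emeasure_bounded_finite[OF bounded_cball] by (simp add: emeasure_lborel_cball_finite)
   finally show ?thesis by simp
  qed
 qed
 moreover have "emeasure lebesgue A <= emeasure lebesgue (D N)" for N
 proof -
  have "emeasure lebesgue (T N) <= emeasure lebesgue (D N)" by (rule emeasure_mono) (use Ds in \<open>auto simp: D_def\<close>)
  then show ?thesis using eT order_trans by blast
 qed
 ultimately have "emeasure lebesgue A <= emeasure lebesgue (\<Inter>N. D N)"
  by (intro LIMSEQ_le_const) auto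
 then have "(\<Inter>N. D N) ~= {}" using eA by (metis emeasure_empty not_less)
 then obtain y where y: "!!N. y \<in> D N" by auto
 have "1 islimpt {t::real. x+t *R (y-x) \<in> A}"
  unfolding islimpt_approachable
 proof (intro allI impI)
  fix e :: real assume "e > 0"
  then obtain N where N: "1/(real N+1) < e" using nat_approx_posE[of e] by (metis Suc_eq_plus1 of_nat_Suc of_nat_add of_nat_1)
  obtain k where k: "k >= N" "y \<in> T k" using y[of N] by (auto simp: D_def)
  have "\<bar>1/l k-1\<bar> = 1-1/l k" using l(1)[of k] by (simp add: abs_if)
  also have "... = (1/(real k+1))/l k" using l(1)[of k] by (simp add: l_def field_simps)
  also have "... <= 1/(real k+1)" using l(1)[of k] by (simp add: divide_le_eq mult_le_cancel_left1)
  also have "... <= 1/(real N+1)" using k by (simp add: frac_le)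
  finally have "dist (1/l k) 1 < e" using N by (simp add: dist_real_def)
  moreover have "1/l k ~= 1" using l(1)[of k] by simp
  ultimately show "\<exists>x'\<in>{t. x+t *R (y-x) \<in> A}. x' ~= 1 & dist x' 1 < e"
   using k(2) mem by blast
 qed
 then show ?thesis using that by blast
qed

text \<open>Near x0 the zero set of the e-derivative is a graph over the directions transverse to e.
  The complex implicit function theorem makes its height over the line with direction theta
  holomorphic, and composition with the complexified f gives F.\<close>

lemma analytic_section:
 fixes f :: "'a::euclidean_space => real" and x0 \<theta> e :: 'a
 assumes dim: "DIM('a) >= 3" and S: "open S" and C2: "Ck_on 2 S f" and lap: "!!x. x \<in> S ==> laplacian f x = \<kappa>" and x0: "x0 \<in> S"
  and p0: "pd e f x0 = 0" and pp: "pd e (pd e f) x0 ~= 0" and \<eta>: "\<eta> > 0"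
 obtains \<rho> F where "\<rho> > 0" "F holomorphic_on ball 0 \<rho>" 
  "!!t. \<bar>t\<bar> < \<rho> ==> \<exists>s. \<bar>s\<bar> < \<eta> & x0+t *R \<theta>+s *R e \<in> S & pd e f (x0+t *R \<theta>+s *R e) = 0 &
    F (of_real t) = of_real (f (x0+t *R \<theta>+s *R e))"
proof -
 have C: "Ck_on k S f" for k by (rule lap_const_Ck[OF dim S C2 lap])
 have C2': "Ck_on 2 S (pd e f)" by (rule Ck_on_Suc_pd[of 2]) (rule C)
 have lap': "laplacian (pd e f) x = 0" if "x \<in> S" for x by (rule laplacian_pd[OF S C lap that])
 obtain \<delta>1 V where V: "\<delta>1 > 0"
  "!!t s. \<bar>t\<bar> < \<delta>1 ==> \<bar>s\<bar> < \<delta>1 ==> x0+t *R \<theta>+s *R e \<in> S &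
    V (of_real t) (of_real s) = of_real (f (x0+t *R \<theta>+s *R e))"
  "continuous_on (ball 0 \<delta>1 \<times> ball 0 \<delta>1) (%z. V (fst z) (snd z))"
  "!!U g h. open U ==> g holomorphic_on U ==> h holomorphic_on U ==> g ` U \<subseteq> ball 0 \<delta>1 ==> h ` U \<subseteq> ball 0 \<delta>1
   ==> (%\<tau>. V (g \<tau>) (h \<tau>)) holomorphic_on U"
  by (rule lap_const_complexify[OF dim S C2 lap x0, of \<theta> e]) (assumption, rule that, assumption+)
 obtain \<delta>2 V' where V': "\<delta>2 > 0"
  "!!t s. \<bar>t\<bar> < \<delta>2 ==> \<bar>s\<bar> < \<delta>2 ==> x0+t *R \<theta>+s *R e \<in> S &
    V' (of_real t) (of_real s) = of_real (pd e f (x0+t *R \<theta>+s *R e))"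
  "continuous_on (ball 0 \<delta>2 \<times> ball 0 \<delta>2) (%z. V' (fst z) (snd z))"
  "!!U g h. open U ==> g holomorphic_on U ==> h holomorphic_on U ==> g ` U \<subseteq> ball 0 \<delta>2 ==> h ` U \<subseteq> ball 0 \<delta>2
   ==> (%\<tau>. V' (g \<tau>) (h \<tau>)) holomorphic_on U"
  by (rule lap_const_complexify[OF dim S C2' lap' x0, of \<theta> e]) (assumption, rule that, assumption+)
 define \<delta> where "\<delta> = min (min \<delta>1 \<delta>2) \<eta>"
 have \<delta>: "\<delta> > 0" "\<delta> <= \<delta>1" "\<delta> <= \<delta>2" "\<delta> <= \<eta>" using V V' \<eta> by (auto simp: \<delta>_def)
 have b1: "ball (0::complex) \<delta> \<subseteq> ball 0 \<delta>1" and b2: "ball (0::complex) \<delta> \<subseteq> ball 0 \<delta>2" using \<delta> by auto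
 \<comment> \<open>The complex derivative at 0 is identified by approaching along the real axis,
   where V' is the e-derivative of f.\<close>
 have dV: "(V' 0 has_field_derivative of_real (pd e (pd e f) x0)) (at 0)"
 proof -
  have "V' 0 holomorphic_on ball 0 \<delta>2"
   using V'(4)[OF open_ball holomorphic_on_const holomorphic_on_ident, of 0 "0" \<delta>2] V'(1) by (auto simp: image_subset_iff)
  then obtain D where D: "(V' 0 has_field_derivative D) (at 0)"
   using holomorphic_derivI[OF _ open_ball, of "V' 0" 0 \<delta>2 0] V'(1) by auto
  have "((%s. V' 0 (of_real s)) has_vector_derivative D) (at 0)"
   using has_vector_derivative_real_field[of "V' 0" D 0 UNIV] D by simp
  moreover have "((%s. V' 0 (of_real s)) has_vector_derivative of_real (pd e (pd e f) x0)) (at 0)"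
  proof -
   have "pd e f differentiable at (x0+0 *R e)" using Ck_on_Suc_diff[OF S, of 1 "pd e f" x0] C2' x0 by (simp add: numeral_2_eq_2)
   from has_real_derivative_along[OF this]
   have "((%s. complex_of_real (pd e f (x0+s *R e))) has_vector_derivative of_real (pd e (pd e f) x0)) (at 0)"
    by (auto intro: has_vector_derivative_of_real simp: has_real_derivative_iff_has_vector_derivative)
   then show ?thesis
    by (rule has_vector_derivative_transform_within_open[of _ _ _ "{-\<delta>2<..<\<delta>2}"]) (use V'(2)[of 0] V'(1) in \<open>auto simp: abs_less_iff\<close>)
  qed
  ultimately have "D = of_real (pd e (pd e f) x0)" by (rule vector_derivative_unique_at)
  then show ?thesis using D by simp
 qed
 obtain \<epsilon> G where G: "\<epsilon> > 0" "\<epsilon> < \<delta>" "G holomorphic_on ball 0 \<epsilon>" "G ` ball 0 \<epsilon> \<subseteq> ball 0 \<delta>"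
  "!!\<tau>. \<tau> \<in> ball 0 \<epsilon> ==> V' \<tau> (G \<tau>) = 0" "!!t. \<bar>t\<bar> < \<epsilon> ==> G (of_real t) \<in> \<real>"
 proof (rule complex_implicit_function[OF \<delta>(1), of V'])
  show "continuous_on (ball 0 \<delta> \<times> ball 0 \<delta>) (%z. V' (fst z) (snd z))"
   by (rule continuous_on_subset[OF V'(3)]) (use b2 in blast)
  show "(%\<tau>. V' (g \<tau>) (h \<tau>)) holomorphic_on U" if "open U" "g holomorphic_on U" "h holomorphic_on U" "g ` U \<subseteq> ball 0 \<delta>" "h ` U \<subseteq> ball 0 \<delta>" for U g h
   using V'(4)[OF that(1-3)] that(4,5) b2 by (meson order_trans)
  show "V' (of_real t) (of_real s) \<in> \<real>" if "\<bar>t\<bar> < \<delta>" "\<bar>s\<bar> < \<delta>" for t s using V'(2)[of t s] that \<delta> by simp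
  show "V' 0 0 = 0" using V'(2)[of 0 0] V'(1) p0 by simp
  show "pd e (pd e f) x0 ~= 0" by (rule pp)
 qed (rule dV, rule that)
 show ?thesis
 proof (rule that[OF G(1), of "%\<tau>. V \<tau> (G \<tau>)"])
  show "(%\<tau>. V \<tau> (G \<tau>)) holomorphic_on ball 0 \<epsilon>"
   using V(4)[OF open_ball holomorphic_on_ident G(3)] G(2,4) b1 subset_ball[of \<epsilon> \<delta>1 "0::complex"] \<delta> by auto
  fix t :: real assume t: "\<bar>t\<bar> < \<epsilon>"
  then obtain s where s: "G (of_real t) = of_real s" using G(6) by (auto elim: Reals_cases)
  have "G (of_real t) \<in> ball 0 \<delta>" using G(4) t by (auto simp: image_subset_iff)
  then have s\<delta>: "\<bar>s\<bar> < \<delta>" by (simp add: s)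
  have "V' (of_real t) (of_real s) = 0" using G(5)[of "of_real t"] t by (simp add: s)
  then have "pd e f (x0+t *R \<theta>+s *R e) = 0" using V'(2)[of t s] t s\<delta> G(2) \<delta> by simp
  then show "\<exists>s. \<bar>s\<bar> < \<eta> & x0+t *R \<theta>+s *R e \<in> S & pd e f (x0+t *R \<theta>+s *R e) = 0 &
    V (of_real t) (G (of_real t)) = of_real (f (x0+t *R \<theta>+s *R e))"
   using V(2)[of t s] t s\<delta> G(2) \<delta> by (intro exI[of _ s]) (auto simp: s)
 qed
qed

lemma analytic_on_lines:
 fixes f :: "'a::euclidean_space => real" and x0 \<theta> :: 'a
 assumes dim: "DIM('a) >= 3" and S: "open S" and C2: "Ck_on 2 S f" and lap: "!!x. x \<in> S ==> laplacian f x = \<kappa>" and x0: "x0 \<in> S"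
 obtains \<rho> F where "\<rho> > 0" "F holomorphic_on ball 0 \<rho>" "!!t. \<bar>t\<bar> < \<rho> ==> F (of_real t) = of_real (f (x0+t *R \<theta>))"
proof -
 obtain \<delta>1 V where V: "\<delta>1 > 0"
  "!!t s. \<bar>t\<bar> < \<delta>1 ==> \<bar>s\<bar> < \<delta>1 ==> x0+t *R \<theta>+s *R 0 \<in> S &
    V (of_real t) (of_real s) = of_real (f (x0+t *R \<theta>+s *R 0))"
  "continuous_on (ball 0 \<delta>1 \<times> ball 0 \<delta>1) (%z. V (fst z) (snd z))"
  "!!U g h. open U ==> g holomorphic_on U ==> h holomorphic_on U ==> g ` U \<subseteq> ball 0 \<delta>1 ==> h ` U \<subseteq> ball 0 \<delta>1
   ==> (%\<tau>. V (g \<tau>) (h \<tau>)) holomorphic_on U"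
  by (rule lap_const_complexify[OF dim S C2 lap x0, of \<theta> 0]) (assumption, rule that, assumption+)
 show ?thesis
 proof (rule that[OF V(1), of "%\<tau>. V \<tau> 0"])
  show "(%\<tau>. V \<tau> 0) holomorphic_on ball 0 \<delta>1"
   using V(4)[OF open_ball holomorphic_on_ident holomorphic_on_const, of 0 \<delta>1 0] V(1) by (auto simp: image_subset_iff)
  show "V (of_real t) 0 = of_real (f (x0+t *R \<theta>))" if "\<bar>t\<bar> < \<delta>1" for t using V(2)[OF that, of 0] V(1) by simp
 qed
qed

section \<open>Foot points and the sections where a directional derivative vanishes\<close>

lemma C1_lipschitz:
 fixes w :: "'a::euclidean_space => real"
 assumes S: "open S" and C: "Ck_on 1 S w" and p: "p \<in> S"
 obtains L r where "L > 0" "r > 0" "ball p r \<subseteq> S" "!!x y. x \<in> ball p r ==> y \<in> ball p r ==> \<bar>w x-w y\<bar> <= L*norm (x-y)"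
proof -
 have d: "w differentiable at x" if "x \<in> S" for x using Ck_on_Suc_diff[OF S, of 0 w] C that by simp
 define B where "B x = (\<Sum>b\<in>Basis. \<bar>pd b w x\<bar>)" for x
 have cB: "continuous_on S B" unfolding B_def using C by (intro continuous_intros) simp
 then have "isCont B p" using p S continuous_on_eq_continuous_at by blast
 then obtain r1 where r1: "r1 > 0" "!!x. dist x p < r1 ==> dist (B x) (B p) < 1"
  unfolding continuous_at_eps_delta by (metis zero_less_one)
 obtain r2 where r2: "r2 > 0" "ball p r2 \<subseteq> S" using S p open_contains_ball by blast
 define r where "r = min r1 r2"
 have r: "r > 0" "ball p r \<subseteq> S" using r1 r2 by (auto simp: r_def)
 have Bp: "B p >= 0" by (simp add: B_def sum_nonneg)
 have on: "onorm (frechet_derivative w (at x)) <= B p+1" if x: "x \<in> ball p r" for x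
 proof (rule onorm_le)
  fix v
  have xS: "x \<in> S" using x r by blast
  have "norm (frechet_derivative w (at x) v) = \<bar>\<Sum>b\<in>Basis. pd b w x*(v \<bullet> b)\<bar>"
   by (subst has_derivative_Basis_expand[OF d[OF xS], of v]) (rule real_norm_def)
  also have "... <= (\<Sum>b\<in>Basis. \<bar>pd b w x\<bar>*norm v)"
   by (rule order_trans[OF sum_abs sum_mono]) (simp add: abs_mult mult_left_mono Basis_le_norm)
  also have "... = B x*norm v" by (simp add: B_def sum_distrib_right)
  also have "... <= (B p+1)*norm v"
  proof (rule mult_right_mono)
   have "dist (B x) (B p) < 1" using r1(2)[of x] x by (simp add: r_def dist_commute)
   then show "B x <= B p+1" by (simp add: dist_real_def)
  qed simp
  finally show "norm (frechet_derivative w (at x) v) <= (B p+1)*norm v" .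
 qed
 show ?thesis
 proof (rule that[of "B p+1" r])
  fix x y assume xy: "x \<in> ball p r" "y \<in> ball p r"
  have "norm (w x-w y) <= (B p+1)*norm (x-y)"
   by (rule differentiable_bound[OF convex_ball _ on xy])
    (use d r in \<open>auto intro!: has_derivative_at_withinI has_derivative_frechet\<close>)
  then show "\<bar>w x-w y\<bar> <= (B p+1)*norm (x-y)" by simp
 qed (use Bp r in auto)
qed

lemma decreasing_along:
 fixes w :: "'a::euclidean_space => real"
 assumes d: "!!x. x \<in> ball p r ==> w differentiable at x" and neg: "!!x. x \<in> ball p r ==> pd b w x <=-k"
  and x: "x+s1 *R b \<in> ball p r" "x+s2 *R b \<in> ball p r" and s: "s1 <= s2"
 shows "w (x+s2 *R b) <= w (x+s1 *R b)-k*(s2-s1)"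
proof (cases "s1 = s2")
 case False
 then have s: "s1 < s2" using s by simp
 have mem: "x+t *R b \<in> ball p r" if t: "s1 <= t" "t <= s2" for t
 proof -
  define a where "a = (t-s1)/(s2-s1)"
  have a: "0 <= a" "a <= 1" using t s by (auto simp: a_def)
  have "a*(s2-s1) = t-s1" using s by (simp add: a_def)
  then have teq: "t = (1-a) * s1+a * s2" by (simp add: algebra_simps)
  have "x+t *R b = (1-a) *R (x+s1 *R b)+a *R (x+s2 *R b)"
   by (subst teq) (simp add: algebra_simps)
  then show ?thesis using convexD[OF convex_ball x, of "1-a" a] a by simp
 qed
 have "DERIV (%t. w (x+t *R b)) t :> pd b w (x+t *R b)" if "s1 <= t" "t <= s2" for t
  by (rule has_real_derivative_along[OF d[OF mem[OF that]]])
 from MVT2[OF s this] obtain z where z: "s1 < z" "z < s2" "w (x+s2 *R b)-w (x+s1 *R b) = (s2-s1)*pd b w (x+z *R b)" by blast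
 have "(s2-s1)*pd b w (x+z *R b) <= (s2-s1)*(- k)"
  by (rule mult_left_mono) (use neg[OF mem] z s in auto)
 then show ?thesis using z by (simp add: algebra_simps)
qed simp

text \<open>Along d the function w is strictly monotone near p with slope at least some k > 0, so
  the intermediate value theorem finds a zero at distance at most |w x|/k. The constant K is chosen
  before the radius r', so it does not deteriorate as the neighbourhood shrinks.\<close>

lemma foot_point:
 fixes w :: "'a::euclidean_space => real"
 assumes S: "open S" and C: "Ck_on 1 S w" and p: "p \<in> S" and w0: "w p = 0" and wd: "pd d w p ~= 0"
 shows "\<exists>K>0. \<forall>r'>0. \<exists>r>0. ball p r \<subseteq> ball p r' & (\<forall>x\<in>ball p r. \<exists>\<tau>. \<bar>\<tau>\<bar> <= K*\<bar>w x\<bar> & \<bar>\<tau>\<bar> <= r' & x+\<tau> *R d \<in> ball p r' & w (x+\<tau> *R d) = 0)"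
proof -
 have main: "\<exists>K>0. \<forall>r'>0. \<exists>r>0. ball p r \<subseteq> ball p r' & (\<forall>x\<in>ball p r. \<exists>\<tau>. \<bar>\<tau>\<bar> <= K*\<bar>w x\<bar> & \<bar>\<tau>\<bar> <= r' & x+\<tau> *R d \<in> ball p r' & w (x+\<tau> *R d) = 0)"
  if neg0: "pd d w p < 0" for d
 proof -
  have dw: "w differentiable at x" if "x \<in> S" for x using Ck_on_Suc_diff[OF S, of 0 w] C that by simp
  obtain L rl where L: "L > 0" "rl > 0" "ball p rl \<subseteq> S" "!!x y. x \<in> ball p rl ==> y \<in> ball p rl ==> \<bar>w x-w y\<bar> <= L*norm (x-y)"
   using C1_lipschitz[OF S C p] by metis
  define k where "k = - pd d w p/2"
  have k: "k > 0" using neg0 by (simp add: k_def)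
  have "continuous_on S (pd d w)" using C by simp
  then have "isCont (pd d w) p" using p S continuous_on_eq_continuous_at by blast
  then obtain rk where rk: "rk > 0" "!!x. dist x p < rk ==> dist (pd d w x) (pd d w p) < k"
   using k unfolding continuous_at_eps_delta by metis
  show ?thesis
  proof (rule exI[of _ "1/k"], intro conjI allI impI)
   show "1/k > 0" using k by simp
   fix r' :: real assume r': "r' > 0"
   define r0 where "r0 = min r' (min rl rk)"
   have r0: "r0 > 0" "ball p r0 \<subseteq> ball p rl" "ball p r0 \<subseteq> S" "r0 <= r'" using L rk r' by (auto simp: r0_def)
   have neg: "pd d w x <=-k" if "x \<in> ball p r0" for x
    using rk(2)[of x] that by (simp add: r0_def dist_commute dist_real_def k_def abs_less_iff)
   have dw0: "w differentiable at x" if "x \<in> ball p r0" for x using dw r0 that by blast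
   define c where "c = 1/k*L"
   have c: "c > 0" using k L by (simp add: c_def)
   \<comment> \<open>Shrinking the ball by this factor leaves room for a shift along d by up to c
     times the distance from p.\<close>
   define Q where "Q = 1+c*(norm d+1)"
   have Q: "Q >= 1" using c by (simp add: Q_def add_nonneg_pos)
   define r where "r = r0/Q"
   have rQ: "r > 0" "r*Q = r0" "r <= r0" using r0 Q by (auto simp: r_def divide_le_eq)
   have sub: "ball p r \<subseteq> ball p r'" "ball p r \<subseteq> ball p r0" by (rule subset_ball, use rQ(3) r0(4) in linarith)+
   have "\<exists>\<tau>. \<bar>\<tau>\<bar> <= 1/k*\<bar>w x\<bar> & \<bar>\<tau>\<bar> <= r' & x+\<tau> *R d \<in> ball p r' & w (x+\<tau> *R d) = 0" if x: "x \<in> ball p r" for x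
   proof -
    have pl: "p \<in> ball p rl" using L by simp
    have xl: "x \<in> ball p rl" using x sub r0 by blast
    define a where "a = 1/k*\<bar>w x\<bar>"
    have a0: "a >= 0" using k by (simp add: a_def)
    have "\<bar>w x\<bar> <= L*norm (x-p)" using L(4)[OF xl pl] w0 by simp
    then have "a <= 1/k*(L*norm (x-p))" unfolding a_def using k by (intro mult_left_mono) auto
    then have aL: "a <= c*norm (x-p)" by (simp add: c_def mult.assoc)
    have near: "x+s *R d \<in> ball p r0 & \<bar>s\<bar> <= r0" if "\<bar>s\<bar> <= a" for s
    proof -
     have xp: "norm (x-p) < r" using x by (simp add: dist_norm norm_minus_commute)
     have "\<bar>s\<bar>*(norm d+1) <= c*norm (x-p)*(norm d+1)"
      using that aL by (intro mult_right_mono) auto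
     then have "norm (x-p)+\<bar>s\<bar>*(norm d+1) <= norm (x-p)*Q" by (simp add: Q_def algebra_simps)
     also have "... < r*Q" using xp Q by simp
     finally have *: "norm (x-p)+\<bar>s\<bar>*(norm d+1) < r0" using rQ by simp
     have "dist p (x+s *R d) = norm (x+s *R d-p)" by (simp add: dist_norm norm_minus_commute)
     also have "x+s *R d-p = (x-p)+s *R d" by simp
     finally have "dist p (x+s *R d) = norm ((x-p)+s *R d)" .
     also note norm_triangle_ineq
     finally have "dist p (x+s *R d) <= norm (x-p)+\<bar>s\<bar>*norm d" by simp
     moreover have "\<bar>s\<bar>*(norm d+1) = \<bar>s\<bar>*norm d+\<bar>s\<bar>" by (simp add: distrib_left)
     moreover have "0 <= \<bar>s\<bar>*norm d" "0 <= norm (x-p)" "0 <= \<bar>s\<bar>" by simp_all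
     ultimately have "dist p (x+s *R d) < r0" "\<bar>s\<bar> <= r0" using * by linarith+
     then show ?thesis by simp
    qed
    have cont: "continuous_on {s. \<bar>s\<bar> <= a} (%s. w (x+s *R d))"
    proof (rule continuous_at_imp_continuous_on, rule ballI)
     fix s assume "s \<in> {s. \<bar>s\<bar> <= a}"
     then have "x+s *R d \<in> ball p r0" using near by blast
     then show "isCont (%s. w (x+s *R d)) s" using DERIV_isCont[OF has_real_derivative_along[OF dw0]] by blast
    qed
    have dec: "w (x+s2 *R d) <= w (x+s1 *R d)-k*(s2-s1)" if "\<bar>s1\<bar> <= a" "\<bar>s2\<bar> <= a" "s1 <= s2" for s1 s2
     by (rule decreasing_along[of p r0, OF _ _ conjunct1[OF near[OF that(1)]] conjunct1[OF near[OF that(2)]] that(3)]) (erule dw0, erule neg)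
    have ka: "k*a = \<bar>w x\<bar>" using k by (simp add: a_def)
    have "\<exists>\<tau>. \<bar>\<tau>\<bar> <= a & w (x+\<tau> *R d) = 0"
    proof (cases "w x >= 0")
     case True
     have "w (x+a *R d) <= 0" using dec[of 0 a] a0 True ka by simp
     moreover have "continuous_on {0..a} (%s. w (x+s *R d))" by (rule continuous_on_subset[OF cont]) auto
     ultimately obtain \<tau> where "0 <= \<tau>" "\<tau> <= a" "w (x+\<tau> *R d) = 0"
      using IVT2'[of "%s. w (x+s *R d)" a 0 0] True a0 by auto
     then show ?thesis by (intro exI[of _ \<tau>]) auto
    next
     case False
     have "w (x+(-a) *R d) >= 0" using dec[of "-a" 0] a0 False ka by simp
     moreover have "continuous_on {-a..0} (%s. w (x+s *R d))" by (rule continuous_on_subset[OF cont]) auto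
     ultimately obtain \<tau> where "-a <= \<tau>" "\<tau> <= 0" "w (x+\<tau> *R d) = 0"
      using IVT2'[of "%s. w (x+s *R d)" 0 0 "-a"] False a0 by auto
     then show ?thesis by (intro exI[of _ \<tau>]) auto
    qed
    then obtain \<tau> where \<tau>: "\<bar>\<tau>\<bar> <= a" "w (x+\<tau> *R d) = 0" by blast
    have "ball p r0 \<subseteq> ball p r'" using r0 by auto
    then show ?thesis using \<tau> near[OF \<tau>(1)] r0(4) by (intro exI[of _ \<tau>]) (auto simp: a_def)
   qed
   then show "\<exists>r>0. ball p r \<subseteq> ball p r' & (\<forall>x\<in>ball p r. \<exists>\<tau>. \<bar>\<tau>\<bar> <= 1/k*\<bar>w x\<bar> & \<bar>\<tau>\<bar> <= r' & x+\<tau> *R d \<in> ball p r' & w (x+\<tau> *R d) = 0)"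
    using rQ sub by blast
  qed
 qed
 show ?thesis
 proof (cases "pd d w p < 0")
  case True then show ?thesis by (rule main)
 next
  case False
  have "w differentiable at p" using Ck_on_Suc_diff[OF S, of 0 w] C p by simp
  from linear_neg[OF linear_frechet_derivative[OF this], of d] have "pd (-d) w p < 0" using False wd by linarith
  from main[OF this] obtain K where K: "K > 0" "\<forall>r'>0. \<exists>r>0. ball p r \<subseteq> ball p r' & (\<forall>x\<in>ball p r. \<exists>\<tau>. \<bar>\<tau>\<bar> <= K*\<bar>w x\<bar> & \<bar>\<tau>\<bar> <= r' & x+\<tau> *R (-d) \<in> ball p r' & w (x+\<tau> *R (-d)) = 0)"
   by (elim exE conjE)
  have eq: "(\<exists>\<tau>. \<bar>\<tau>\<bar> <= a & \<bar>\<tau>\<bar> <= r' & x+\<tau> *R (-d) \<in> X & w (x+\<tau> *R (-d)) = 0)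
   ==> (\<exists>\<tau>. \<bar>\<tau>\<bar> <= a & \<bar>\<tau>\<bar> <= r' & x+\<tau> *R d \<in> X & w (x+\<tau> *R d) = 0)" for a r' x X
   by (elim exE, rule_tac x="-\<tau>" in exI) simp
  show ?thesis
  proof (rule exI[of _ K], intro conjI allI impI)
   fix r' :: real assume "r' > 0"
   with K(2) obtain r where r: "r > 0" "ball p r \<subseteq> ball p r'" "\<forall>x\<in>ball p r. \<exists>\<tau>. \<bar>\<tau>\<bar> <= K*\<bar>w x\<bar> & \<bar>\<tau>\<bar> <= r' & x+\<tau> *R (-d) \<in> ball p r' & w (x+\<tau> *R (-d)) = 0"
    by (elim allE impE exE conjE)
   have "\<forall>x\<in>ball p r. \<exists>\<tau>. \<bar>\<tau>\<bar> <= K*\<bar>w x\<bar> & \<bar>\<tau>\<bar> <= r' & x+\<tau> *R d \<in> ball p r' & w (x+\<tau> *R d) = 0"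
    by (rule ballI, rule eq, rule bspec[OF r(3)])
   with r(1,2) show "\<exists>r>0. ball p r \<subseteq> ball p r' & (\<forall>x\<in>ball p r. \<exists>\<tau>. \<bar>\<tau>\<bar> <= K*\<bar>w x\<bar> & \<bar>\<tau>\<bar> <= r' & x+\<tau> *R d \<in> ball p r' & w (x+\<tau> *R d) = 0)"
    by (intro exI[where x=r] conjI)
  qed (rule K)
 qed
qed

text \<open>Strict concavity along b makes the section where the b-derivative vanishes a Lipschitz
  graph over the directions transverse to b. The values of f on it, extended constantly along b, are
  analytic on lines; positive measure of the cylinder over Z provides, from any point of the
  section, a line on which the value c accumulates. The last conclusion is the Lipschitz bound in a
  form suited to packing boxes along b.\<close>

lemma section_dichotomy:
 fixes f :: "'a::euclidean_space => real" and p b :: 'a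
 assumes dim: "DIM('a) >= 3" and S: "open S" and C2: "Ck_on 2 S f" and lap: "!!x. x \<in> S ==> laplacian f x = \<kappa>" and p: "p \<in> S"
  and b: "norm b = 1" and p0: "pd b f p = 0" and pp: "pd b (pd b f) p < 0"
 obtains r L where "r > 0" "L > 0" "ball p r \<subseteq> S"
  "!!c Z y. compact Z ==> Z \<subseteq> {z \<in> ball p r. pd b f z = 0 & f z = c} ==>
    \<not> negligible ((%(z, s). z+s *R b) ` (Z \<times> {-r..r})) ==> y \<in> ball p r ==> pd b f y = 0 ==> f y = c"
  "!!z z' s. z \<in> ball p r ==> z' \<in> ball p r ==> pd b f z = 0 ==> pd b f z' = 0 ==> \<bar>s\<bar> <= 2*r ==>
    norm (z-z') <= L*norm (z'-z-s *R b)"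
proof -
 define w where "w = pd b f"
 have C: "Ck_on k S f" for k by (rule lap_const_Ck[OF dim S C2 lap])
 have w1: "Ck_on 1 S w" unfolding w_def by (rule Ck_on_Suc_pd[of 1]) (rule C)
 have dw: "w differentiable at x" if "x \<in> S" for x using Ck_on_Suc_diff[OF S, of 0 w] w1 that by simp
 obtain M rl where M: "M > 0" "rl > 0" "ball p rl \<subseteq> S" "!!x y. x \<in> ball p rl ==> y \<in> ball p rl ==> \<bar>w x-w y\<bar> <= M*norm (x-y)"
  using C1_lipschitz[OF S w1 p] by metis
 define k where "k = - pd b w p/2"
 have k: "k > 0" using pp by (simp add: k_def w_def)
 have "continuous_on S (pd b w)" using w1 by simp
 then have "isCont (pd b w) p" using p S continuous_on_eq_continuous_at by blast
 then obtain rk where rk: "rk > 0" "!!x. dist x p < rk ==> dist (pd b w x) (pd b w p) < k"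
  using k unfolding continuous_at_eps_delta by metis
 define r0 where "r0 = min rl rk"
 have r0: "r0 > 0" "ball p r0 \<subseteq> ball p rl" "ball p r0 \<subseteq> S" using M rk by (auto simp: r0_def)
 have neg: "pd b w x <=-k" if "x \<in> ball p r0" for x
  using rk(2)[of x] that by (simp add: r0_def dist_commute dist_real_def k_def abs_less_iff)
 have dw0: "w differentiable at x" if "x \<in> ball p r0" for x using dw r0 that by blast
 have dec: "w (x+s2 *R b) <= w (x+s1 *R b)-k*(s2-s1)"
  if "x+s1 *R b \<in> ball p r0" "x+s2 *R b \<in> ball p r0" "s1 <= s2" for x s1 s2
  by (rule decreasing_along[of p r0, OF _ _ that]) (erule dw0, erule neg)
 define \<eta> where "\<eta> = r0/4"
 have \<eta>: "\<eta> > 0" "\<eta> < r0" using r0 by (auto simp: \<eta>_def)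
 have "w p = 0" "pd b w p ~= 0" using p0 pp by (simp_all add: w_def)
 from foot_point[OF S w1 p this] obtain K where "\<forall>r'>0. \<exists>r>0. ball p r \<subseteq> ball p r' & (\<forall>x\<in>ball p r. \<exists>\<tau>. \<bar>\<tau>\<bar> <= K*\<bar>w x\<bar> & \<bar>\<tau>\<bar> <= r' & x+\<tau> *R b \<in> ball p r' & w (x+\<tau> *R b) = 0)"
  by (elim exE conjE)
 from this[rule_format, OF half_gt_zero[OF \<eta>(1)]] obtain r2 where r2: "r2 > 0" "\<forall>x\<in>ball p r2. \<exists>\<tau>. \<bar>\<tau>\<bar> <= K*\<bar>w x\<bar> & \<bar>\<tau>\<bar> <= \<eta>/2 & x+\<tau> *R b \<in> ball p (\<eta>/2) & w (x+\<tau> *R b) = 0"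
  by (elim exE conjE)
 define r1 where "r1 = min \<eta> r2"
 have r1: "r1 > 0" "r1 <= \<eta>" "r1 <= r2" using \<eta> r2(1) by (auto simp: r1_def)
 have near: "x+s *R b \<in> ball p r0" if "x \<in> ball p r1" "\<bar>s\<bar> <= 2*\<eta>" for x s
 proof -
  have "dist p (x+s *R b) <= dist p x+dist x (x+s *R b)" by (rule dist_triangle)
  also have "dist x (x+s *R b) = \<bar>s\<bar>" using b by (simp add: dist_norm)
  finally show ?thesis using that r1 \<eta> by (simp add: \<eta>_def)
 qed
 have uniq: "s = s'" if x: "x \<in> ball p r1" and s: "\<bar>s\<bar> <= \<eta>" "\<bar>s'\<bar> <= \<eta>" and w: "w (x+s *R b) = 0" "w (x+s' *R b) = 0" for x s s'
 proof -
  have *: "\<not> a < a'" if "\<bar>a\<bar> <= \<eta>" "\<bar>a'\<bar> <= \<eta>" "w (x+a *R b) = 0" "w (x+a' *R b) = 0" for a a'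
  proof
   assume "a < a'"
   then have "w (x+a' *R b) <= w (x+a *R b)-k*(a'-a)"
    using near[OF x, of a] near[OF x, of a'] that \<eta> by (intro dec) auto
   moreover have "k*(a'-a) > 0" using k \<open>a < a'\<close> by simp
   ultimately show False using that by simp
  qed
  show ?thesis using *[OF s w] *[OF s(2,1) w(2,1)] by simp
 qed
 have "\<exists>s. \<bar>s\<bar> < \<eta> & w (x+s *R b) = 0" if x: "x \<in> ball p r1" for x
 proof -
  have "x \<in> ball p r2" using x r1(3) by simp
  from bspec[OF r2(2) this] obtain \<tau> where "\<bar>\<tau>\<bar> <= \<eta>/2" "w (x+\<tau> *R b) = 0" by (elim exE conjE)
  then show ?thesis using \<eta> by (intro exI[of _ \<tau>]) auto
 qed
 then obtain \<phi> where \<phi>: "!!x. x \<in> ball p r1 ==> \<bar>\<phi> x\<bar> < \<eta> & w (x+\<phi> x *R b) = 0" by metis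
 have \<phi>u: "\<phi> x = s" if "x \<in> ball p r1" "\<bar>s\<bar> <= \<eta>" "w (x+s *R b) = 0" for x s
  using uniq[OF that(1) _ that(2) _ that(3), of "\<phi> x"] \<phi>[OF that(1)] by simp
 \<comment> \<open>The value of f at the point of the section above x. It equals c on the whole
   cylinder A over Z, a set of full dimension to which the dilation argument applies.\<close>
 define g where "g x = f (x+\<phi> x *R b)" for x
 define r where "r = r1/2"
 have r: "r > 0" "2*r = r1" "r < r1" using r1 by (auto simp: r_def)
 have rsub: "ball p r \<subseteq> ball p r1" "ball p r1 \<subseteq> ball p r0" using r r1 \<eta> by auto
 show ?thesis
 proof (rule that[of r "1+M/k"])
  show "r > 0" "0 < 1+M/k" using r k M by (auto intro: add_pos_pos)
  show "ball p r \<subseteq> S" using rsub r0 by blast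
 next
  fix c Z y0
  assume Z: "compact Z" "Z \<subseteq> {z \<in> ball p r. pd b f z = 0 & f z = c}"
   and nn: "\<not> negligible ((%(z, s). z+s *R b) ` (Z \<times> {-r..r}))" and y0: "y0 \<in> ball p r" "pd b f y0 = 0"
  define A where "A = (%(z, s). z+s *R b) ` (Z \<times> {-r..r})"
  have cA: "compact A" unfolding A_def split_beta
   by (intro compact_continuous_image continuous_intros compact_Times Z) auto
  have Ag: "a \<in> ball p r1 & g a = c" if "a \<in> A" for a
  proof -
   from that obtain z s where a: "a = z+s *R b" "z \<in> Z" "\<bar>s\<bar> <= r" by (auto simp: A_def abs_le_iff)
   have z: "z \<in> ball p r" "w z = 0" "f z = c" using a(2) Z(2) by (auto simp: w_def)
   have "dist p a <= dist p z+\<bar>s\<bar>" using dist_triangle[of p a z] b by (simp add: a dist_norm)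
   then have 1: "a \<in> ball p r1" using z(1) a(3) r by simp
   have "\<phi> a = - s" by (rule \<phi>u[OF 1]) (use a z r r1 in auto)
   then show ?thesis using 1 z by (simp add: g_def a)
  qed
  obtain y where y: "1 islimpt {t::real. y0+t *R (y-y0) \<in> A}"
   using dilation_accumulation[OF cA] nn by (auto simp: A_def)
  have "closed {t::real. y0+t *R (y-y0) \<in> A}"
   using continuous_closed_vimage[OF compact_imp_closed[OF cA], of "%t. y0+t *R (y-y0)"]
   by (auto simp: vimage_def intro!: continuous_intros)
  then have "1 \<in> {t::real. y0+t *R (y-y0) \<in> A}" using y closed_limpt by blast
  then have yA: "y \<in> A" by simp
  then have yb: "y \<in> ball p r1" using Ag by blast
  have y0b: "y0 \<in> ball p r1" using y0 rsub by blast
  define h where "h t = g (y0+t *R (y-y0))" for t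
  have "h 0 = c"
  proof (rule real_analytic_identity[of h 1 c 0])
   show "1 islimpt {t. h t = c}"
    by (rule islimpt_subset[OF y]) (use Ag in \<open>auto simp: h_def\<close>)
   fix t0 :: real assume t0: "t0 \<in> {0..1}"
   define x where "x = y0+t0 *R (y-y0)"
   have xb: "x \<in> ball p r1"
    using convexD[OF convex_ball y0b yb, of "1-t0" t0] t0 by (simp add: x_def algebra_simps)
   define X where "X = x+\<phi> x *R b"
   have X: "X \<in> ball p r0" unfolding X_def by (rule near[OF xb]) (use \<phi>[OF xb] \<eta> in auto)
   have X0: "pd b f X = 0" using \<phi>[OF xb] by (simp add: X_def w_def)
   have Xneg: "pd b (pd b f) X ~= 0" using neg[OF X] k by (simp add: w_def)
   \<comment> \<open>The remaining height: a zero found within this distance of X lies within \<eta>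
     of the base point, where zeros along b are unique, so it is the one selected by \<phi>.\<close>
   have e: "\<eta>-\<bar>\<phi> x\<bar> > 0" using \<phi>[OF xb] by simp
   have XS: "X \<in> S" using X r0 by blast
   obtain \<rho> F where F: "\<rho> > 0" "F holomorphic_on ball 0 \<rho>" 
    "!!t. \<bar>t\<bar> < \<rho> ==> \<exists>s. \<bar>s\<bar> < \<eta>-\<bar>\<phi> x\<bar> & X+t *R (y-y0)+s *R b \<in> S & pd b f (X+t *R (y-y0)+s *R b) = 0 &
     F (of_real t) = of_real (f (X+t *R (y-y0)+s *R b))"
    using analytic_section[OF dim S C2 lap XS X0 Xneg e, of "y-y0"] by metis
   have "\<exists>\<rho>'>0. \<forall>t. \<bar>t\<bar> < \<rho>' --> x+t *R (y-y0) \<in> ball p r1"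
   proof -
    have "open {t::real. x+t *R (y-y0) \<in> ball p r1}"
     using continuous_open_vimage[OF open_ball, of "%t. x+t *R (y-y0)" p r1]
     by (auto simp: vimage_def intro!: continuous_intros)
    moreover have "0 \<in> {t::real. x+t *R (y-y0) \<in> ball p r1}" using xb by simp
    ultimately obtain e where "e > 0" "ball 0 e \<subseteq> {t::real. x+t *R (y-y0) \<in> ball p r1}" using open_contains_ball by blast
    then show ?thesis by (intro exI[of _ e]) (auto simp: subset_eq dist_real_def)
   qed
   then obtain \<rho>' where \<rho>': "\<rho>' > 0" "!!t. \<bar>t\<bar> < \<rho>' ==> x+t *R (y-y0) \<in> ball p r1" by blast
   have "F (of_real t) = of_real (h (t0+t))" if t: "\<bar>t\<bar> < min \<rho> \<rho>'" for t
   proof -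
    from F(3)[of t] t obtain s where s: "\<bar>s\<bar> < \<eta>-\<bar>\<phi> x\<bar>" "pd b f (X+t *R (y-y0)+s *R b) = 0"
     "F (of_real t) = of_real (f (X+t *R (y-y0)+s *R b))" by auto
    have eq: "X+t *R (y-y0)+s *R b = x+t *R (y-y0)+(\<phi> x+s) *R b" by (simp add: X_def algebra_simps)
    have xt: "x+t *R (y-y0) = y0+(t0+t) *R (y-y0)" by (simp add: x_def algebra_simps)
    have "\<phi> (x+t *R (y-y0)) = \<phi> x+s"
     by (rule \<phi>u[OF \<rho>'(2)]) (use t s in \<open>auto simp: eq[symmetric] w_def\<close>)
    then have "h (t0+t) = f (X+t *R (y-y0)+s *R b)" unfolding eq h_def g_def xt[symmetric] by simp
    then show ?thesis using s by simp
   qed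
   moreover have "F holomorphic_on ball 0 (min \<rho> \<rho>')" by (rule holomorphic_on_subset[OF F(2)]) auto
   ultimately show "\<exists>\<rho>>0. \<exists>F. F holomorphic_on ball 0 \<rho> & (\<forall>t. \<bar>t\<bar> < \<rho> --> F (of_real t) = of_real (h (t0+t)))"
    using F(1) \<rho>'(1) by (intro exI[of _ "min \<rho> \<rho>'"]) auto
  qed auto
  moreover have "\<phi> y0 = 0" by (rule \<phi>u[OF y0b]) (use y0 \<eta> in \<open>auto simp: w_def\<close>)
  ultimately show "f y0 = c" by (simp add: h_def g_def)
 next
  fix z z' s assume z: "z \<in> ball p r" "z' \<in> ball p r" "pd b f z = 0" "pd b f z' = 0" and s: "\<bar>s\<bar> <= 2*r"
  have zb: "z \<in> ball p r1" using z rsub by blast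
  have zs: "z+s *R b \<in> ball p r0" by (rule near[OF zb]) (use s r r1 \<eta> in auto)
  have z0: "z+0 *R b \<in> ball p r0" by (rule near[OF zb]) (use \<eta> in auto)
  \<comment> \<open>Moving by s along b from a point of the section changes w by at least k|s|. As w
    vanishes at z' and is Lipschitz, z' has to stay away from z + s b in proportion to |s|.\<close>
  have "k*\<bar>s\<bar> <= \<bar>w (z+s *R b)\<bar>"
  proof (cases "s >= 0")
   case True
   have "w (z+s *R b) <= w (z+0 *R b)-k*(s-0)" by (rule dec[OF z0 zs True])
   then show ?thesis using True z by (simp add: w_def)
  next
   case False
   then have "w (z+0 *R b) <= w (z+s *R b)-k*(0-s)" by (intro dec[OF zs z0]) simp
   then show ?thesis using False z by (simp add: w_def)
  qed
  also have "... = \<bar>w z'-w (z+s *R b)\<bar>" using z by (simp add: w_def)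
  also have "... <= M*norm (z'-(z+s *R b))"
   by (rule M(4)) (use zs z(2) rsub r0(2) in blast)+
  finally have "\<bar>s\<bar> <= M/k*norm (z'-z-s *R b)" using k by (simp add: field_simps)
  moreover have "norm (z-z') <= norm (z'-z-s *R b)+\<bar>s\<bar>"
   using norm_triangle_ineq[of "z'-z-s *R b" "s *R b"] b by (simp add: norm_minus_commute)
  ultimately show "norm (z-z') <= (1+M/k)*norm (z'-z-s *R b)" by (simp add: algebra_simps)
 qed
qed

section \<open>Sets of positive Hausdorff measure\<close>

text \<open>Nullity in dimension m tested by finite covers with small balls and by bare powers of
  their radii. It implies vanishing Hausdorff measure, and unlike the latter it is checked directly
  by counting.\<close>

definition ball_null :: "nat => 'a::euclidean_space set => bool" where
 "ball_null m A \<longleftrightarrow> (\<forall>\<epsilon>>0. \<forall>\<delta>>0. \<exists>F :: ('a \<times> real) set. finite F & A \<subseteq> (\<Union>(x, d)\<in>F. cball x d) &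
   (\<forall>(x, d)\<in>F. 0 < d & d <= \<delta>) & (\<Sum>(x, d)\<in>F. d ^ m) < \<epsilon>)"

lemma ball_null_Un:
 assumes "ball_null m A" "ball_null m B"
 shows "ball_null m (A \<union> B)"
 unfolding ball_null_def
proof (intro allI impI)
 fix \<epsilon> \<delta> :: real assume "\<epsilon> > 0" and \<delta>: "\<delta> > 0"
 then have e: "\<epsilon>/2 > 0" by simp
 obtain F where F: "finite F" "A \<subseteq> (\<Union>(x, d)\<in>F. cball x d)" "\<forall>(x, d)\<in>F. 0 < d & d <= \<delta>" "(\<Sum>(x, d)\<in>F. d ^ m) < \<epsilon>/2"
  using assms(1) e \<delta> unfolding ball_null_def by meson
 obtain G where G: "finite G" "B \<subseteq> (\<Union>(x, d)\<in>G. cball x d)" "\<forall>(x, d)\<in>G. 0 < d & d <= \<delta>" "(\<Sum>(x, d)\<in>G. d ^ m) < \<epsilon>/2"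
  using assms(2) e \<delta> unfolding ball_null_def by meson
 have "(\<Sum>(x, d)\<in>F \<union> G. d ^ m) <= (\<Sum>(x, d)\<in>F. d ^ m)+(\<Sum>(x, d)\<in>G. d ^ m)"
 proof -
  have "(\<Sum>(x, d)\<in>F \<inter> G. d ^ m) >= 0" using F(3) by (intro sum_nonneg) auto
  then show ?thesis using sum.union_inter[OF F(1) G(1), of "%(x, d). d ^ m"] by linarith
 qed
 then show "\<exists>F. finite F & A \<union> B \<subseteq> (\<Union>(x, d)\<in>F. cball x d) & (\<forall>(x, d)\<in>F. 0 < d & d <= \<delta>) & (\<Sum>(x, d)\<in>F. d ^ m) < \<epsilon>"
  using F G by (intro exI[of _ "F \<union> G"]) auto
qed

lemma ball_null_finite_UN:
 assumes "finite I" "!!i. i \<in> I ==> ball_null m (A i)"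
 shows "ball_null m (\<Union>i\<in>I. A i)"
 using assms
proof (induction I rule: finite_induct)
 case empty
 show ?case unfolding ball_null_def by (intro allI impI exI[of _ "{}"]) auto
next
 case (insert i I) then show ?case by (simp add: ball_null_Un)
qed

lemma ball_null_subset: "ball_null m A ==> B \<subseteq> A ==> ball_null m B"
 unfolding ball_null_def by (meson order_trans)

lemma hausdorff_const_pos: "s >= 0 ==> hausdorff_const s > 0"
 unfolding hausdorff_const_def by (intro divide_pos_pos Gamma_real_pos) auto

lemma hausdorff_measure_ball_null:
 fixes A :: "'a::euclidean_space set"
 assumes m: "m > 0" and A: "ball_null m A"
 shows "hausdorff_measure (real m) A = 0"
proof -
 define c where "c = hausdorff_const (real m)"
 have c: "c > 0" unfolding c_def by (rule hausdorff_const_pos) simp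
 have "hausdorff_pre (real m) \<delta> A <= ennreal \<epsilon>" if \<delta>: "\<delta> > 0" and \<epsilon>: "\<epsilon> > 0" for \<delta> \<epsilon> :: real
 proof -
  have "\<epsilon>/c > 0" "\<delta>/2 > 0" using \<epsilon> \<delta> c by auto
  then obtain F where F: "finite F" "A \<subseteq> (\<Union>(x, d)\<in>F. cball x d)" "\<forall>(x, d)\<in>F. 0 < d & d <= \<delta>/2" "(\<Sum>(x, d)\<in>F. d ^ m) < \<epsilon>/c"
   using A unfolding ball_null_def by meson
  obtain h where h: "bij_betw h {0..<card F} F" using ex_bij_betw_nat_finite[OF F(1)] by blast
  \<comment> \<open>The pre-measure asks for a sequence of sets, so the finite cover is padded by
    empty sets, which contribute nothing. Radii up to \<delta>/2 keep the diameters below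
    \<delta>.\<close>
  define C where "C i = (if i < card F then cball (fst (h i)) (snd (h i)) else {})" for i
  have hF: "h i \<in> F" if "i < card F" for i using h that by (auto simp: bij_betw_def)
  have d: "0 < snd (h i)" "snd (h i) <= \<delta>/2" if "i < card F" for i using F(3) hF[OF that] by (auto simp: case_prod_beta)
  have diam: "diameter (C i) <= 2 * snd (h i)" "0 <= diameter (C i)" if "i < card F" for i
  proof -
   show "diameter (C i) <= 2 * snd (h i)" using d[OF that] that by (simp add: C_def diameter_cball)
   show "0 <= diameter (C i)" by (rule diameter_ge_0) (simp add: C_def)
  qed
  have "A \<subseteq> (\<Union>i. C i)"
  proof
   fix x assume "x \<in> A"
   then obtain z where z: "z \<in> F" "x \<in> cball (fst z) (snd z)" using F(2) by fastforce
   have "z \<in> h ` {0..<card F}" using z(1) h by (simp add: bij_betw_def)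
   then obtain i where "i < card F" "h i = z" by auto
   then show "x \<in> (\<Union>i. C i)" using z by (auto simp: C_def)
  qed
  moreover have "bounded (C i) & diameter (C i) <= \<delta>" for i
   using d[of i] diam[of i] \<delta> by (cases "i < card F") (auto simp: C_def)
  ultimately have "hausdorff_pre (real m) \<delta> A <= (\<Sum>i. ennreal (c*(diameter (C i)/2) powr real m))"
   unfolding hausdorff_pre_def c_def by (intro INF_lower) auto
  also have "... = (\<Sum>i\<in>{0..<card F}. ennreal (c*(diameter (C i)/2) powr real m))"
   by (rule suminf_finite) (use m in \<open>auto simp: C_def\<close>)
  also have "... <= (\<Sum>i\<in>{0..<card F}. ennreal (c * snd (h i) ^ m))"
  proof (rule sum_mono, rule ennreal_leI, rule mult_left_mono)
   fix i assume "i \<in> {0..<card F}"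
   then have i: "i < card F" by simp
   have "(diameter (C i)/2) powr real m <= snd (h i) powr real m"
    using diam[OF i] by (intro powr_mono2) auto
   then show "(diameter (C i)/2) powr real m <= snd (h i) ^ m" using d[OF i] by (simp add: powr_realpow)
  qed (use c in simp)
  also have "... = ennreal (\<Sum>i\<in>{0..<card F}. c * snd (h i) ^ m)"
   by (rule sum_ennreal) (use c d in \<open>auto intro!: mult_nonneg_nonneg zero_le_power less_imp_le\<close>)
  also have "(\<Sum>i\<in>{0..<card F}. c * snd (h i) ^ m) = c*(\<Sum>(x, d)\<in>F. d ^ m)"
   using sum.reindex_bij_betw[OF h, of "%z. snd z ^ m"] by (simp add: sum_distrib_left[symmetric] case_prod_beta)
  also have "ennreal (c*(\<Sum>(x, d)\<in>F. d ^ m)) <= ennreal \<epsilon>"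
   using F(4) c by (intro ennreal_leI) (simp add: pos_less_divide_eq mult.commute less_imp_le)
  finally show ?thesis .
 qed
 note H = this
 have pre: "hausdorff_pre (real m) \<delta> A <= 0" if d: "\<delta> > 0" for \<delta>
 proof (rule ennreal_le_epsilon)
  fix e :: real assume "0 < e"
  from H[OF d this] show "hausdorff_pre (real m) \<delta> A <= 0+ennreal e" by simp
 qed
 have "hausdorff_measure (real m) A <= 0" unfolding hausdorff_measure_def
  by (rule SUP_least) (simp only: greaterThan_iff pre)
 then show ?thesis by simp
qed

text \<open>A packing bound: disjoint boxes along the direction b centred at a separated subset of Z
 fit into a small neighbourhood of the cylinder over Z.\<close>
lemma cylinder_negligible_imp_ball_null:
 fixes Z :: "'a::euclidean_space set" and b :: 'a
 assumes dim: "DIM('a) >= 2" and b: "b \<in> Basis" and Z: "compact Z" and r: "r > 0" and L: "L > 0"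
  and sep: "!!z z' s. z \<in> Z ==> z' \<in> Z ==> \<bar>s\<bar> <= 2*r ==> norm (z-z') <= L*norm (z'-z-s *R b)"
  and neg: "negligible ((%(z, s). z+s *R b) ` (Z \<times> {-r..r}))"
 shows "ball_null (DIM('a)-1) Z"
 unfolding ball_null_def
proof (intro allI impI)
 fix \<epsilon> \<delta> :: real assume \<epsilon>: "\<epsilon> > 0" and \<delta>: "\<delta> > 0"
 define n where "n = DIM('a)"
 have n: "n > 0" by (simp add: n_def)
 define C where "C = (%(z, s). z+s *R b) ` (Z \<times> {-r..r})"
 have cC: "compact C" unfolding C_def split_beta
  by (intro compact_continuous_image continuous_intros compact_Times Z) auto
 \<comment> \<open>Calibrated for the final count: a box has volume 2r(2\<rho>)^(n-1) and its
   covering radius is n(2\<rho>)L, so total volume below \<epsilon>' leaves half of \<epsilon> for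
   the sum of the powers of the radii.\<close>
 define \<epsilon>' where "\<epsilon>' = \<epsilon>*(2*r)/(real n*L) ^ (n-1)/2"
 have \<epsilon>': "\<epsilon>' > 0" using \<epsilon> r n L by (simp add: \<epsilon>'_def)
 have C0: "C \<in> lmeasurable" "measure lebesgue C = 0"
  using neg negligible_iff_measure by (auto simp: C_def)
 obtain U where U: "open U" "C \<subseteq> U" "U \<in> lmeasurable" "measure lebesgue U < \<epsilon>'"
 proof -
  obtain U where U: "open U" "C \<subseteq> U" "U-C \<in> lmeasurable" "emeasure lebesgue (U-C) < ennreal \<epsilon>'"
   using sets_lebesgue_outer_open[OF fmeasurableD[OF C0(1)] \<epsilon>'] by blast
  have "C \<union> (U-C) \<in> lmeasurable" by (rule fmeasurable.Un[OF C0(1) U(3)])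
  moreover have CU: "C \<union> (U-C) = U" using U by blast
  moreover have "measure lebesgue (U-C) < \<epsilon>'"
   using U(4) \<epsilon>' unfolding emeasure_eq_measure2[OF U(3)] by (simp add: ennreal_less_iff del: measure_completion)
  moreover have "measure lebesgue (C \<union> (U-C)) <= measure lebesgue C+measure lebesgue (U-C)"
   by (rule measure_Un_le[OF fmeasurableD[OF C0(1)] fmeasurableD[OF U(3)]])
  ultimately show ?thesis using that[OF U(1,2)] C0(2) by simp
 qed
 obtain d0 where d0: "d0 > 0" "(\<Union>x\<in>C. ball x d0) \<subseteq> U"
  using compact_subset_open_imp_ball_epsilon_subset[OF cC U(1,2)] by blast
 define dd where "dd = min \<delta> (d0*L)"
 have dd: "dd > 0" "dd <= \<delta>" "dd <= d0*L" using \<delta> d0 L by (auto simp: dd_def)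
 \<comment> \<open>If two boxes met, their centres would differ by at most n(2\<rho>) up to a
   multiple of b, and the separation hypothesis would bring them within distance dd.\<close>
 define \<rho> where "\<rho> = dd/(2*real n*L)"
 have \<rho>: "\<rho> > 0" using dd n L by (simp add: \<rho>_def)
 have \<rho>2: "real n*(2*\<rho>)*L = dd" using n L by (simp add: \<rho>_def)
 define v where "v = (\<Sum>i\<in>Basis. (if i = b then r else \<rho>) *R i)"
 have vi: "v \<bullet> i = (if i = b then r else \<rho>)" if "i \<in> Basis" for i using that by (simp add: v_def)
 have perp: "norm (y-(y \<bullet> b) *R b) <= real n*a" if "!!i. i \<in> Basis ==> i ~= b ==> \<bar>y \<bullet> i\<bar> <= a" "a >= 0" for y a
 proof -
  have "norm (y-(y \<bullet> b) *R b) <= (\<Sum>i\<in>Basis. \<bar>(y-(y \<bullet> b) *R b) \<bullet> i\<bar>)" by (rule norm_le_l1)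
  also have "... <= (\<Sum>i\<in>(Basis::'a set). a)"
  proof (rule sum_mono)
   fix i :: 'a assume i: "i \<in> Basis"
   show "\<bar>(y-(y \<bullet> b) *R b) \<bullet> i\<bar> <= a"
    using that i b by (cases "i = b") (auto simp: inner_diff_left inner_Basis)
  qed
  finally show ?thesis by (simp add: n_def)
 qed
 define Bx where "Bx z = cbox (z-v) (z+v)" for z
 have Bxi: "\<bar>(y-z) \<bullet> i\<bar> <= (if i = b then r else \<rho>)" if "y \<in> Bx z" "i \<in> Basis" for y z i
  using that vi[OF that(2)] by (force simp: Bx_def mem_box inner_simps abs_le_iff)
 have BU: "Bx z \<subseteq> U" if z: "z \<in> Z" for z
 proof
  fix y assume y: "y \<in> Bx z"
  define s where "s = (y-z) \<bullet> b"
  have s: "\<bar>s\<bar> <= r" using Bxi[OF y b] by (simp add: s_def)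
  have "norm ((y-z)-s *R b) <= real n*\<rho>" unfolding s_def
  proof (rule perp)
   show "\<bar>(y-z) \<bullet> i\<bar> <= \<rho>" if "i \<in> Basis" "i ~= b" for i using Bxi[OF y that(1)] that(2) by simp
  qed (use \<rho> in simp)
  also have "... < d0"
  proof -
   have "real n*\<rho>*(2*L) <= d0*L" using \<rho>2 dd by (simp add: algebra_simps)
   then have "real n*\<rho>*2 <= d0" using L by (simp add: mult.assoc[symmetric])
   moreover have "real n*\<rho> > 0" using n \<rho> by simp
   ultimately show ?thesis by linarith
  qed
  finally have "dist (z+s *R b) y < d0" by (simp add: dist_norm norm_minus_commute algebra_simps)
  moreover have "z+s *R b \<in> C" unfolding C_def using z s by (force simp: abs_le_iff)
  ultimately have "y \<in> (\<Union>x\<in>C. ball x d0)" by auto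
  then show "y \<in> U" using d0(2) by (rule subsetD[rotated])
 qed
 have disj: "Bx z \<inter> Bx z' = {}" if z: "z \<in> Z" "z' \<in> Z" and far: "dist z z' > dd" for z z'
 proof (rule ccontr)
  assume "Bx z \<inter> Bx z' ~= {}"
  then obtain y where y: "y \<in> Bx z" "y \<in> Bx z'" by blast
  have i: "\<bar>(z'-z) \<bullet> i\<bar> <= 2*(if i = b then r else \<rho>)" if "i \<in> Basis" for i
  proof -
   have "(z'-z) \<bullet> i = (y-z) \<bullet> i-(y-z') \<bullet> i" by (simp add: inner_simps)
   then show ?thesis using Bxi[OF y(1) that] Bxi[OF y(2) that] by (simp add: abs_le_iff)
  qed
  define s where "s = (z'-z) \<bullet> b"
  have s: "\<bar>s\<bar> <= 2*r" using i[OF b] by (simp add: s_def)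
  have "norm ((z'-z)-s *R b) <= real n*(2*\<rho>)" unfolding s_def
  proof (rule perp)
   show "\<bar>(z'-z) \<bullet> j\<bar> <= 2*\<rho>" if "j \<in> Basis" "j ~= b" for j using i[OF that(1)] that(2) by simp
  qed (use \<rho> in simp)
  then have "L*norm (z'-z-s *R b) <= L*(real n*(2*\<rho>))" using L by (intro mult_left_mono) auto
  with sep[OF z s] have "norm (z-z') <= dd" using \<rho>2 by (simp add: algebra_simps)
  then show False using far by (simp add: dist_norm)
 qed
 have mB: "measure lebesgue (Bx z) = 2*r*(2*\<rho>) ^ (n-1)" for z
 proof -
  have "measure lebesgue (Bx z) = (\<Prod>i\<in>Basis. (z+v) \<bullet> i-(z-v) \<bullet> i)"
  proof -
   have "\<forall>i\<in>Basis. (z-v) \<bullet> i <= (z+v) \<bullet> i" using vi r \<rho> by (auto simp: inner_simps)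
   then have "cbox (z-v) (z+v) ~= {}" by (simp add: box_ne_empty)
   from content_cbox'[OF this] show ?thesis unfolding Bx_def by simp
  qed
  also have "... = (\<Prod>i\<in>Basis. if i = b then 2*r else 2*\<rho>)"
   by (rule prod.cong) (auto simp: inner_simps vi)
  also have "... = 2*r*(2*\<rho>) ^ (n-1)"
   using b by (subst prod.remove[of _ b]) (auto simp: n_def card_Diff_singleton)
  finally show ?thesis .
 qed
 have bound: "real (card X)*(2*r*(2*\<rho>) ^ (n-1)) < \<epsilon>'"
  if X: "finite X" "X \<subseteq> Z" "!!z z'. z \<in> X ==> z' \<in> X ==> z ~= z' ==> dist z z' > dd" for X
 proof -
  have "real (card X)*(2*r*(2*\<rho>) ^ (n-1)) = (\<Sum>z\<in>X. measure lebesgue (Bx z))" by (simp add: mB)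
  also have "... = measure lebesgue (\<Union>z\<in>X. Bx z)"
  proof (rule measure_finite_Union[symmetric, OF X(1)])
   show "disjoint_family_on Bx X" unfolding disjoint_family_on_def using disj X by blast
   show "emeasure lebesgue (Bx z) ~= \<infinity>" for z
    unfolding Bx_def using fmeasurableD2[OF lmeasurable_cbox[of "z-v" "z+v"]] by (simp add: infinity_ennreal_def)
  qed (auto simp: Bx_def)
  also have "... <= measure lebesgue U"
   by (rule measure_mono_fmeasurable) (use BU X U(3) in \<open>auto intro!: sets.finite_UN simp: Bx_def\<close>)
  finally show ?thesis using U(4) by simp
 qed
 define P where "P X \<longleftrightarrow> finite X & X \<subseteq> Z & (\<forall>z\<in>X. \<forall>z'\<in>X. z ~= z' --> dist z z' > dd)" for X
 have q: "2*r*(2*\<rho>) ^ (n-1) > 0" using r \<rho> by simp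
 obtain N :: nat where N: "\<epsilon>'/(2*r*(2*\<rho>) ^ (n-1)) <= real N" using real_arch_simple by blast
 have cardN: "card X <= N" if "P X" for X
 proof -
  have "real (card X)*(2*r*(2*\<rho>) ^ (n-1)) < \<epsilon>'" using that by (intro bound) (auto simp: P_def)
  then have "real (card X) < \<epsilon>'/(2*r*(2*\<rho>) ^ (n-1))" using q by (simp add: pos_less_divide_eq)
  then show ?thesis using N by linarith
 qed
 have "P {}" by (simp add: P_def)
 \<comment> \<open>A separated set of largest cardinality, which exists because the volume bounds
   the cardinality. Maximality makes the balls of radius dd around it a cover of Z.\<close>
 then obtain X where X: "P X" "!!Y. P Y ==> card Y <= card X"
 proof -
  assume P: "P {}" and th: "!!X. P X ==> (!!Y. P Y ==> card Y <= card X) ==> thesis"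
  have "\<exists>X. P X & (\<forall>Y. P Y --> card Y <= card X)"
   by (rule ex_has_greatest_nat[of P "{}" card "Suc N"]) (use P cardN in \<open>auto simp: less_Suc_eq_le\<close>)
  then show thesis using th by auto
 qed
 have cover: "Z \<subseteq> (\<Union>z\<in>X. cball z dd)"
 proof
  fix y assume y: "y \<in> Z"
  show "y \<in> (\<Union>z\<in>X. cball z dd)"
  proof (rule ccontr)
   assume "y \<notin> (\<Union>z\<in>X. cball z dd)"
   then have far: "dist z y > dd" if "z \<in> X" for z using that by auto
   then have "P (insert y X)" using X(1) y by (auto simp: P_def dist_commute)
   moreover have "y \<notin> X" using far[of y] dd by auto
   ultimately show False using X(2)[of "insert y X"] X(1) by (auto simp: P_def)
  qed
 qed
 have "real (card X)*dd ^ (n-1) < \<epsilon>"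
 proof -
  have "real (card X)*(2*r*(2*\<rho>) ^ (n-1)) < \<epsilon>'" using X(1) by (intro bound) (auto simp: P_def)
  then have "real (card X)*(2*r*(2*\<rho>) ^ (n-1))*(real n*L) ^ (n-1) < \<epsilon>'*(real n*L) ^ (n-1)"
   using n L by (intro mult_strict_right_mono) auto
  moreover have "\<epsilon>'*(real n*L) ^ (n-1) = \<epsilon>*r" using n L by (simp add: \<epsilon>'_def)
  moreover have "dd ^ (n-1) = (2*\<rho>) ^ (n-1)*(real n*L) ^ (n-1)"
   unfolding power_mult_distrib[symmetric] using \<rho>2 by (simp add: algebra_simps)
  ultimately have "(real (card X)*dd ^ (n-1))*(2*r) < \<epsilon>*r" by (simp add: algebra_simps)
  then have "(real (card X)*dd ^ (n-1))*2 < \<epsilon>" using r by (simp add: mult.assoc[symmetric])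
  moreover have "real (card X)*dd ^ (n-1) >= 0" using dd by simp
  ultimately show ?thesis by linarith
 qed
 moreover have "(\<Sum>(x, d)\<in>X \<times> {dd}. d ^ (n-1)) = real (card X)*dd ^ (n-1)"
  using X(1) by (simp add: sum.cartesian_product[symmetric] P_def)
 moreover have "(\<Union>(x, d)\<in>X \<times> {dd}. cball x d) = (\<Union>z\<in>X. cball z dd)" by auto
 ultimately show "\<exists>F. finite F & Z \<subseteq> (\<Union>(x, d)\<in>F. cball x d) & (\<forall>(x, d)\<in>F. 0 < d & d <= \<delta>) & (\<Sum>(x, d)\<in>F. d ^ (DIM('a)-1)) < \<epsilon>"
  using X(1) cover dd by (intro exI[of _ "X \<times> {dd}"]) (simp add: P_def n_def)
qed

text \<open>If every point had a null neighbourhood in K, finitely many of these would cover K and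
  make it null.\<close>

lemma hausdorff_pos_point:
 fixes K :: "'a::euclidean_space set"
 assumes dim: "DIM('a) >= 2" and K: "compact K" and pos: "hausdorff_measure (real DIM('a)-1) K > 0"
 obtains p where "p \<in> K" "!!r. r > 0 ==> \<not> ball_null (DIM('a)-1) (K \<inter> cball p r)"
proof (rule ccontr)
 assume "\<not> thesis"
 then have "\<forall>p\<in>K. \<exists>r>0. ball_null (DIM('a)-1) (K \<inter> cball p r)" using that by blast
 then obtain r where r: "!!p. p \<in> K ==> r p > 0 & ball_null (DIM('a)-1) (K \<inter> cball p (r p))" by metis
 obtain I where I: "I \<subseteq> K" "finite I" "K \<subseteq> (\<Union>p\<in>I. ball p (r p))"
 proof (rule compactE_image[OF K, of K "%p. ball p (r p)"])
  show "K \<subseteq> (\<Union>p\<in>K. ball p (r p))" using r by force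
 qed auto
 have "ball_null (DIM('a)-1) (\<Union>p\<in>I. K \<inter> cball p (r p))"
  by (rule ball_null_finite_UN[OF I(2)]) (use I(1) r in blast)
 moreover have "K \<subseteq> (\<Union>p\<in>I. K \<inter> cball p (r p))" 
 proof
  fix x assume "x \<in> K"
  with I(3) obtain p where "p \<in> I" "x \<in> ball p (r p)" by blast
  then show "x \<in> (\<Union>p\<in>I. K \<inter> cball p (r p))" using \<open>x \<in> K\<close> by (intro UN_I[of p]) auto
 qed
 ultimately have "ball_null (DIM('a)-1) K" by (rule ball_null_subset)
 then have "hausdorff_measure (real (DIM('a)-1)) K = 0" using dim by (intro hausdorff_measure_ball_null) auto
 then show False using pos dim by (simp add: of_nat_diff)
qed

text \<open>Differentiability at p that is uniform over pairs of nearby points. A point is later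
  compared with its foot on the core, neither of which is p.\<close>

lemma C1_strict:
 fixes w :: "'a::euclidean_space => real"
 assumes S: "open S" and C: "Ck_on 1 S w" and p: "p \<in> S" and \<epsilon>: "\<epsilon> > 0"
 shows "\<exists>r>0. ball p r \<subseteq> S & (\<forall>x\<in>ball p r. \<forall>y\<in>ball p r. \<bar>w x-w y-pd (x-y) w p\<bar> <= \<epsilon>*norm (x-y))"
proof -
 have d: "w differentiable at x" if "x \<in> S" for x using Ck_on_Suc_diff[OF S, of 0 w] C that by simp
 define B where "B x = (\<Sum>b\<in>Basis. \<bar>pd b w x-pd b w p\<bar>)" for x
 have cB: "continuous_on S B" unfolding B_def using C by (intro continuous_intros) simp
 then have "isCont B p" using p S continuous_on_eq_continuous_at by blast
 then obtain r1 where r1: "r1 > 0" "!!x. dist x p < r1 ==> dist (B x) (B p) < \<epsilon>"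
  using \<epsilon> unfolding continuous_at_eps_delta by metis
 obtain r2 where r2: "r2 > 0" "ball p r2 \<subseteq> S" using S p open_contains_ball by blast
 define r where "r = min r1 r2"
 have r: "r > 0" "ball p r \<subseteq> S" using r1 r2 by (auto simp: r_def)
 have Bp: "B p = 0" by (simp add: B_def)
 have l: "bounded_linear (frechet_derivative w (at p))" using has_derivative_bounded_linear[OF has_derivative_frechet[OF d[OF p]]] .
 define w' where "w' x = w x-frechet_derivative w (at p) x" for x
 have dw': "(w' has_derivative (%v. pd v w x-pd v w p)) (at x)" if "x \<in> S" for x
  unfolding w'_def by (intro has_derivative_diff has_derivative_frechet d that bounded_linear_imp_has_derivative l)
 have on: "onorm (%v. pd v w x-pd v w p) <= \<epsilon>" if x: "x \<in> ball p r" for x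
 proof (rule onorm_le)
  fix v
  have xS: "x \<in> S" using x r by blast
  have "norm (pd v w x-pd v w p) = \<bar>\<Sum>b\<in>Basis. (pd b w x-pd b w p)*(v \<bullet> b)\<bar>"
   unfolding has_derivative_Basis_expand[OF d[OF xS], of v] has_derivative_Basis_expand[OF d[OF p], of v]
   by (simp add: sum_subtractf left_diff_distrib)
  also have "... <= (\<Sum>b\<in>Basis. \<bar>pd b w x-pd b w p\<bar>*norm v)"
   by (rule order_trans[OF sum_abs sum_mono]) (simp add: abs_mult mult_left_mono Basis_le_norm)
  also have "... = B x*norm v" by (simp add: B_def sum_distrib_right)
  also have "... <= \<epsilon>*norm v"
  proof (rule mult_right_mono)
   have "dist (B x) (B p) < \<epsilon>" using r1(2)[of x] x by (simp add: r_def dist_commute)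
   then show "B x <= \<epsilon>" by (simp add: dist_real_def Bp)
  qed simp
  finally show "norm (pd v w x-pd v w p) <= \<epsilon>*norm v" .
 qed
 have "\<bar>w x-w y-pd (x-y) w p\<bar> <= \<epsilon>*norm (x-y)" if xy: "x \<in> ball p r" "y \<in> ball p r" for x y
 proof -
  have "norm (w' x-w' y) <= \<epsilon>*norm (x-y)"
   by (rule differentiable_bound[OF convex_ball _ on xy], rule has_derivative_at_withinI, rule dw', rule subsetD[OF r(2)])
  moreover have "w' x-w' y = w x-w y-pd (x-y) w p"
   using linear_diff[OF bounded_linear.linear[OF l], of x y] by (simp add: w'_def)
  ultimately show ?thesis by simp
 qed
 then show ?thesis using r by blast
qed

lemma local_min_second_derivative:
 fixes f :: "'a::euclidean_space => real"
 assumes S: "open S" and C: "Ck_on 2 S f" and x: "x \<in> S" and r: "r > 0" and min: "!!y. y \<in> ball x r ==> y \<in> S ==> f x <= f y"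
 shows "pd b f x = 0" "pd b (pd b f) x >= 0"
proof -
 obtain r0 where r0: "r0 > 0" "ball x r0 \<subseteq> S" using S x open_contains_ball by blast
 define \<delta> where "\<delta> = min r r0/(norm b+1)"
 have nb: "norm b+1 > 0" by (simp add: add_nonneg_pos)
 have \<delta>: "\<delta> > 0" using r r0 nb by (simp add: \<delta>_def)
 have mem: "x+t *R b \<in> ball x r \<inter> S" if "\<bar>t\<bar> < \<delta>" for t
 proof -
  have "\<bar>t\<bar>*norm b <= \<bar>t\<bar>*(norm b+1)" by (intro mult_left_mono) auto
  also have "... < min r r0" using that nb by (simp add: \<delta>_def pos_less_divide_eq)
  finally have "x+t *R b \<in> ball x (min r r0)" by (simp add: dist_norm)
  then show ?thesis using r0 by auto
 qed
 define g where "g t = f (x+t *R b)" for t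
 have d1: "f differentiable at y" "pd b f differentiable at y" if "y \<in> S" for y
  using Ck_on_Suc_diff[OF S, of 1 f] Ck_on_Suc_diff[OF S, of 0 "pd b f"] C that by (simp_all add: numeral_2_eq_2)
 have dg: "DERIV g t :> pd b f (x+t *R b)" if "\<bar>t\<bar> < \<delta>" for t
  unfolding g_def using has_real_derivative_along[OF d1(1)] mem[OF that] by blast
 have dg2: "DERIV (%t. pd b f (x+t *R b)) 0 :> pd b (pd b f) (x+0 *R b)"
  by (rule has_real_derivative_along) (use d1(2)[OF x] in simp)
 have "pd b f (x+0 *R b) = 0"
  by (rule DERIV_local_min[OF dg \<delta>]) (use \<delta> mem min in \<open>auto simp: g_def\<close>)
 then show p0: "pd b f x = 0" by simp
 show "pd b (pd b f) x >= 0"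
 proof (rule ccontr)
  assume "\<not> ?thesis"
  then have "pd b (pd b f) (x+0 *R b) < 0" by simp
  from DERIV_neg_dec_right[OF dg2 this] obtain d where d: "d > 0" "!!h. 0 < h ==> h < d ==> pd b f (x+h *R b) < 0"
   using p0 by auto
  define h where "h = min d \<delta>/2"
  have h: "0 < h" "h < d" "h < \<delta>" using d \<delta> by (auto simp: h_def)
  obtain z where z: "0 < z" "z < h" "g h-g 0 = (h-0)*pd b f (x+z *R b)"
   using MVT2[OF h(1), of g "%t. pd b f (x+t *R b)"] dg h by force
  have "h*pd b f (x+z *R b) < 0" using d(2)[of z] z h by (intro mult_pos_neg) auto
  then have "g h < g 0" using z by simp
  moreover have "f x <= f (x+h *R b)" using mem[of h] h min by auto
  ultimately show False by (simp add: g_def)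
 qed
qed

lemma local_max_second_derivative:
 fixes f :: "'a::euclidean_space => real"
 assumes S: "open S" and C: "Ck_on 2 S f" and x: "x \<in> S" and r: "r > 0" and max: "!!y. y \<in> ball x r ==> y \<in> S ==> f y <= f x"
 shows "pd b f x = 0" "laplacian f x <= 0"
proof -
 have C': "Ck_on 2 S (%y. (-1)*f y)" by (rule Ck_on_cmult[OF S C])
 have d1: "f differentiable at y" "pd b f differentiable at y" if "y \<in> S" for y b
  using Ck_on_Suc_diff[OF S, of 1 f] Ck_on_Suc_diff[OF S, of 0 "pd b f"] C that by (simp_all add: numeral_2_eq_2)
 have neg: "pd b (%y. (-1)*g y) y = - pd b g y" if "g differentiable at y" for b y and g :: "'a => real"
  using frechet_derivative_eqI[OF has_derivative_mult_right[OF has_derivative_frechet[OF that], of "-1"]] by simp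
 have neg2: "pd b (pd b (%y. (-1)*f y)) x = - pd b (pd b f) x" for b
 proof -
  have "frechet_derivative (pd b (%y. (-1)*f y)) (at x) = frechet_derivative (%y. (-1)*pd b f y) (at x)"
   by (rule frechet_derivative_cong_open[OF S x]) (use neg[OF d1(1)] in simp)
  then show ?thesis using neg[OF d1(2)[OF x]] by simp
 qed
 have A: "pd b (%y. (-1)*f y) x = 0" "pd b (pd b (%y. (-1)*f y)) x >= 0" for b
  by (rule local_min_second_derivative[OF S C' x r]; use max in simp)+
 show "pd b f x = 0" using A(1)[of b] neg[OF d1(1)[OF x]] by simp
 show "laplacian f x <= 0" unfolding laplacian_def using A(2) neg2 by (intro sum_nonpos) simp
qed

section \<open>The core\<close>

locale torsion =
 fixes \<Omega> :: "'a::euclidean_space set" and u :: "'a => real"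
 assumes dim: "DIM('a) >= 3" and op: "open \<Omega>" and conn: "connected \<Omega>" and bdd: "bounded \<Omega>" and ne: "\<Omega> ~= {}"
  and C2: "Ck_on 2 \<Omega> u" and cont: "continuous_on (closure \<Omega>) u"
  and pde: "!!x. x \<in> \<Omega> ==> laplacian u x = - real DIM('a)" and bc: "!!x. x \<in> frontier \<Omega> ==> u x = 0"
begin

abbreviation M where "M \<equiv> umax \<Omega> u"
abbreviation MX where "MX \<equiv> MAXset \<Omega> u"

definition hess :: "'a => 'a => 'a" where "hess x h = (\<Sum>i\<in>Basis. pd h (pd i u) x *R i)"

lemma uC: "Ck_on k \<Omega> u"
 by (rule lap_const_Ck[OF dim op C2 pde])

lemma pdC: "Ck_on k \<Omega> (pd v u)"
 by (rule Ck_on_Suc_pd[OF uC])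

lemma pdC2: "Ck_on k \<Omega> (pd w (pd v u))"
 by (rule Ck_on_Suc_pd[OF pdC])

lemma diffs: "x \<in> \<Omega> ==> u differentiable at x" "x \<in> \<Omega> ==> pd v u differentiable at x"
  "x \<in> \<Omega> ==> pd w (pd v u) differentiable at x"
 using Ck_on_Suc_diff[OF op uC] Ck_on_Suc_diff[OF op pdC] Ck_on_Suc_diff[OF op pdC2] by blast+

lemma pd_comm: "x \<in> \<Omega> ==> pd a (pd b u) x = pd b (pd a u) x"
 by (rule pd_commute[OF op uC])

lemma grad_inner: "x \<in> \<Omega> ==> grad u x \<bullet> v = pd v u x"
 unfolding grad_def using has_derivative_Basis_expand[OF diffs(1), of x v]
 by (simp add: inner_commute[of _ v] inner_sum_right)

lemma grad_Basis: "grad u x \<bullet> b = pd b u x" if "b \<in> Basis"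
 using that by (simp add: grad_def inner_sum_left inner_Basis if_distrib cong: if_cong)

lemma hess_linear: assumes x: "x \<in> \<Omega>" shows "linear (hess x)"
proof (rule linearI)
 note l = linear_frechet_derivative[OF diffs(2)[OF x]]
 show "hess x (a+b) = hess x a+hess x b" for a b
  by (simp add: hess_def linear_add[OF l] scaleR_add_left sum.distrib)
 show "hess x (c *R a) = c *R hess x a" for a c
  by (simp add: hess_def linear_cmul[OF l] scaleR_sum_right)
qed

lemma hess_inner: assumes x: "x \<in> \<Omega>" shows "hess x h \<bullet> k = pd h (pd k u) x"
proof -
 have "pd k u y = (\<Sum>b\<in>Basis. pd b u y*(k \<bullet> b))" if "y \<in> \<Omega>" for y
  using has_derivative_Basis_expand[OF diffs(1)[OF that], of k] .
 then have "frechet_derivative (pd k u) (at x) = frechet_derivative (%y. \<Sum>b\<in>Basis. pd b u y*(k \<bullet> b)) (at x)"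
  by (intro frechet_derivative_cong_open[OF op x])
 also have "... = (%v. \<Sum>b\<in>Basis. pd v (pd b u) x*(k \<bullet> b))"
  by (intro frechet_derivative_eqI has_derivative_sum has_derivative_mult_left has_derivative_frechet diffs x)
 finally show ?thesis by (simp add: hess_def inner_commute[of _ k] inner_sum_right)
qed

lemma hess_sym: "x \<in> \<Omega> ==> hess x h \<bullet> k = hess x k \<bullet> h"
 by (simp add: hess_inner pd_comm)

lemma hess_trace: "x \<in> \<Omega> ==> (\<Sum>b\<in>Basis. hess x b \<bullet> b) = - real DIM('a)"
 using pde by (simp add: hess_inner laplacian_def)

lemma grad_derivative: "x \<in> \<Omega> ==> (grad u has_derivative hess x) (at x)"
 unfolding grad_def[abs_def] hess_def[abs_def]
 by (intro has_derivative_sum has_derivative_scaleR_left has_derivative_frechet diffs)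

lemma grad_cont: "continuous_on \<Omega> (grad u)"
 using grad_derivative has_derivative_continuous op by (metis continuous_at_imp_continuous_on)

lemma grad_strict:
 assumes p: "p \<in> \<Omega>" and \<epsilon>: "\<epsilon> > 0"
 shows "\<exists>r>0. ball p r \<subseteq> \<Omega> & (\<forall>x\<in>ball p r. \<forall>y\<in>ball p r. norm (grad u x-grad u y-hess p (x-y)) <= \<epsilon>*norm (x-y))"
proof -
 define e where "e = \<epsilon>/real DIM('a)"
 have e: "e > 0" using \<epsilon> by (simp add: e_def)
 have "\<forall>b. \<exists>r>0. ball p r \<subseteq> \<Omega> & (\<forall>x\<in>ball p r. \<forall>y\<in>ball p r. \<bar>pd b u x-pd b u y-pd (x-y) (pd b u) p\<bar> <= e*norm (x-y))"
  using C1_strict[OF op pdC p e] by blast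
 then obtain R where R: "!!b. R b > 0 & ball p (R b) \<subseteq> \<Omega> & (\<forall>x\<in>ball p (R b). \<forall>y\<in>ball p (R b). \<bar>pd b u x-pd b u y-pd (x-y) (pd b u) p\<bar> <= e*norm (x-y))"
  by metis
 define r where "r = Min (R ` Basis)"
 have r: "r > 0" "!!b. b \<in> Basis ==> r <= R b" using R by (auto simp: r_def)
 have sub: "ball p r \<subseteq> ball p (R b)" if "b \<in> Basis" for b using r(2)[OF that] by auto
 have "norm (grad u x-grad u y-hess p (x-y)) <= \<epsilon>*norm (x-y)" if xy: "x \<in> ball p r" "y \<in> ball p r" for x y
 proof -
  have "norm (grad u x-grad u y-hess p (x-y)) <= (\<Sum>b\<in>Basis. \<bar>(grad u x-grad u y-hess p (x-y)) \<bullet> b\<bar>)" by (rule norm_le_l1)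
  also have "... <= (\<Sum>b\<in>(Basis::'a set). e*norm (x-y))"
  proof (rule sum_mono)
   fix b :: 'a assume b: "b \<in> Basis"
   have "(grad u x-grad u y-hess p (x-y)) \<bullet> b = pd b u x-pd b u y-pd (x-y) (pd b u) p"
    by (simp add: inner_diff_left grad_Basis[OF b] hess_inner[OF p])
   then show "\<bar>(grad u x-grad u y-hess p (x-y)) \<bullet> b\<bar> <= e*norm (x-y)" using R[of b] subsetD[OF sub[OF b] xy(1)] subsetD[OF sub[OF b] xy(2)] by simp
  qed
  also have "... = \<epsilon>*norm (x-y)" by (simp add: e_def)
  finally show ?thesis .
 qed
 moreover obtain b :: 'a where "b \<in> Basis" using nonempty_Basis by blast
 then have "ball p r \<subseteq> \<Omega>" using sub R by blast
 ultimately show ?thesis using r(1) by blast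
qed

lemma closure_compact: "compact (closure \<Omega>)"
 using bdd by (simp add: compact_closure)

text \<open>At an interior minimum all second derivatives would be nonnegative, against a Laplacian
  of -n. The strict conclusion is what contradicts u <= M later on.\<close>

lemma min_principle:
 assumes V: "open V" "V \<subseteq> \<Omega>" "V ~= {}" and fr: "!!x. x \<in> frontier V ==> m <= u x" and x: "x \<in> V"
 shows "m < u x"
proof -
 have cl: "closure V \<subseteq> closure \<Omega>" using V by (intro closure_mono)
 have cV: "compact (closure V)" using bdd V bounded_subset by (auto simp: compact_closure)
 obtain y where y: "y \<in> closure V" "!!z. z \<in> closure V ==> u y <= u z"
  using continuous_attains_inf[OF cV _ continuous_on_subset[OF cont cl]] V by auto
 have notV: False if z: "z \<in> V" "!!w. w \<in> closure V ==> u z <= u w" for z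
 proof -
  obtain r where r: "r > 0" "ball z r \<subseteq> V" using V z open_contains_ball by blast
  have zO: "z \<in> \<Omega>" using z V by blast
  have "pd b (pd b u) z >= 0" for b
   by (rule local_min_second_derivative(2)[OF op uC zO r(1)]) (use z(2) r closure_subset in blast)
  then have "laplacian u z >= 0" unfolding laplacian_def by (intro sum_nonneg) auto
  then show False using pde[OF zO] dim by simp
 qed
 have "y \<notin> V" using notV[of y] y by blast
 then have "y \<in> frontier V" using y V by (simp add: frontier_def interior_open)
 then have my: "m <= u y" by (rule fr)
 have "u y <= u x" using y x closure_subset by blast
 moreover have "u y ~= u x" using notV[OF x] y(2) by metis
 ultimately show ?thesis using my by simp
qed

lemma u_pos: "x \<in> \<Omega> ==> 0 < u x"
 by (rule min_principle[OF op _ ne]) (auto simp: bc)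

lemma max_attained: "\<exists>x\<in>\<Omega>. u x = M" and u_le_M: "!!x. x \<in> \<Omega> ==> u x <= M"
proof -
 obtain y where y: "y \<in> closure \<Omega>" "!!z. z \<in> closure \<Omega> ==> u z <= u y"
  using continuous_attains_sup[OF closure_compact _ cont] ne by auto
 obtain z where z: "z \<in> \<Omega>" using ne by blast
 then have "0 < u y" using u_pos[OF z] y(2)[of z] closure_subset by force
 then have "y \<notin> frontier \<Omega>" using bc by force
 then have yO: "y \<in> \<Omega>" using y op by (simp add: frontier_def interior_open)
 have "M = u y" unfolding umax_def
  by (rule cSup_eq_maximum) (use yO y closure_subset in auto)
 then show "\<exists>x\<in>\<Omega>. u x = M" "!!x. x \<in> \<Omega> ==> u x <= M" using yO y closure_subset by auto
qed

lemma M_pos: "M > 0"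
 using max_attained u_pos by force

text \<open>The maximum is positive while u vanishes on the boundary, so the level set of M in the
  closure stays inside.\<close>

lemma MX_compact: "compact MX" and MX_sub: "MX \<subseteq> \<Omega>"
proof -
 show "MX \<subseteq> \<Omega>" by (auto simp: MAXset_def)
 have "MX = {x \<in> closure \<Omega>. u x = M}"
 proof
  show "MX \<subseteq> {x \<in> closure \<Omega>. u x = M}" using closure_subset by (auto simp: MAXset_def)
  show "{x \<in> closure \<Omega>. u x = M} \<subseteq> MX"
  proof
   fix x assume x: "x \<in> {x \<in> closure \<Omega>. u x = M}"
   then have "x \<notin> frontier \<Omega>" using bc M_pos by force
   then show "x \<in> MX" using x op by (simp add: frontier_def interior_open MAXset_def)
  qed
 qed
 moreover have "closed {x \<in> closure \<Omega>. u x = M}"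
  using continuous_closed_preimage_constant[OF cont closed_closure] by simp
 moreover have "{x \<in> closure \<Omega>. u x = M} \<inter> closure \<Omega> = {x \<in> closure \<Omega>. u x = M}" by blast
 ultimately show "compact MX" using closed_Int_compact[OF _ closure_compact, of MX] by simp
qed

lemma MX_pd: "x \<in> MX ==> pd b u x = 0" and MX_grad: "x \<in> MX ==> grad u x = 0"
proof -
 show 1: "pd b u x = 0" if "x \<in> MX" for x b
  by (rule local_max_second_derivative(1)[OF op uC, of x 1]) (use that u_le_M in \<open>auto simp: MAXset_def\<close>)
 show "grad u x = 0" if "x \<in> MX" for x using 1[OF that] by (simp add: grad_def)
qed

text \<open>The trace of the Hessian is -n. The direction found here is the one along which the
  section through a maximum point is a graph.\<close>

lemma neg_direction: "x \<in> \<Omega> ==> \<exists>b\<in>Basis. pd b (pd b u) x < 0"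
proof (rule ccontr)
 assume x: "x \<in> \<Omega>" and "\<not> (\<exists>b\<in>Basis. pd b (pd b u) x < 0)"
 then have "laplacian u x >= 0" unfolding laplacian_def by (intro sum_nonneg) auto
 then show False using pde[OF x] dim by simp
qed

end

section \<open>Line fields and the structure of the core\<close>

lemma norm_minus_projection:
 fixes v q :: "'a::real_inner"
 shows "norm (v-((v \<bullet> q)/(q \<bullet> q)) *R q) <= norm v"
proof (cases "q = 0")
 case False
 define c where "c = (v \<bullet> q)/(q \<bullet> q)"
 have c: "c*(q \<bullet> q) = v \<bullet> q" using False by (simp add: c_def)
 have "(norm (v-c *R q))^2 = v \<bullet> v-2*c*(v \<bullet> q)+c*(c*(q \<bullet> q))"
  unfolding power2_norm_eq_inner by (simp add: inner_simps inner_commute algebra_simps)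
 also have "... = v \<bullet> v-c*(c*(q \<bullet> q))" unfolding c by (simp add: algebra_simps)
 also have "... <= (norm v)^2" unfolding power2_norm_eq_inner by (simp add: mult.assoc[symmetric])
 finally show ?thesis unfolding c_def[symmetric] by (rule power2_le_imp_le) simp
qed simp

text \<open>The projections onto two nearby lines are close, irrespective of orientation.\<close>
lemma line_projection_close:
 fixes a e z :: "'a::real_inner"
 assumes a: "norm a = 1" and e: "norm e = 1" and d: "norm (a-(a \<bullet> e) *R e) <= \<epsilon>" "\<epsilon> <= 1"
 shows "norm ((z \<bullet> a) *R a-(z \<bullet> e) *R e) <= 4*\<epsilon>*norm z"
proof -
 define c where "c = a \<bullet> e"
 define w where "w = a-c *R e"
 have aw: "a = c *R e+w" by (simp add: w_def)
 have ee: "e \<bullet> e = 1" "a \<bullet> a = 1" using e a by (simp_all add: norm_eq_1)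
 have we: "e \<bullet> w = 0" unfolding w_def c_def using ee by (simp add: inner_simps inner_commute)
 have nw: "norm w <= \<epsilon>" using d by (simp add: w_def c_def)
 have \<epsilon>: "\<epsilon> >= 0" using nw norm_ge_zero order_trans by blast
 have c1: "\<bar>c\<bar> <= 1" unfolding c_def using Cauchy_Schwarz_ineq2[of a e] a e by simp
 \<comment> \<open>Pythagoras for a unit vector split along and across e: the defect of the cosine
   is quadratic in the deviation.\<close>
 have cc: "c^2-1 = - ((norm w)^2)"
 proof -
  have "1 = (c *R e+w) \<bullet> (c *R e+w)" using ee(2) unfolding aw[symmetric] by simp
  also have "... = c^2+w \<bullet> w" using we ee by (simp add: inner_simps inner_commute power2_eq_square)
  finally show ?thesis by (simp add: power2_norm_eq_inner)
 qed
 have "(z \<bullet> a) *R a-(z \<bullet> e) *R e = ((c^2-1)*(z \<bullet> e)) *R e+(c*(z \<bullet> e)) *R w+((z \<bullet> w)*c) *R e+(z \<bullet> w) *R w"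
  unfolding aw by (simp add: inner_simps algebra_simps power2_eq_square)
 also have "norm ... <= \<bar>(c^2-1)*(z \<bullet> e)\<bar>+\<bar>c*(z \<bullet> e)\<bar>*norm w+\<bar>(z \<bullet> w)*c\<bar>+\<bar>z \<bullet> w\<bar>*norm w"
  by (rule norm_triangle_le, rule add_mono, rule norm_triangle_le, rule add_mono, rule norm_triangle_le, rule add_mono)
   (simp_all add: e)
 also have "... <= \<epsilon>*norm z+\<epsilon>*norm z+\<epsilon>*norm z+\<epsilon>*norm z"
 proof (intro add_mono)
  have ze: "\<bar>z \<bullet> e\<bar> <= norm z" using Cauchy_Schwarz_ineq2[of z e] e by simp
  have zw: "\<bar>z \<bullet> w\<bar> <= norm z*\<epsilon>" using Cauchy_Schwarz_ineq2[of z w] mult_left_mono[OF nw, of "norm z"] by simp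
  have w1: "norm w <= 1" using nw d(2) by simp
  have "\<bar>c^2-1\<bar> <= \<epsilon>*1" unfolding cc using mult_mono[OF nw w1] \<epsilon> by (simp add: power2_eq_square)
  then show "\<bar>(c^2-1)*(z \<bullet> e)\<bar> <= \<epsilon>*norm z" unfolding abs_mult using ze \<epsilon> by (intro mult_mono) auto
  have "\<bar>c*(z \<bullet> e)\<bar> <= 1*norm z" unfolding abs_mult using c1 ze by (intro mult_mono) auto
  then have "\<bar>c*(z \<bullet> e)\<bar>*norm w <= norm z*\<epsilon>" using nw \<epsilon> by (intro mult_mono) auto
  then show "\<bar>c*(z \<bullet> e)\<bar>*norm w <= \<epsilon>*norm z" by (simp add: mult.commute)
  have "\<bar>(z \<bullet> w)*c\<bar> <= (norm z*\<epsilon>)*1" unfolding abs_mult using c1 zw \<epsilon> by (intro mult_mono) auto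
  then show "\<bar>(z \<bullet> w)*c\<bar> <= \<epsilon>*norm z" by (simp add: mult.commute)
  have "\<bar>z \<bullet> w\<bar>*norm w <= (norm z*\<epsilon>)*1" using zw w1 \<epsilon> by (intro mult_mono) auto
  then show "\<bar>z \<bullet> w\<bar>*norm w <= \<epsilon>*norm z" by (simp add: mult.commute)
 qed
 finally show ?thesis by simp
qed

text \<open>A continuous line field on a ball is oriented by transport along the rays from the centre.\<close>
lemma line_field_lift:
 fixes P :: "'a::euclidean_space => 'b::euclidean_space => 'b" and R :: real
 assumes R: "R > 0" and cont: "continuous_on (cball 0 R \<times> sphere 0 1) (%z. P (fst z) (snd z))"
  and proj: "!!x. x \<in> cball 0 R ==> \<exists>a. norm a = 1 & (\<forall>z. P x z = (z \<bullet> a) *R a)"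
 obtains v where "continuous_on (cball 0 R) v" "!!x. x \<in> cball 0 R ==> norm (v x) = 1"
  "!!x z. x \<in> cball 0 R ==> P x z = (z \<bullet> v x) *R v x"
proof -
 have "compact (cball (0::'a) R \<times> sphere (0::'b) 1)" by (intro compact_Times compact_cball compact_sphere)
 then have "uniformly_continuous_on (cball 0 R \<times> sphere 0 1) (%z. P (fst z) (snd z))"
  using compact_uniformly_continuous[OF cont] by blast
 then obtain \<delta> where \<delta>: "\<delta> > 0" "!!z z'. z \<in> cball 0 R \<times> sphere 0 1 ==> z' \<in> cball 0 R \<times> sphere 0 1 ==> dist z' z < \<delta> ==>
   dist (P (fst z') (snd z')) (P (fst z) (snd z)) < 1/2"
  unfolding uniformly_continuous_on_def by (metis zero_less_divide_1_iff zero_less_numeral)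
 obtain N0 :: nat where N0: "R/\<delta> < real N0" using reals_Archimedean2 by blast
 define N where "N = Suc N0"
 have N: "N > 0" "R/real N < \<delta>"
 proof -
  have "R < real N0*\<delta>" using N0 \<delta>(1) by (simp add: pos_divide_less_eq)
  also have "... <= real N*\<delta>" using \<delta>(1) by (simp add: N_def)
  finally show "R/real N < \<delta>" by (simp add: N_def pos_divide_less_eq mult.commute)
 qed (simp add: N_def)
 have "(0::'a) \<in> cball 0 R" using R by simp
 then obtain a0 where a0: "norm a0 = 1" "!!z. P 0 z = (z \<bullet> a0) *R a0" using proj by blast
 \<comment> \<open>Transport from the centre towards x in N steps: the current vector is projected
   to the line at the next point and normalised. The steps are so short that the projection moves it
   by less than 1/2 and never vanishes.\<close>
 define v where "v k x = rec_nat a0 (%k w. P ((real (Suc k)/real N) *R x) w /\<^sub>R norm (P ((real (Suc k)/real N) *R x) w)) k" for k x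
 have v0: "v 0 x = a0" and vS: "v (Suc k) x = P ((real (Suc k)/real N) *R x) (v k x) /\<^sub>R norm (P ((real (Suc k)/real N) *R x) (v k x))" for k x
  by (simp_all add: v_def)
 have sc: "(real k/real N) *R x \<in> cball 0 R" if "k <= N" "x \<in> cball 0 R" for k and x :: 'a
 proof -
  have "real k/real N*norm x <= 1 * R" using that N by (intro mult_mono) auto
  then show ?thesis by simp
 qed
 have main: "norm (v k x) = 1 & (\<forall>z. P ((real k/real N) *R x) z = (z \<bullet> v k x) *R v k x)" if x: "x \<in> cball 0 R" and k: "k <= N" for k x
  using k
 proof (induction k)
  case 0 then show ?case using a0 by (simp add: v0)
 next
  case (Suc k)
  let ?y = "(real k/real N) *R x" and ?y' = "(real (Suc k)/real N) *R x" and ?w = "v k x"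
  have IH: "norm ?w = 1" "!!z. P ?y z = (z \<bullet> ?w) *R ?w" using Suc by auto
  have y: "?y \<in> cball 0 R" "?y' \<in> cball 0 R" using sc[OF _ x, of k] sc[OF Suc.prems x] Suc.prems by auto
  have "?y'-?y = (1/real N) *R x" by (simp add: scaleR_diff_left[symmetric] diff_divide_distrib[symmetric])
  then have "dist ?y' ?y = norm x/real N" unfolding dist_norm by simp
  also have "... <= R/real N" using x N by (intro divide_right_mono) auto
  finally have "dist (?y', ?w) (?y, ?w) < \<delta>" using N by (simp add: dist_Pair_Pair)
  then have "dist (P ?y' ?w) (P ?y ?w) < 1/2" using \<delta>(2)[of "(?y, ?w)" "(?y', ?w)"] y IH(1) by simp
  moreover have "P ?y ?w = ?w" using IH by (simp add: norm_eq_1)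
  ultimately have "P ?y' ?w ~= 0" using IH(1) by auto
  obtain a where a: "norm a = 1" "!!z. P ?y' z = (z \<bullet> a) *R a" using proj[OF y(2)] by blast
  have wa: "?w \<bullet> a ~= 0" using \<open>P ?y' ?w ~= 0\<close> a by auto
  have vk: "v (Suc k) x = sgn (?w \<bullet> a) *R a" unfolding vS a(2) using a(1) wa by (simp add: sgn_real_def divide_inverse abs_if)
  show ?case unfolding vk a(2) using wa a(1) by (auto simp: sgn_real_def abs_if)
 qed
 have cv: "continuous_on (cball 0 R) (v k)" if "k <= N" for k
  using that
 proof (induction k)
  case 0 then show ?case by (simp add: v0)
 next
  case (Suc k)
  have c1: "continuous_on (cball 0 R) (%x. P ((real (Suc k)/real N) *R x) (v k x))"
  proof -
   have "continuous_on (cball 0 R) (%x. (%z. P (fst z) (snd z)) ((real (Suc k)/real N) *R x, v k x))"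
   proof (rule continuous_on_compose2[OF cont])
    show "continuous_on (cball 0 R) (%x. ((real (Suc k)/real N) *R x, v k x))"
     by (intro continuous_intros Suc.IH) (use Suc.prems in simp)
    show "(%x. ((real (Suc k)/real N) *R x, v k x)) ` cball 0 R \<subseteq> cball 0 R \<times> sphere 0 1"
    proof (rule image_subsetI)
     fix x :: 'a assume x: "x \<in> cball 0 R"
     show "((real (Suc k)/real N) *R x, v k x) \<in> cball 0 R \<times> sphere 0 1"
      using sc[OF Suc.prems x] main[OF x, of k] Suc.prems by simp
    qed
   qed
   then show ?thesis by simp
  qed
  have nz: "norm (P ((real (Suc k)/real N) *R x) (v k x)) ~= 0" if x: "x \<in> cball 0 R" for x
  proof
   assume "norm (P ((real (Suc k)/real N) *R x) (v k x)) = 0"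
   then have "v (Suc k) x = 0" unfolding vS norm_eq_zero by simp
   then show False using conjunct1[OF main[OF x Suc.prems]] by simp
  qed
  have "continuous_on (cball 0 R) (%x. P ((real (Suc k)/real N) *R x) (v k x) /\<^sub>R norm (P ((real (Suc k)/real N) *R x) (v k x)))"
   by (intro continuous_on_scaleR continuous_on_inverse continuous_on_norm c1) (use nz in blast)
  moreover have "v (Suc k) = (%x. P ((real (Suc k)/real N) *R x) (v k x) /\<^sub>R norm (P ((real (Suc k)/real N) *R x) (v k x)))"
   by (rule ext) (rule vS)
  ultimately show ?case by simp
 qed
 show ?thesis
 proof (rule that[of "v N"])
  show "continuous_on (cball 0 R) (v N)" by (rule cv) simp
  fix x :: 'a assume x: "x \<in> cball 0 R"
  show "norm (v N x) = 1" using main[OF x order.refl] by blast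
  show "P x z = (z \<bullet> v N x) *R v N x" for z using main[OF x order.refl] N(1) by simp
 qed
qed

context torsion
begin

text \<open>The part of the maximum set that is locally a full hypersurface: strictly concave along
  b, with the section where the b-derivative vanishes made up of maximum points only. The direction
  b may change from point to point.\<close>

definition E :: "'a set" where
 "E = {p \<in> MX. \<exists>b\<in>Basis. \<exists>r>0. ball p r \<subseteq> \<Omega> & (\<forall>x\<in>ball p r. pd b (pd b u) x < 0 & (pd b u x = 0 --> x \<in> MX))}"

lemma E_MX: "E \<subseteq> MX" by (auto simp: E_def)

lemma E_Omega: "E \<subseteq> \<Omega>" using E_MX MX_sub by blast

lemma E_open_in_MX:
 assumes "p \<in> MX" "b \<in> Basis" "r > 0" "ball p r \<subseteq> \<Omega>" "!!x. x \<in> ball p r ==> pd b (pd b u) x < 0 & (pd b u x = 0 --> x \<in> MX)"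
 shows "MX \<inter> ball p r \<subseteq> E"
proof
 fix q assume q: "q \<in> MX \<inter> ball p r"
 then obtain r' where r': "r' > 0" "ball q r' \<subseteq> ball p r" using open_contains_ball open_ball by blast
 then show "q \<in> E" unfolding E_def using q assms by blast
qed

lemma hess_cont: "continuous_on \<Omega> (%x. hess x h)"
proof -
 have "continuous_on \<Omega> (pd h (pd i u))" for i using pdC2[of 0] by simp
 then show ?thesis unfolding hess_def by (intro continuous_intros)
qed

text \<open>Near p every point x has a foot on the core at distance O(|grad u|) along the fixed
  direction b, and the gradient vanishes at the foot. Linearising at p shows both that the Hessian
  maps onto the line of its value at b, and that the gradient at x is nearly parallel to that line.
  Since C does not depend on the tolerance, the distance to the core is controlled linearly by the
  gradient.\<close>

lemma E_point:
 assumes p: "p \<in> E"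
 obtains \<nu> C where "norm \<nu> = 1" "!!h. hess p h = (- real DIM('a)*(\<nu> \<bullet> h)) *R \<nu>" "C > 0"
  "!!\<epsilon>. \<epsilon> > 0 ==> \<exists>r>0. ball p r \<subseteq> \<Omega> & (\<forall>x\<in>ball p r. infdist x E <= C*norm (grad u x) &
    norm (grad u x-(grad u x \<bullet> \<nu>) *R \<nu>) <= \<epsilon>*norm (grad u x))"
proof -
 have pM: "p \<in> MX" and pO: "p \<in> \<Omega>" using p E_MX E_Omega by auto
 obtain b rE where b: "b \<in> Basis" and rE: "rE > 0" "ball p rE \<subseteq> \<Omega>"
  "!!x. x \<in> ball p rE ==> pd b (pd b u) x < 0 & (pd b u x = 0 --> x \<in> MX)" using p unfolding E_def by blast
 have subE: "MX \<inter> ball p rE \<subseteq> E" by (rule E_open_in_MX[OF pM b rE])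
 have pp: "p \<in> ball p rE" using rE by simp
 define w where "w = pd b u"
 have w0: "w p = 0" unfolding w_def by (rule MX_pd[OF pM])
 have wb: "pd b w p < 0" using rE(3)[OF pp] by (simp add: w_def)
 have wC: "Ck_on 1 \<Omega> w" unfolding w_def by (rule pdC)
 obtain K where K: "K > 0" "\<forall>r'>0. \<exists>r>0. ball p r \<subseteq> ball p r' & (\<forall>x\<in>ball p r. \<exists>\<tau>. \<bar>\<tau>\<bar> <= K*\<bar>w x\<bar> & \<bar>\<tau>\<bar> <= r' & x+\<tau> *R b \<in> ball p r' & w (x+\<tau> *R b) = 0)"
  using foot_point[OF op wC pO w0] wb by (metis less_irrefl)
 have foot: "\<exists>r>0. ball p r \<subseteq> ball p r' & (\<forall>x\<in>ball p r. \<exists>\<tau>. \<bar>\<tau>\<bar> <= K*\<bar>w x\<bar> & x+\<tau> *R b \<in> ball p r' & x+\<tau> *R b \<in> E & grad u (x+\<tau> *R b) = 0)"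
  if r': "r' > 0" "r' <= rE" for r'
 proof -
  obtain r where r: "r > 0" "ball p r \<subseteq> ball p r'" "\<forall>x\<in>ball p r. \<exists>\<tau>. \<bar>\<tau>\<bar> <= K*\<bar>w x\<bar> & \<bar>\<tau>\<bar> <= r' & x+\<tau> *R b \<in> ball p r' & w (x+\<tau> *R b) = 0"
   using K(2) r'(1) by (elim allE impE exE conjE)
  have "\<exists>\<tau>. \<bar>\<tau>\<bar> <= K*\<bar>w x\<bar> & x+\<tau> *R b \<in> ball p r' & x+\<tau> *R b \<in> E & grad u (x+\<tau> *R b) = 0" if "x \<in> ball p r" for x
  proof -
   from bspec[OF r(3) that] obtain \<tau> where t: "\<bar>\<tau>\<bar> <= K*\<bar>w x\<bar>" "x+\<tau> *R b \<in> ball p r'" "w (x+\<tau> *R b) = 0" by (elim exE conjE)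
   have tE: "x+\<tau> *R b \<in> ball p rE" using t(2) r'(2) by simp
   then have "x+\<tau> *R b \<in> MX" using rE(3) t(3) by (simp add: w_def)
   then show ?thesis using t tE subE MX_grad by (intro exI[of _ \<tau>]) auto
  qed
  then show ?thesis using r(1,2) by blast
 qed
 define q where "q = hess p b"
 have qb: "q \<bullet> b < 0" using wb by (simp add: q_def w_def hess_inner[OF pO])
 then have q0: "q \<bullet> q > 0" by (auto simp: inner_gt_zero_iff)
 note lin = hess_linear[OF pO]
 obtain L rL where L: "L > 0" "rL > 0" "ball p rL \<subseteq> \<Omega>" "!!x y. x \<in> ball p rL ==> y \<in> ball p rL ==> \<bar>w x-w y\<bar> <= L*norm (x-y)"
  using C1_lipschitz[OF op wC pO] by metis
 \<comment> \<open>T is the part of hess p h orthogonal to q. The foot of p + t h differs from p by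
   t h + tau b, and the Hessian sends this to o(t); the term with b only adds a multiple of q, so T
   is smaller than every e.\<close>
 have span: "hess p h = ((hess p h \<bullet> q)/(q \<bullet> q)) *R q" for h
 proof -
  define T where "T = hess p h-((hess p h \<bullet> q)/(q \<bullet> q)) *R q"
  have "norm T <= 0+e" if e: "e > 0" for e
  proof -
   define Q where "Q = norm h+K*(L*norm h)+1"
   have Q: "Q > 0" using K L by (simp add: Q_def add_nonneg_pos)
   obtain r1 where r1: "r1 > 0" "ball p r1 \<subseteq> \<Omega>" "!!x y. x \<in> ball p r1 ==> y \<in> ball p r1 ==> norm (grad u x-grad u y-hess p (x-y)) <= e/Q*norm (x-y)"
    using grad_strict[OF pO, of "e/Q"] e Q by (metis divide_pos_pos)
   define r' where "r' = min rE (min r1 rL)"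
   have r': "r' > 0" "r' <= rE" "r' <= r1" "r' <= rL" using rE r1 L by (auto simp: r'_def)
   from foot[OF r'(1,2)] obtain r where r: "r > 0" "ball p r \<subseteq> ball p r'" "\<forall>x\<in>ball p r. \<exists>\<tau>. \<bar>\<tau>\<bar> <= K*\<bar>w x\<bar> & x+\<tau> *R b \<in> ball p r' & x+\<tau> *R b \<in> E & grad u (x+\<tau> *R b) = 0" by (elim exE conjE)
   define t where "t = r/(norm h+1)"
   have h1: "norm h+1 > 0" by (simp add: add_nonneg_pos)
   have t: "t > 0" "t*norm h < r" using r(1) h1 by (auto simp: t_def pos_divide_less_eq)
   define x where "x = p+t *R h"
   have xr: "x \<in> ball p r" using t by (simp add: x_def dist_norm)
   from bspec[OF r(3) xr] obtain \<tau> where \<tau>: "\<bar>\<tau>\<bar> <= K*\<bar>w x\<bar>" "x+\<tau> *R b \<in> ball p r'" "grad u (x+\<tau> *R b) = 0" by (elim exE conjE)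
   have "x \<in> ball p rL" "p \<in> ball p rL" using xr r(2) r' L by auto
   then have "\<bar>w x\<bar> <= L*(t*norm h)" using L(4)[of x p] w0 t by (simp add: x_def)
   then have "K*\<bar>w x\<bar> <= K*(L*(t*norm h))" using K by (intro mult_left_mono) auto
   then have \<tau>b: "\<bar>\<tau>\<bar> <= t*(K*(L*norm h))" using \<tau>(1) by (simp add: algebra_simps)
   have yp: "x+\<tau> *R b-p = t *R h+\<tau> *R b" by (simp add: x_def)
   have "norm (grad u (x+\<tau> *R b)-grad u p-hess p (x+\<tau> *R b-p)) <= e/Q*norm (x+\<tau> *R b-p)"
    by (rule r1(3)) (use \<tau>(2) r' r1 in auto)
   then have "norm (hess p (t *R h+\<tau> *R b)) <= e/Q*norm (t *R h+\<tau> *R b)"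
    unfolding yp by (simp add: \<tau>(3) MX_grad[OF pM])
   also have "... <= e/Q*(t*Q)"
   proof (rule mult_left_mono)
    show "norm (t *R h+\<tau> *R b) <= t*Q"
     using norm_triangle_ineq[of "t *R h" "\<tau> *R b"] t b \<tau>b by (simp add: Q_def algebra_simps)
   qed (use e Q in simp)
   finally have "norm (hess p (t *R h+\<tau> *R b)) <= e/Q*(t*Q)" .
   then have 1: "norm (hess p (t *R h+\<tau> *R b)) <= e*t" using Q by simp
   define v where "v = hess p h+(\<tau>/t) *R q"
   have "hess p (t *R h+\<tau> *R b) = t *R v"
    using t by (simp add: v_def linear_add[OF lin] linear_cmul[OF lin] q_def scaleR_add_right)
   with 1 t have v: "norm v <= e" by (simp add: mult.commute)
   have "T = v-((v \<bullet> q)/(q \<bullet> q)) *R q"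
    using q0 by (simp add: T_def v_def inner_simps add_divide_distrib algebra_simps)
   then show ?thesis using norm_minus_projection[of v q] v by simp
  qed
  then have "norm T <= 0" by (rule field_le_epsilon)
  then show ?thesis by (simp add: T_def)
 qed
 define \<mu> where "\<mu> = (hess p q \<bullet> q)/(q \<bullet> q)"
 have hq: "hess p h = (\<mu>*(q \<bullet> h)/(q \<bullet> q)) *R q" for h
 proof -
  have "hess p h \<bullet> q = hess p q \<bullet> h" by (rule hess_sym[OF pO])
  also have "hess p q = \<mu> *R q" unfolding \<mu>_def by (rule span)
  finally show ?thesis using span[of h] by simp
 qed
 \<comment> \<open>The Hessian is symmetric of rank one, and its only nonzero eigenvalue is the
   trace -n.\<close>
 have "- real DIM('a) = (\<Sum>i\<in>Basis. hess p i \<bullet> i)" by (rule hess_trace[OF pO, symmetric])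
 also have "... = (\<Sum>i\<in>Basis. \<mu>/(q \<bullet> q)*(q \<bullet> i)^2)" 
 proof (rule sum.cong[OF refl])
  show "hess p i \<bullet> i = \<mu>/(q \<bullet> q)*(q \<bullet> i)^2" for i unfolding hq[of i] by (simp add: power2_eq_square)
 qed
 also have "... = \<mu>" using q0 by (simp only: sum_distrib_left[symmetric] sum_Basis_inner_square) simp
 finally have \<mu>: "\<mu> = - real DIM('a)" by simp
 define \<nu> where "\<nu> = q /\<^sub>R norm q"
 have nq: "norm q > 0" using q0 by auto
 have \<nu>: "norm \<nu> = 1" using nq by (simp add: \<nu>_def)
 have h\<nu>: "hess p h = (- real DIM('a)*(\<nu> \<bullet> h)) *R \<nu>" for h
  unfolding hq[of h] \<mu> \<nu>_def by (simp add: power2_norm_eq_inner[symmetric] power2_eq_square divide_inverse)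
 show ?thesis
 proof (rule that[OF \<nu> h\<nu> K(1)])
  fix \<epsilon> :: real assume \<epsilon>: "\<epsilon> > 0"
  obtain r1 where r1: "r1 > 0" "ball p r1 \<subseteq> \<Omega>" "!!x y. x \<in> ball p r1 ==> y \<in> ball p r1 ==> norm (grad u x-grad u y-hess p (x-y)) <= \<epsilon>/K*norm (x-y)"
   using grad_strict[OF pO, of "\<epsilon>/K"] \<epsilon> K by (metis divide_pos_pos)
  define r' where "r' = min rE r1"
  have r': "r' > 0" "r' <= rE" "r' <= r1" using rE r1 by (auto simp: r'_def)
  from foot[OF r'(1,2)] obtain r where r: "r > 0" "ball p r \<subseteq> ball p r'" "\<forall>x\<in>ball p r. \<exists>\<tau>. \<bar>\<tau>\<bar> <= K*\<bar>w x\<bar> & x+\<tau> *R b \<in> ball p r' & x+\<tau> *R b \<in> E & grad u (x+\<tau> *R b) = 0" by (elim exE conjE)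
  have r1sub: "ball p r' \<subseteq> ball p r1" using r' by auto
  have "infdist x E <= K*norm (grad u x) & norm (grad u x-(grad u x \<bullet> \<nu>) *R \<nu>) <= \<epsilon>*norm (grad u x)" if x: "x \<in> ball p r" for x
  proof -
   from bspec[OF r(3) x] obtain \<tau> where \<tau>: "\<bar>\<tau>\<bar> <= K*\<bar>w x\<bar>" "x+\<tau> *R b \<in> ball p r'" "x+\<tau> *R b \<in> E" "grad u (x+\<tau> *R b) = 0" by (elim exE conjE)
   have "\<bar>w x\<bar> <= norm (grad u x)" unfolding w_def grad_Basis[OF b, symmetric] by (rule Basis_le_norm[OF b])
   then have "K*\<bar>w x\<bar> <= K*norm (grad u x)" using K by (intro mult_left_mono) auto
   then have \<tau>g: "\<bar>\<tau>\<bar> <= K*norm (grad u x)" using \<tau>(1) by simp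
   have "infdist x E <= dist x (x+\<tau> *R b)" by (rule infdist_le[OF \<tau>(3)])
   also have "... = \<bar>\<tau>\<bar>" using b by (simp add: dist_norm)
   finally have 1: "infdist x E <= K*norm (grad u x)" using \<tau>g by simp
   have d: "x-(x+\<tau> *R b) = (- \<tau>) *R b" by simp
   have "norm (grad u x-grad u (x+\<tau> *R b)-hess p (x-(x+\<tau> *R b))) <= \<epsilon>/K*norm (x-(x+\<tau> *R b))"
    by (rule r1(3)) (use x r(2) \<tau>(2) r1sub in blast)+
   then have "norm (grad u x-hess p ((- \<tau>) *R b)) <= \<epsilon>/K*\<bar>\<tau>\<bar>" unfolding d using b by (simp add: \<tau>(4))
   also have "... <= \<epsilon>/K*(K*norm (grad u x))" using \<tau>g \<epsilon> K by (intro mult_left_mono) auto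
   finally have 2: "norm (grad u x-hess p ((- \<tau>) *R b)) <= \<epsilon>*norm (grad u x)" using K by simp
   define c where "c = - real DIM('a)*(\<nu> \<bullet> ((- \<tau>) *R b))"
   define v where "v = grad u x-c *R \<nu>"
   have \<nu>1: "\<nu> \<bullet> \<nu> = 1" using \<nu> by (simp add: norm_eq_1)
   have "grad u x-(grad u x \<bullet> \<nu>) *R \<nu> = v-((v \<bullet> \<nu>)/(\<nu> \<bullet> \<nu>)) *R \<nu>"
    by (simp add: v_def inner_simps \<nu>1 algebra_simps)
   then have "norm (grad u x-(grad u x \<bullet> \<nu>) *R \<nu>) <= norm v" using norm_minus_projection[of v \<nu>] by simp
   also have "norm v <= \<epsilon>*norm (grad u x)" using 2 unfolding h\<nu>[of "(- \<tau>) *R b"] v_def c_def .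
   finally show ?thesis using 1 by blast
  qed
  moreover have "ball p r \<subseteq> \<Omega>" using r(2) r1sub r1(2) by blast
  ultimately show "\<exists>r>0. ball p r \<subseteq> \<Omega> & (\<forall>x\<in>ball p r. infdist x E <= K*norm (grad u x) &
    norm (grad u x-(grad u x \<bullet> \<nu>) *R \<nu>) <= \<epsilon>*norm (grad u x))"
   using r(1) by blast
 qed
qed

lemma full_imp_E:
 assumes p: "p \<in> MX" and b: "b \<in> Basis" "pd b (pd b u) p < 0" and r: "r > 0"
  and full: "!!y. y \<in> ball p r ==> pd b u y = 0 ==> y \<in> \<Omega> & u y = M"
 shows "p \<in> E"
proof -
 have pO: "p \<in> \<Omega>" using p MX_sub by blast
 have "continuous_on \<Omega> (pd b (pd b u))" using pdC2[of 0] by simp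
 then have "isCont (pd b (pd b u)) p" using pO op continuous_on_eq_continuous_at by blast
 then have "\<forall>\<^sub>F x in at p. pd b (pd b u) x < 0" using b(2) order_tendstoD(2) by (auto simp: isCont_def)
 then obtain r1 where r1: "r1 > 0" "!!x. x ~= p ==> dist x p < r1 ==> pd b (pd b u) x < 0" unfolding eventually_at by blast
 have neg: "pd b (pd b u) x < 0" if "x \<in> ball p r1" for x using r1(2)[of x] b(2) that by (cases "x = p") (auto simp: dist_commute)
 obtain r2 where r2: "r2 > 0" "ball p r2 \<subseteq> \<Omega>" using op pO open_contains_ball by blast
 define s where "s = min r (min r1 r2)"
 have s: "s > 0" "ball p s \<subseteq> ball p r" "ball p s \<subseteq> ball p r1" "ball p s \<subseteq> ball p r2" using r r1 r2 by (auto simp: s_def)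
 have "pd b (pd b u) x < 0 & (pd b u x = 0 --> x \<in> MX)" if "x \<in> ball p s" for x
  using neg full that s by (auto simp: MAXset_def subset_iff)
 then show ?thesis unfolding E_def using p b(1) s r2(2) by blast
qed

text \<open>At a point around which the maximum set is nowhere null, the cylinder over a small piece
  cannot be negligible, because packing would make the piece null. The dichotomy then fills the
  whole section with maximum points.\<close>

lemma E_nonempty:
 assumes h: "hausdorff_measure (real DIM('a)-1) MX > 0"
 shows "E ~= {}"
proof -
 obtain p where p: "p \<in> MX" "!!r. r > 0 ==> \<not> ball_null (DIM('a)-1) (MX \<inter> cball p r)"
  using hausdorff_pos_point[OF _ MX_compact h] dim by auto
 have pO: "p \<in> \<Omega>" using p MX_sub by blast
 obtain b where b: "b \<in> Basis" "pd b (pd b u) p < 0" using neg_direction[OF pO] by blast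
 have nb: "norm b = 1" using b by simp
 obtain r L where r: "r > 0" "L > 0" "ball p r \<subseteq> \<Omega>"
  "!!c Z y. compact Z ==> Z \<subseteq> {z \<in> ball p r. pd b u z = 0 & u z = c} ==>
    \<not> negligible ((%(z, s). z+s *R b) ` (Z \<times> {-r..r})) ==> y \<in> ball p r ==> pd b u y = 0 ==> u y = c"
  "!!z z' s. z \<in> ball p r ==> z' \<in> ball p r ==> pd b u z = 0 ==> pd b u z' = 0 ==> \<bar>s\<bar> <= 2*r ==>
    norm (z-z') <= L*norm (z'-z-s *R b)"
  by (rule section_dichotomy[OF dim op C2 pde pO nb MX_pd[OF p(1)] b(2)]) (assumption, rule that, assumption+)
 define Z where "Z = MX \<inter> cball p (r/2)"
 have Z: "compact Z" unfolding Z_def using MX_compact by (intro compact_Int) auto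
 have Zs: "z \<in> ball p r" "pd b u z = 0" "u z = M" if "z \<in> Z" for z
  using that r(1) MX_pd by (auto simp: Z_def MAXset_def)
 have "\<not> negligible ((%(z, s). z+s *R b) ` (Z \<times> {-r..r}))"
 proof
  assume neg: "negligible ((%(z, s). z+s *R b) ` (Z \<times> {-r..r}))"
  have "ball_null (DIM('a)-1) Z"
   by (rule cylinder_negligible_imp_ball_null[OF _ b(1) Z r(1,2) _ neg]) (use dim r(5) Zs in auto)
  then show False using p(2)[of "r/2"] r(1) by (simp add: Z_def)
 qed
 from r(4)[OF Z _ this, of M] have "u y = M" if "y \<in> ball p r" "pd b u y = 0" for y
  using Zs that by blast
 then have "p \<in> E" using r(3) by (intro full_imp_E[OF p(1) b r(1)]) auto
 then show ?thesis by blast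
qed

text \<open>A limit p of points of the core is a maximum point with its own concave direction b. A
  nearby q in the core carries a full hypersurface, whose cylinder along b contains a ball; the
  dichotomy at p spreads the maximum over the section through p.\<close>

lemma E_compact: "compact E"
proof -
 have "closed E"
  unfolding closed_limpt
 proof (intro allI impI)
  fix p assume lim: "p islimpt E"
  have "p islimpt MX" using islimpt_subset[OF lim E_MX] .
  then have p: "p \<in> MX" using compact_imp_closed[OF MX_compact] closed_limpt by blast
  then have pO: "p \<in> \<Omega>" using MX_sub by blast
  obtain b where b: "b \<in> Basis" "pd b (pd b u) p < 0" using neg_direction[OF pO] by blast
  have nb: "norm b = 1" using b by simp
  obtain r L where r: "r > 0" "L > 0" "ball p r \<subseteq> \<Omega>"
   "!!c Z y. compact Z ==> Z \<subseteq> {z \<in> ball p r. pd b u z = 0 & u z = c} ==>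
     \<not> negligible ((%(z, s). z+s *R b) ` (Z \<times> {-r..r})) ==> y \<in> ball p r ==> pd b u y = 0 ==> u y = c"
   "!!z z' s. z \<in> ball p r ==> z' \<in> ball p r ==> pd b u z = 0 ==> pd b u z' = 0 ==> \<bar>s\<bar> <= 2*r ==>
     norm (z-z') <= L*norm (z'-z-s *R b)"
   by (rule section_dichotomy[OF dim op C2 pde pO nb MX_pd[OF p] b(2)]) (assumption, rule that, assumption+)
  have "continuous_on \<Omega> (pd b (pd b u))" using pdC2[of 0] by simp
  then have "isCont (pd b (pd b u)) p" using pO op continuous_on_eq_continuous_at by blast
  then have "\<forall>\<^sub>F x in at p. pd b (pd b u) x < 0" using b(2) order_tendstoD(2) by (auto simp: isCont_def)
  then obtain r1 where r1: "r1 > 0" "!!x. x ~= p ==> dist x p < r1 ==> pd b (pd b u) x < 0" unfolding eventually_at by blast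
  obtain q where q: "q \<in> E" "q ~= p" "dist q p < min r r1" using lim r(1) r1(1) unfolding islimpt_approachable by (metis min_less_iff_conj)
  have qb: "pd b (pd b u) q < 0" using r1(2) q by simp
  have qM: "q \<in> MX" and qO: "q \<in> \<Omega>" using q(1) E_MX E_Omega by auto
  obtain c rq where c: "c \<in> Basis" and rq: "rq > 0" "ball q rq \<subseteq> \<Omega>"
   "!!x. x \<in> ball q rq ==> pd c (pd c u) x < 0 & (pd c u x = 0 --> x \<in> MX)" using q(1) unfolding E_def by blast
  obtain \<nu> where \<nu>: "!!h. hess q h = (- real DIM('a)*(\<nu> \<bullet> h)) *R \<nu>" using E_point[OF q(1)] by metis
  \<comment> \<open>The Hessian at q has rank one and is negative along both b and c, so neither
    direction is tangent to the core and the mixed derivative does not vanish. Hence lines along b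
    cross the section for c.\<close>
  have "hess q b \<bullet> b ~= 0" "hess q c \<bullet> c ~= 0" using qb rq(3)[of q] rq(1) by (simp_all add: hess_inner[OF qO])
  then have "hess q b \<bullet> c ~= 0" unfolding \<nu> by auto
  then have bc: "pd b (pd c u) q ~= 0" by (simp add: hess_inner[OF qO])
  have "q \<in> ball p r" using q(3) by (simp add: dist_commute)
  then obtain r2 where r2: "r2 > 0" "ball q r2 \<subseteq> ball p r" using open_contains_ball open_ball by blast
  define r3 where "r3 = min (min rq r2) r/2"
  have r3: "r3 > 0" "r3 < rq" "r3 < r2" "r3 <= r" using rq r2 r(1) by (auto simp: r3_def)
  obtain K where K: "K > 0" "\<forall>r'>0. \<exists>r>0. ball q r \<subseteq> ball q r' & (\<forall>x\<in>ball q r. \<exists>\<tau>. \<bar>\<tau>\<bar> <= K*\<bar>pd c u x\<bar> & \<bar>\<tau>\<bar> <= r' & x+\<tau> *R b \<in> ball q r' & pd c u (x+\<tau> *R b) = 0)"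
   using foot_point[OF op pdC qO MX_pd[OF qM] bc] by (elim exE conjE)
  from K(2) r3(1) obtain r4 where r4: "r4 > 0" "ball q r4 \<subseteq> ball q r3" "\<forall>x\<in>ball q r4. \<exists>\<tau>. \<bar>\<tau>\<bar> <= K*\<bar>pd c u x\<bar> & \<bar>\<tau>\<bar> <= r3 & x+\<tau> *R b \<in> ball q r3 & pd c u (x+\<tau> *R b) = 0"
   by (elim allE impE exE conjE)
  define Z where "Z = MX \<inter> cball q r3"
  have Z: "compact Z" unfolding Z_def using MX_compact by (intro compact_Int) auto
  have Zs: "Z \<subseteq> {z \<in> ball p r. pd b u z = 0 & u z = M}"
  proof
   fix z assume z: "z \<in> Z"
   then have "z \<in> ball q r2" using r3 by (auto simp: Z_def)
   then show "z \<in> {z \<in> ball p r. pd b u z = 0 & u z = M}" using z r2 MX_pd by (auto simp: Z_def MAXset_def)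
  qed
  have "ball q r4 \<subseteq> (%(z, s). z+s *R b) ` (Z \<times> {-r..r})"
  proof
   fix x assume "x \<in> ball q r4"
   from bspec[OF r4(3) this] obtain \<tau> where \<tau>: "\<bar>\<tau>\<bar> <= r3" "x+\<tau> *R b \<in> ball q r3" "pd c u (x+\<tau> *R b) = 0" by (elim exE conjE)
   have "x+\<tau> *R b \<in> ball q rq" using \<tau>(2) r3 by simp
   then have "x+\<tau> *R b \<in> Z" using rq(3) \<tau> by (simp add: Z_def)
   moreover have "- \<tau> \<in> {-r..r}" using \<tau>(1) r3 by (simp add: abs_le_iff)
   moreover have "x = (%(z, s). z+s *R b) (x+\<tau> *R b, - \<tau>)" by simp
   ultimately show "x \<in> (%(z, s). z+s *R b) ` (Z \<times> {-r..r})" by blast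
  qed
  moreover have "\<not> negligible (ball q r4)" using r4(1) open_not_negligible[of "ball q r4"] by simp
  ultimately have nn: "\<not> negligible ((%(z, s). z+s *R b) ` (Z \<times> {-r..r}))" using negligible_subset by blast
  have "u y = M" if "y \<in> ball p r" "pd b u y = 0" for y by (rule r(4)[OF Z Zs nn that])
  then show "p \<in> E" using r(3) by (intro full_imp_E[OF p b r(1)]) auto
 qed
 moreover have "bounded E" using E_Omega bdd bounded_subset by blast
 ultimately show ?thesis by (simp add: compact_eq_bounded_closed)
qed

text \<open>The sign function is the last component of an orientation of the line field spanned by
 $(\nabla u, d(\cdot,E)^2)$, which extends continuously over $E$ by the normal direction.\<close>
lemma separation:
 assumes En: "E ~= {}" and R: "R > 0" "closure \<Omega> \<subseteq> ball 0 R"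
 obtains \<sigma> :: "'a => real" where "continuous_on (cball 0 R) \<sigma>" "!!x. x \<in> cball 0 R ==> \<sigma> x = 0 \<longleftrightarrow> x \<in> E"
  "!!p. p \<in> E ==> \<exists>\<nu>. norm \<nu> = 1 & (\<forall>h. hess p h = (- real DIM('a)*(\<nu> \<bullet> h)) *R \<nu>) &
    (\<exists>s0>0. \<forall>s. 0 < s & s < s0 --> \<sigma> (p+s *R \<nu>) < 0 & 0 < \<sigma> (p-s *R \<nu>))"
proof -
 define n where "n = real DIM('a)"
 have n: "n > 0" by (simp add: n_def)
 obtain \<eta>0 where \<eta>0: "\<eta>0 > 0" "(\<Union>x\<in>E. ball x \<eta>0) \<subseteq> \<Omega>"
  using compact_subset_open_imp_ball_epsilon_subset[OF E_compact op E_Omega] by blast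
 define \<eta> where "\<eta> = \<eta>0/2"
 have \<eta>: "\<eta> > 0" using \<eta>0 by (simp add: \<eta>_def)
 have nbhd: "x \<in> \<Omega>" if "infdist x E <= \<eta>" for x
 proof -
  obtain y where "y \<in> E" "infdist x E = dist x y" using infdist_attains_inf[OF compact_imp_closed[OF E_compact] En] by blast
  then have "dist y x < \<eta>0" using that \<eta>0(1) by (simp add: \<eta>_def dist_commute)
  then have "x \<in> (\<Union>x\<in>E. ball x \<eta>0)" using \<open>y \<in> E\<close> by auto
  then show ?thesis by (rule subsetD[OF \<eta>0(2)])
 qed
 have id0: "infdist x E = 0 \<longleftrightarrow> x \<in> E" for x
  using in_closed_iff_infdist_zero[OF compact_imp_closed[OF E_compact] En] by blast
 define f where "f x = max 0 (1-infdist x E/\<eta>)" for x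
 have fc: "continuous_on X f" for X unfolding f_def by (intro continuous_intros) (use \<eta> in auto)
 have f0: "f x >= 0" for x by (simp add: f_def)
 \<comment> \<open>The gradient is faded out near the core's neighbourhood boundary and extended by
   zero, so that the line field is defined on a ball containing the domain and not only on the
   domain, whose topology could obstruct an orientation.\<close>
 define G where "G x = (if x \<in> \<Omega> then f x *R grad u x else 0)" for x
 have Gc: "continuous_on UNIV G"
 proof -
  have 1: "continuous_on \<Omega> G"
  proof (rule continuous_on_eq)
   show "continuous_on \<Omega> (%x. f x *R grad u x)" by (intro continuous_intros fc grad_cont)
  qed (simp add: G_def)
  have o: "open {x. \<eta> < infdist x E}" by (intro open_Collect_less continuous_intros)
  have 2: "continuous_on {x. \<eta> < infdist x E} G"
  proof (rule continuous_on_eq)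
   show "continuous_on {x. \<eta> < infdist x E} (%x. 0::'a)" by simp
   show "0 = G x" if "x \<in> {x. \<eta> < infdist x E}" for x
    using that \<eta> by (simp add: G_def f_def max_def divide_le_eq)
  qed
  have "\<Omega> \<union> {x. \<eta> < infdist x E} = UNIV" using nbhd by force
  then show ?thesis using continuous_on_open_Un[OF op o 1 2] by simp
 qed
 \<comment> \<open>The square matters: the gradient is bounded below by a multiple of the distance
   to the core, so this component is negligible against it there and the lines tend to the
   horizontal normal. Off the core it is positive, so the field never vanishes.\<close>
 define \<zeta> where "\<zeta> x = (infdist x E)^2" for x
 have \<zeta>0: "\<zeta> x = 0 \<longleftrightarrow> x \<in> E" "\<zeta> x >= 0" for x by (simp_all add: \<zeta>_def id0)
 define A where "A x = (G x, \<zeta> x)" for x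
 have Ac: "continuous_on UNIV A" unfolding A_def \<zeta>_def by (intro continuous_intros Gc)
 have A0: "A x ~= 0" if "x \<notin> E" for x using that \<zeta>0(1)[of x] by (simp add: A_def zero_prod_def)
 \<comment> \<open>Projection onto the line, a quantity that needs no orientation. On the core it is
   minus the Hessian over n, the projection to the normal.\<close>
 define P where "P x z = (if x \<in> E then ((-1/n) *R hess x (fst z), 0) else ((z \<bullet> A x)/(A x \<bullet> A x)) *R A x)" for x :: 'a and z :: "'a \<times> real"
 have projE: "\<exists>\<nu>. norm \<nu> = 1 & (\<forall>h. hess x h = (- n*(\<nu> \<bullet> h)) *R \<nu>) & (\<forall>z. P x z = (z \<bullet> (\<nu>, 0)) *R (\<nu>, 0))" if x: "x \<in> E" for x
 proof -
  obtain \<nu> where \<nu>: "norm \<nu> = 1" "!!h. hess x h = (- real DIM('a)*(\<nu> \<bullet> h)) *R \<nu>" using E_point[OF x] by metis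
  have "P x z = (z \<bullet> (\<nu>, 0)) *R (\<nu>, 0)" for z
   unfolding P_def using x n by (simp add: \<nu>(2) n_def[symmetric] inner_prod_def inner_commute)
  then show ?thesis using \<nu> by (auto simp: n_def)
 qed
 have proj: "\<exists>a. norm a = 1 & (\<forall>z. P x z = (z \<bullet> a) *R a)" for x
 proof (cases "x \<in> E")
  case True
  from projE[OF this] obtain \<nu> where "norm \<nu> = 1" "\<forall>z. P x z = (z \<bullet> (\<nu>, 0)) *R (\<nu>, 0)" by blast
  then show ?thesis by (intro exI[of _ "(\<nu>, 0)"]) (simp add: norm_prod_def)
 next
  case False
  have nA: "norm (A x) > 0" using A0[OF False] by simp
  have "P x z = (z \<bullet> (A x /\<^sub>R norm (A x))) *R (A x /\<^sub>R norm (A x))" for z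
   using False nA by (simp add: P_def power2_norm_eq_inner[symmetric] power2_eq_square divide_inverse)
  then show ?thesis using nA by (intro exI[of _ "A x /\<^sub>R norm (A x)"]) simp
 qed
 have Pdiff: "norm (P x z-P x z0) <= norm (z-z0)" for x z z0
 proof -
  obtain a where a: "norm a = 1" "!!z. P x z = (z \<bullet> a) *R a" using proj[of x] by blast
  have "P x z-P x z0 = ((z-z0) \<bullet> a) *R a" by (simp add: a inner_diff_left scaleR_diff_left)
  then show ?thesis using Cauchy_Schwarz_ineq2[of "z-z0" a] a(1) by simp
 qed
 have closeE: "\<exists>r>0. \<forall>x\<in>ball p r. \<forall>z. norm z = 1 --> norm (P x z-P p z) <= e" if p: "p \<in> E" and e: "e > 0" "e <= 1" for p e
 proof -
  have pO: "p \<in> \<Omega>" using p E_Omega by blast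
  obtain \<nu> C where \<nu>: "norm \<nu> = 1" "!!h. hess p h = (- real DIM('a)*(\<nu> \<bullet> h)) *R \<nu>" and C: "C > 0"
   "!!\<epsilon>. \<epsilon> > 0 ==> \<exists>r>0. ball p r \<subseteq> \<Omega> & (\<forall>x\<in>ball p r. infdist x E <= C*norm (grad u x) &
    norm (grad u x-(grad u x \<bullet> \<nu>) *R \<nu>) <= \<epsilon>*norm (grad u x))"
   by (rule E_point[OF p]) (rule that, assumption+)
  have Pp: "P p z = (z \<bullet> (\<nu>, 0)) *R (\<nu>, 0)" for z
   unfolding P_def using p n by (simp add: \<nu>(2) n_def[symmetric] inner_prod_def inner_commute)
  have "e/8 > 0" using e by simp
  from C(2)[OF this] obtain r1 where r1: "r1 > 0" "ball p r1 \<subseteq> \<Omega>"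
   "!!x. x \<in> ball p r1 ==> infdist x E <= C*norm (grad u x) & norm (grad u x-(grad u x \<bullet> \<nu>) *R \<nu>) <= e/8*norm (grad u x)" by blast
  define B where "B x = (\<Sum>j\<in>Basis. norm (hess x j-hess p j))" for x
  have "continuous_on \<Omega> B" unfolding B_def by (intro continuous_intros hess_cont)
  then have "isCont B p" using pO op continuous_on_eq_continuous_at by blast
  then obtain r2 where r2: "r2 > 0" "!!x. dist x p < r2 ==> dist (B x) (B p) < e" unfolding continuous_at_eps_delta using e by metis
  \<comment> \<open>The last entry gives infdist^2 <= (e/8)(f x |grad u|), using f x >= 1/2 within
    half the cutoff distance. Together with the tilt e/8 of the gradient the line deviates by at
    most e/4, as required by the factor 4 of the projection estimate.\<close>
  define r where "r = Min {r1, r2, \<eta>/2, e/(16*C)}"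
  have r: "r > 0" "r <= r1" "r <= r2" "r <= \<eta>/2" "r <= e/(16*C)" using r1 r2 \<eta> e C by (auto simp: r_def)
  have "norm (P x z-P p z) <= e" if x: "x \<in> ball p r" and z: "norm z = 1" for x z
  proof (cases "x \<in> E")
   case True
   have nz: "norm (fst z) <= 1" using z norm_fst_le[of "fst z" "snd z"] by simp
   have xO: "x \<in> \<Omega>" using True E_Omega by blast
   note l = hess_linear[OF xO] hess_linear[OF pO]
   have rep: "hess y h = (\<Sum>j\<in>Basis. (h \<bullet> j) *R hess y j)" if "linear (hess y)" for y h
   proof -
    have "hess y h = hess y (\<Sum>j\<in>Basis. (h \<bullet> j) *R j)" by (simp add: euclidean_representation)
    then show ?thesis by (simp add: linear_sum[OF that] linear_cmul[OF that])
   qed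
   have "norm (hess x (fst z)-hess p (fst z)) = norm (\<Sum>j\<in>Basis. (fst z \<bullet> j) *R (hess x j-hess p j))"
    by (subst rep[OF l(1)], subst rep[OF l(2)]) (simp add: sum_subtractf scaleR_diff_right)
   also have "... <= (\<Sum>j\<in>(Basis::'a set). 1*norm (hess x j-hess p j))"
   proof (rule order_trans[OF norm_sum sum_mono])
    fix j :: 'a assume "j \<in> Basis"
    then have "\<bar>fst z \<bullet> j\<bar> <= 1" using Basis_le_norm[of j "fst z"] nz by simp
    then show "norm ((fst z \<bullet> j) *R (hess x j-hess p j)) <= 1*norm (hess x j-hess p j)"
     unfolding norm_scaleR by (rule mult_right_mono) simp
   qed
   also have "... = B x" by (simp add: B_def)
   also have "... <= e" using r2(2)[of x] x r by (simp add: dist_commute B_def dist_real_def)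
   finally have h: "norm (hess x (fst z)-hess p (fst z)) <= e" .
   have "P x z-P p z = ((-1/n) *R (hess x (fst z)-hess p (fst z)), 0)"
    using True p by (simp add: P_def scaleR_diff_right)
   then have "norm (P x z-P p z) = norm (hess x (fst z)-hess p (fst z))/n" using n by (simp add: norm_prod_def)
   also have "... <= norm (hess x (fst z)-hess p (fst z))/1" using dim by (intro divide_left_mono) (auto simp: n_def)
   finally show ?thesis using h by simp
  next
   case False
   have xr: "x \<in> ball p r1" using x r by simp
   have xO: "x \<in> \<Omega>" using xr r1(2) by blast
   define g where "g = grad u x"
   have g: "infdist x E <= C*norm g" "norm (g-(g \<bullet> \<nu>) *R \<nu>) <= e/8*norm g" using r1(3)[OF xr] by (auto simp: g_def)
   have id: "infdist x E < r" using infdist_le[OF p, of x] x by (simp add: dist_commute)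
   have fh: "f x >= 1/2"
   proof -
    have "infdist x E <= \<eta>/2" using id r by simp
    then have "infdist x E/\<eta> <= 1/2" using \<eta> by (simp add: divide_le_eq)
    then show ?thesis unfolding f_def by linarith
   qed
   have Ax: "A x = (f x *R g, \<zeta> x)" using xO by (simp add: A_def G_def g_def)
   have nA: "f x*norm g <= norm (A x)" using norm_fst_le[of "f x *R g" "\<zeta> x"] f0[of x] by (simp add: Ax)
   have nA0: "norm (A x) > 0" using A0[OF False] by simp
   have "\<zeta> x <= r*(C*norm g)"
    unfolding \<zeta>_def power2_eq_square using id g(1) infdist_nonneg[of x E] by (intro mult_mono) auto
   also have "... <= e/(16*C)*(C*norm g)" using r C by (intro mult_right_mono) auto
   also have "... = e/8*(1/2*norm g)" using C by simp
   also have "... <= e/8*(f x*norm g)" using fh e by (intro mult_left_mono mult_right_mono) auto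
   finally have \<zeta>: "\<zeta> x <= e/8*(f x*norm g)" .
   define a where "a = A x /\<^sub>R norm (A x)"
   have a1: "norm a = 1" using nA0 by (simp add: a_def)
   define e0 where "e0 = (\<nu>, 0::real)"
   have e01: "norm e0 = 1" using \<nu>(1) by (simp add: e0_def norm_prod_def)
   have "A x-(A x \<bullet> e0) *R e0 = (f x *R (g-(g \<bullet> \<nu>) *R \<nu>), \<zeta> x)"
    by (simp add: Ax e0_def scaleR_diff_right)
   also have "norm ... <= norm (f x *R (g-(g \<bullet> \<nu>) *R \<nu>))+norm (\<zeta> x)" by (rule norm_Pair_le)
   also have "norm (f x *R (g-(g \<bullet> \<nu>) *R \<nu>)) = f x*norm (g-(g \<bullet> \<nu>) *R \<nu>)"
    using f0[of x] by simp
   also have "... <= f x*(e/8*norm g)" by (rule mult_left_mono[OF g(2) f0])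
   finally have "norm (A x-(A x \<bullet> e0) *R e0) <= f x*(e/8*norm g)+norm (\<zeta> x)" by simp
   also have "... <= f x*(e/8*norm g)+e/8*(f x*norm g)" using \<zeta> \<zeta>0(2)[of x] by (intro add_left_mono) simp
   also have "... = e/4*(f x*norm g)" by (simp add: field_simps)
   also have "... <= e/4*norm (A x)" using nA e by (intro mult_left_mono) auto
   finally have dA: "norm (A x-(A x \<bullet> e0) *R e0) <= e/4*norm (A x)" .
   have "a-(a \<bullet> e0) *R e0 = (A x-(A x \<bullet> e0) *R e0) /\<^sub>R norm (A x)"
    by (simp add: a_def scaleR_diff_right)
   then have "norm (a-(a \<bullet> e0) *R e0) = norm (A x-(A x \<bullet> e0) *R e0)/norm (A x)"
    using nA0 by (simp add: divide_inverse mult.commute)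
   also have "... <= e/4" using dA nA0 by (simp add: pos_divide_le_eq)
   finally have "norm ((z \<bullet> a) *R a-(z \<bullet> e0) *R e0) <= 4*(e/4)*norm z"
    using e by (intro line_projection_close[OF a1 e01]) auto
   moreover have "P x z = (z \<bullet> a) *R a"
    using False nA0 by (simp add: P_def a_def power2_norm_eq_inner[symmetric] power2_eq_square divide_inverse)
   ultimately show ?thesis using z by (simp add: Pp e0_def)
  qed
  then show ?thesis using r(1) by blast
 qed
 have close: "\<exists>r>0. \<forall>x\<in>ball p r. \<forall>z. norm z = 1 --> norm (P x z-P p z) <= e" if e: "e > 0" for p e
 proof (cases "p \<in> E")
  case True
  have "min e 1 > 0" "min e 1 <= 1" using e by auto
  from closeE[OF True this] show ?thesis by (meson min.bounded_iff)
 next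
  case False
  have oE: "open (- E)" using compact_imp_closed[OF E_compact] by (simp add: open_Compl)
  define a where "a x = A x /\<^sub>R norm (A x)" for x
  have "continuous_on (- E) a" unfolding a_def
   by (intro continuous_intros continuous_on_subset[OF Ac]) (use A0 in auto)
  then have "isCont a p" using False oE continuous_on_eq_continuous_at by blast
  moreover have "e/2 > 0" using e by simp
  ultimately obtain r1 where r1: "r1 > 0" "!!x. dist x p < r1 ==> dist (a x) (a p) < e/2" unfolding continuous_at_eps_delta by metis
  obtain r2 where r2: "r2 > 0" "ball p r2 \<subseteq>-E" using oE False open_contains_ball by blast
  have Pa: "P x z = (z \<bullet> a x) *R a x" and na: "norm (a x) = 1" if "x \<notin> E" for x z
   using A0[OF that] that by (simp_all add: P_def a_def power2_norm_eq_inner[symmetric] power2_eq_square divide_inverse)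
  have "norm (P x z-P p z) <= e" if x: "x \<in> ball p (min r1 r2)" and z: "norm z = 1" for x z
  proof -
   have xE: "x \<notin> E" using x r2 by auto
   have d: "norm (a x-a p) < e/2" using r1(2)[of x] x by (simp add: dist_norm norm_minus_commute)
   have "P x z-P p z = (z \<bullet> (a x-a p)) *R a x+(z \<bullet> a p) *R (a x-a p)"
    by (simp add: Pa xE False inner_diff_right algebra_simps)
   also have "norm ... <= \<bar>z \<bullet> (a x-a p)\<bar>*norm (a x)+\<bar>z \<bullet> a p\<bar>*norm (a x-a p)"
    by (rule norm_triangle_le) simp
   also have "... <= e/2*1+1*(e/2)"
   proof (intro add_mono mult_mono)
    show "\<bar>z \<bullet> (a x-a p)\<bar> <= e/2" using Cauchy_Schwarz_ineq2[of z "a x-a p"] z d by simp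
    show "\<bar>z \<bullet> a p\<bar> <= 1" using Cauchy_Schwarz_ineq2[of z "a p"] z na[OF False] by simp
   qed (use na[OF xE] d e in auto)
   finally show ?thesis by simp
  qed
  then show ?thesis using r1(1) r2(1) by (intro exI[of _ "min r1 r2"]) auto
 qed
 have "continuous_on (cball 0 R \<times> sphere 0 1) (%z. P (fst z) (snd z))"
  unfolding continuous_on_iff
 proof (intro ballI allI impI)
  fix y :: "'a \<times> ('a \<times> real)" and e :: real
  assume y: "y \<in> cball 0 R \<times> sphere 0 1" and e: "0 < e"
  have "e/2 > 0" using e by simp
  from close[OF this] obtain r where r: "r > 0" "!!x z. x \<in> ball (fst y) r ==> norm z = 1 ==> norm (P x z-P (fst y) z) <= e/2" by metis
  show "\<exists>d>0. \<forall>x'\<in>cball 0 R \<times> sphere 0 1. dist x' y < d --> dist (P (fst x') (snd x')) (P (fst y) (snd y)) < e"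
  proof (intro exI[of _ "min r (e/2)"] conjI ballI impI)
   show "min r (e/2) > 0" using r e by simp
   fix x' :: "'a \<times> ('a \<times> real)" assume x': "x' \<in> cball 0 R \<times> sphere 0 1" "dist x' y < min r (e/2)"
   have "dist (fst x') (fst y) < r" "dist (snd x') (snd y) < e/2"
    using x'(2) dist_fst_le[of x' y] dist_snd_le[of x' y] by auto
   then have fx: "fst x' \<in> ball (fst y) r" and sx: "norm (snd x'-snd y) < e/2" by (simp_all add: dist_commute dist_norm norm_minus_commute)
   have "norm (snd x') = 1" using x'(1) by (cases x') auto
   then have "norm (P (fst x') (snd x')-P (fst y) (snd x')) <= e/2" by (rule r(2)[OF fx])
   moreover have "norm (P (fst y) (snd x')-P (fst y) (snd y)) < e/2" using Pdiff sx by (rule le_less_trans)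
   ultimately show "dist (P (fst x') (snd x')) (P (fst y) (snd y)) < e"
    using norm_triangle_ineq[of "P (fst x') (snd x')-P (fst y) (snd x')" "P (fst y) (snd x')-P (fst y) (snd y)"]
    by (simp add: dist_norm)
  qed
 qed
 from line_field_lift[OF R(1) this proj] obtain v where v: "continuous_on (cball 0 R) v" "!!x. x \<in> cball 0 R ==> norm (v x) = 1"
  "!!x z. x \<in> cball 0 R ==> P x z = (z \<bullet> v x) *R v x" by metis
 have vE: "snd (v x) = 0" if "x \<in> E" "x \<in> cball 0 R" for x
 proof -
  have "P x (0, 1) = 0" using that hess_linear[of x] E_Omega linear_0 by (auto simp: P_def zero_prod_def)
  then have "snd (v x) *R v x = 0" using v(3)[OF that(2), of "(0,1)"] by (simp add: inner_prod_def)
  then show ?thesis using v(2)[OF that(2)] by auto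
 qed
 have vnE: "\<exists>\<kappa>. \<kappa> ~= 0 & v x = \<kappa> *R A x" if "x \<notin> E" "x \<in> cball 0 R" for x
 proof -
  have "v x = P x (v x)" using v(2,3)[OF that(2)] by (simp add: norm_eq_1)
  also have "... = ((v x \<bullet> A x)/(A x \<bullet> A x)) *R A x" using that(1) by (simp add: P_def)
  finally show ?thesis using v(2)[OF that(2)] by (metis norm_zero scaleR_zero_left zero_neq_one)
 qed
 show ?thesis
 proof (rule that[of "%x. snd (v x)"])
  show "continuous_on (cball 0 R) (%x. snd (v x))" by (intro continuous_intros v(1))
  fix x :: 'a assume x: "x \<in> cball 0 R"
  show "snd (v x) = 0 \<longleftrightarrow> x \<in> E"
  proof (cases "x \<in> E")
   case False
   from vnE[OF this x] obtain \<kappa> where "\<kappa> ~= 0" "v x = \<kappa> *R A x" by blast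
   then show ?thesis using False \<zeta>0(1)[of x] by (simp add: A_def)
  qed (use vE x in simp)
 next
  fix p assume p: "p \<in> E"
  have pO: "p \<in> \<Omega>" using p E_Omega by blast
  have OR: "\<Omega> \<subseteq> ball 0 R" using R(2) closure_subset by blast
  have pR: "p \<in> cball 0 R" using pO OR by auto
  define \<nu> where "\<nu> = fst (v p)"
  have vp: "v p = (\<nu>, 0)" using vE[OF p pR] by (simp add: \<nu>_def prod_eq_iff)
  have n1: "norm \<nu> = 1" using v(2)[OF pR] by (simp add: vp norm_prod_def)
  have hp: "hess p h = (- n*(\<nu> \<bullet> h)) *R \<nu>" for h
  proof -
   have "fst (P p (h, 0)) = (h \<bullet> \<nu>) *R \<nu>" using v(3)[OF pR, of "(h,0)"] by (simp add: vp inner_prod_def)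
   moreover have "fst (P p (h, 0)) = (-1/n) *R hess p h" using p by (simp add: P_def)
   ultimately have "(-1/n) *R hess p h = (h \<bullet> \<nu>) *R \<nu>" by simp
   then have "(-n) *R ((-1/n) *R hess p h) = (-n) *R ((h \<bullet> \<nu>) *R \<nu>)" by simp
   then show ?thesis using n by (simp add: inner_commute)
  qed
  have "DERIV (%s. pd \<nu> u (p+s *R \<nu>)) 0 :> pd \<nu> (pd \<nu> u) (p+0 *R \<nu>)"
   by (rule has_real_derivative_along) (simp add: diffs(2)[OF pO])
  moreover have "pd \<nu> (pd \<nu> u) (p+0 *R \<nu>) = - n"
   using hess_inner[OF pO, of \<nu> \<nu>] hp[of \<nu>] n1 by (simp add: norm_eq_1)
  ultimately have dd: "DERIV (%s. pd \<nu> u (p+s *R \<nu>)) 0 :> -n" by simp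
  have "p \<in> MX" using p E_MX by blast
  then have g0: "pd \<nu> u (p+0 *R \<nu>) = 0" using MX_pd by simp
  obtain d1 where d1: "d1 > 0" "!!h. 0 < h ==> h < d1 ==> pd \<nu> u (p+h *R \<nu>) < 0"
   using DERIV_neg_dec_right[OF dd] n g0 by auto
  obtain d2 where d2: "d2 > 0" "!!h. 0 < h ==> h < d2 ==> 0 < pd \<nu> u (p-h *R \<nu>)"
   using DERIV_neg_dec_left[OF dd] n g0 by auto
  have "isCont v p"
  proof -
   have "continuous_on (ball 0 R) v" by (rule continuous_on_subset[OF v(1)]) auto
   then show ?thesis using pO OR open_ball continuous_on_eq_continuous_at by blast
  qed
  then obtain d3 where d3: "d3 > 0" "!!x. dist x p < d3 ==> dist (v x) (v p) < 1" unfolding continuous_at_eps_delta by (metis zero_less_one)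
  obtain d4 where d4: "d4 > 0" "ball p d4 \<subseteq> \<Omega>" using op pO open_contains_ball by blast
  \<comment> \<open>The oriented vector is a multiple kappa of (f grad u, squared distance) with
    horizontal part close to \<nu>. So kappa has the sign of the normal derivative of u, which
    changes from positive to negative across the core, and the last component inherits that
    sign.\<close>
  have key: "snd (v x)*pd \<nu> u x > 0" if x: "dist x p < Min {d3, d4, \<eta>}" and g: "pd \<nu> u x ~= 0" for x
  proof -
   have xO: "x \<in> \<Omega>" using d4 x by (auto simp: dist_commute)
   have xR: "x \<in> cball 0 R" using xO OR by auto
   have xE: "x \<notin> E" using g MX_pd E_MX by blast
   from vnE[OF xE xR] obtain \<kappa> where \<kappa>: "\<kappa> ~= 0" "v x = \<kappa> *R A x" by blast
   have "norm (fst (v x)-\<nu>) < 1"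
   proof -
    have "norm (fst (v x-v p)) <= norm (v x-v p)" by (metis norm_fst_le prod.collapse)
    also have "... < 1" using d3(2)[of x] x by (simp add: dist_norm)
    finally show ?thesis by (simp add: vp)
   qed
   then have "\<bar>(fst (v x)-\<nu>) \<bullet> \<nu>\<bar> < 1" using Cauchy_Schwarz_ineq2[of "fst (v x)-\<nu>" \<nu>] n1 by simp
   then have pos: "fst (v x) \<bullet> \<nu> > 0" using n1 by (simp add: inner_diff_left norm_eq_1 abs_less_iff)
   have fp: "f x > 0"
   proof -
    have "infdist x E < \<eta>" using infdist_le[OF p, of x] x by simp
    then show ?thesis using \<eta> by (simp add: f_def divide_less_eq)
   qed
   have "fst (v x) \<bullet> \<nu> = \<kappa>*(f x*pd \<nu> u x)"
    using xO by (simp add: \<kappa> A_def G_def grad_inner)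
   with pos have "0 < \<kappa>*(f x*pd \<nu> u x)" by simp
   then have "0 < f x*(\<kappa>*pd \<nu> u x)" by (simp only: mult.left_commute)
   then have "0 < \<kappa>*pd \<nu> u x" using fp zero_less_mult_pos by blast
   moreover have "\<zeta> x > 0" using \<zeta>0[of x] xE by simp
   ultimately have "0 < (\<kappa>*pd \<nu> u x)*\<zeta> x" by simp
   then show ?thesis by (simp add: \<kappa> A_def algebra_simps)
  qed
  define s0 where "s0 = Min {d1, d2, d3, d4, \<eta>}"
  have s0: "s0 > 0" using d1 d2 d3 d4 \<eta> by (simp add: s0_def)
  have "snd (v (p+s *R \<nu>)) < 0 & 0 < snd (v (p-s *R \<nu>))" if s: "0 < s" "s < s0" for s
  proof
   have 1: "pd \<nu> u (p+s *R \<nu>) < 0" "0 < pd \<nu> u (p-s *R \<nu>)" using d1(2)[of s] d2(2)[of s] s by (auto simp: s0_def)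
   have "dist (p+s *R \<nu>) p < Min {d3, d4, \<eta>}" "dist (p-s *R \<nu>) p < Min {d3, d4, \<eta>}" using s n1 by (auto simp: s0_def dist_norm)
   then show "snd (v (p+s *R \<nu>)) < 0" "0 < snd (v (p-s *R \<nu>))"
    using key[of "p+s *R \<nu>"] key[of "p-s *R \<nu>"] 1 by (simp_all add: zero_less_mult_iff)
  qed
  then show "\<exists>\<nu>. norm \<nu> = 1 & (\<forall>h. hess p h = (- real DIM('a)*(\<nu> \<bullet> h)) *R \<nu>) &
    (\<exists>s0>0. \<forall>s. 0 < s & s < s0 --> snd (v (p+s *R \<nu>)) < 0 & 0 < snd (v (p-s *R \<nu>)))"
   using n1 hp s0 unfolding n_def by blast
 qed
qed

end

lemma connected_sign:
 fixes \<sigma> :: "'a::topological_space => real"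
 assumes "connected X" "continuous_on X \<sigma>" "!!x. x \<in> X ==> \<sigma> x ~= 0"
 shows "(\<forall>x\<in>X. \<sigma> x > 0) \<or> (\<forall>x\<in>X. \<sigma> x < 0)"
proof (rule ccontr)
 assume "\<not> ?thesis"
 then obtain x y where xy: "x \<in> X" "y \<in> X" "\<sigma> x <= 0" "0 <= \<sigma> y" by force
 have "connected (\<sigma> ` X)" using connected_continuous_image assms by blast
 then have "0 \<in> \<sigma> ` X" using xy connected_contains_Icc[of "\<sigma> ` X" "\<sigma> x" "\<sigma> y"] by auto
 then show False using assms(3) by auto
qed

context torsion
begin

text \<open>A side not reaching the outer frontier would have its whole boundary in the core, where
  u = M, and the minimum principle would force u > M inside.\<close>

lemma positive_side:
 assumes R: "closure \<Omega> \<subseteq> ball 0 R" and \<sigma>: "continuous_on (cball 0 R) \<sigma>" "!!x. x \<in> cball 0 R ==> \<sigma> x = (0::real) \<longleftrightarrow> x \<in> E"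
  and q: "q \<in> \<Omega>" "0 < \<sigma> q"
 shows "open {x \<in> \<Omega>. 0 < \<sigma> x}" "frontier {x \<in> \<Omega>. 0 < \<sigma> x} \<subseteq> E \<union> {x \<in> frontier \<Omega>. 0 < \<sigma> x}"
  "\<exists>x\<in>frontier \<Omega>. 0 < \<sigma> x"
proof -
 let ?V = "{x \<in> \<Omega>. 0 < \<sigma> x}"
 have cl: "closure \<Omega> \<subseteq> cball 0 R" using R ball_subset_cball by blast
 then have OR: "\<Omega> \<subseteq> cball 0 R" using closure_subset by blast
 show o: "open ?V"
  using continuous_open_preimage[OF continuous_on_subset[OF \<sigma>(1) OR] op, of "{0<..}"] by (simp add: vimage_def Int_def)
 have "closed {x \<in> cball 0 R. 0 <= \<sigma> x}"
  using continuous_closed_preimage[OF \<sigma>(1) closed_cball, of "{0..}"] by (simp add: vimage_def Int_def)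
 moreover have "?V \<subseteq> {x \<in> cball 0 R. 0 <= \<sigma> x}" using OR by auto
 ultimately have "closure ?V \<subseteq> {x \<in> cball 0 R. 0 <= \<sigma> x}" by (rule closure_minimal[rotated])
 moreover have "closure ?V \<subseteq> closure \<Omega>" by (intro closure_mono) auto
 ultimately have c: "closure ?V \<subseteq> {x \<in> closure \<Omega>. 0 <= \<sigma> x}" by blast
 have nE: "\<sigma> x ~= 0" if "x \<in> frontier \<Omega>" for x
 proof -
  have "x \<in> cball 0 R" using that cl by (auto simp: frontier_def)
  moreover have "x \<notin> E" using that E_Omega op by (auto simp: frontier_def interior_open)
  ultimately show ?thesis using \<sigma>(2) by blast
 qed
 show f: "frontier ?V \<subseteq> E \<union> {x \<in> frontier \<Omega>. 0 < \<sigma> x}"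
 proof
  fix x assume "x \<in> frontier ?V"
  then have x: "x \<in> closure \<Omega>" "0 <= \<sigma> x" "x \<notin> ?V" using c o by (auto simp: frontier_def interior_open)
  show "x \<in> E \<union> {x \<in> frontier \<Omega>. 0 < \<sigma> x}"
  proof (cases "x \<in> \<Omega>")
   case True
   then have "\<sigma> x = 0" using x by auto
   then show ?thesis using \<sigma>(2) True OR by blast
  next
   case False
   then have "x \<in> frontier \<Omega>" using x op by (simp add: frontier_def interior_open)
   then show ?thesis using nE[of x] x by auto
  qed
 qed
 show "\<exists>x\<in>frontier \<Omega>. 0 < \<sigma> x"
 proof (rule ccontr)
  assume "\<not> ?thesis"
  then have "frontier ?V \<subseteq> E" using f by blast
  then have "M <= u x" if "x \<in> frontier ?V" for x using that E_MX by (auto simp: MAXset_def)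
  from min_principle[OF o _ _ this, of q] have "M < u q" using q by auto
  then show False using u_le_M[OF q(1)] by simp
 qed
qed

text \<open>The sign is constant on each connected boundary component, and both signs occur on the
  frontier, so the two components carry opposite signs. This assigns one side of the core to each
  component.\<close>

lemma two_sides:
 assumes comps: "components (frontier \<Omega>) = {\<Gamma>1, \<Gamma>2}" "\<Gamma>1 ~= \<Gamma>2" and En: "E ~= {}"
 obtains V1 V2 where "open V1" "V1 \<subseteq> \<Omega>" "frontier V1 \<subseteq> E \<union> \<Gamma>1" "open V2" "V2 \<subseteq> \<Omega>" "frontier V2 \<subseteq> E \<union> \<Gamma>2"
  "!!p. p \<in> E ==> \<exists>\<nu>. norm \<nu> = 1 & (\<forall>h. hess p h = (- real DIM('a)*(\<nu> \<bullet> h)) *R \<nu>) &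
    (\<exists>s0>0. \<forall>s. 0 < s & s < s0 --> p+s *R \<nu> \<in> V2 & p-s *R \<nu> \<in> V1)"
proof -
 obtain R where R: "R > 0" "closure \<Omega> \<subseteq> ball 0 R"
 proof -
  have "bounded (closure \<Omega>)" by (rule bounded_closure[OF bdd])
  then show ?thesis using that bounded_subset_ballD[of "closure \<Omega>" 0] by blast
 qed
 obtain \<sigma> where \<sigma>: "continuous_on (cball 0 R) \<sigma>" "!!x. x \<in> cball 0 R ==> \<sigma> x = (0::real) \<longleftrightarrow> x \<in> E"
  "!!p. p \<in> E ==> \<exists>\<nu>. norm \<nu> = 1 & (\<forall>h. hess p h = (- real DIM('a)*(\<nu> \<bullet> h)) *R \<nu>) &
    (\<exists>s0>0. \<forall>s. 0 < s & s < s0 --> \<sigma> (p+s *R \<nu>) < 0 & 0 < \<sigma> (p-s *R \<nu>))"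
  by (rule separation[OF En R]) (rule that, assumption+)
 define \<sigma>' where "\<sigma>' x = - \<sigma> x" for x
 have \<sigma>': "continuous_on (cball 0 R) \<sigma>'" "!!x. x \<in> cball 0 R ==> \<sigma>' x = (0::real) \<longleftrightarrow> x \<in> E"
  using \<sigma>(1,2) by (auto simp: \<sigma>'_def intro: continuous_intros)
 have near: "\<exists>s0>0. \<forall>s. 0 < s & s < s0 --> p+s *R \<nu> \<in> \<Omega> & p-s *R \<nu> \<in> \<Omega>" if "p \<in> E" "norm \<nu> = 1" for p \<nu>
 proof -
  have "p \<in> \<Omega>" using that(1) E_Omega by blast
  then obtain r where "r > 0" "ball p r \<subseteq> \<Omega>" using op open_contains_ball by blast
  moreover have "p+s *R \<nu> \<in> ball p r" "p-s *R \<nu> \<in> ball p r" if "0 < s & s < r" for s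
   using that \<open>norm \<nu> = 1\<close> by (simp_all add: dist_norm)
  ultimately show ?thesis by (intro exI[of _ r]) (simp add: subsetD)
 qed
 have pts: "\<exists>q q'. q \<in> \<Omega> & 0 < \<sigma> q & q' \<in> \<Omega> & 0 < \<sigma>' q'"
 proof -
  obtain p where p: "p \<in> E" using En by blast
  from \<sigma>(3)[OF p] obtain \<nu> s0 where \<nu>: "norm \<nu> = 1" "s0 > 0" "\<forall>s. 0 < s & s < s0 --> \<sigma> (p+s *R \<nu>) < 0 & 0 < \<sigma> (p-s *R \<nu>)" by (elim exE conjE)
  from near[OF p \<nu>(1)] obtain s1 where s1: "s1 > 0" "!!s. 0 < s ==> s < s1 ==> p+s *R \<nu> \<in> \<Omega> & p-s *R \<nu> \<in> \<Omega>" by blast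
  define s where "s = min s0 s1/2"
  have "0 < s" "s < s0" "s < s1" using \<nu>(2) s1(1) by (auto simp: s_def)
  then have "p-s *R \<nu> \<in> \<Omega> & 0 < \<sigma> (p-s *R \<nu>) & p+s *R \<nu> \<in> \<Omega> & 0 < \<sigma>' (p+s *R \<nu>)"
   using \<nu>(3)[rule_format, of s] s1(2)[of s] by (simp add: \<sigma>'_def)
  then show ?thesis by - (intro exI)
 qed
 then obtain q q' where q: "q \<in> \<Omega>" "0 < \<sigma> q" and q': "q' \<in> \<Omega>" "0 < \<sigma>' q'" by (elim exE conjE)
 note P = positive_side[OF R(2) \<sigma>(1,2) q] and N = positive_side[OF R(2) \<sigma>' q']
 have fr: "frontier \<Omega> = \<Gamma>1 \<union> \<Gamma>2" using Union_components[of "frontier \<Omega>"] comps(1) by simp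
 have sgn: "(\<forall>x\<in>\<Gamma>. \<sigma> x > 0) \<or> (\<forall>x\<in>\<Gamma>. \<sigma> x < 0)" if "\<Gamma> \<in> {\<Gamma>1, \<Gamma>2}" for \<Gamma>
 proof (rule connected_sign)
  have g: "\<Gamma> \<in> components (frontier \<Omega>)" using that comps by simp
  then show "connected \<Gamma>" by (rule in_components_connected)
  have sub: "\<Gamma> \<subseteq> frontier \<Omega>" by (rule in_components_subset[OF g])
  then have sub': "\<Gamma> \<subseteq> cball 0 R" using R(2) ball_subset_cball by (fastforce simp: frontier_def)
  show "continuous_on \<Gamma> \<sigma>" by (rule continuous_on_subset[OF \<sigma>(1) sub'])
  show "\<sigma> x ~= 0" if x: "x \<in> \<Gamma>" for x
  proof -
   have "x \<notin> E" using x sub E_Omega op by (auto simp: frontier_def interior_open)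
   then show ?thesis using \<sigma>(2) sub' x by blast
  qed
 qed
 have ne: "\<Gamma>1 ~= {}" "\<Gamma>2 ~= {}" using in_components_nonempty[of _ "frontier \<Omega>"] comps(1) by blast+
 have cases: "((\<forall>x\<in>\<Gamma>1. \<sigma> x > 0) & (\<forall>x\<in>\<Gamma>2. \<sigma> x < 0)) \<or> ((\<forall>x\<in>\<Gamma>1. \<sigma> x < 0) & (\<forall>x\<in>\<Gamma>2. \<sigma> x > 0))"
 proof -
  obtain x where x: "x \<in> \<Gamma>1 \<union> \<Gamma>2" "\<sigma> x > 0" using P(3) unfolding fr by blast
  obtain y where y: "y \<in> \<Gamma>1 \<union> \<Gamma>2" "\<sigma> y < 0" using N(3) unfolding fr \<sigma>'_def by auto
  show ?thesis
   using sgn[OF insertI1] sgn[OF insertI2[OF singletonI]] x y by (elim disjE UnE) (auto dest: bspec less_asym)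
 qed
 define VP where "VP = {x \<in> \<Omega>. 0 < \<sigma> x}"
 define VN where "VN = {x \<in> \<Omega>. 0 < \<sigma>' x}"
 note P = P[folded VP_def] and N = N[folded VN_def]
 have sub: "VP \<subseteq> \<Omega>" "VN \<subseteq> \<Omega>" by (auto simp: VP_def VN_def)
 have E: "\<exists>\<nu>. norm \<nu> = 1 & (\<forall>h. hess p h = (- real DIM('a)*(\<nu> \<bullet> h)) *R \<nu>) &
    (\<exists>s0>0. \<forall>s. 0 < s & s < s0 --> p+s *R \<nu> \<in> VN & p-s *R \<nu> \<in> VP)" if p: "p \<in> E" for p
 proof -
  from \<sigma>(3)[OF p] obtain \<nu> s0 where \<nu>: "norm \<nu> = 1" "\<forall>h. hess p h = (- real DIM('a)*(\<nu> \<bullet> h)) *R \<nu>" "s0 > 0" "\<forall>s. 0 < s & s < s0 --> \<sigma> (p+s *R \<nu>) < 0 & 0 < \<sigma> (p-s *R \<nu>)" by (elim exE conjE)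
  from near[OF p \<nu>(1)] obtain s1 where s1: "s1 > 0" "!!s. 0 < s ==> s < s1 ==> p+s *R \<nu> \<in> \<Omega> & p-s *R \<nu> \<in> \<Omega>" by blast
  have "\<forall>s. 0 < s & s < min s0 s1 --> p+s *R \<nu> \<in> VN & p-s *R \<nu> \<in> VP"
   using \<nu>(4) s1(2) by (simp add: VN_def VP_def \<sigma>'_def)
  moreover have "min s0 s1 > 0" using s1(1) \<nu>(3) by simp
  ultimately show ?thesis by (intro exI[of _ \<nu>] conjI exI[of _ "min s0 s1"] \<nu>(1,2))
 qed
 show ?thesis
 proof (rule disjE[OF cases])
  assume c: "(\<forall>x\<in>\<Gamma>1. \<sigma> x > 0) & (\<forall>x\<in>\<Gamma>2. \<sigma> x < 0)"
  show ?thesis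
  proof (rule that[of VP VN])
   show "frontier VP \<subseteq> E \<union> \<Gamma>1" "frontier VN \<subseteq> E \<union> \<Gamma>2" using P(2) N(2) c unfolding fr by (force simp: \<sigma>'_def)+
  qed (use P(1) N(1) sub E in auto)
 next
  assume c: "(\<forall>x\<in>\<Gamma>1. \<sigma> x < 0) & (\<forall>x\<in>\<Gamma>2. \<sigma> x > 0)"
  \<comment> \<open>When the signs are interchanged, reversing the normal restores the convention
    that it points into the side of \<Gamma>2; the Hessian is unaffected.\<close>
  have E': "\<exists>\<nu>. norm \<nu> = 1 & (\<forall>h. hess p h = (- real DIM('a)*(\<nu> \<bullet> h)) *R \<nu>) &
    (\<exists>s0>0. \<forall>s. 0 < s & s < s0 --> p+s *R \<nu> \<in> VP & p-s *R \<nu> \<in> VN)" if p: "p \<in> E" for p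
  proof -
   from E[OF p] obtain \<nu> where "norm \<nu> = 1 & (\<forall>h. hess p h = (- real DIM('a)*(\<nu> \<bullet> h)) *R \<nu>) &
    (\<exists>s0>0. \<forall>s. 0 < s & s < s0 --> p+s *R \<nu> \<in> VN & p-s *R \<nu> \<in> VP)" by (rule exE)
   then show ?thesis by (intro exI[of _ "- \<nu>"]) (simp add: conj_commute[of "_ \<in> VN"])
  qed
  show ?thesis
  proof (rule that[of VN VP])
   show "frontier VN \<subseteq> E \<union> \<Gamma>1" "frontier VP \<subseteq> E \<union> \<Gamma>2" using P(2) N(2) c unfolding fr by (force simp: \<sigma>'_def)+
  qed (use P(1) N(1) sub E' in auto)
 qed
qed

end

section \<open>Limits of second and third order\<close>

lemma lhopital_power:
 fixes f :: "real => real"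
 assumes d: "\<forall>\<^sub>F s in at 0. DERIV f s :> f1 s" and f0: "(f \<longlongrightarrow> 0) (at 0)"
  and l: "((%s. f1 s/s ^ k) \<longlongrightarrow> L) (at 0)"
 shows "((%s. f s/s ^ Suc k) \<longlongrightarrow> L/real (Suc k)) (at 0)"
proof (rule lhopital[OF f0 _ _ _ d])
 show "((%s::real. s ^ Suc k) \<longlongrightarrow> 0) (at 0)" by (rule tendsto_eq_intros | simp)+
 have ne: "\<forall>\<^sub>F s::real in at 0. s ~= 0" by (simp add: eventually_at_filter)
 show "\<forall>\<^sub>F s::real in at 0. s ^ Suc k ~= 0" "\<forall>\<^sub>F s::real in at 0. real (Suc k) * s ^ k ~= 0"
  by (rule eventually_mono[OF ne], simp)+
 show "\<forall>\<^sub>F s::real in at 0. DERIV (%s. s ^ Suc k) s :> real (Suc k) * s ^ k"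
  using DERIV_pow[of "Suc k"] by (intro always_eventually allI) simp
 have "((%s. f1 s/s ^ k/real (Suc k)) \<longlongrightarrow> L/real (Suc k)) (at 0)" by (intro tendsto_divide l tendsto_const) simp
 then show "((%s. f1 s/(real (Suc k) * s ^ k)) \<longlongrightarrow> L/real (Suc k)) (at 0)" by (simp add: mult.commute)
qed

text \<open>The top derivative is required at 0 only: after one use of l'Hopital's rule the
  remaining limit is its difference quotient.\<close>

lemma quadratic_limit:
 fixes f :: "real => real"
 assumes \<delta>: "\<delta> > 0" and d: "!!s. \<bar>s\<bar> < \<delta> ==> DERIV f s :> f1 s" and d1: "DERIV f1 0 :> L"
  and z: "f 0 = 0" "f1 0 = 0"
 shows "((%s. f s/s ^ 2) \<longlongrightarrow> L/2) (at 0)"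
proof -
 have ev: "\<forall>\<^sub>F s in at 0. DERIV f s :> f1 s"
  using \<delta> d by (auto simp: eventually_at intro!: exI[of _ \<delta>])
 have "isCont f 0" using d[of 0] \<delta> DERIV_isCont by auto
 then have f0: "(f \<longlongrightarrow> 0) (at 0)" using z by (simp add: isCont_def)
 have "((%s. f1 s/s ^ 1) \<longlongrightarrow> L) (at 0)" using d1 z by (simp add: has_field_derivative_iff)
 from lhopital_power[OF ev f0 this] show ?thesis by (simp add: numeral_2_eq_2)
qed

lemma cubic_limit:
 fixes f :: "real => real"
 assumes \<delta>: "\<delta> > 0" and d: "!!s. \<bar>s\<bar> < \<delta> ==> DERIV f s :> f1 s" "!!s. \<bar>s\<bar> < \<delta> ==> DERIV f1 s :> f2 s"
  and d2: "DERIV f2 0 :> L"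
  and z: "f 0 = 0" "f1 0 = 0" "f2 0 = 0"
 shows "((%s. f s/s ^ 3) \<longlongrightarrow> L/6) (at 0)"
proof -
 have ev: "\<forall>\<^sub>F s in at 0. DERIV f s :> f1 s"
  using \<delta> d by (auto simp: eventually_at intro!: exI[of _ \<delta>])
 have "isCont f 0" using d(1)[of 0] \<delta> DERIV_isCont by auto
 then have f0: "(f \<longlongrightarrow> 0) (at 0)" using z by (simp add: isCont_def)
 from lhopital_power[OF ev f0 quadratic_limit[OF \<delta> d(2) d2 z(2,3)]] show ?thesis by (simp add: numeral_3_eq_3 numeral_2_eq_2)
qed

section \<open>Model solutions\<close>

text \<open>The model of core radius $\rho$ has depth $\rho^2 T(|x|/\rho)$ below its maximum and gradient norm
 $\rho |\varphi(|x|/\rho)|$. In terms of $q = y^{-n}$ all derivatives are rational.\<close>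
definition mq :: "nat => real => real" where "mq n y = 1/y ^ n"
definition mT :: "nat => real => real" where
 "mT n y = y^2/2+y^2*mq n y/(real n-2)-real n/(2*(real n-2))"
definition mphi :: "nat => real => real" where "mphi n y = y*(1-mq n y)"

lemma mq_deriv: "y > 0 ==> DERIV (mq n) y :> (- real n*mq n y/y)"
proof -
 assume y: "y > 0"
 then have "DERIV (%x. inverse (x ^ n)) y :> -(inverse (y ^ n)*(real n*y ^ (n-Suc 0))*inverse (y ^ n))"
  by (intro DERIV_inverse'[OF DERIV_pow]) simp
 moreover have "- (inverse (y ^ n)*(real n*y ^ (n-Suc 0))*inverse (y ^ n)) = - real n*inverse (y ^ n)/y"
  using y by (cases n) (simp_all add: field_simps)
 ultimately show ?thesis unfolding mq_def inverse_eq_divide[symmetric] by simp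
qed

lemma mphi_deriv: "y > 0 ==> DERIV (mphi n) y :> 1+(real n-1)*mq n y"
 unfolding mphi_def by (auto intro!: derivative_eq_intros mq_deriv simp: algebra_simps)

lemma mT_deriv: assumes "n >= 3" "y > 0" shows "DERIV (mT n) y :> mphi n y"
proof -
 have "DERIV (mT n) y :> y+(2*y*mq n y+y^2*(- real n*mq n y/y))/(real n-2)"
  unfolding mT_def using assms by (auto intro!: derivative_eq_intros mq_deriv)
 moreover have eq: "2*y*mq n y+y^2*(- real n*mq n y/y) = (real n-2)*(- y*mq n y)"
  using assms by (simp add: power2_eq_square field_simps)
 ultimately show ?thesis unfolding eq using assms by (simp add: mphi_def right_diff_distrib)
qed

lemma mq_pos: "y > 0 ==> mq n y > 0" by (simp add: mq_def)
lemma mq_1: "mq n 1 = 1" by (simp add: mq_def)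
lemma mT_1: "n >= 3 ==> mT n 1 = 0" by (simp add: mT_def mq_1 field_simps)
lemma mphi_1: "mphi n 1 = 0" by (simp add: mphi_def mq_1)

lemma mq_sign:
 assumes "n >= 3" "y > 0" shows "mq n y < 1 \<longleftrightarrow> 1 < y" "1 < mq n y \<longleftrightarrow> y < 1"
proof -
 have n0: "n > 0" using assms by simp
 have "1 < y ==> 1 < y ^ n" "y < 1 ==> y ^ n < 1" "y = 1 ==> y ^ n = 1"
  using one_less_power[of y n] power_Suc_less_one[of y "n-1"] n0 assms(2) by auto
 then have "1 < y ^ n \<longleftrightarrow> 1 < y" "y ^ n < 1 \<longleftrightarrow> y < 1" by (metis less_asym less_irrefl linorder_neqE_linordered_idom)+
 then show "mq n y < 1 \<longleftrightarrow> 1 < y" "1 < mq n y \<longleftrightarrow> y < 1"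
  using assms(2) by (simp_all add: mq_def divide_less_eq less_divide_eq)
qed

lemma mphi_sign:
 assumes "n >= 3" "y > 0" shows "0 < mphi n y \<longleftrightarrow> 1 < y" "mphi n y < 0 \<longleftrightarrow> y < 1"
 using mq_sign[OF assms] assms by (auto simp: mphi_def zero_less_mult_iff mult_less_0_iff)

lemma mT_continuous: "n >= 3 ==> S \<subseteq> {0<..} ==> continuous_on S (mT n)"
 using mT_deriv DERIV_isCont by (metis continuous_at_imp_continuous_on greaterThan_iff subsetD)

lemma mT_strict:
 assumes n: "n >= 3" shows "1 <= a ==> a < b ==> mT n a < mT n b" "0 < a ==> a < b ==> b <= 1 ==> mT n b < mT n a"
proof -
 show "mT n a < mT n b" if "1 <= a" "a < b"
 proof (rule DERIV_pos_imp_increasing_open[OF that(2)])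
  show "\<exists>y. DERIV (mT n) x :> y & 0 < y" if "a < x" "x < b" for x
   using mT_deriv[OF n, of x] mphi_sign(1)[OF n, of x] that \<open>1 <= a\<close> by force
 qed (rule mT_continuous[OF n], use that in auto)
 show "mT n b < mT n a" if "0 < a" "a < b" "b <= 1"
 proof (rule DERIV_neg_imp_decreasing_open[OF that(2)])
  show "\<exists>y. DERIV (mT n) x :> y & y < 0" if "a < x" "x < b" for x
   using mT_deriv[OF n, of x] mphi_sign(2)[OF n, of x] that \<open>0 < a\<close> \<open>b <= 1\<close> by force
 qed (rule mT_continuous[OF n], use that in auto)
qed

lemma mT_pos: "n >= 3 ==> 0 < y ==> y ~= 1 ==> 0 < mT n y"
 using mT_strict(1)[of n 1 y] mT_strict(2)[of n y 1] mT_1 by (cases "y < 1") auto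

text \<open>The two branches of the inverse of \<open>mT\<close>: outside (\<open>e = 1\<close>) and inside (\<open>e = -1\<close>) the core.\<close>
definition branch :: "real => real set" where "branch e = {y. 0 < y & 0 <= e*(y-1)}"
definition mpsi :: "nat => real => real => real" where "mpsi n e t = (THE y. y \<in> branch e & mT n y = t)"

lemma mT_inj: assumes n: "n >= 3" and e: "e \<in> {1, -1}" and y: "y \<in> branch e" "z \<in> branch e" "mT n y = mT n z"
 shows "y = z"
proof (rule ccontr)
 assume "y ~= z"
 then show False using e y mT_strict(1)[OF n, of y z] mT_strict(1)[OF n, of z y] mT_strict(2)[OF n, of y z] mT_strict(2)[OF n, of z y]
  by (auto simp: branch_def linorder_neq_iff)
qed

lemma mT_surj: assumes n: "n >= 3" and e: "e \<in> {1, -1}" and t: "t >= 0" shows "\<exists>y\<in>branch e. mT n y = t"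
proof (cases "e = 1")
 case True
 \<comment> \<open>As Y^2 >= Y and the constant term is at most n/2, the quadratic term alone
   exceeds the depth t.\<close>
 define Y where "Y = 1+2*t+real n"
 have Y: "Y >= 1" using t by (simp add: Y_def)
 have "real n/(2*(real n-2)) <= real n/2" using n by (simp add: field_simps)
 moreover have "Y*1 <= Y^2" unfolding power2_eq_square using Y by (intro mult_left_mono) auto
 moreover have "0 <= Y^2*mq n Y/(real n-2)" using n Y by (simp add: mq_def)
 ultimately have "t <= mT n Y" by (simp add: mT_def Y_def)
 moreover have "continuous_on {1..Y} (mT n)" by (rule mT_continuous[OF n]) auto
 ultimately obtain y where "1 <= y" "y <= Y" "mT n y = t"
  using IVT'[of "mT n" 1 t Y] mT_1[OF n] t Y by auto
 then show ?thesis using True by (intro bexI[of _ y]) (auto simp: branch_def)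
next
 case False
 \<comment> \<open>Inside the core the singular term dominates: at 1/Y it is Y^(n-2)/(n-2), which is
   at least t + n and outweighs the constant.\<close>
 define Y where "Y = real n*(t+real n)"
 have nn: "real n*1 <= real n*(t+real n)" using n t by (intro mult_left_mono) auto
 then have Y: "Y >= 1" using n unfolding Y_def by linarith
 define y0 where "y0 = 1/Y"
 have y0: "0 < y0" "y0 <= 1" using Y by (auto simp: y0_def)
 have "real n/(2*(real n-2)) <= real n" using n by (simp add: field_simps)
 moreover have "t+real n <= y0^2*mq n y0/(real n-2)"
 proof -
  have "Y ^ 1 <= Y ^ (n-2)" using Y n by (intro power_increasing) auto
  also have "Y ^ (n-2) = y0^2*mq n y0"
  proof -
   have "Y ^ n = Y ^ (n-2)*Y^2" using n power_add[of Y "n-2" 2] by (simp only: le_add_diff_inverse2)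
   then show ?thesis using Y by (simp add: y0_def mq_def power_divide)
  qed
  finally have "Y <= y0^2*mq n y0" by simp
  moreover have "(t+real n)*(real n-2) <= Y" using t n by (simp add: Y_def algebra_simps)
  ultimately show ?thesis using n by (simp add: pos_le_divide_eq)
 qed
 moreover have "0 <= y0^2" by simp
 ultimately have "t <= mT n y0" unfolding mT_def by linarith
 moreover have "continuous_on {y0..1} (mT n)" by (rule mT_continuous[OF n]) (use y0 in auto)
 ultimately obtain y where "y0 <= y" "y <= 1" "mT n y = t"
  using IVT2'[of "mT n" 1 t y0] mT_1[OF n] t y0 by auto
 then show ?thesis using False e y0 by (intro bexI[of _ y]) (auto simp: branch_def)
qed

lemma mpsi: assumes n: "n >= 3" and e: "e \<in> {1, -1}" and t: "t >= 0"
 shows "mpsi n e t \<in> branch e" "mT n (mpsi n e t) = t"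
proof -
 have "\<exists>!y. y \<in> branch e & mT n y = t" using mT_surj[OF assms] mT_inj[OF n e] by metis
 from theI'[OF this] show "mpsi n e t \<in> branch e" "mT n (mpsi n e t) = t" by (simp_all add: mpsi_def)
qed

lemma mpsi_pos: "n >= 3 ==> e \<in> {1, -1} ==> t >= 0 ==> 0 < mpsi n e t"
 using mpsi(1) by (auto simp: branch_def)

lemma mT_nonneg: "n >= 3 ==> 0 < y ==> 0 <= mT n y"
 using mT_pos[of n y] mT_1[of n] by (cases "y = 1") auto

lemma mpsi_mT: assumes n: "n >= 3" and e: "e \<in> {1, -1}" and y: "y \<in> branch e" shows "mpsi n e (mT n y) = y"
proof -
 have "0 <= mT n y" using y by (intro mT_nonneg[OF n]) (simp add: branch_def)
 from mpsi[OF n e this] show ?thesis using mT_inj[OF n e _ y] by blast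
qed

lemma mpsi_0: "n >= 3 ==> e \<in> {1, -1} ==> mpsi n e 0 = 1"
 using mpsi_mT[of n e 1] mT_1[of n] by (simp add: branch_def)

lemma mpsi_side: assumes n: "n >= 3" and e: "e \<in> {1, -1}" and t: "t > 0" shows "0 < e*(mpsi n e t-1)" "0 < e*mphi n (mpsi n e t)"
proof -
 have y: "mpsi n e t \<in> branch e" "mT n (mpsi n e t) = t" using mpsi[OF n e] t by auto
 then have "mpsi n e t ~= 1" using mT_1[OF n] t by auto
 then show "0 < e*(mpsi n e t-1)" using y(1) e by (auto simp: branch_def)
 then show "0 < e*mphi n (mpsi n e t)" using mphi_sign[OF n, of "mpsi n e t"] y(1) e by (auto simp: branch_def)
qed

text \<open>The derivative of the inverse blows up at depth 0, where \<open>mphi\<close> vanishes,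
  so continuity up to 0 comes from inverting a continuous injection on a compact interval.\<close>

lemma mpsi_continuous: assumes n: "n >= 3" and e: "e \<in> {1, -1}" shows "continuous_on {0..b} (mpsi n e)"
proof (cases "b >= 0")
 case b: True
 define S where "S = closed_segment 1 (mpsi n e b)"
 have pb: "mpsi n e b \<in> branch e" and Tb: "mT n (mpsi n e b) = b" using mpsi[OF n e b] by auto
 have Sb: "S \<subseteq> branch e" using pb e by (auto simp: S_def closed_segment_eq_real_ivl branch_def split: if_splits)
 have "continuous_on (mT n ` S) (mpsi n e)"
 proof (rule continuous_on_inv)
  show "continuous_on S (mT n)" by (rule mT_continuous[OF n]) (use Sb in \<open>auto simp: branch_def\<close>)
 qed (use Sb mpsi_mT[OF n e] in \<open>auto simp: S_def\<close>)
 moreover have "{0..b} \<subseteq> mT n ` S"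
 proof
  fix t assume t: "t \<in> {0..b}"
  have y: "mpsi n e t \<in> branch e" "mT n (mpsi n e t) = t" using mpsi[OF n e] t by auto
  have "mpsi n e t <= mpsi n e b" if "e = 1"
   using y pb Tb t that mT_strict(1)[OF n, of "mpsi n e b" "mpsi n e t"] by (force simp: branch_def)
  moreover have "mpsi n e b <= mpsi n e t" if "e = -1"
   using y pb Tb t that mT_strict(2)[OF n, of "mpsi n e t" "mpsi n e b"] by (force simp: branch_def)
  ultimately have "mpsi n e t \<in> S" using e y pb by (auto simp: S_def closed_segment_eq_real_ivl branch_def)
  then show "t \<in> mT n ` S" using y(2) by force
 qed
 ultimately show ?thesis by (rule continuous_on_subset)
qed simp

lemma mpsi_deriv: assumes n: "n >= 3" and e: "e \<in> {1, -1}" and t: "t > 0"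
 shows "DERIV (mpsi n e) t :> 1/mphi n (mpsi n e t)"
proof -
 have "isCont (mpsi n e) t"
  by (rule continuous_on_interior[OF mpsi_continuous[OF n e, of "t+1"]]) (use t in simp)
 moreover have "mphi n (mpsi n e t) ~= 0" using mpsi_side(2)[OF assms] by auto
 moreover have "DERIV (mT n) (mpsi n e t) :> mphi n (mpsi n e t)" using t by (intro mT_deriv[OF n] mpsi_pos[OF n e]) simp
 ultimately have "DERIV (mpsi n e) t :> inverse (mphi n (mpsi n e t))"
  by (intro DERIV_inverse_function[where f="mT n" and a=0 and b="t+1"]) (use t mpsi(2)[OF n e] in auto)
 then show ?thesis by (simp add: divide_inverse)
qed

text \<open>In the squared gradient minus 2n times the depth the quadratic terms cancel. The cubic
  coefficient that remains is where the core radius becomes visible once h is replaced by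
  s/rho.\<close>

lemma model_limits:
 assumes n: "n >= 3"
 shows "((%h. mT n (1+h)/h ^ 2) \<longlongrightarrow> real n/2) (at 0)"
  "((%h. ((mphi n (1+h))^2-2*real n*mT n (1+h))/h ^ 3) \<longlongrightarrow> -(2/3)*(real n)^2*(real n-1)) (at 0)"
proof -
 have sh: "DERIV (%h. f (1+h)) s :> D" if "DERIV f (1+s) :> D" for f D s
  using that DERIV_shift[of f D s 1] by (simp add: add.commute)
 have p: "1+s > 0" if "\<bar>s\<bar> < 1" for s :: real using that by linarith
 note T = sh[OF mT_deriv[OF n p]] and P = sh[OF mphi_deriv[OF p]] and Q = sh[OF mq_deriv[OF p]]
 define P where "P h = mphi n (1+h)" for h
 define A where "A h = 1+(real n-1)*mq n (1+h)" for h
 define B where "B h = (real n-1)*(- real n*mq n (1+h)/(1+h))" for h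
 have dP: "DERIV P s :> A s" if "\<bar>s\<bar> < 1" for s unfolding P_def A_def by (rule P[OF that])
 have dA: "DERIV A s :> B s" if "\<bar>s\<bar> < 1" for s
  unfolding A_def B_def using that by (auto intro!: derivative_eq_intros Q)
 \<comment> \<open>Only existence is needed: at 0 the value is multiplied by \<open>P 0\<close>,
   which is zero.\<close>
 have dB: "\<exists>B'. DERIV B 0 :> B'"
  unfolding B_def by (rule exI) (rule DERIV_cmult DERIV_divide DERIV_add DERIV_const DERIV_ident Q | simp)+
 then obtain B' where dB: "DERIV B 0 :> B'" by blast
 have v: "P 0 = 0" "A 0 = real n" "B 0 = - real n*(real n-1)" by (simp_all add: P_def A_def B_def mq_1 mphi_1)
 show "((%h. mT n (1+h)/h ^ 2) \<longlongrightarrow> real n/2) (at 0)"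
  by (rule quadratic_limit[OF zero_less_one, where ?f1.0=P]) (use T dP[of 0] v mT_1[OF n] in \<open>auto simp: P_def\<close>)
 have d1: "DERIV (%h. (P h)^2-2*real n*mT n (1+h)) s :> 2*(P s*A s)-2*real n*P s" if "\<bar>s\<bar> < 1" for s
  using dP[OF that] T[OF that, folded P_def] by (auto intro!: derivative_eq_intros)
 have d2: "DERIV (%s. 2*(P s*A s)-2*real n*P s) s :> 2*(A s*A s+P s*B s)-2*real n*A s" if "\<bar>s\<bar> < 1" for s
  using dP[OF that] dA[OF that] by (auto intro!: derivative_eq_intros)
 have "DERIV (%s. 2*(A s*A s+P s*B s)-2*real n*A s) 0 :> 2*(2*(A 0*B 0)+(A 0*B 0+P 0*B'))-2*real n*B 0"
  using dP[of 0] dA[of 0] dB by (auto intro!: derivative_eq_intros)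
 then have d3: "DERIV (%s. 2*(A s*A s+P s*B s)-2*real n*A s) 0 :> -4*(real n)^2*(real n-1)"
  unfolding v by (simp add: power2_eq_square algebra_simps)
 have "((%h. ((P h)^2-2*real n*mT n (1+h))/h ^ 3) \<longlongrightarrow> (- 4*(real n)^2*(real n-1))/6) (at 0)"
  by (rule cubic_limit[OF zero_less_one d1 d2 d3]) (simp_all add: v mT_1[OF n])
 then show "((%h. ((mphi n (1+h))^2-2*real n*mT n (1+h))/h ^ 3) \<longlongrightarrow> -(2/3)*(real n)^2*(real n-1)) (at 0)"
  by (simp add: P_def mult_ac)
qed

text \<open>The square of the boundary stress tau of the model whose boundary component has radius y
  times the core radius: squared gradient over twice the maximum, in units of the core
  radius.\<close>

definition mratio :: "nat => real => real" where "mratio n y = (mphi n y)^2/(2*mT n y)"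
text \<open>The core radius R of the normalised model that has a boundary component at radius R y,
  obtained by solving f_R(R y) = 0 for R.\<close>

definition mR :: "nat => real => real" where "mR n y = 1/sqrt (2*mT n y+real n/(real n-2))"

lemma positive_off_one:
 fixes D D' :: "real => real"
 assumes d: "!!y. y > 0 ==> DERIV D y :> D' y" and D1: "D 1 = 0"
 shows "(!!y. y > 1 ==> D' y < 0) ==> y > 1 ==> D y < 0" "(!!y. 0 < y ==> y < 1 ==> D' y < 0) ==> 0 < y ==> y < 1 ==> 0 < D y"
proof -
 have c: "continuous_on {a..b} D" if "0 < a" for a b
 proof (rule continuous_at_imp_continuous_on, rule ballI)
  fix x assume "x \<in> {a..b}"
  then show "isCont D x" using d[of x] DERIV_isCont that by simp
 qed
 show "D y < 0" if "!!y. y > 1 ==> D' y < 0" "y > 1"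
 proof -
  have ex: "\<exists>z. DERIV D x :> z & z < 0" if "1 < x" "x < y" for x
   using d[of x] \<open>!!y. y > 1 ==> D' y < 0\<close>[of x] that by (intro exI[of _ "D' x"]) auto
  have "D y < D 1" by (rule DERIV_neg_imp_decreasing_open[OF that(2) ex c]) simp_all
  then show ?thesis by (simp add: D1)
 qed
 show "0 < D y" if "!!y. 0 < y ==> y < 1 ==> D' y < 0" "0 < y" "y < 1"
 proof -
  have ex: "\<exists>z. DERIV D x :> z & z < 0" if "y < x" "x < 1" for x
   using d[of x] \<open>!!y. 0 < y ==> y < 1 ==> D' y < 0\<close>[of x] that \<open>0 < y\<close> by (intro exI[of _ "D' x"]) auto
  have "D 1 < D y" by (rule DERIV_neg_imp_decreasing_open[OF that(3) ex c]) (use that in simp_all)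
  then show ?thesis by (simp add: D1)
 qed
qed

text \<open>The sign of the derivative is that of phi D with D = 2 phi' T - phi^2. Here D vanishes
  at 1 and decreases, since D' = 2 phi'' T and phi is concave, so D always has the sign opposite to
  phi.\<close>

lemma mratio_deriv:
 assumes n: "n >= 3" and y: "y > 0" "y ~= 1"
 shows "\<exists>d<0. DERIV (mratio n) y :> d"
proof -
 define \<phi>' where "\<phi>' y = 1+(real n-1)*mq n y" for y
 define D where "D y = 2*\<phi>' y*mT n y-(mphi n y)^2" for y
 have "DERIV D y :> 2*((real n-1)*(- real n*mq n y/y))*mT n y" if "y > 0" for y
 proof -
  have "DERIV \<phi>' y :> (real n-1)*(- real n*mq n y/y)"
   unfolding \<phi>'_def using that by (auto intro!: derivative_eq_intros mq_deriv)
  then have "DERIV D y :> (2*((real n-1)*(- real n*mq n y/y)))*mT n y+mphi n y*(2*\<phi>' y)-2*(\<phi>' y*mphi n y)"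
   unfolding D_def[abs_def] using mphi_deriv[OF that, of n, folded \<phi>'_def] mT_deriv[OF n that]
   by (auto intro!: derivative_eq_intros)
  then show ?thesis by simp
 qed
 moreover have "2*((real n-1)*(- real n*mq n y/y))*mT n y < 0" if "y > 0" "y ~= 1" for y
  using that n mq_pos[of y n] mT_pos[of n y] by (auto simp: mult_neg_pos zero_less_mult_iff mult_less_0_iff divide_less_0_iff)
 moreover have "D 1 = 0" by (simp add: D_def mT_1[OF n] mphi_1)
 ultimately have D: "y > 1 ==> D y < 0" "y < 1 ==> 0 < D y"
  using positive_off_one[of D "%y. 2*((real n-1)*(- real n*mq n y/y))*mT n y" y] y by auto
 have T: "mT n y > 0" by (rule mT_pos[OF n y])
 have "DERIV (%y. (mphi n y)^2/(2*mT n y)) y :> ((2*(\<phi>' y*mphi n y))*(2*mT n y)-(mphi n y)^2*(2*mphi n y))/((2*mT n y)*(2*mT n y))"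
  using mphi_deriv[OF y(1), of n] mT_deriv[OF n y(1)] T by (auto intro!: derivative_eq_intros simp: \<phi>'_def)
 moreover have "((2*(\<phi>' y*mphi n y))*(2*mT n y)-(mphi n y)^2*(2*mphi n y))/((2*mT n y)*(2*mT n y)) = mphi n y*D y/(2*(mT n y)^2)"
  using T by (simp add: D_def power2_eq_square field_simps)
 moreover have "mphi n y*D y/(2*(mT n y)^2) < 0"
  using D mphi_sign[OF n y(1)] y T by (auto simp: divide_less_0_iff mult_less_0_iff linorder_neq_iff)
 ultimately show ?thesis unfolding mratio_def[abs_def] by auto
qed

lemma mratio_strict:
 assumes n: "n >= 3" and ab: "0 < a" "a < b" "b < 1 \<or> 1 < a"
 shows "mratio n b < mratio n a"
proof (rule DERIV_neg_imp_decreasing[OF ab(2)])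
 show "\<exists>d. DERIV (mratio n) x :> d & d < 0" if "a <= x" "x <= b" for x
  using mratio_deriv[OF n, of x] that ab by auto
qed

lemma mratio_cont: assumes n: "n >= 3" and S: "S \<subseteq> {0<..}" "1 \<notin> S" shows "continuous_on S (mratio n)"
proof (rule continuous_at_imp_continuous_on, rule ballI)
 fix x assume "x \<in> S"
 then have "x > 0" "x ~= 1" using S by auto
 then show "isCont (mratio n) x" using mratio_deriv[OF n] DERIV_isCont by blast
qed

text \<open>The difference phi^2 - 2nT vanishes at 1 and has derivative 2(n-1) phi (q-1), a product
  of factors of opposite sign. The value n separates inner from outer boundaries.\<close>

lemma mratio_bounds:
 assumes n: "n >= 3" and y: "y > 0"
 shows "1 < y ==> mratio n y < real n" "y < 1 ==> real n < mratio n y"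
proof -
 define D where "D y = (mphi n y)^2-2*real n*mT n y" for y
 have "DERIV D y :> 2*(real n-1)*(mphi n y*(mq n y-1))" if "y > 0" for y
 proof -
  have "DERIV D y :> 2*((1+(real n-1)*mq n y)*mphi n y)-2*real n*mphi n y"
   unfolding D_def[abs_def] using mphi_deriv[OF that, of n] mT_deriv[OF n that] by (auto intro!: derivative_eq_intros)
  then show ?thesis by (simp add: algebra_simps)
 qed
 moreover have "2*(real n-1)*(mphi n y*(mq n y-1)) < 0" if "y > 0" "y ~= 1" for y
  using that n mq_sign[OF n that(1)] mphi_sign[OF n that(1)] by (auto simp: mult_less_0_iff linorder_neq_iff)
 moreover have "D 1 = 0" by (simp add: D_def mT_1[OF n] mphi_1)
 ultimately have "y > 1 ==> D y < 0" "y < 1 ==> 0 < D y"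
  using positive_off_one[of D "%y. 2*(real n-1)*(mphi n y*(mq n y-1))" y] y by auto
 then show "1 < y ==> mratio n y < real n" "y < 1 ==> real n < mratio n y"
  using mT_pos[OF n y] by (simp_all add: mratio_def D_def divide_less_eq less_divide_eq mult_ac)
qed

lemma mratio_near_one:
 assumes n: "n >= 3" shows "((%h. mratio n (1+h)) \<longlongrightarrow> real n) (at 0)"
proof -
 have "((%h. real n+h*(((mphi n (1+h))^2-2*real n*mT n (1+h))/h ^ 3)/(2*(mT n (1+h)/h ^ 2))) \<longlongrightarrow> real n+0*(- (2/3)*(real n)^2*(real n-1))/(2*(real n/2))) (at 0)"
  by (intro tendsto_intros model_limits[OF n]) (use n in auto)
 moreover have "\<forall>\<^sub>F h in at 0. real n+h*(((mphi n (1+h))^2-2*real n*mT n (1+h))/h ^ 3)/(2*(mT n (1+h)/h ^ 2)) = mratio n (1+h)"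
 proof -
  have "\<forall>\<^sub>F h in at (0::real). h ~= 0 & \<bar>h\<bar> < 1" by (auto simp: eventually_at intro!: exI[of _ 1])
  then show ?thesis
  proof (rule eventually_mono)
   fix h :: real assume h: "h ~= 0 & \<bar>h\<bar> < 1"
   then have "mT n (1+h) > 0" by (intro mT_pos[OF n]) auto
   then show "real n+h*(((mphi n (1+h))^2-2*real n*mT n (1+h))/h ^ 3)/(2*(mT n (1+h)/h ^ 2)) = mratio n (1+h)"
    using h by (simp add: mratio_def power2_eq_square power3_eq_cube field_simps)
  qed
 qed
 ultimately show ?thesis using tendsto_cong by fastforce
qed

lemma mratio_surj:
 assumes n: "n >= 3"
 shows "1 < t ==> t < real n ==> \<exists>y>1. mratio n y = t" "real n < t ==> \<exists>y. 0 < y & y < 1 & mratio n y = t"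
proof -
 show "\<exists>y>1. mratio n y = t" if t: "1 < t" "t < real n"
 proof -
  from order_tendstoD(1)[OF mratio_near_one[OF n] t(2)] obtain d where d: "d > 0" "!!h. h ~= 0 ==> \<bar>h\<bar> < d ==> t < mratio n (1+h)"
   by (auto simp: eventually_at)
  define a where "a = 1+min (d/2) 1"
  have a: "1 < a" "a <= 2" "t < mratio n a" using d(1) d(2)[of "min (d/2) 1"] by (auto simp: a_def)
  \<comment> \<open>Far out phi^2 <= b^2 and 2T >= b^2 - n, so it suffices that b^2(t-1) > tn, and
    b^2 >= b.\<close>
  define b where "b = 2+t*real n/(t-1)+real n"
  have tn: "0 <= t*real n/(t-1)" using t by simp
  have b: "b >= 2" "b > t*real n/(t-1)" "b > real n" using tn by (simp_all add: b_def)
  have bb: "b*1 <= b^2" unfolding power2_eq_square using b by (intro mult_left_mono) auto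
  have "mratio n b < t"
  proof -
   have q: "0 < mq n b" "mq n b < 1" using mq_pos[of b n] mq_sign(1)[OF n, of b] b by auto
   have "(mphi n b)^2 <= b^2" unfolding mphi_def power_mult_distrib using q by (simp add: mult_left_le power_le_one)
   moreover have "b^2-real n <= 2*mT n b"
   proof -
    have "real n/(real n-2) <= real n" using n by (simp add: field_simps)
    moreover have "0 <= b^2*mq n b/(real n-2)" using n q by simp
    moreover have h: "real n/(2*(real n-2)) = real n/(real n-2)/2" by simp
    moreover have "c <= N ==> 0 <= X ==> B-N <= 2*(B/2+X-c/2)" for c N X B :: real by simp
    ultimately show ?thesis unfolding mT_def h by blast
   qed
   moreover have "b^2 < t*(b^2-real n)"
   proof -
    have "t*real n/(t-1) < b^2" using b bb by linarith
    then have "t*real n < b^2*(t-1)" using t by (simp add: pos_divide_less_eq)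
    then show ?thesis by (simp add: algebra_simps)
   qed
   moreover have "t*(b^2-real n) <= t*(2*mT n b)" using calculation(2) t by (intro mult_left_mono) auto
   ultimately have "(mphi n b)^2 < t*(2*mT n b)" by linarith
   moreover have "mT n b > 0" using b by (intro mT_pos[OF n]) auto
   ultimately show ?thesis by (simp add: mratio_def divide_less_eq)
  qed
  moreover have "continuous_on {a..b} (mratio n)" by (rule mratio_cont[OF n]) (use a in auto)
  ultimately obtain y where "a <= y" "mratio n y = t" using IVT2'[of "mratio n" b t a] a b by auto
  then show ?thesis using a by (intro exI[of _ y]) auto
 qed
 show "\<exists>y. 0 < y & y < 1 & mratio n y = t" if t: "real n < t"
 proof -
  from order_tendstoD(2)[OF mratio_near_one[OF n] t] obtain d where d: "d > 0" "!!h. h ~= 0 ==> \<bar>h\<bar> < d ==> mratio n (1+h) < t"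
   by (auto simp: eventually_at)
  define b where "b = 1-min (d/2) (1/2)"
  have b: "b < 1" "1/2 <= b" "mratio n b < t" using d(1) d(2)[of "- min (d/2) (1/2)"] by (auto simp: b_def)
  \<comment> \<open>Near 0 the singular part dominates: q >= 3t+3 bounds 2T by 3 a^2 q, while phi^2
    = a^2(q-1)^2 exceeds t times that.\<close>
  define a where "a = 1/(3*t+3)"
  have t3: "t > 3" using t n by simp
  then have a: "0 < a" "a < 1/2" by (simp_all add: a_def)
  have "t < mratio n a"
  proof -
   define Q where "Q = mq n a"
   have "(3*t+3) ^ 1 <= (3*t+3) ^ n" using t3 n by (intro power_increasing) auto
   then have Q: "3*t+3 <= Q" by (simp add: Q_def mq_def a_def power_divide)
   have T: "mT n a > 0" using a by (intro mT_pos[OF n]) auto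
   have "2*mT n a <= a^2*(3*Q)"
   proof -
    have "a^2*Q/(real n-2) <= a^2*Q/1" using n Q t3 by (intro divide_left_mono) auto
    moreover have "a^2*1 <= a^2*Q" using Q t3 by (intro mult_left_mono) auto
    moreover have "0 <= real n/(2*(real n-2))" using n by simp
    ultimately show ?thesis unfolding mT_def Q_def[symmetric] by simp
   qed
   then have "t*(2*mT n a) <= t*(a^2*(3*Q))" using t3 by (intro mult_left_mono) auto
   also have "... = a^2*(3*t*Q)" by simp
   also have "... < a^2*(1-Q)^2"
   proof (rule mult_strict_left_mono)
    have "3*t*Q <= (Q-3)*Q" using Q t3 by (intro mult_right_mono) auto
    also have "... < (1-Q)^2" using Q t3 by (simp add: power2_eq_square algebra_simps)
    finally show "3*t*Q < (1-Q)^2" .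
   qed (use a in simp)
   also have "... = (mphi n a)^2" by (simp add: mphi_def Q_def power_mult_distrib)
   finally show ?thesis using T by (simp add: mratio_def less_divide_eq)
  qed
  moreover have "continuous_on {a..b} (mratio n)" by (rule mratio_cont[OF n]) (use a b in auto)
  ultimately obtain y where "a <= y" "y <= b" "mratio n y = t" using IVT2'[of "mratio n" b t a] a b by auto
  then show ?thesis using a b by (intro exI[of _ y]) auto
 qed
qed

text \<open>Rescaling by the core radius separates R from the shape. The zeros of f_R thus
  correspond to the two solutions y of one equation for \<open>mT\<close>, one on each
  branch.\<close>

lemma fR_model:
 assumes n: "n >= 3" and R: "R > 0" and y: "y > 0"
 shows "fR n R (R*y) = 1-R^2*(2*mT n y+real n/(real n-2))"
proof -
 have pn: "z ^ n = z ^ (n-2)*z^2" for z :: real using n power_add[of z "n-2" 2] by (simp only: le_add_diff_inverse2)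
 have e: "2 * R ^ n/((real n-2)*(R*y) ^ (n-2)) = R^2*(2*(y^2*mq n y/(real n-2)))"
  unfolding mq_def pn using R y by (simp add: power_mult_distrib mult_ac)
 have h: "real n/(2*(real n-2)) = real n/(real n-2)/2" by simp
 have "1-(R*y)^2-R^2*(2*X) = 1-R^2*(2*(y^2/2+X-c/2)+c)" for X c by (simp add: power_mult_distrib algebra_simps)
 then show ?thesis unfolding fR_def mT_def h e by blast
qed

lemma mR_denominator: assumes n: "n >= 3" and y: "y > 0" shows "0 < 2*mT n y+real n/(real n-2)"
 using mT_nonneg[OF assms] n by (simp add: add_nonneg_pos)

lemma mR_props:
 assumes n: "n >= 3" and y: "y > 0"
 shows "0 < mR n y" "(mR n y)^2*(2*mT n y+real n/(real n-2)) = 1" "1-real n*(mR n y)^2/(real n-2) = (mR n y)^2*(2*mT n y)"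
proof -
 note d = mR_denominator[OF assms]
 show "0 < mR n y" using d by (simp add: mR_def)
 show 1: "(mR n y)^2*(2*mT n y+real n/(real n-2)) = 1" unfolding mR_def power_divide using d by simp
 show "1-real n*(mR n y)^2/(real n-2) = (mR n y)^2*(2*mT n y)" unfolding 1[symmetric] by (simp add: algebra_simps)
qed

lemma mR_mono: assumes n: "n >= 3" and y: "y > 0" "z > 0" shows "mR n y <= mR n z \<longleftrightarrow> mT n z <= mT n y"
 using mR_denominator[OF n y(1)] mR_denominator[OF n y(2)] by (simp add: mR_def divide_le_eq le_divide_eq)

lemma mR_less_Rmax: assumes n: "n >= 3" and y: "y > 0" "y ~= 1" shows "mR n y < Rmax n"
proof -
 have "mR n 1 = Rmax n" using n by (simp add: mR_def mT_1 Rmax_def real_sqrt_divide)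
 moreover have "\<not> mR n 1 <= mR n y" using mR_mono[OF n zero_less_one y(1)] mT_pos[OF n y] mT_1[OF n] by simp
 ultimately show ?thesis by simp
qed

lemma mR_onto:
 assumes n: "n >= 3" and R: "0 < R" "R < Rmax n" and e: "e \<in> {1, -1}"
 shows "\<exists>y. 0 < y & 0 < e*(y-1) & R = mR n y"
proof -
 define c where "c = real n/(real n-2)"
 define s where "s = (1/R^2-c)/2"
 have "R^2 < (Rmax n)^2" using R by (intro power_strict_mono) auto
 also have "... = (real n-2)/real n" using n by (simp add: Rmax_def)
 finally have s: "s > 0" using n R by (simp add: s_def c_def field_simps)
 define y where "y = mpsi n e s"
 have y: "y > 0" "0 < e*(y-1)" "mT n y = s" unfolding y_def using mpsi_pos[OF n e] mpsi_side(1)[OF n e s] mpsi(2)[OF n e] s by auto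
 have "2*mT n y+real n/(real n-2) = 1/R^2" unfolding y c_def[symmetric] by (simp add: s_def diff_divide_distrib)
 then have "mR n y = R" unfolding mR_def using R by (simp add: real_sqrt_divide)
 then show ?thesis using y by blast
qed

lemma model_radii:
 assumes n: "n >= 3" and y: "y > 0"
 shows "y < 1 ==> r1 n (mR n y) = mR n y*y" "1 < y ==> r2 n (mR n y) = mR n y*y"
proof -
 define R where "R = mR n y"
 note p = mR_props[OF assms, folded R_def]
 have z: "fR n R (R*x) = 0 \<longleftrightarrow> mT n x = mT n y" if "x > 0" for x
 proof -
  have "fR n R (R*x) = R^2*(2*mT n y-2*mT n x)" using fR_model[OF n p(1) that] p(2) by (simp add: algebra_simps)
  then show ?thesis using p(1) by auto
 qed
 show "r1 n R = R*y" if "y < 1"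
  unfolding r1_def
 proof (rule the_equality)
  show "0 < R*y & R*y < R & fR n R (R*y) = 0" using z[OF y] y that p(1) by simp
  fix r assume r: "0 < r & r < R & fR n R r = 0"
  have "r = R*(r/R)" "r/R > 0" "r/R < 1" using r p(1) by auto
  then show "r = R*y" using z[of "r/R"] r mT_inj[OF n, of "-1" "r/R" y] y that by (auto simp: branch_def)
 qed
 show "r2 n R = R*y" if "1 < y"
 proof -
  have "(THE r. R < r & fR n R r = 0) = R*y"
  proof (rule the_equality)
   show "R < R*y & fR n R (R*y) = 0" using z[OF y] y that p(1) by simp
   fix r assume r: "R < r & fR n R r = 0"
   have "r = R*(r/R)" "r/R > 1" using r p(1) by auto
   then show "r = R*y" using z[of "r/R"] r mT_inj[OF n, of 1 "r/R" y] y that by (auto simp: branch_def)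
  qed
  then show ?thesis using p(1) by (simp add: r2_def)
 qed
qed

lemma model_tau:
 assumes n: "n >= 3" and y: "y > 0"
 shows "y < 1 ==> tau1 n (mR n y) = sqrt (mratio n y)" "1 < y ==> tau2 n (mR n y) = sqrt (mratio n y)"
proof -
 define R where "R = mR n y"
 note p = mR_props[OF assms, folded R_def]
 have q: "R ^ n/(R*y) ^ n = mq n y" using p(1) y by (simp add: power_mult_distrib mq_def)
 have s: "sqrt (R^2*(2*mT n y)) = R * sqrt (2*mT n y)" using p(1) by (simp add: real_sqrt_mult)
 have m: "sqrt (mratio n y) = \<bar>mphi n y\<bar>/sqrt (2*mT n y)" by (simp add: mratio_def real_sqrt_divide)
 show "tau1 n R = sqrt (mratio n y)" if y1: "y < 1"
 proof -
  have "R < Rmax n" unfolding R_def using y y1 by (intro mR_less_Rmax[OF n]) auto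
  then have "tau1 n R = R*y*(mq n y-1)/(R * sqrt (2*mT n y))"
   unfolding tau1_def p(3) s using model_radii(1)[OF n y y1, folded R_def] q by simp
  also have "R*y*(mq n y-1) = R*\<bar>mphi n y\<bar>" using mphi_sign(2)[OF n y] y1 by (simp add: mphi_def algebra_simps)
  finally show ?thesis using p(1) m by simp
 qed
 show "tau2 n R = sqrt (mratio n y)" if y1: "1 < y"
 proof -
  have "tau2 n R = R*y*(1-mq n y)/(R * sqrt (2*mT n y))"
   unfolding tau2_def p(3) s using model_radii(2)[OF n y y1, folded R_def] q p(1) by simp
  also have "R*y*(1-mq n y) = R*\<bar>mphi n y\<bar>" using mphi_sign(1)[OF n y] y1 by (simp add: mphi_def)
  finally show ?thesis using p(1) m by simp
 qed
qed

lemma u_model_scaled: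
 assumes n: "n >= 3" and y: "y > 0" and w: "w > 0" and x: "norm (x::'a::euclidean_space) = mR n y*w"
 shows "u_model n (mR n y) x = (mR n y)^2*(mT n y-mT n w)"
proof -
 have "u_model n (mR n y) x = fR n (mR n y) (mR n y*w)/2" unfolding u_model_def fR_def x by (simp add: diff_divide_distrib)
 also have "... = (1-(mR n y)^2*(2*mT n w+real n/(real n-2)))/2" by (simp only: fR_model[OF n mR_props(1)[OF n y] w])
 also have "... = (mR n y)^2*(mT n y-mT n w)"
 proof -
  have "R^2*(2*m+d) = 1 ==> (1-R^2*(2*T+d))/2 = R^2*(m-T)" for R m d T :: real by (simp add: field_simps)
  then show ?thesis using mR_props(2)[OF n y] by blast
 qed
 finally show ?thesis .
qed

lemma sqrt_eq_square: "0 <= t ==> sqrt a = t \<longleftrightarrow> a = (t::real)^2"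
 by auto

text \<open>Reduces the relation to the parameter y, on which the stress is strictly monotone. The
  strict bound 1 < t excludes R = 0, where tau2 takes the value 1 by definition.\<close>

lemma core_radius_outer:
 assumes n: "n >= 3" and t: "1 < t" "t < sqrt (real n)"
 obtains y where "y > 1" "mratio n y = t^2" "!!R. core_radius_rel n t R \<longleftrightarrow> R = mR n y"
proof -
 have "1 < t^2" using t by simp
 moreover have "t^2 < (sqrt (real n))^2" using t by (intro power_strict_mono) auto
 then have "t^2 < real n" by simp
 ultimately obtain y where y: "y > 1" "mratio n y = t^2" using mratio_surj(1)[OF n] by blast
 have "core_radius_rel n t R \<longleftrightarrow> R = mR n y" for R
 proof
  assume "core_radius_rel n t R"
  then have R: "0 <= R" "R < Rmax n" "tau2 n R = t" using t by (auto simp: core_radius_rel_def)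
  then have "R ~= 0" using t by (auto simp: tau2_def)
  then obtain z where z: "0 < z" "1 < z" "R = mR n z" using mR_onto[OF n, of R 1] R by auto
  then have "mratio n z = t^2" using R(3) model_tau(2)[OF n z(1,2)] t sqrt_eq_square[of t] by simp
  then have "z = y" using mratio_strict[OF n, of z y] mratio_strict[OF n, of y z] y z by (cases z y rule: linorder_cases) auto
  then show "R = mR n y" using z by simp
 next
  assume R: "R = mR n y"
  have y0: "y > 0" "y ~= 1" using y by auto
  show "core_radius_rel n t R" unfolding core_radius_rel_def R
   using model_tau(2)[OF n y0(1) y(1)] mR_props(1)[OF n y0(1)] mR_less_Rmax[OF n y0] t y(2) by simp
 qed
 then show ?thesis using that y by blast
qed

lemma core_radius_inner:
 assumes n: "n >= 3" and t: "sqrt (real n) < t"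
 obtains y where "0 < y" "y < 1" "mratio n y = t^2" "!!R. core_radius_rel n t R \<longleftrightarrow> R = mR n y"
proof -
 have t0: "0 < t" using t by (metis real_sqrt_ge_zero le_less_trans of_nat_0_le_iff)
 have "(sqrt (real n))^2 < t^2" using t by (intro power_strict_mono) auto
 then have "real n < t^2" by simp
 then obtain y where y: "0 < y" "y < 1" "mratio n y = t^2" using mratio_surj(2)[OF n] by blast
 have "core_radius_rel n t R \<longleftrightarrow> R = mR n y" for R
 proof
  assume "core_radius_rel n t R"
  then have R: "0 < R" "R <= Rmax n" "tau1 n R = t" using t by (auto simp: core_radius_rel_def)
  then have "R ~= Rmax n" using t by (auto simp: tau1_def)
  then obtain z where z: "0 < z" "z < 1" "R = mR n z" using mR_onto[OF n, of R "-1"] R by auto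
  then have "mratio n z = t^2" using R(3) model_tau(1)[OF n z(1,2)] t0 sqrt_eq_square[of t] by simp
  then have "z = y" using mratio_strict[OF n, of z y] mratio_strict[OF n, of y z] y z by (cases z y rule: linorder_cases) auto
  then show "R = mR n y" using z by simp
 next
  assume R: "R = mR n y"
  have y1: "y ~= 1" using y by auto
  show "core_radius_rel n t R" unfolding core_radius_rel_def R
   using model_tau(1)[OF n y(1,2)] mR_props(1)[OF n y(1)] mR_less_Rmax[OF n y(1) y1] t t0 y(3) by simp
 qed
 then show ?thesis using that y by blast
qed

lemma core_radius_exists_unique:
 assumes n: "n >= 3" and t: "1 < t" shows "\<exists>!R. core_radius_rel n t R"
proof (cases t "sqrt (real n)" rule: linorder_cases)
 case less then show ?thesis using core_radius_outer[OF n t] by metis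
next
 case greater then show ?thesis using core_radius_inner[OF n] by metis
next
 case equal
 \<comment> \<open>In this borderline case the core is itself the boundary, y = 1, which the ratio
   attains only as a limit; it is the separate clause of tau1.\<close>
 have "core_radius_rel n t R \<longleftrightarrow> R = Rmax n" for R
 proof
  assume "core_radius_rel n t R"
  then have R: "0 < R" "R <= Rmax n" "tau1 n R = t" using equal by (auto simp: core_radius_rel_def)
  show "R = Rmax n"
  proof (rule ccontr)
   assume "R ~= Rmax n"
   then obtain z where z: "0 < z" "z < 1" "R = mR n z" using mR_onto[OF n, of R "-1"] R by auto
   then have "mratio n z = real n" using R(3) model_tau(1)[OF n z(1,2)] equal by simp
   then show False using mratio_bounds(2)[OF n z(1,2)] by simp
  qed
 next
  assume "R = Rmax n"
  then show "core_radius_rel n t R" using n equal by (simp add: core_radius_rel_def tau1_def Rmax_def)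
 qed
 then show ?thesis by simp
qed

text \<open>The derivatives of order \<open>j\<close> of the squared gradient of the model as a function of its depth.\<close>
definition mprofile :: "nat => real => real => nat => real => real" where
 "mprofile n e \<rho> j t = (let y = mpsi n e (t/\<rho>^2) in
  if j = 0 then \<rho>^2*(mphi n y)^2 else if j = 1 then 2*(1+(real n-1)*mq n y)
  else -2*real n*(real n-1)*mq n y/(\<rho>^2*(y*mphi n y)))"

lemma mprofile_nonneg: "0 <= mprofile n e \<rho> 0 t"
 by (simp add: mprofile_def Let_def)

context
 fixes n :: nat and e \<rho> :: real
 assumes n: "n >= 3" and e: "e \<in> {1, -1}" and \<rho>: "\<rho> > 0"
begin

lemma scaled_mpsi_pos: "t >= 0 ==> 0 < mpsi n e (t/\<rho>^2)"
 by (rule mpsi_pos[OF n e]) simp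

lemma scaled_mphi_nonzero: "t > 0 ==> mphi n (mpsi n e (t/\<rho>^2)) ~= 0"
 using mpsi_side(2)[OF n e, of "t/\<rho>^2"] \<rho> by auto

lemma scaled_mpsi_deriv:
 assumes "t > 0"
 shows "DERIV (%t. mpsi n e (t/\<rho>^2)) t :> 1/(\<rho>^2*mphi n (mpsi n e (t/\<rho>^2)))"
proof -
 have "t/\<rho>^2 > 0" using assms \<rho> by simp
 from DERIV_chain2[OF mpsi_deriv[OF n e this] DERIV_cdivide[OF DERIV_ident]] show ?thesis by (simp add: mult.commute)
qed

lemma scaled_mq_deriv:
 assumes t: "t > 0"
 shows "((%t. mq n (mpsi n e (t/\<rho>^2))) has_real_derivative
  - real n*mq n (mpsi n e (t/\<rho>^2))/(\<rho>^2*(mpsi n e (t/\<rho>^2)*mphi n (mpsi n e (t/\<rho>^2))))) (at t)"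
 using DERIV_chain2[OF mq_deriv[OF scaled_mpsi_pos] scaled_mpsi_deriv[OF t], of n] t by (simp add: mult_ac)

lemma scaled_mpsi_continuous: "continuous_on {0..b} (%t. mpsi n e (t/\<rho>^2))"
 by (rule continuous_on_compose2[OF mpsi_continuous[OF n e, of "b/\<rho>^2"]])
  (use \<rho> in \<open>auto intro!: continuous_intros divide_right_mono\<close>)

lemma scaled_mq_continuous: "continuous_on {0..b} (%t. mq n (mpsi n e (t/\<rho>^2)))"
proof (rule continuous_on_compose2[OF _ scaled_mpsi_continuous])
 show "continuous_on {0<..} (mq n)" unfolding mq_def[abs_def] by (intro continuous_intros) auto
qed (use scaled_mpsi_pos in auto)

lemma mprofile_deriv:
 assumes j: "j < 2" and t: "t > 0"
 shows "DERIV (mprofile n e \<rho> j) t :> mprofile n e \<rho> (Suc j) t"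
proof (cases "j = 0")
 case True
 define y where "y = mpsi n e (t/\<rho>^2)"
 have y: "y > 0" "mphi n y ~= 0" unfolding y_def using scaled_mpsi_pos scaled_mphi_nonzero t by auto
 have "DERIV (%t. mphi n (mpsi n e (t/\<rho>^2))) t :> (1+(real n-1)*mq n y)*(1/(\<rho>^2*mphi n y))"
  unfolding y_def by (rule DERIV_chain2[OF mphi_deriv scaled_mpsi_deriv[OF t]]) (use y in \<open>simp add: y_def\<close>)
 from DERIV_cmult[OF DERIV_power[OF this, of 2], of "\<rho>^2"] show ?thesis
  using True y \<rho> by (simp add: mprofile_def[abs_def] Let_def y_def[symmetric] mult_ac)
next
 case False
 then have "j = 1" using j by simp
 define c where "c = real n-1"
 from DERIV_cmult[OF DERIV_add[OF DERIV_const[of 1] DERIV_cmult[OF scaled_mq_deriv[OF t], of c]], of 2]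
 show ?thesis using \<open>j = 1\<close> by (simp add: mprofile_def[abs_def] Let_def c_def[symmetric] mult_ac)
qed

lemma mprofile_continuous: "continuous_on {0..b} (mprofile n e \<rho> 0)" "continuous_on {0<..<b} (mprofile n e \<rho> 2)"
proof -
 show "continuous_on {0..b} (mprofile n e \<rho> 0)" unfolding mprofile_def[abs_def] Let_def mphi_def
  by (simp, intro continuous_intros scaled_mpsi_continuous scaled_mq_continuous)
 have sub: "{0<..<b} \<subseteq> {0..b}" by auto
 note c = continuous_on_subset[OF scaled_mpsi_continuous sub] continuous_on_subset[OF scaled_mq_continuous sub]
 have "continuous_on {0<..<b} (%t. mphi n (mpsi n e (t/\<rho>^2)))" unfolding mphi_def by (intro continuous_intros c)
 note c' = c this
 have "mpsi n e (t/\<rho>^2) ~= 0" if "t > 0" for t using scaled_mpsi_pos[of t] that by simp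
 then show "continuous_on {0<..<b} (mprofile n e \<rho> 2)" unfolding mprofile_def[abs_def] Let_def
  by (simp, intro continuous_intros c') (use \<rho> scaled_mphi_nonzero in auto)
qed

text \<open>The term of the comparison equation that depends on the profile alone vanishes for the
  model. It is an ordinary differential equation for the squared gradient as a function of depth,
  free of the core radius.\<close>

lemma mprofile_balanced:
 assumes t: "t > 0"
 shows "2*real n/(real n-1)*(mprofile n e \<rho> 1 t/2-1)*(mprofile n e \<rho> 1 t/2-real n) = mprofile n e \<rho> 2 t*mprofile n e \<rho> 0 t"
proof -
 define y where "y = mpsi n e (t/\<rho>^2)"
 have y: "y > 0" "mphi n y ~= 0" unfolding y_def using scaled_mpsi_pos scaled_mphi_nonzero t by auto
 have 5: "2*(1+(real n-1)*mq n y)/2-1 = (real n-1)*mq n y" "2*(1+(real n-1)*mq n y)/2-real n = (real n-1)*(mq n y-1)"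
  by (simp_all add: field_simps)
 have "2*real n/(real n-1)*((real n-1)*mq n y)*((real n-1)*(mq n y-1)) = 2*real n*mq n y*((real n-1)*(mq n y-1))"
  using n by simp
 also have "... = - 2*real n*(real n-1)*mq n y*(1-mq n y)" by (simp add: algebra_simps)
 also have "... = - 2*real n*(real n-1)*mq n y/(\<rho>^2*(y*mphi n y))*(\<rho>^2*(mphi n y)^2)"
 proof -
  have "1-mq n y = mphi n y/y" using y by (simp add: mphi_def)
  then show ?thesis using y \<rho> by (simp add: power2_eq_square)
 qed
 finally have "2*real n/(real n-1)*((real n-1)*mq n y)*((real n-1)*(mq n y-1))
  = - 2*real n*(real n-1)*mq n y/(\<rho>^2*(y*mphi n y))*(\<rho>^2*(mphi n y)^2)" .
 moreover have "mprofile n e \<rho> 1 t = 2*(1+(real n-1)*mq n y)" "mprofile n e \<rho> 0 t = \<rho>^2*(mphi n y)^2"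
  "mprofile n e \<rho> 2 t = - 2*real n*(real n-1)*mq n y/(\<rho>^2*(y*mphi n y))"
  by (simp_all add: mprofile_def Let_def y_def)
 ultimately show ?thesis by (simp only: 5)
qed

end

section \<open>Comparison with the model\<close>

text \<open>At a zero touched from inside by a ball of negative values, a small multiple of the Gaussian barrier
 $e^{-k|x-c|^2} - e^{-k\rho^2}$ can be added without losing the interior maximum.\<close>
lemma strong_maximum:
 fixes h :: "'a::euclidean_space => real"
 assumes C: "Ck_on 2 (ball x0 R) h" and R: "R > 0" and K: "K >= 0"
  and le: "!!y. y \<in> ball x0 R ==> h y <= 0" and h0: "h x0 = 0"
  and ineq: "!!y. y \<in> ball x0 R ==> \<exists>\<nu>. norm \<nu> = 1 &-K*(\<bar>pd \<nu> h y\<bar>+\<bar>h y\<bar>) <= laplacian h y"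
  and x1: "x1 \<in> ball x0 (R/4)"
 shows "h x1 = 0"
proof (rule ccontr)
 assume "h x1 ~= 0"
 have hc: "continuous_on (ball x0 R) h" using Ck_on_le[OF open_ball C, of 0] by simp
 define Z where "Z = {y \<in> cball x0 (R/2). h y = 0}"
 have sub: "cball x0 (R/2) \<subseteq> ball x0 R" using R by auto
 have "closed Z" unfolding Z_def
  using continuous_closed_preimage_constant[OF continuous_on_subset[OF hc sub] closed_cball, of 0] by simp
 moreover have x0Z: "x0 \<in> Z" using h0 R by (simp add: Z_def)
 then have "Z ~= {}" by blast
 ultimately obtain z where z: "z \<in> Z" "infdist x1 Z = dist x1 z" using infdist_attains_inf by blast
 define d where "d = dist x1 z"
 have d4: "d < R/4"
 proof -
  have "d <= dist x1 x0" unfolding d_def z(2)[symmetric] by (rule infdist_le[OF x0Z])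
  then show ?thesis using x1 by (simp add: dist_commute)
 qed
 have d0: "d > 0" using z(1) \<open>h x1 ~= 0\<close> by (auto simp: d_def Z_def)
 have neg: "h y < 0" if "dist x1 y < d" for y
 proof -
  have "dist x0 y <= dist x0 x1+dist x1 y" by (rule dist_triangle)
  then have y: "dist x0 y < R/2" using x1 that d4 by simp
  have "y \<notin> Z" using that infdist_le[of y Z x1] z(2) by (auto simp: d_def)
  then have "h y ~= 0" using y by (simp add: Z_def)
  moreover have "y \<in> ball x0 R" using y R by simp
  ultimately show ?thesis using le[of y] by simp
 qed
 \<comment> \<open>Halving the ball around x1 that first meets the zero set gives an interior ball
   whose closure meets it at z only.\<close>
 define c where "c = (1/2) *R (x1+z)"
 define \<rho> where "\<rho> = d/2"
 define \<delta> where "\<delta> = \<rho>/2"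
 have \<rho>: "\<rho> > 0" using d0 by (simp add: \<rho>_def)
 have cz: "norm (z-c) = \<rho>" "norm (c-x1) = \<rho>"
 proof -
  have "z-c = (1/2) *R (z-x1)" "c-x1 = (1/2) *R (z-x1)"
   by (simp_all add: c_def algebra_simps flip: scaleR_add_left)
  then show "norm (z-c) = \<rho>" "norm (c-x1) = \<rho>" by (simp_all add: \<rho>_def d_def dist_norm norm_minus_commute)
 qed
 have touch: "h y < 0" if y: "norm (y-c) <= \<rho>" "y ~= z" for y
 proof (rule neg)
  have "dist x1 y <= norm (y-c)+norm (c-x1)" using norm_triangle_ineq[of "y-c" "c-x1"] by (simp add: dist_norm norm_minus_commute)
  then have "dist x1 y <= d" using y(1) cz by (simp add: \<rho>_def)
  moreover have "dist x1 y ~= d"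
  proof
   assume eq: "dist x1 y = d"
   \<comment> \<open>Equality in the triangle inequality would be needed; the parallelogram law
     turns it into a = b, that is y = z.\<close>
   define a b where "a = y-c" and "b = c-x1"
   have "norm (a+b) = 2*\<rho>" using eq by (simp add: a_def b_def dist_norm norm_minus_commute \<rho>_def)
   then have "(norm (a+b))^2 = 4*\<rho>^2" by (simp add: power_mult_distrib)
   moreover have nb: "norm b = \<rho>" "norm a <= \<rho>" using cz y(1) by (simp_all add: a_def b_def)
   moreover have "(norm (a+b))^2+(norm (a-b))^2 = 2*(norm a)^2+2*(norm b)^2"
    by (simp add: power2_norm_eq_inner inner_simps inner_commute)
   moreover have "(norm a)^2 <= \<rho>^2" using nb by (intro power_mono) auto
   ultimately have "(norm (a-b))^2 <= 0" unfolding nb(1) by linarith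
   then have "a = b" by simp
   then have "y = z" unfolding a_def b_def c_def by (simp add: algebra_simps flip: scaleR_add_left)
   then show False using y(2) by simp
  qed
  ultimately show "dist x1 y < d" by simp
 qed
 have zx: "dist x0 z < R/2"
  using dist_triangle[of x0 z x1] d4 x1 by (simp add: d_def)
 have B: "cball z \<delta> \<subseteq> ball x0 R"
 proof
  fix y assume "y \<in> cball z \<delta>"
  then show "y \<in> ball x0 R" using dist_triangle[of x0 y z] zx d4 d0 by (simp add: \<delta>_def \<rho>_def)
 qed
 define n where "n = real DIM('a)"
 \<comment> \<open>At distance at least \<rho>/2 from c the leading part 4 k^2 |y-c|^2 of the
   Laplacian of the Gaussian then beats 2nk and the contribution of the lower-order terms, which
   involve |y-c| <= 2\<rho>.\<close>
 define k where "k = 1+(2*n+K*(4*\<rho>+1))/\<rho>^2"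
 have k: "k >= 1" "2*n+K*(4*\<rho>+1) < k*\<rho>^2"
 proof -
  show "k >= 1" using K \<rho> by (simp add: k_def n_def)
  have "k*\<rho>^2 = \<rho>^2+(2*n+K*(4*\<rho>+1))" using \<rho> by (simp add: k_def field_simps)
  then show "2*n+K*(4*\<rho>+1) < k*\<rho>^2" using \<rho> by simp
 qed
 define F where "F j s = (if j = 0 then exp (- k * s)-exp (- k*\<rho>^2) else (- k) ^ j*exp (- k * s))" for j :: nat and s
 have Fd: "DERIV (F j) s :> F (Suc j) s" for j s
  unfolding F_def[abs_def] by (cases "j = 0") (auto intro!: derivative_eq_intros)
 define s where "s y = (y-c) \<bullet> (y-c)" for y
 have sn: "s y = (norm (y-c))^2" for y by (simp add: s_def power2_norm_eq_inner)
 define g where "g y = F 0 (s y)" for y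
 have gC: "Ck_on 2 (ball x0 R) g" unfolding g_def s_def
  by (rule Ck_on_compose_real[OF open_ball Ck_on_dist_square[OF open_ball], where T=UNIV]) (auto intro: Fd DERIV_continuous_on[OF DERIV_subset[OF Fd]])
 have gp: "frechet_derivative g (at y) = (%v. 2*((y-c) \<bullet> v)*F 1 (s y))" "laplacian g y = 2*n*F 1 (s y)+4 * s y*F 2 (s y)" for y
  unfolding g_def s_def n_def by (rule laplacian_radial[of UNIV F]; use Fd in simp)+
 define K1 where "K1 = sphere z \<delta> \<inter> cball c \<rho>"
 have K1c: "compact K1" unfolding K1_def by (intro compact_Int_closed compact_sphere closed_cball)
 obtain m where m: "m > 0" "!!y. y \<in> K1 ==> h y <=-m"
 proof (cases "K1 = {}")
  case True then show ?thesis using that[of 1] by simp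
 next
  case False
  have "K1 \<subseteq> ball x0 R" using B by (auto simp: K1_def)
  then obtain w where w: "w \<in> K1" "!!y. y \<in> K1 ==> h y <= h w"
   using continuous_attains_sup[OF K1c False continuous_on_subset[OF hc]] by blast
  have "h w < 0" by (rule touch) (use w(1) \<rho> in \<open>auto simp: K1_def \<delta>_def dist_norm norm_minus_commute\<close>)
  then show ?thesis using that[of "- h w"] w(2) by simp
 qed
 \<comment> \<open>The barrier is at most 1, so on the part of the sphere inside the ball around c
   the sum stays below -m/2; on the rest the barrier itself is negative.\<close>
 define \<epsilon> where "\<epsilon> = m/2"
 have \<epsilon>: "\<epsilon> > 0" using m by (simp add: \<epsilon>_def)
 define f where "f y = h y+\<epsilon>*g y" for y
 have fC: "Ck_on 2 (ball x0 R) f" unfolding f_def by (intro Ck_on_add Ck_on_cmult open_ball C gC)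
 have g1: "g y <= 1" for y
 proof -
  have "exp (- k * s y) <= 1" using k by (simp add: sn)
  then show ?thesis unfolding g_def F_def if_P[OF refl] using exp_gt_zero[of "- k*\<rho>^2"] by linarith
 qed
 have bd: "f y < 0" if y: "dist z y = \<delta>" for y
 proof (cases "norm (y-c) <= \<rho>")
  case True
  then have "h y <=-m" using y by (intro m(2)) (simp add: K1_def dist_norm norm_minus_commute)
  moreover have "\<epsilon>*g y <= \<epsilon>*1" using g1 \<epsilon> by (intro mult_left_mono) auto
  ultimately show ?thesis unfolding f_def using m(1) \<epsilon>_def by linarith
 next
  case False
  then have "\<rho>^2 < s y" unfolding sn using \<rho> by (intro power_strict_mono) auto
  then have "g y < 0" using k by (simp add: g_def F_def)
  then have "\<epsilon>*g y < 0" using \<epsilon> by (simp add: mult_pos_neg)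
  moreover have "h y <= 0" using le B y by auto
  ultimately show ?thesis by (simp add: f_def)
 qed
 have fc: "continuous_on (cball z \<delta>) f" using continuous_on_subset[OF _ B] Ck_on_le[OF open_ball fC, of 0] by simp
 have "cball z \<delta> ~= {}" using \<rho> by (simp add: \<delta>_def)
 from continuous_attains_sup[OF compact_cball this fc] obtain y where y: "y \<in> cball z \<delta>" "!!w. w \<in> cball z \<delta> ==> f w <= f y" by blast
 have "f z = 0" using z(1) cz(1) by (simp add: f_def g_def F_def sn Z_def)
 then have fy: "0 <= f y" using y(2)[of z] \<rho> by (simp add: \<delta>_def)
 have "dist z y ~= \<delta>" using bd[of y] fy by auto
 then have yb: "y \<in> ball z \<delta>" using y(1) by auto
 have yR: "y \<in> ball x0 R" using y(1) B by blast
 obtain r where r: "r > 0" "ball y r \<subseteq> ball z \<delta>" using open_contains_ball yb open_ball by blast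
 have mx: "f w <= f y" if "w \<in> ball y r" for w
 proof -
  have "w \<in> ball z \<delta>" using that r by blast
  then show ?thesis using y(2) by simp
 qed
 have dh: "h differentiable at y" using Ck_on_Suc_diff[OF open_ball, of 1] C yR by (simp add: numeral_2_eq_2)
 have dg: "g differentiable at y" using Ck_on_Suc_diff[OF open_ball, of 1] gC yR by (simp add: numeral_2_eq_2)
 have "frechet_derivative f (at y) = (%v. pd v h y+\<epsilon>*pd v g y)"
  unfolding f_def by (intro frechet_derivative_eqI has_derivative_add has_derivative_mult_right has_derivative_frechet dh dg)
 moreover have "pd v f y = 0" for v by (rule local_max_second_derivative(1)[OF open_ball fC yR r(1) mx])
 ultimately have ph: "pd v h y = - \<epsilon>*(2*((y-c) \<bullet> v)*F 1 (s y))" for v by (simp add: gp add_eq_0_iff)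
 have le_s: "\<rho>/2 <= norm (y-c)" "norm (y-c) <= 2*\<rho>"
  using norm_triangle_ineq[of "y-z" "z-c"] norm_triangle_ineq[of "z-y" "y-c"] yb cz(1) by (simp_all add: \<delta>_def dist_norm norm_minus_commute)
 define E where "E = exp (- k * s y)"
 have E: "E > 0" by (simp add: E_def)
 have F12: "F 1 (s y) = - k*E" "F 2 (s y) = k^2*E" by (simp_all add: F_def E_def)
 have lf: "laplacian h y+\<epsilon>*laplacian g y <= 0"
 proof -
  have "laplacian f y <= 0" by (rule local_max_second_derivative(2)[OF open_ball fC yR r(1) mx])
  moreover have "laplacian f y = laplacian h y+laplacian (%y. \<epsilon>*g y) y"
   unfolding f_def by (rule laplacian_add[OF open_ball C Ck_on_cmult[OF open_ball gC] yR])
  moreover have "laplacian (%y. \<epsilon>*g y) y = \<epsilon>*laplacian g y"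
  proof -
   have ig: "(%y. \<epsilon>*g y) = (%y. (%j s. \<epsilon>*F j s) 0 ((y-c) \<bullet> (y-c)))" by (simp add: g_def s_def)
   have "laplacian (%y. (%j s. \<epsilon>*F j s) 0 ((y-c) \<bullet> (y-c))) y = 2*n*(\<epsilon>*F 1 (s y))+4 * s y*(\<epsilon>*F 2 (s y))"
    unfolding s_def n_def by (rule laplacian_radial(2)[of UNIV "%j s. \<epsilon>*F j s"]) (auto intro: DERIV_cmult Fd)
   then show ?thesis unfolding ig by (simp add: gp algebra_simps)
  qed
  ultimately show ?thesis by simp
 qed
 obtain \<nu> where \<nu>: "norm \<nu> = 1" "- K*(\<bar>pd \<nu> h y\<bar>+\<bar>h y\<bar>) <= laplacian h y" using ineq[OF yR] by blast
 have "\<bar>pd \<nu> h y\<bar> = \<epsilon>*(2*k*E)*\<bar>(y-c) \<bullet> \<nu>\<bar>" unfolding ph F12 using \<epsilon> k E by (simp add: abs_mult)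
 also have "... <= \<epsilon>*(2*k*E)*(2*\<rho>)"
  using Cauchy_Schwarz_ineq2[of "y-c" \<nu>] \<nu>(1) le_s \<epsilon> k E by (intro mult_left_mono) auto
 finally have p1: "\<bar>pd \<nu> h y\<bar> <= \<epsilon>*E*(4*k*\<rho>)" by (simp add: mult_ac)
 have "- h y <= \<epsilon>*g y" using fy by (simp add: f_def)
 also have "... <= \<epsilon>*E" using \<epsilon> exp_gt_zero[of "- k*\<rho>^2"] by (intro mult_left_mono) (auto simp: g_def F_def E_def)
 finally have p2: "\<bar>h y\<bar> <= \<epsilon>*E" using le[OF yR] by simp
 have "\<epsilon>*E*1 <= \<epsilon>*E*k" using k \<epsilon> E by (intro mult_left_mono) auto
 then have "\<bar>pd \<nu> h y\<bar>+\<bar>h y\<bar> <= \<epsilon>*E*(k*(4*\<rho>+1))" using p1 p2 by (simp add: algebra_simps)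
 then have "K*(\<bar>pd \<nu> h y\<bar>+\<bar>h y\<bar>) <= K*(\<epsilon>*E*(k*(4*\<rho>+1)))" using K by (rule mult_left_mono)
 then have "\<epsilon>*laplacian g y <= \<epsilon>*E*k*(K*(4*\<rho>+1))" using lf \<nu>(2) by (simp add: algebra_simps)
 moreover have "\<epsilon>*laplacian g y = \<epsilon>*E*k*(4 * s y*k-2*n)" unfolding gp F12 by (simp add: power2_eq_square algebra_simps)
 moreover have "\<epsilon>*E*k > 0" using \<epsilon> E k by simp
 ultimately have "4 * s y*k-2*n <= K*(4*\<rho>+1)" by (metis mult_le_cancel_left_pos)
 moreover have "\<rho>^2 <= 4 * s y"
 proof -
  have "(\<rho>/2)^2 <= s y" unfolding sn using le_s \<rho> by (intro power_mono) auto
  then show ?thesis by (simp add: power_divide)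
 qed
 then have "\<rho>^2*k <= 4 * s y*k" using k by (intro mult_right_mono) auto
 ultimately show False using k(2) by (simp add: mult.commute)
qed

text \<open>Unique continuation from analyticity on lines: a zero ball propagates along every
  segment in S, so the interior of the zero set is open and closed in the connected S.\<close>

lemma harmonic_identity:
 fixes f :: "'a::euclidean_space => real"
 assumes dim: "DIM('a) >= 3" and S: "open S" "connected S" and C2: "Ck_on 2 S f" and lap: "!!x. x \<in> S ==> laplacian f x = 0"
  and z: "ball x0 r \<subseteq> S" "r > 0" "!!y. y \<in> ball x0 r ==> f y = 0" and x: "x \<in> S"
 shows "f x = 0"
proof -
 define Z where "Z = {x \<in> S. \<exists>r>0. ball x r \<subseteq> S & (\<forall>y\<in>ball x r. f y = 0)}"
 have key: "f y = 0" if aZ: "a \<in> Z" and seg: "closed_segment a y \<subseteq> S" for a y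
 proof -
  obtain r where r: "r > 0" "\<forall>y\<in>ball a r. f y = 0" using aZ unfolding Z_def by blast
  define h where "h t = f (a+t *R (y-a))" for t
  have "h 1 = 0"
  proof (rule real_analytic_identity[where h=h and ?t1.0=0 and t=1 and c=0])
   fix t0 :: real assume t0: "t0 \<in> {0..1}"
   have "a+t0 *R (y-a) = (1-t0) *R a+t0 *R y" by (simp add: algebra_simps)
   then have "a+t0 *R (y-a) \<in> closed_segment a y" using t0 unfolding closed_segment_def by auto
   then have m: "a+t0 *R (y-a) \<in> S" using seg by blast
   obtain \<rho> F where "\<rho> > 0" "F holomorphic_on ball 0 \<rho>" "!!t. \<bar>t\<bar> < \<rho> ==> F (of_real t) = of_real (f (a+t0 *R (y-a)+t *R (y-a)))"
    by (rule analytic_on_lines[OF dim S(1) C2 lap m]) (assumption, rule that, assumption+)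
   then show "\<exists>\<rho>>0. \<exists>F. F holomorphic_on ball 0 \<rho> & (\<forall>t. \<bar>t\<bar> < \<rho> --> F (of_real t) = of_real (h (t0+t)))"
    by (intro exI[of _ \<rho>] exI[of _ F] conjI allI impI) (simp_all add: h_def scaleR_add_left add.assoc)
  next
   show "0 islimpt {t. h t = 0}"
    unfolding islimpt_approachable
   proof (intro allI impI)
    fix e :: real assume e: "e > 0"
    define q where "q = r/(norm (y-a)+1)"
    define t where "t = min (e/2) (q/2)"
    have p: "norm (y-a)+1 > 0" by (simp add: add_nonneg_pos)
    have "q > 0" using r(1) p by (simp add: q_def)
    then have t: "t > 0" "t < e" "t < q" using e by (auto simp: t_def)
    have "t*norm (y-a) <= t*(norm (y-a)+1)" using t by (intro mult_left_mono) auto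
    also have "... < r" using t(3) p by (simp add: q_def pos_less_divide_eq)
    finally have "h t = 0" unfolding h_def using t by (intro bspec[OF r(2)]) (simp add: dist_norm)
    then show "\<exists>x'\<in>{t. h t = 0}. x' ~= 0 & dist x' 0 < e" using t by (intro bexI[of _ t]) auto
   qed
  qed auto
  then show ?thesis by (simp add: h_def)
 qed
 have "open Z"
  unfolding open_contains_ball
 proof
  fix a assume "a \<in> Z"
  then obtain r where r: "r > 0" "ball a r \<subseteq> S" "\<forall>y\<in>ball a r. f y = 0" unfolding Z_def by blast
  have "ball a r \<subseteq> Z"
  proof
   fix b assume b: "b \<in> ball a r"
   then obtain q where "q > 0" "ball b q \<subseteq> ball a r" using open_contains_ball open_ball by blast
   then show "b \<in> Z" using r b unfolding Z_def by blast
  qed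
  then show "\<exists>e>0. ball a e \<subseteq> Z" using r(1) by blast
 qed
 moreover have "open (S-Z)"
  unfolding open_contains_ball
 proof
  fix b assume b: "b \<in> S-Z"
  obtain q where q: "q > 0" "ball b q \<subseteq> S" using S(1) b open_contains_ball by blast
  have "ball b q \<inter> Z = {}"
  proof (rule ccontr)
   assume "ball b q \<inter> Z ~= {}"
   then obtain a where a: "a \<in> ball b q" "a \<in> Z" by blast
   have "f y = 0" if y: "y \<in> ball b q" for y
    using key[OF a(2), of y] closed_segment_subset[OF a(1) y convex_ball] q(2) by blast
   then have "b \<in> Z" using b q unfolding Z_def by blast
   then show False using b by simp
  qed
  then show "\<exists>e>0. ball b e \<subseteq> S-Z" using q by (intro exI[of _ q]) auto
 qed
 ultimately have "Z \<inter> S = {} \<or> (S-Z) \<inter> S = {}" by (intro connectedD[OF S(2)]) auto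
 moreover have "x0 \<in> S" using z(1,2) by auto
 then have "x0 \<in> Z" using z unfolding Z_def by blast
 ultimately have "(S-Z) \<inter> S = {}" using \<open>x0 \<in> S\<close> by blast
 then have "x \<in> Z" using x by blast
 then show ?thesis by (auto simp: Z_def)
qed

context torsion
begin

abbreviation W where "W x \<equiv> grad u x \<bullet> grad u x"
abbreviation dep where "dep x \<equiv> M-u x"
abbreviation \<Omega>' where "\<Omega>' \<equiv> {x \<in> \<Omega>. u x < M}"

lemma dep_bounds: "x \<in> \<Omega>' ==> 0 < dep x & dep x < M"
 using u_pos by auto

lemma open_\<Omega>': "open \<Omega>'"
 using continuous_open_preimage[OF continuous_on_subset[OF cont closure_subset] op, of "{..<M}"]
 by (simp add: vimage_def Int_def)

lemma W_expand: "W = (%x. \<Sum>c\<in>Basis. pd c u x*pd c u x)"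
 by (rule ext, subst euclidean_inner, rule sum.cong) (simp_all add: grad_Basis)

lemma W_Ck: "Ck_on k \<Omega> W"
 unfolding W_expand by (intro Ck_on_sum Ck_on_mult op pdC)

lemma pd_W: "x \<in> \<Omega> ==> pd v W x = 2*(hess x v \<bullet> grad u x)"
 using frechet_derivative_eqI[OF has_derivative_inner[OF grad_derivative grad_derivative]]
 by (simp add: inner_commute)

text \<open>Bochner's formula in flat space. The term with third derivatives drops out because the
  partial derivatives of u are harmonic.\<close>

lemma laplacian_W:
 assumes x: "x \<in> \<Omega>"
 shows "laplacian W x = 2*(\<Sum>b\<in>Basis. hess x b \<bullet> hess x b)"
proof -
 have "pd b (pd b W) x = (\<Sum>c\<in>Basis. 2*(pd b (pd b (pd c u)) x*pd c u x+pd b (pd c u) x*pd b (pd c u) x))" for b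
 proof -
  have "pd b W y = (\<Sum>c\<in>Basis. 2*(pd b (pd c u) y*pd c u y))" if "y \<in> \<Omega>" for y
   unfolding pd_W[OF that] euclidean_inner[of "hess y b" "grad u y"] sum_distrib_left
   by (rule sum.cong) (simp_all add: grad_Basis hess_inner[OF that])
  then have "frechet_derivative (pd b W) (at x) = frechet_derivative (%y. \<Sum>c\<in>Basis. 2*(pd b (pd c u) y*pd c u y)) (at x)"
   by (intro frechet_derivative_cong_open[OF op x])
  also have "... = (%v. \<Sum>c\<in>Basis. 2*(pd b (pd c u) x*pd v (pd c u) x+pd v (pd b (pd c u)) x*pd c u x))"
   by (intro frechet_derivative_eqI has_derivative_sum has_derivative_mult_right has_derivative_mult has_derivative_frechet diffs x)
  finally show ?thesis by (simp add: add.commute)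
 qed
 then have "laplacian W x = (\<Sum>b\<in>Basis. \<Sum>c\<in>Basis. 2*(pd b (pd b (pd c u)) x*pd c u x+pd b (pd c u) x*pd b (pd c u) x))"
  unfolding laplacian_def by simp
 also have "... = (\<Sum>b\<in>Basis. \<Sum>c\<in>Basis. 2*(pd b (pd b (pd c u)) x*pd c u x))+2*(\<Sum>b\<in>Basis. \<Sum>c\<in>Basis. pd b (pd c u) x*pd b (pd c u) x)"
  by (simp only: distrib_left sum.distrib sum_distrib_left)
 also have "(\<Sum>b\<in>Basis. \<Sum>c\<in>Basis. 2*(pd b (pd b (pd c u)) x*pd c u x)) = (\<Sum>c\<in>Basis. 2*(laplacian (pd c u) x*pd c u x))"
  unfolding laplacian_def sum_distrib_right sum_distrib_left by (rule sum.swap)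
 also have "(\<Sum>b\<in>Basis. \<Sum>c\<in>Basis. pd b (pd c u) x*pd b (pd c u) x) = (\<Sum>b\<in>Basis. hess x b \<bullet> hess x b)"
  by (rule sum.cong[OF refl], subst euclidean_inner) (simp add: hess_inner[OF x])
 finally show ?thesis by (simp add: laplacian_pd[OF op uC pde x])
qed

lemma compare_derivs:
 assumes F: "!!j t. j < 2 ==> 0 < t ==> t < M ==> DERIV (F j) t :> F (Suc j) t" "continuous_on {0<..<M} (F 2)"
 defines "h \<equiv> %y. W y-F 0 (dep y)"
 shows "Ck_on 2 \<Omega>' h" and "x \<in> \<Omega>' ==> pd v h x = 2*(hess x v \<bullet> grad u x)+F 1 (dep x)*(grad u x \<bullet> v)"
  and "x \<in> \<Omega>' ==> laplacian h x = 2*(\<Sum>b\<in>Basis. hess x b \<bullet> hess x b)-F 2 (dep x)*W x-real DIM('a)*F 1 (dep x)"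
proof -
 have sub: "\<Omega>' \<subseteq> \<Omega>" by auto
 have dC: "Ck_on k \<Omega>' dep" for k
  by (intro Ck_on_diff Ck_on_const open_\<Omega>' Ck_on_subset[OF op open_\<Omega>' sub uC])
 have ran: "dep ` \<Omega>' \<subseteq> {0<..<M}" using dep_bounds by fastforce
 have WC: "Ck_on 2 \<Omega>' W" by (rule Ck_on_subset[OF op open_\<Omega>' sub W_Ck])
 have FC: "Ck_on 2 \<Omega>' (%y. F 0 (dep y))"
  by (rule Ck_on_compose_real[OF open_\<Omega>' dC ran]) (use F in auto)
 show hC: "Ck_on 2 \<Omega>' h" unfolding h_def by (rule Ck_on_diff[OF open_\<Omega>' WC FC])
 have Fd: "((%y. F j (dep y)) has_derivative (%v. - F (Suc j) (dep y)*pd v u y)) (at y)" if "j < 2" "y \<in> \<Omega>'" for j y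
 proof -
  have "DERIV (F j) (dep y) :> F (Suc j) (dep y)" using F(1) dep_bounds that by blast
  moreover have "(dep has_derivative (%v. 0-pd v u y)) (at y)"
   using that by (intro has_derivative_diff has_derivative_const has_derivative_frechet diffs) auto
  ultimately have "((%y. F j (dep y)) has_derivative (%v. F (Suc j) (dep y)*(0-pd v u y))) (at y)"
   using has_derivative_compose has_field_derivative_imp_has_derivative by blast
  then show ?thesis by simp
 qed
 have Wd: "(W has_derivative (%v. 2*(hess y v \<bullet> grad u y))) (at y)" if "y \<in> \<Omega>'" for y
  using has_derivative_inner[OF grad_derivative grad_derivative, of y] that by (simp add: inner_commute)
 have hd: "pd v h y = 2*(hess y v \<bullet> grad u y)+F 1 (dep y)*(grad u y \<bullet> v)" if y: "y \<in> \<Omega>'" for v y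
 proof -
  have "frechet_derivative h (at y) = (%v. 2*(hess y v \<bullet> grad u y)-(- F (Suc 0) (dep y)*pd v u y))"
   unfolding h_def by (intro frechet_derivative_eqI has_derivative_diff Wd Fd y) simp
  then show ?thesis using y by (simp add: grad_inner)
 qed
 then show "x \<in> \<Omega>' ==> pd v h x = 2*(hess x v \<bullet> grad u x)+F 1 (dep x)*(grad u x \<bullet> v)" .
 assume x: "x \<in> \<Omega>'"
 have xO: "x \<in> \<Omega>" using x by simp
 have 1: "pd b (pd b (%y. F 0 (dep y))) x = F 2 (dep x)*pd b u x*pd b u x-F 1 (dep x)*pd b (pd b u) x" for b
 proof -
  have "frechet_derivative (pd b (%y. F 0 (dep y))) (at x) = frechet_derivative (%y. - F 1 (dep y)*pd b u y) (at x)"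
   by (rule frechet_derivative_cong_open[OF open_\<Omega>' x]) (simp add: frechet_derivative_eqI[OF Fd])
  also have "... = (%v. - F 1 (dep x)*pd v (pd b u) x + - (- F (Suc 1) (dep x)*pd v u x)*pd b u x)"
   by (intro frechet_derivative_eqI has_derivative_mult has_derivative_minus has_derivative_frechet diffs xO Fd x) simp
  finally show ?thesis by (simp add: numeral_2_eq_2)
 qed
 have "laplacian (%y. F 0 (dep y)) x = (\<Sum>b\<in>Basis. F 2 (dep x)*(pd b u x*pd b u x)-F 1 (dep x)*pd b (pd b u) x)"
  unfolding laplacian_def by (simp only: 1 mult.assoc)
 also have "... = F 2 (dep x)*W x-F 1 (dep x)*laplacian u x"
  unfolding fun_cong[OF W_expand, of x] by (simp add: laplacian_def sum_subtractf sum_distrib_left)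
 finally have 2: "laplacian (%y. F 0 (dep y)) x = F 2 (dep x)*W x+real DIM('a)*F 1 (dep x)" by (simp add: pde[OF xO])
 have Wh: "W y = h y+F 0 (dep y)" for y by (simp add: h_def)
 have "laplacian W x = laplacian h x+laplacian (%y. F 0 (dep y)) x"
  unfolding Wh by (rule laplacian_add[OF open_\<Omega>' hC FC x])
 then show "laplacian h x = 2*(\<Sum>b\<in>Basis. hess x b \<bullet> hess x b)-F 2 (dep x)*W x-real DIM('a)*F 1 (dep x)"
  by (simp add: 2 laplacian_W[OF xO])
qed

text \<open>Completes the square against a matrix of the shape that Hessians of radial functions
  have; its trace part is known because the trace of the Hessian is -n.\<close>

lemma hess_square_decomposition:
 assumes x: "x \<in> \<Omega>" and \<nu>: "norm \<nu> = 1"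
 shows "(\<Sum>b\<in>Basis. (norm (hess x b-(\<alpha> *R b+(\<beta>*(\<nu> \<bullet> b)) *R \<nu>)))^2)
  = (\<Sum>b\<in>Basis. hess x b \<bullet> hess x b)+2*\<alpha>*real DIM('a)-2*\<beta>*(hess x \<nu> \<bullet> \<nu>)+real DIM('a)*\<alpha>^2+2*\<alpha>*\<beta>+\<beta>^2"
proof -
 have n1: "\<nu> \<bullet> \<nu> = 1" using \<nu> by (simp add: norm_eq_1)
 have "(norm (hess x b-(\<alpha> *R b+(\<beta>*(\<nu> \<bullet> b)) *R \<nu>)))^2
   = hess x b \<bullet> hess x b-2*\<alpha>*(hess x b \<bullet> b)-2*\<beta>*((\<nu> \<bullet> b)*(hess x b \<bullet> \<nu>))+\<alpha>^2+(2*\<alpha>*\<beta>+\<beta>^2)*(\<nu> \<bullet> b)^2"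
  if "b \<in> Basis" for b
 proof -
  define w where "w = \<alpha> *R b+(\<beta>*(\<nu> \<bullet> b)) *R \<nu>"
  have "(norm (hess x b-w))^2 = hess x b \<bullet> hess x b-2*(hess x b \<bullet> w)+w \<bullet> w"
   unfolding power2_norm_eq_inner by (simp add: inner_diff_left inner_diff_right inner_commute)
  moreover have "hess x b \<bullet> w = \<alpha>*(hess x b \<bullet> b)+\<beta>*((\<nu> \<bullet> b)*(hess x b \<bullet> \<nu>))"
   by (simp add: w_def inner_add_right)
  moreover have "w \<bullet> w = \<alpha>^2+(2*\<alpha>*\<beta>+\<beta>^2)*(\<nu> \<bullet> b)^2"
  proof -
   define c where "c = \<nu> \<bullet> b"
   have "b \<bullet> b = 1" "b \<bullet> \<nu> = c" using that by (simp_all add: c_def inner_commute)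
   then show ?thesis
    unfolding w_def c_def[symmetric] inner_add_left inner_add_right inner_scaleR_left inner_scaleR_right n1
    by (simp add: c_def[symmetric] power2_eq_square algebra_simps)
  qed
  ultimately show ?thesis unfolding w_def[symmetric] by (simp add: algebra_simps)
 qed
 then have "(\<Sum>b\<in>Basis. (norm (hess x b-(\<alpha> *R b+(\<beta>*(\<nu> \<bullet> b)) *R \<nu>)))^2)
   = (\<Sum>b\<in>Basis. hess x b \<bullet> hess x b)-2*\<alpha>*(\<Sum>b\<in>Basis. hess x b \<bullet> b)-2*\<beta>*(\<Sum>b\<in>Basis. (\<nu> \<bullet> b)*(hess x b \<bullet> \<nu>))
    + real DIM('a)*\<alpha>^2+(2*\<alpha>*\<beta>+\<beta>^2)*(\<Sum>b\<in>Basis. (\<nu> \<bullet> b)^2)"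
  by (simp add: sum.distrib sum_subtractf sum_distrib_left)
 moreover have "(\<Sum>b\<in>Basis. (\<nu> \<bullet> b)*(hess x b \<bullet> \<nu>)) = hess x \<nu> \<bullet> \<nu>"
 proof -
  have "hess x \<nu> \<bullet> \<nu> = (\<Sum>b\<in>Basis. (hess x \<nu> \<bullet> b)*(\<nu> \<bullet> b))" by (rule euclidean_inner)
  also have "... = (\<Sum>b\<in>Basis. (\<nu> \<bullet> b)*(hess x b \<bullet> \<nu>))"
   by (rule sum.cong[OF refl], subst hess_sym[OF x]) (rule mult.commute)
  finally show ?thesis by (rule sym)
 qed
 ultimately show ?thesis by (simp add: hess_trace[OF x] sum_Basis_inner_square n1)
qed

text \<open>With these \<alpha> and \<beta> the comparison matrix has trace -n, and -\<mu> in the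
  direction of the gradient, the value that the second derivative of u takes wherever h is critical
  in that direction. What is left besides the square is the profile equation, a drift term and a
  zero-order term.\<close>

lemma laplacian_decomposition:
 assumes F: "!!j t. j < 2 ==> 0 < t ==> t < M ==> DERIV (F j) t :> F (Suc j) t" "continuous_on {0<..<M} (F 2)"
  and x: "x \<in> \<Omega>'" and g0: "grad u x ~= 0"
 defines "h \<equiv> %y. W y-F 0 (dep y)" and "n \<equiv> real DIM('a)" and "\<mu> \<equiv> F 1 (dep x)/2" and "\<nu> \<equiv> grad u x /\<^sub>R norm (grad u x)"
 defines "\<alpha> \<equiv> (\<mu>-n)/(n-1)"
 defines "\<beta> \<equiv>-\<mu>-\<alpha>"
 shows "laplacian h x = 2*(\<Sum>b\<in>Basis. (norm (hess x b-(\<alpha> *R b+(\<beta>*(\<nu> \<bullet> b)) *R \<nu>)))^2)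
  + (2*n/(n-1)*(\<mu>-1)*(\<mu>-n)-F 2 (dep x)*F 0 (dep x))
  + 2*\<beta>*pd \<nu> h x/norm (grad u x)-F 2 (dep x)*h x"
proof -
 have xO: "x \<in> \<Omega>" using x by simp
 define G where "G = norm (grad u x)"
 have G: "G > 0" using g0 by (simp add: G_def)
 have g: "grad u x = G *R \<nu>" using G by (simp add: \<nu>_def G_def)
 have \<nu>: "norm \<nu> = 1" using g0 by (simp add: \<nu>_def)
 then have n1: "\<nu> \<bullet> \<nu> = 1" by (simp add: norm_eq_1)
 have n: "n > 1" using dim by (simp add: n_def)
 have "pd \<nu> h x = 2*(hess x \<nu> \<bullet> grad u x)+F 1 (dep x)*(grad u x \<bullet> \<nu>)"
  unfolding h_def by (rule compare_derivs(2)[OF F x])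
 then have k: "hess x \<nu> \<bullet> \<nu> = - \<mu>+pd \<nu> h x/G/2" using G by (simp add: g n1 \<mu>_def field_simps)
 have lap: "laplacian h x = 2*(\<Sum>b\<in>Basis. hess x b \<bullet> hess x b)-F 2 (dep x)*W x-n*(2*\<mu>)"
  unfolding h_def n_def \<mu>_def using compare_derivs(3)[OF F x] by simp
 have \<mu>: "\<mu> = n+(n-1)*\<alpha>" using n by (simp add: \<alpha>_def)
 then have e1: "2*n/(n-1)*(\<mu>-1)*(\<mu>-n) = 2*n*\<alpha>*(\<mu>-1)" using n by simp
 have hx: "h x = W x-F 0 (dep x)" by (simp add: h_def)
 have key: "2*H-F2*w-n*(2*\<mu>) = 2*(H+2*\<alpha>*n-2*\<beta>*(- \<mu>+K/2)+n*\<alpha>^2+2*\<alpha>*\<beta>+\<beta>^2)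
   + (2*n*\<alpha>*(\<mu>-1)-F2*F0)+2*\<beta>*K-F2*(w-F0)" for H F2 F0 w K
  unfolding \<beta>_def \<mu> by (simp add: power2_eq_square algebra_simps)
 show ?thesis
  unfolding lap hess_square_decomposition[OF xO \<nu>] k G_def[symmetric] n_def[symmetric] hx e1
  using key[where H="\<Sum>b\<in>Basis. hess x b \<bullet> hess x b" and ?F2.0="F 2 (dep x)" and ?F0.0="F 0 (dep x)" and w="W x" and K="pd \<nu> h x/G"]
  by (simp only: times_divide_eq_right)
qed

lemma laplacian_lower_bound:
 assumes F: "!!j t. j < 2 ==> 0 < t ==> t < M ==> DERIV (F j) t :> F (Suc j) t" "continuous_on {0<..<M} (F 2)"
  and x: "x \<in> \<Omega>'" and g0: "grad u x ~= 0"
 defines "h \<equiv> %y. W y-F 0 (dep y)" and "n \<equiv> real DIM('a)" and "\<mu> \<equiv> F 1 (dep x)/2"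
 shows "(2*n/(n-1)*(\<mu>-1)*(\<mu>-n)-F 2 (dep x)*F 0 (dep x))
  + 2*(- \<mu>-(\<mu>-n)/(n-1))*pd (grad u x /\<^sub>R norm (grad u x)) h x/norm (grad u x)-F 2 (dep x)*h x <= laplacian h x"
proof -
 have aux: "X = 2*Y+S+B-C ==> 0 <= Y ==> S+B-C <= X" for X Y S B C :: real by simp
 show ?thesis
  unfolding h_def n_def \<mu>_def by (rule aux[OF laplacian_decomposition[OF F x g0] sum_nonneg]) (assumption+, rule zero_le_power2)
qed

text \<open>The coefficient of h in the comparison equation may have the wrong sign, so the maximum
  of W - w itself need not be contradictory. Instead the whole family w + k a is raised until it
  touches W from above; the touching profile satisfies a strict inequality, and the Laplacian of the
  difference is positive at its own maximum.\<close>

lemma barrier: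
 assumes G: "continuous_on (closure \<Omega>) G" "!!x. x \<in> \<Omega> ==> G x = grad u x"
  and V: "V \<subseteq> \<Omega>" "open V"
  and wc: "continuous_on {0..M} (w 0)" and ac: "continuous_on {0..M} (a 0)"
  and w: "!!j t. j < 2 ==> 0 < t ==> t < M ==> DERIV (w j) t :> w (Suc j) t" "continuous_on {0<..<M} (w 2)"
  and a: "!!j t. j < 2 ==> 0 < t ==> t < M ==> DERIV (a j) t :> a (Suc j) t" "continuous_on {0<..<M} (a 2)"
  and w0: "!!t. 0 <= t ==> t <= M ==> 0 <= w 0 t" and a0: "!!t. 0 <= t ==> t <= M ==> 0 < a 0 t"
  and S: "!!k t. 0 < k ==> 0 < t ==> t < M ==>
   0 < 2*real DIM('a)/(real DIM('a)-1)*((w 1 t+k*a 1 t)/2-1)*((w 1 t+k*a 1 t)/2-real DIM('a))-(w 2 t+k*a 2 t)*(w 0 t+k*a 0 t)"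
  and fr: "!!x. x \<in> frontier V ==> G x \<bullet> G x <= w 0 (dep x)"
  and x: "x \<in> V"
 shows "W x <= w 0 (dep x)"
proof (rule ccontr)
 assume nt: "\<not> W x <= w 0 (dep x)"
 have VO: "closure V \<subseteq> closure \<Omega>" using V by (intro closure_mono)
 have cV: "compact (closure V)" using closure_compact VO by (metis closed_closure compact_Int_closed inf.absorb_iff2)
 have dep: "dep y \<in> {0..M}" if "y \<in> closure V" for y
 proof (cases "y \<in> \<Omega>")
  case True then show ?thesis using u_pos[OF True] u_le_M[OF True] by auto
 next
  case False
  then have "y \<in> frontier \<Omega>" using that VO op by (auto simp: frontier_def interior_open)
  then show ?thesis using bc M_pos by simp
 qed
 have dc: "continuous_on (closure V) dep" by (intro continuous_intros continuous_on_subset[OF cont VO])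
 have Gc: "continuous_on (closure V) G" by (rule continuous_on_subset[OF G(1) VO])
 \<comment> \<open>The parameter at which the member of the family through y passes through the
   squared gradient. Its largest value, if positive, is attained in the interior because the
   boundary values are nonpositive.\<close>
 define k where "k y = (G y \<bullet> G y-w 0 (dep y))/a 0 (dep y)" for y
 have ap: "a 0 (dep y) > 0" if "y \<in> closure V" for y using a0 dep[OF that] by simp
 have anz: "a 0 (dep y) ~= 0" if "y \<in> closure V" for y using ap[OF that] by simp
 have kc: "continuous_on (closure V) k" unfolding k_def
  by (intro continuous_intros continuous_on_compose2[OF wc dc] continuous_on_compose2[OF ac dc] Gc) (use anz dep in auto)
 have xc: "x \<in> closure V" using x closure_subset by blast
 have "\<exists>z\<in>closure V. \<forall>y\<in>closure V. k y <= k z" using xc by (intro continuous_attains_sup[OF cV _ kc]) auto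
 then obtain z where z: "z \<in> closure V" "!!y. y \<in> closure V ==> k y <= k z" by blast
 have "G x = grad u x" using G(2) V(1) x by blast
 then have "k x > 0" unfolding k_def using nt ap[OF xc] by simp
 then have kz: "k z > 0" using z(2)[OF xc] by simp
 have "z \<notin> frontier V"
 proof
  assume "z \<in> frontier V"
  from fr[OF this] have "k z <= 0" unfolding k_def using ap[OF z(1)] by (simp add: divide_le_0_iff)
  then show False using kz by simp
 qed
 then have zV: "z \<in> V" using z(1) V(2) by (simp add: frontier_def interior_open)
 then have zO: "z \<in> \<Omega>" using V by blast
 define F where "F j t = w j t+k z*a j t" for j t
 have F: "DERIV (F j) t :> F (Suc j) t" if "j < 2" "0 < t" "t < M" for j t
  unfolding F_def[abs_def] by (intro derivative_intros w(1) a(1) DERIV_cmult that)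
 have F2: "continuous_on {0<..<M} (F 2)" unfolding F_def[abs_def] by (intro continuous_intros w(2) a(2))
 define h where "h y = W y-F 0 (dep y)" for y
 have hz: "h z = 0" using ap[OF z(1)] G(2)[OF zO] by (simp add: h_def F_def k_def)
 have hle: "h y <= 0" if y: "y \<in> V" for y
 proof -
  have yc: "y \<in> closure V" using y closure_subset by blast
  have "y \<in> \<Omega>" using y V by blast
  then show ?thesis using z(2)[OF yc] ap[OF yc] G(2)[of y] by (simp add: h_def F_def k_def[of y] divide_le_eq algebra_simps)
 qed
 have "F 0 (dep z) > 0" using w0[of "dep z"] ap[OF z(1)] dep[OF z(1)] kz by (simp add: F_def add_nonneg_pos)
 then have Wz: "W z > 0" using hz by (simp add: h_def)
 then have gz: "grad u z ~= 0" by auto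
 then have "z \<notin> MX" using MX_grad by blast
 then have z': "z \<in> \<Omega>'" using zO u_le_M[OF zO] by (auto simp: MAXset_def)
 obtain r where r: "r > 0" "ball z r \<subseteq> V" using V(2) zV open_contains_ball by blast
 have hC: "Ck_on 2 \<Omega>' h" unfolding h_def by (rule compare_derivs(1)[OF F F2])
 have le: "h y <= h z" if "y \<in> ball z r" for y using hle[OF subsetD[OF r(2) that]] hz by simp
 note m = local_max_second_derivative[OF open_\<Omega>' hC z' r(1) le]
 have "0 < 2*real DIM('a)/(real DIM('a)-1)*(F 1 (dep z)/2-1)*(F 1 (dep z)/2-real DIM('a))-F 2 (dep z)*F 0 (dep z)"
  unfolding F_def using S[OF kz] dep_bounds[OF z'] by blast
 moreover have "(2*real DIM('a)/(real DIM('a)-1)*(F 1 (dep z)/2-1)*(F 1 (dep z)/2-real DIM('a))-F 2 (dep z)*F 0 (dep z))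
  + 2*(- (F 1 (dep z)/2)-(F 1 (dep z)/2-real DIM('a))/(real DIM('a)-1))*pd (grad u z /\<^sub>R norm (grad u z)) h z/norm (grad u z)-F 2 (dep z)*h z <= laplacian h z"
  unfolding h_def by (rule laplacian_lower_bound[OF F F2 z' gz])
 ultimately have "laplacian h z > 0" using m(1) hz by simp
 then show False using m(2) by simp
qed

lemma model_barrier:
 assumes e: "e \<in> {1, -1}" and \<rho>: "\<rho> > 0"
  and G: "continuous_on (closure \<Omega>) G" "!!x. x \<in> \<Omega> ==> G x = grad u x"
  and V: "V \<subseteq> \<Omega>" "open V"
  and fr: "!!x. x \<in> frontier V ==> G x \<bullet> G x <= mprofile DIM('a) e \<rho> 0 (dep x)"
  and x: "x \<in> V"
 shows "W x <= mprofile DIM('a) e \<rho> 0 (dep x)"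
proof -
 let ?n = "DIM('a)"
 define n where "n = real ?n"
 have n: "n >= 3" using dim by (simp add: n_def)
 define \<psi> where "\<psi> t = mpsi ?n e (t/\<rho>^2)" for t
 define q where "q t = mq ?n (\<psi> t)" for t
 define F where "F t = \<psi> t*mphi ?n (\<psi> t)" for t
 have r2: "\<rho>^2 > 0" using \<rho> by simp
 have \<psi>p: "\<psi> t > 0" if "t >= 0" for t unfolding \<psi>_def by (rule scaled_mpsi_pos[OF dim e \<rho> that])
 have Fs: "e*F t > 0" "e*(1-q t) > 0" if "t > 0" for t
 proof -
  have s: "0 < e*(\<psi> t-1)" "0 < e*mphi ?n (\<psi> t)" unfolding \<psi>_def using mpsi_side[OF dim e, of "t/\<rho>^2"] that r2 by auto
  have p: "\<psi> t > 0" using \<psi>p that by simp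
  show "e*F t > 0" using mult_pos_pos[OF p s(2)] by (simp add: F_def mult_ac)
  show "e*(1-q t) > 0" using mq_sign[OF dim p] s(1) e by (auto simp: q_def)
 qed
 have F0: "F t ~= 0" if "t > 0" for t using Fs(1)[OF that] by auto
 have Fq: "F t = (\<psi> t)^2*(1-q t)" for t by (simp add: F_def mphi_def q_def power2_eq_square)
 have d\<psi>: "DERIV \<psi> t :> \<psi> t/(\<rho>^2*F t)" if "t > 0" for t
  using scaled_mpsi_deriv[OF dim e \<rho> that] \<psi>p[of t] that by (simp add: F_def \<psi>_def[abs_def])
 have dq: "DERIV q t :> -n*q t/(\<rho>^2*F t)" if t: "t > 0" for t
  using scaled_mq_deriv[OF dim e \<rho> t] by (simp add: F_def q_def[abs_def] \<psi>_def[abs_def] n_def)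
 have dF: "DERIV F t :> (\<psi> t)^2*(2+(n-2)*q t)/(\<rho>^2*F t)" if t: "t > 0" for t
 proof -
  have Ff: "F = (%t. (\<psi> t)^2*(1-q t))" by (rule ext) (rule Fq)
  have "DERIV (%t. (\<psi> t)^2*(1-q t)) t :> 2*\<psi> t*(\<psi> t/(\<rho>^2*F t))*(1-q t)+(\<psi> t)^2*(0 - - n*q t/(\<rho>^2*F t))"
   by (rule DERIV_cong[OF DERIV_mult[OF DERIV_power[OF d\<psi>[OF t], of 2] DERIV_diff[OF DERIV_const dq[OF t], of 1]]]) (simp add: mult_ac)
  moreover have "2*\<psi> t*(\<psi> t/(\<rho>^2*F t))*(1-q t)+(\<psi> t)^2*(0 - - n*q t/(\<rho>^2*F t)) = (\<psi> t)^2*(2+(n-2)*q t)/(\<rho>^2*F t)"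
   using r2 F0[OF t] by (simp add: divide_simps) (simp add: algebra_simps power2_eq_square)
  ultimately show ?thesis unfolding Ff[symmetric] by (rule DERIV_cong)
 qed
 define w where "w = mprofile ?n e \<rho>"
 have wF: "w 0 t = (F t)^2*\<rho>^2/(\<psi> t)^2" "w 1 t = 2*(1+(n-1)*q t)" "w 2 t = - 2*n*(n-1)*q t/(\<rho>^2*F t)" if "t > 0" for t
  using \<psi>p[of t] that by (simp_all add: w_def mprofile_def Let_def \<psi>_def[symmetric] F_def q_def n_def power_mult_distrib)
 \<comment> \<open>Outside the core the profile has negative second derivative, so adding constants
   already gives strict members of the family. Inside the sign is reversed, and q = y^(-n), which
   varies with the depth, takes the place of the constant.\<close>
 define a where "a j t = (if e = 1 then if j = 0 then 1 else 0
  else if j = 0 then q t else if j = 1 then -n*q t/(\<rho>^2*F t) else n*q t*(\<psi> t)^2*(n+2-2*q t)/((\<rho>^2)^2*(F t) ^ 3))" for j :: nat and t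
 have da: "DERIV (a j) t :> a (Suc j) t" if "j < 2" "0 < t" for j t
 proof (cases "e = 1")
  case True then show ?thesis by (simp add: a_def[abs_def])
 next
  case ne: False
  have "((%t. - n*q t/(\<rho>^2*F t)) has_real_derivative
   ((- n*(- n*q t/(\<rho>^2*F t)))*(\<rho>^2*F t)-(- n*q t)*(\<rho>^2*((\<psi> t)^2*(2+(n-2)*q t)/(\<rho>^2*F t))))/((\<rho>^2*F t)*(\<rho>^2*F t))) (at t)"
   by (intro DERIV_divide DERIV_cmult dq dF) (use that(2) F0 r2 in auto)
  moreover have "((- n*(- n*q t/(\<rho>^2*F t)))*(\<rho>^2*F t)-(- n*q t)*(\<rho>^2*((\<psi> t)^2*(2+(n-2)*q t)/(\<rho>^2*F t))))/((\<rho>^2*F t)*(\<rho>^2*F t))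
   = n*q t*(\<psi> t)^2*(n+2-2*q t)/((\<rho>^2)^2*(F t) ^ 3)"
  proof -
   have "((- n*(- n*Q/(R*f)))*(R*f)-(- n*Q)*(R*(P*(2+(n-2)*Q)/(R*f))))/((R*f)*(R*f))
    = n*Q*(n*f+P*(2+(n-2)*Q))/(R^2*f ^ 3)" if "R ~= 0" "f ~= 0" for Q R f P
    using that by (simp add: field_simps power2_eq_square power3_eq_cube)
   moreover have "n*F t+(\<psi> t)^2*(2+(n-2)*q t) = (\<psi> t)^2*(n+2-2*q t)" by (simp add: Fq algebra_simps)
   ultimately show ?thesis using r2 F0[OF that(2)] by (simp add: mult.assoc)
  qed
  ultimately have d1: "DERIV (%t. - n*q t/(\<rho>^2*F t)) t :> n*q t*(\<psi> t)^2*(n+2-2*q t)/((\<rho>^2)^2*(F t) ^ 3)" by simp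
  show ?thesis
  proof (cases "j = 0")
   case True then show ?thesis using ne dq that by (simp add: a_def[abs_def])
  next
   case False
   then have "j = 1" using that by simp
   then show ?thesis using ne d1 by (simp add: a_def[abs_def])
  qed
 qed
 have \<psi>c: "continuous_on {0..b} \<psi>" and qc: "continuous_on {0..b} q" for b
  unfolding q_def[abs_def] \<psi>_def[abs_def] by (rule scaled_mpsi_continuous[OF dim e \<rho>], rule scaled_mq_continuous[OF dim e \<rho>])
 have sub: "{0<..<M} \<subseteq> {0..M}" by auto
 note c' = continuous_on_subset[OF \<psi>c sub] continuous_on_subset[OF qc sub]
 have Fc: "continuous_on {0<..<M} F" unfolding Fq by (intro continuous_intros c')
 have "W x <= w 0 (dep x)"
 proof (rule barrier[OF G V, where a=a])
  show "continuous_on {0..M} (w 0)" "continuous_on {0<..<M} (w 2)" unfolding w_def by (rule mprofile_continuous[OF dim e \<rho>])+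
  show "continuous_on {0..M} (a 0)" unfolding a_def by (cases "e = 1") (simp_all add: qc)
  show "continuous_on {0<..<M} (a 2)" unfolding a_def
   by (cases "e = 1"; simp; intro continuous_intros c' Fc) (use F0 r2 in auto)
  show "0 <= w 0 t" for t by (simp add: w_def mprofile_def Let_def)
  show "0 < a 0 t" if "0 <= t" for t using mq_pos[OF \<psi>p[OF that]] by (simp add: a_def q_def)
  show "G y \<bullet> G y <= w 0 (dep y)" if "y \<in> frontier V" for y using fr[OF that] by (simp add: w_def)
  fix k t :: real assume kt: "0 < k" "0 < t" "t < M"
  define Q where "Q = q t"
  define f where "f = F t*\<rho>^2"
  define P where "P = (\<psi> t)^2*\<rho>^2"
  have Q: "Q > 0" using mq_pos[OF \<psi>p[of t]] kt by (simp add: Q_def q_def)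
  have P: "P > 0" using \<psi>p[of t] kt r2 by (simp add: P_def)
  have fP: "f = P*(1-Q)" by (simp add: f_def P_def Q_def Fq)
  have f0: "f ~= 0" using F0[OF kt(2)] r2 by (simp add: f_def)
  have w: "w 1 t = 2*(1+(n-1)*Q)" "w 2 t = - 2*n*(n-1)*Q/f" "w 0 t = f^2/P"
   using wF[OF kt(2)] r2 by (simp_all add: Q_def f_def P_def power_mult_distrib power2_eq_square mult_ac)
  have e1: "0 < e*f" "0 < e*(1-Q)" using Fs[OF kt(2)] r2 mult_pos_pos[OF Fs(1)[OF kt(2)] r2] by (simp_all add: f_def Q_def mult.assoc)
  have "0 < 2*n/(n-1)*((w 1 t+k*a 1 t)/2-1)*((w 1 t+k*a 1 t)/2-n)-(w 2 t+k*a 2 t)*(w 0 t+k*a 0 t)"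
  proof (cases "e = 1")
   case True
   have "2*n/(n-1)*((w 1 t+k*a 1 t)/2-1)*((w 1 t+k*a 1 t)/2-n)-(w 2 t+k*a 2 t)*(w 0 t+k*a 0 t)
    = 2*n/(n-1)*((n-1)*Q)*((n-1)*(Q-1))+2*n*(n-1)*Q/f*(f^2/P+k)"
   proof -
    have a: "a 0 t = 1" "a 1 t = 0" "a 2 t = 0" using True by (simp_all add: a_def)
    have 5: "2*(1+(n-1)*Q)/2-1 = (n-1)*Q" "2*(1+(n-1)*Q)/2-n = (n-1)*(Q-1)" by (simp_all add: field_simps)
    show ?thesis unfolding w a mult_zero_right add_0_right 5 by simp
   qed
   also have "2*n/(n-1)*((n-1)*Q)*((n-1)*(Q-1)) = 2*n*Q*((n-1)*(Q-1))" using n by simp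
   also have "... = - (2*n*(n-1)*Q*(1-Q))" by (simp add: algebra_simps)
   also have "2*n*(n-1)*Q/f*(f^2/P+k) = 2*n*(n-1)*Q*(1-Q)+2*n*(n-1)*Q*k/f"
    using f0 P by (simp add: distrib_left power2_eq_square) (simp add: fP)
   finally show ?thesis using n Q kt e1 True by simp
  next
   case False
   then have em: "e = -1" using e by simp
   then have f: "f < 0" "Q > 1" using e1 by auto
   have a: "a 0 t = Q" "a 1 t = - n*Q/f" "a 2 t = n*Q*P*(n+2-2*Q)/f ^ 3"
    using False r2 by (simp_all add: a_def Q_def f_def P_def power_mult_distrib power2_eq_square power3_eq_cube mult_ac)
   \<comment> \<open>The balanced part cancels, leaving a linear and a quadratic term in k. Both
     have the right sign inside the core, where f < 0 and Q > 1; \<delta> = kQ/f reduces the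
     verification to polynomial identities.\<close>
   have id: "2*n/(n-1)*((2*(1+(n-1)*Q)+k*(- n*Q/f))/2-1)*((2*(1+(n-1)*Q)+k*(- n*Q/f))/2-n)
     - (- 2*n*(n-1)*Q/f+k*(n*Q*P*(n+2-2*Q)/f ^ 3))*(f^2/P+k*Q)
    = - 2*k*n*Q/f+k^2*n*Q^2/f^2*((n-2)^2/(2*(n-1))+n/(Q-1))"
   proof -
    define \<delta> where "\<delta> = k*Q/f"
    have Pf: "P/f = 1/(1-Q)" "f/P = 1-Q" using f f0 P by (simp_all add: fP)
    have 1: "k*(n*Q*P*(n+2-2*Q)/f ^ 3)*(f^2/P) = n*\<delta>*(n+2-2*Q)"
     using f0 P by (simp add: \<delta>_def power2_eq_square power3_eq_cube)
    have 2: "k*(n*Q*P*(n+2-2*Q)/f ^ 3)*(k*Q) = n*\<delta>^2*(n+2-2*Q)*(P/f)"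
     using f0 by (simp add: \<delta>_def power2_eq_square power3_eq_cube)
    have 3: "- 2*n*(n-1)*Q/f*(f^2/P) = - 2*n*(n-1)*Q*(f/P)" using f0 by (simp add: power2_eq_square)
    have 4: "- 2*n*(n-1)*Q/f*(k*Q) = - 2*n*(n-1)*Q*\<delta>" by (simp add: \<delta>_def)
    have 5: "(2*(1+(n-1)*Q)+k*(- n*Q/f))/2-1 = (n-1)*Q-n*\<delta>/2"
     "(2*(1+(n-1)*Q)+k*(- n*Q/f))/2-n = (n-1)*(Q-1)-n*\<delta>/2" using f0 by (simp_all add: \<delta>_def field_simps)
    have 6: "2*n/(n-1)*((n-1)*Q-n*\<delta>/2)*((n-1)*(Q-1)-n*\<delta>/2) = 2*n*(n-1)*Q*(Q-1)-n^2*\<delta>*(2*Q-1)+n ^ 3*\<delta>^2/(2*(n-1))"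
     using n by (simp add: divide_simps) (simp add: power2_eq_square power3_eq_cube algebra_simps)
    have 7: "- (n*\<delta>^2*(n+2-2*Q)*(1/(1-Q))) = n*\<delta>^2*(n/(Q-1)-2)"
     using f(2) by (simp add: field_simps)
    have 8: "n ^ 3*\<delta>^2/(2*(n-1)) = n*\<delta>^2*((n-2)^2/(2*(n-1))+2)"
     using n by (simp add: divide_simps) (simp add: power2_eq_square power3_eq_cube algebra_simps)
    have 9: "k^2*n*Q^2/f^2*X = n*\<delta>^2*X" for X by (simp add: \<delta>_def power_divide power_mult_distrib)
    have 10: "- 2*k*n*Q/f = - 2*n*\<delta>" by (simp add: \<delta>_def)
    have d: "(X+Z)*(A+B) = X*A+X*B+Z*A+Z*B" for X Z A B :: real by (simp add: algebra_simps)
    have gen: "V = - (U*(D-2)) ==> 2*n*(n-1)*Q*(Q-1)-n^2*\<delta>*(2*Q-1)+U*(c+2)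
      - (- 2*n*(n-1)*Q*(1-Q) + - 2*n*(n-1)*Q*\<delta>+n*\<delta>*(n+2-2*Q)+V) = - 2*n*\<delta>+U*(c+D)" for U V c D
     by (simp add: algebra_simps power2_eq_square)
    show ?thesis unfolding 5 unfolding 6 unfolding 8 9 10 d unfolding 1 2 3 4 unfolding Pf
     by (rule gen) (use 7 in linarith)
   qed
   have "0 < - 2*k*n*Q/f" using kt n Q f by (simp add: divide_less_0_iff zero_less_divide_iff)
   moreover have "0 <= k^2*n*Q^2/f^2*((n-2)^2/(2*(n-1))+n/(Q-1))" using n f by (intro mult_nonneg_nonneg add_nonneg_nonneg) auto
   ultimately show ?thesis unfolding w a id by simp
  qed
  then show "0 < 2*real DIM('a)/(real DIM('a)-1)*((w 1 t+k*a 1 t)/2-1)*((w 1 t+k*a 1 t)/2-real DIM('a))-(w 2 t+k*a 2 t)*(w 0 t+k*a 0 t)"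
   unfolding n_def .
 qed (use mprofile_deriv[OF dim e \<rho>, folded w_def] da x in auto)
 then show ?thesis by (simp add: w_def)
qed

text \<open>For a profile of slope 2\<kappa> the profile equation reduces to
  (\<kappa>-1)(\<kappa>-n) = 0. The chosen a shifts the slope below 1 or above n, where the product
  becomes positive. Slope n stands for the limit of an infinitely large core, slope 1 for the
  ball.\<close>

lemma linear_barrier:
 assumes G: "continuous_on (closure \<Omega>) G" "!!x. x \<in> \<Omega> ==> G x = grad u x"
  and V: "V \<subseteq> \<Omega>" "open V" and \<kappa>: "\<kappa> \<in> {1, real DIM('a)}"
  and fr: "!!x. x \<in> frontier V ==> G x \<bullet> G x <= 2*\<kappa>*dep x"
  and x: "x \<in> V"
 shows "W x <= 2*\<kappa>*dep x"
proof -
 define n where "n = real DIM('a)"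
 have n: "n >= 3" using dim by (simp add: n_def)
 define \<delta> where "\<delta> = (if \<kappa> = 1 then -1 else 1 :: real)"
 define w where "w j t = (if j = 0 then 2*\<kappa>*t else if j = 1 then 2*\<kappa> else 0)" for j :: nat and t
 define a where "a j t = (if j = 0 then M+1+\<delta>*t else if j = 1 then \<delta> else 0)" for j :: nat and t
 have "W x <= w 0 (dep x)"
 proof (rule barrier[OF G V, where a=a])
  show "continuous_on {0..M} (w 0)" "continuous_on {0..M} (a 0)" "continuous_on {0<..<M} (w 2)" "continuous_on {0<..<M} (a 2)"
   unfolding w_def[abs_def] a_def[abs_def] by (simp_all add: continuous_intros)
  show "DERIV (w j) t :> w (Suc j) t" if "j < 2" for j t
   using that by (cases "j = 0") (auto simp: w_def[abs_def] intro!: derivative_eq_intros)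
  show "DERIV (a j) t :> a (Suc j) t" if "j < 2" for j t
   using that by (cases "j = 0") (auto simp: a_def[abs_def] intro!: derivative_eq_intros)
  show "0 <= w 0 t" if "0 <= t" for t using that \<kappa> by (auto simp: w_def)
  show "0 < a 0 t" if "0 <= t" "t <= M" for t using that M_pos by (auto simp: a_def \<delta>_def)
  show "G y \<bullet> G y <= w 0 (dep y)" if "y \<in> frontier V" for y using fr[OF that] by (simp add: w_def)
  fix k t :: real assume kt: "0 < k" "0 < t" "t < M"
  have "0 < ((w 1 t+k*a 1 t)/2-1)*((w 1 t+k*a 1 t)/2-n)"
  proof (cases "\<kappa> = 1")
   case True
   have "(w 1 t+k*a 1 t)/2-1 < 0" "(w 1 t+k*a 1 t)/2-n < 0" using True kt n by (simp_all add: w_def a_def \<delta>_def)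
   then show ?thesis by (rule mult_neg_neg)
  next
   case False
   then have "\<kappa> = n" using \<kappa> by (simp add: n_def)
   then have "0 < (w 1 t+k*a 1 t)/2-1" "0 < (w 1 t+k*a 1 t)/2-n" using False kt n by (simp_all add: w_def a_def \<delta>_def)
   then show ?thesis by (rule mult_pos_pos)
  qed
  moreover have "0 < 2*n/(n-1)" using n by simp
  ultimately have "0 < 2*n/(n-1)*(((w 1 t+k*a 1 t)/2-1)*((w 1 t+k*a 1 t)/2-n))" by (rule mult_pos_pos[rotated])
  then show "0 < 2*real DIM('a)/(real DIM('a)-1)*((w 1 t+k*a 1 t)/2-1)*((w 1 t+k*a 1 t)/2-real DIM('a))-(w 2 t+k*a 2 t)*(w 0 t+k*a 0 t)"
   unfolding n_def mult.assoc by (simp add: w_def a_def)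
 qed (use x in auto)
 then show ?thesis by (simp add: w_def)
qed

section \<open>Expansion at the core\<close>

text \<open>The third derivative of u at p in direction \<nu>.\<close>

definition kap :: "'a => 'a => real" where
 "kap p \<nu> = (\<Sum>c\<in>Basis. (\<nu> \<bullet> c)*pd \<nu> (pd \<nu> (pd c u)) p)"

text \<open>The rank-one Hessian makes the quadratic parts of W and of 2n times the depth equal.
  Fourth derivatives of u enter only multiplied by the vanishing gradient, so the cubic coefficient
  depends on \<open>kap\<close> alone.\<close>

lemma core_expansion:
 assumes p: "p \<in> MX" and \<nu>: "norm \<nu> = 1" and H: "!!h. hess p h = (- real DIM('a)*(\<nu> \<bullet> h)) *R \<nu>"
 shows "((%s. dep (p+s *R \<nu>)/s ^ 2) \<longlongrightarrow> real DIM('a)/2) (at 0)"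
  "((%s. (W (p+s *R \<nu>)-2*real DIM('a)*dep (p+s *R \<nu>))/s ^ 3) \<longlongrightarrow> -(2/3)*real DIM('a)*kap p \<nu>) (at 0)"
proof -
 define n where "n = real DIM('a)"
 have pO: "p \<in> \<Omega>" using p MX_sub by blast
 obtain r where r: "r > 0" "ball p r \<subseteq> \<Omega>" using op pO open_contains_ball by blast
 have mem: "p+s *R \<nu> \<in> \<Omega>" if "\<bar>s\<bar> < r" for s
 proof -
  have "p+s *R \<nu> \<in> ball p r" using that \<nu> by (simp add: dist_norm)
  then show ?thesis using r(2) by blast
 qed
 define g where "g k c s = ((pd \<nu>) ^^ k) (pd c u) (p+s *R \<nu>)" for k :: nat and c s
 have Ck: "Ck_on j \<Omega> (((pd \<nu>) ^^ k) (pd c u))" for j k c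
  by (induction k arbitrary: j) (auto intro: pdC Ck_on_Suc_pd)
 have dg: "DERIV (g k c) s :> g (Suc k) c s" if "\<bar>s\<bar> < r" for k c s
  using has_real_derivative_along[OF Ck_on_Suc_diff[OF op Ck mem[OF that]]] unfolding g_def[abs_def] by simp
 define A where "A k s = (\<Sum>c\<in>Basis. (\<nu> \<bullet> c)*g k c s)" for k s
 have dA: "DERIV (A k) s :> A (Suc k) s" if "\<bar>s\<bar> < r" for k s
  unfolding A_def[abs_def] by (intro DERIV_sum DERIV_cmult dg that)
 have dd: "DERIV (%s. dep (p+s *R \<nu>)) s :> -A 0 s" if s: "\<bar>s\<bar> < r" for s
 proof -
  have "DERIV (%s. dep (p+s *R \<nu>)) s :> 0-pd \<nu> u (p+s *R \<nu>)"
   by (intro DERIV_diff DERIV_const has_real_derivative_along diffs mem s)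
  moreover have "pd \<nu> u (p+s *R \<nu>) = A 0 s"
   unfolding A_def g_def using has_derivative_Basis_expand[OF diffs(1)[OF mem[OF s]], of \<nu>] by (simp add: mult.commute)
  ultimately show ?thesis by simp
 qed
 have nn: "(\<Sum>c\<in>Basis. (\<nu> \<bullet> c)*(\<nu> \<bullet> c)) = 1" using \<nu> euclidean_inner[of \<nu> \<nu>] by (simp add: norm_eq_1)
 have g0: "g 0 c 0 = 0" for c using MX_pd[OF p] by (simp add: g_def)
 have g1: "g 1 c 0 = - n*(\<nu> \<bullet> c)" for c
  using hess_inner[OF pO, of \<nu> c] \<nu> by (simp add: g_def H n_def norm_eq_1)
 have A0: "A 0 0 = 0" by (simp add: A_def g0)
 have A1: "A 1 0 = - n"
 proof -
  have "A 1 0 = (\<Sum>c\<in>Basis. - n*((\<nu> \<bullet> c)*(\<nu> \<bullet> c)))" unfolding A_def by (intro sum.cong refl) (simp only: g1 mult_ac)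
  then show ?thesis by (simp only: sum_distrib_left[symmetric] nn)
 qed
 have A2: "A 2 0 = kap p \<nu>" by (simp add: A_def g_def kap_def numeral_2_eq_2)
 have d0: "dep p = 0" using p by (simp add: MAXset_def)
 have "DERIV (%s. - A 0 s) 0 :> n" using DERIV_minus[OF dA[of 0 0]] r A1 by simp
 from quadratic_limit[OF r(1) dd this] show "((%s. dep (p+s *R \<nu>)/s ^ 2) \<longlongrightarrow> real DIM('a)/2) (at 0)"
  using d0 A0 by (simp add: n_def)
 define f1 where "f1 s = (\<Sum>c\<in>Basis. 2*(g 0 c s*g 1 c s))+2*n*A 0 s" for s
 define f2 where "f2 s = (\<Sum>c\<in>Basis. 2*(g 0 c s*g 2 c s+g 1 c s*g 1 c s))+2*n*A 1 s" for s
 have W: "W (p+s *R \<nu>) = (\<Sum>c\<in>Basis. g 0 c s*g 0 c s)" for s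
  unfolding fun_cong[OF W_expand, of "p+s *R \<nu>"] by (simp add: g_def)
 have e1: "DERIV (%s. W (p+s *R \<nu>)-2*n*dep (p+s *R \<nu>)) s :> f1 s" if "\<bar>s\<bar> < r" for s
 proof -
  have "DERIV (%s. (\<Sum>c\<in>Basis. g 0 c s*g 0 c s)-2*n*dep (p+s *R \<nu>)) s :> (\<Sum>c\<in>Basis. g (Suc 0) c s*g 0 c s+g (Suc 0) c s*g 0 c s)-2*n*(- A 0 s)"
   by (intro DERIV_diff DERIV_sum DERIV_mult dg that DERIV_cmult dd)
  then show ?thesis unfolding W f1_def by (simp add: mult.commute)
 qed
 have e2: "DERIV f1 s :> f2 s" if "\<bar>s\<bar> < r" for s
 proof -
  have "DERIV f1 s :> (\<Sum>c\<in>Basis. 2*(g (Suc 0) c s*g 1 c s+g (Suc 1) c s*g 0 c s))+2*n*A (Suc 0) s"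
   unfolding f1_def[abs_def] by (intro DERIV_add DERIV_sum DERIV_mult dg that DERIV_cmult dA)
  then show ?thesis by (simp add: f2_def mult.commute add.commute numeral_2_eq_2)
 qed
 have "DERIV f2 0 :> (\<Sum>c\<in>Basis. 2*((g (Suc 0) c 0*g 2 c 0+g (Suc 2) c 0*g 0 c 0)+(g (Suc 1) c 0*g 1 c 0+g (Suc 1) c 0*g 1 c 0)))+2*n*A (Suc 1) 0"
  unfolding f2_def[abs_def] by (intro DERIV_add DERIV_sum DERIV_mult dg DERIV_cmult dA) (use r in auto)
 moreover have "(\<Sum>c\<in>Basis. 2*((g (Suc 0) c 0*g 2 c 0+g (Suc 2) c 0*g 0 c 0)+(g (Suc 1) c 0*g 1 c 0+g (Suc 1) c 0*g 1 c 0))) = - 6*n*A 2 0"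
 proof -
  have "2*((g (Suc 0) c 0*g 2 c 0+g (Suc 2) c 0*g 0 c 0)+(g (Suc 1) c 0*g 1 c 0+g (Suc 1) c 0*g 1 c 0)) = - 6*n*((\<nu> \<bullet> c)*g 2 c 0)" for c
   using g1[of c] by (simp add: g0 numeral_2_eq_2)
  then show ?thesis by (simp only: A_def sum_distrib_left)
 qed
 ultimately have e3: "DERIV f2 0 :> -4*n*kap p \<nu>" using A2 by (simp add: numeral_2_eq_2 mult.assoc)
 have z: "f1 0 = 0" by (simp add: f1_def g0 A0)
 have "(\<Sum>c\<in>Basis. 2*(g 0 c 0*g 2 c 0+g 1 c 0*g 1 c 0)) = (\<Sum>c\<in>Basis. 2*n*n*((\<nu> \<bullet> c)*(\<nu> \<bullet> c)))"
  by (intro sum.cong refl) (simp add: g0 g1[unfolded One_nat_def])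
 then have z2: "f2 0 = 0" unfolding f2_def A1 by (simp only: sum_distrib_left[symmetric] nn)
 have "((%s. (W (p+s *R \<nu>)-2*n*dep (p+s *R \<nu>))/s ^ 3) \<longlongrightarrow> (- 4*n*kap p \<nu>)/6) (at 0)"
  by (rule cubic_limit[OF r(1) e1 e2 e3]) (use z z2 MX_grad[OF p] d0 in simp_all)
 then show "((%s. (W (p+s *R \<nu>)-2*real DIM('a)*dep (p+s *R \<nu>))/s ^ 3) \<longlongrightarrow> -(2/3)*real DIM('a)*kap p \<nu>) (at 0)"
  by (simp add: n_def mult.assoc)
qed

text \<open>The expansion of the model profile has the same form with n(n-1)/\<rho> in place of
  \<open>kap\<close>. Dividing the comparison by s^3, whose sign is e on the side considered, orders
  the two cubic coefficients.\<close>

lemma model_comparison_at_core: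
 assumes p: "p \<in> MX" and \<nu>: "norm \<nu> = 1" and H: "!!h. hess p h = (- real DIM('a)*(\<nu> \<bullet> h)) *R \<nu>"
  and e: "e \<in> {1, -1}" and \<rho>: "\<rho> > 0"
  and le: "\<forall>\<^sub>F s in at 0 within {s. 0 < e * s}. W (p+s *R \<nu>) <= mprofile DIM('a) e \<rho> 0 (dep (p+s *R \<nu>))"
 shows "e*(real DIM('a)*(real DIM('a)-1)/\<rho>) <= e*kap p \<nu>"
proof -
 define n where "n = real DIM('a)"
 have n: "n >= 3" using dim by (simp add: n_def)
 let ?F = "at 0 within {s. 0 < e * s}"
 have nt: "?F ~= bot"
 proof (cases "e = 1")
  case True then show ?thesis using trivial_limit_at_right_real[of 0] by (simp add: trivial_limit_def greaterThan_def)
 next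
  case False
  then have "{s. 0 < e * s} = {..<0}" using e by auto
  then show ?thesis using trivial_limit_at_left_real[of 0] by (simp add: trivial_limit_def)
 qed
 have F0: "?F <= at 0" by (simp add: at_le)
 define t where "t s = dep (p+s *R \<nu>)" for s
 note E = core_expansion[OF p \<nu> H, THEN tendsto_mono[OF F0], folded t_def n_def]
 have r2: "\<rho>^2 > 0" using \<rho> by simp
 have es: "\<forall>\<^sub>F s in ?F. 0 < e * s" by (simp add: eventually_at_filter)
 have "\<forall>\<^sub>F s in ?F. 0 < t s/s ^ 2" using order_tendstoD(1)[OF E(1), of 0] n by simp
 then have tp: "\<forall>\<^sub>F s in ?F. 0 < t s" by (rule eventually_mono) (auto simp: zero_less_divide_iff)
 define h where "h s = mpsi DIM('a) e (t s/\<rho>^2)-1" for s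
 have "((%s. t s/s ^ 2 * s ^ 2) \<longlongrightarrow> n/2*0 ^ 2) ?F" by (intro tendsto_mult E(1) tendsto_power tendsto_ident_at)
 moreover have "\<forall>\<^sub>F s in ?F. t s/s ^ 2 * s ^ 2 = t s" by (rule eventually_mono[OF es]) auto
 ultimately have t0: "(t \<longlongrightarrow> 0) ?F" using tendsto_cong[of "%s. t s/s ^ 2 * s ^ 2" t] by simp
 have "((%s. mpsi DIM('a) e (t s/\<rho>^2)) \<longlongrightarrow> mpsi DIM('a) e 0) ?F"
 proof (rule continuous_on_tendsto_compose[OF mpsi_continuous[OF dim e, of 1]])
  show t0': "((%s. t s/\<rho>^2) \<longlongrightarrow> 0) ?F" using tendsto_divide[OF t0 tendsto_const, of "\<rho>^2"] r2 by simp
  show "\<forall>\<^sub>F s in ?F. t s/\<rho>^2 \<in> {0..1}"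
   using tp order_tendstoD(2)[OF t0' zero_less_one] by eventually_elim (use r2 in auto)
 qed simp
 then have h0: "(h \<longlongrightarrow> 0) ?F" unfolding h_def[abs_def] using tendsto_diff[OF _ tendsto_const[of 1]] by (fastforce simp: mpsi_0[OF dim e])
 have eh: "\<forall>\<^sub>F s in ?F. 0 < e*h s"
  using tp by (rule eventually_mono) (use mpsi_side(1)[OF dim e] r2 in \<open>simp add: h_def\<close>)
 have "\<forall>\<^sub>F s in ?F. h s ~= 0" using eh by (rule eventually_mono) auto
 then have hf: "filterlim h (at 0) ?F" using h0 by (simp add: filterlim_at)
 have T: "\<forall>\<^sub>F s in ?F. mT DIM('a) (1+h s) = t s/\<rho>^2"
  using tp by (rule eventually_mono) (use mpsi(2)[OF dim e] r2 in \<open>simp add: h_def\<close>)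
 note L = filterlim_compose[OF model_limits(1)[OF dim] hf] filterlim_compose[OF model_limits(2)[OF dim] hf]
 have "((%s. (t s/s ^ 2)/(\<rho>^2*(mT DIM('a) (1+h s)/h s ^ 2))) \<longlongrightarrow> (n/2)/(\<rho>^2*(n/2))) ?F"
  by (intro tendsto_divide E(1) tendsto_mult tendsto_const L(1)[folded n_def]) (use n r2 in auto)
 moreover have "\<forall>\<^sub>F s in ?F. (t s/s ^ 2)/(\<rho>^2*(mT DIM('a) (1+h s)/h s ^ 2)) = (h s/s)^2"
  using T tp by eventually_elim (use r2 in \<open>simp add: power_divide\<close>)
 ultimately have "((%s. (h s/s)^2) \<longlongrightarrow> (n/2)/(\<rho>^2*(n/2))) ?F" using tendsto_cong by fastforce
 then have "((%s. sqrt ((h s/s)^2)) \<longlongrightarrow> sqrt ((n/2)/(\<rho>^2*(n/2)))) ?F" by (rule tendsto_real_sqrt)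
 moreover have "sqrt ((n/2)/(\<rho>^2*(n/2))) = 1/\<rho>" using n \<rho> by (simp add: real_sqrt_divide)
 moreover have hs: "\<forall>\<^sub>F s in ?F. sqrt ((h s/s)^2) = h s/s"
  using es eh by eventually_elim (use e in \<open>auto simp: divide_nonneg_nonneg divide_nonpos_nonpos\<close>)
 \<comment> \<open>Equal depths of u and of the model to leading order: the rescaled model distance
   h satisfies h ~ s/\<rho>. Only its square is controlled by the depths; the side e fixes the sign
   of the root.\<close>
 ultimately have hsl: "((%s. h s/s) \<longlongrightarrow> 1/\<rho>) ?F" using tendsto_cong[OF hs] by simp
 define w where "w s = \<rho>^2*(mphi DIM('a) (1+h s))^2" for s
 have "((%s. \<rho>^2*(((mphi DIM('a) (1+h s))^2-2*n*mT DIM('a) (1+h s))/h s ^ 3*(h s/s) ^ 3)) \<longlongrightarrow> \<rho>^2*(- (2/3)*n^2*(n-1)*(1/\<rho>) ^ 3)) ?F"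
  by (intro tendsto_mult tendsto_const L(2)[folded n_def] tendsto_power hsl)
 moreover have "\<forall>\<^sub>F s in ?F. \<rho>^2*(((mphi DIM('a) (1+h s))^2-2*n*mT DIM('a) (1+h s))/h s ^ 3*(h s/s) ^ 3) = (w s-2*n*t s)/s ^ 3"
  using T eh by eventually_elim (use r2 in \<open>auto simp: w_def power_divide right_diff_distrib\<close>)
 ultimately have wl: "((%s. (w s-2*n*t s)/s ^ 3) \<longlongrightarrow> \<rho>^2*(- (2/3)*n^2*(n-1)*(1/\<rho>) ^ 3)) ?F" using tendsto_cong by fastforce
 have "e*(- (2/3)*n*kap p \<nu>) <= e*(\<rho>^2*(- (2/3)*n^2*(n-1)*(1/\<rho>) ^ 3))"
 proof (rule tendsto_le[OF nt tendsto_mult[OF tendsto_const wl] tendsto_mult[OF tendsto_const E(2)]])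
  show "\<forall>\<^sub>F s in ?F. e*((W (p+s *R \<nu>)-2*n*t s)/s ^ 3) <= e*((w s-2*n*t s)/s ^ 3)"
   using le es
  proof eventually_elim
   fix s assume s: "W (p+s *R \<nu>) <= mprofile DIM('a) e \<rho> 0 (dep (p+s *R \<nu>))" "0 < e * s"
   have "W (p+s *R \<nu>)-2*n*t s <= w s-2*n*t s" using s(1) by (simp add: w_def h_def t_def mprofile_def Let_def)
   moreover have "0 < e/s ^ 3" using s(2) e by (auto simp: divide_neg_neg power_less_zero_eq)
   ultimately show "e*((W (p+s *R \<nu>)-2*n*t s)/s ^ 3) <= e*((w s-2*n*t s)/s ^ 3)"
    using mult_left_mono[of "W (p+s *R \<nu>)-2*n*t s" "w s-2*n*t s" "e/s ^ 3"] by simp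
  qed
 qed
 moreover have "\<rho>^2*(- (2/3)*n^2*(n-1)*(1/\<rho>) ^ 3) = - (2/3)*n*(n*(n-1)/\<rho>)"
  using \<rho> by (simp add: power2_eq_square power3_eq_cube)
 ultimately have "e*(- (2/3)*n*kap p \<nu>) <= e*(- (2/3)*n*(n*(n-1)/\<rho>))" by (simp only:)
 moreover have "e*(- (2/3)*n*K) <= e*(- (2/3)*n*X) ==> (2/3*n)*(e*X) <= (2/3*n)*(e*K)" for K X
  by (simp add: algebra_simps)
 ultimately have "(2/3*n)*(e*(n*(n-1)/\<rho>)) <= (2/3*n)*(e*kap p \<nu>)" by blast
 then show ?thesis using n unfolding n_def by (simp only: mult_le_cancel_left_pos)
qed

text \<open>At the core W is asymptotically 2n times the depth, so a bound by twice the depth fails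
  already at second order, on whichever side. A bound with the critical factor 2n survives at second
  order and constrains the cubic term.\<close>

lemma linear_comparison_at_core:
 assumes p: "p \<in> MX" and \<nu>: "norm \<nu> = 1" and H: "!!h. hess p h = (- real DIM('a)*(\<nu> \<bullet> h)) *R \<nu>"
 shows "F <= at 0 ==> F ~= bot ==> \<not> (\<forall>\<^sub>F s in F. W (p+s *R \<nu>) <= 2*dep (p+s *R \<nu>))"
  "\<forall>\<^sub>F s in at_left 0. W (p+s *R \<nu>) <= 2*real DIM('a)*dep (p+s *R \<nu>) ==> kap p \<nu> <= 0"
proof -
 define n where "n = real DIM('a)"
 have n: "n >= 3" using dim by (simp add: n_def)
 define t where "t s = dep (p+s *R \<nu>)" for s
 note E = core_expansion[OF p \<nu> H, folded t_def n_def]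
 show "\<not> (\<forall>\<^sub>F s in F. W (p+s *R \<nu>) <= 2*dep (p+s *R \<nu>))" if F: "F <= at 0" "F ~= bot"
 proof
  assume le: "\<forall>\<^sub>F s in F. W (p+s *R \<nu>) <= 2*dep (p+s *R \<nu>)"
  have "((%s. (W (p+s *R \<nu>)-2*n*t s)/s ^ 3 * s+2*(n-1)*(t s/s ^ 2)) \<longlongrightarrow> -(2/3)*n*kap p \<nu>*0+2*(n-1)*(n/2)) (at 0)"
   by (intro tendsto_intros E)
  from tendsto_mono[OF F(1) this] have "((%s. (W (p+s *R \<nu>)-2*n*t s)/s ^ 3 * s+2*(n-1)*(t s/s ^ 2)) \<longlongrightarrow> (n-1)*n) F"
   by (rule back_subst[where P="%L. (_ \<longlongrightarrow> L) F"]) simp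
  moreover have "\<forall>\<^sub>F s in F. s ~= 0" using F(1) by (rule filter_leD) (simp add: eventually_at_filter)
  with le have "\<forall>\<^sub>F s in F. (W (p+s *R \<nu>)-2*n*t s)/s ^ 3 * s+2*(n-1)*(t s/s ^ 2) <= 0"
  proof eventually_elim
   fix s :: real assume s: "W (p+s *R \<nu>) <= 2*dep (p+s *R \<nu>)" "s ~= 0"
   have "(W (p+s *R \<nu>)-2*n*t s)/s ^ 3 * s+2*(n-1)*(t s/s ^ 2) = (W (p+s *R \<nu>)-2*t s)/s ^ 2"
    using s(2) by (simp add: power2_eq_square power3_eq_cube field_simps)
   also have "... <= 0" using s(1) by (intro divide_nonpos_nonneg) (auto simp: t_def)
   finally show "(W (p+s *R \<nu>)-2*n*t s)/s ^ 3 * s+2*(n-1)*(t s/s ^ 2) <= 0" .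
  qed
  ultimately have "(n-1)*n <= 0" using tendsto_upperbound F(2) by blast
  moreover have "0 < (n-1)*n" using n by simp
  ultimately show False by simp
 qed
 assume le: "\<forall>\<^sub>F s in at_left 0. W (p+s *R \<nu>) <= 2*real DIM('a)*dep (p+s *R \<nu>)"
 have neg: "\<forall>\<^sub>F s in at_left 0. s < (0::real)" by (simp add: eventually_at_filter)
 have "at_left (0::real) <= at 0" by (simp add: at_le)
 from tendsto_mono[OF this E(2)]
 have "0 <=-(2/3)*n*kap p \<nu>"
 proof (rule tendsto_lowerbound)
  show "\<forall>\<^sub>F s in at_left 0. 0 <= (W (p+s *R \<nu>)-2*n*t s)/s ^ 3"
   using le neg
  proof eventually_elim
   fix s :: real assume "W (p+s *R \<nu>) <= 2*real DIM('a)*dep (p+s *R \<nu>)" "s < 0"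
   then show "0 <= (W (p+s *R \<nu>)-2*n*t s)/s ^ 3"
    by (intro divide_nonpos_nonpos) (auto simp: n_def t_def)
  qed
 qed simp
 then show "kap p \<nu> <= 0" using n by (simp add: mult_le_0_iff)
qed

end

section \<open>Rigidity in the case of equality\<close>

lemma real_mult_lower: "\<bar>a\<bar> <= K ==>-K*\<bar>b\<bar> <= a*(b::real)"
 using mult_right_mono[of "\<bar>a\<bar>" K "\<bar>b\<bar>"] abs_mult[of a b] by (simp add: abs_le_iff)

context torsion
begin

text \<open>At a touching point the gradient is nonzero, so the drift and zero-order coefficients
  are bounded nearby. The profile being balanced, the comparison equation is the differential
  inequality of the strong maximum principle.\<close>

lemma touching_imp_equal:
 fixes e \<rho> :: real
 assumes e: "e \<in> {1, -1}" and \<rho>: "\<rho> > 0" and V: "open V" "V \<subseteq> \<Omega>'"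
 defines "h \<equiv> %x. W x-mprofile DIM('a) e \<rho> 0 (dep x)"
 assumes le: "!!x. x \<in> V ==> h x <= 0" and x0: "x0 \<in> V" "h x0 = 0"
 shows "\<exists>r>0. ball x0 r \<subseteq> V & (\<forall>x\<in>ball x0 r. h x = 0)"
proof -
 define n where "n = real DIM('a)"
 let ?F = "mprofile DIM('a) e \<rho>"
 note P = mprofile_deriv[OF dim e \<rho>] and P2 = mprofile_continuous(2)[OF dim e \<rho>, of M]
 have x0': "x0 \<in> \<Omega>'" using x0 V by blast
 have Wp: "W x > 0" if "x \<in> \<Omega>'" "h x = 0" for x
 proof -
  have "W x = ?F 0 (dep x)" using that by (simp add: h_def)
  also have "... > 0" using scaled_mphi_nonzero[OF dim e \<rho>, of "dep x"] dep_bounds[OF that(1)] \<rho> by (simp add: mprofile_def Let_def)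
  finally show ?thesis .
 qed
 have sub: "\<Omega>' \<subseteq> \<Omega>" by auto
 have dc: "continuous_on \<Omega>' dep" by (intro continuous_intros continuous_on_subset[OF cont]) (use closure_subset in auto)
 have ran: "dep ` \<Omega>' \<subseteq> {0<..<M}" using dep_bounds by fastforce
 have F1c: "continuous_on {0<..<M} (?F 1)"
  using P[of 1] by (intro continuous_at_imp_continuous_on ballI DERIV_isCont) auto
 define b where "b x = 2*(- (?F 1 (dep x)/2)-(?F 1 (dep x)/2-n)/(n-1))" for x
 define \<Omega>'' where "\<Omega>'' = \<Omega>' \<inter> {x \<in> \<Omega>. grad u x ~= 0}"
 have "open {x \<in> \<Omega>. grad u x ~= 0}"
  using continuous_open_preimage[OF grad_cont op open_Compl[OF closed_singleton[of 0]]] by (simp add: vimage_def Int_def)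
 then have op'': "open \<Omega>''" unfolding \<Omega>''_def using open_\<Omega>' by blast
 have x0'': "x0 \<in> \<Omega>''" using x0' Wp[OF x0' x0(2)] by (auto simp: \<Omega>''_def)
 define k where "k x = \<bar>b x/norm (grad u x)\<bar>+\<bar>?F 2 (dep x)\<bar>" for x
 have s'': "\<Omega>'' \<subseteq> \<Omega>'" "\<Omega>'' \<subseteq> \<Omega>" by (auto simp: \<Omega>''_def)
 note c1 = continuous_on_compose2[OF F1c continuous_on_subset[OF dc s''(1)]] and c2 = continuous_on_compose2[OF P2 continuous_on_subset[OF dc s''(1)]]
 have n1: "n-1 ~= 0" using dim by (simp add: n_def)
 have "continuous_on \<Omega>'' k" unfolding k_def b_def
  by (intro continuous_intros c1 c2 continuous_on_subset[OF grad_cont s''(2)]) (use ran n1 in \<open>auto simp: \<Omega>''_def\<close>)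
 then have "isCont k x0" using op'' x0'' continuous_on_eq_continuous_at by blast
 then obtain r1 where r1: "r1 > 0" "!!x. dist x x0 < r1 ==> dist (k x) (k x0) < 1" unfolding continuous_at_eps_delta by (metis zero_less_one)
 have "open (V \<inter> \<Omega>'')" "x0 \<in> V \<inter> \<Omega>''" using V(1) op'' x0 x0'' by auto
 then obtain r2 where r2: "r2 > 0" "ball x0 r2 \<subseteq> V \<inter> \<Omega>''" using open_contains_ball by blast
 define R where "R = min r1 r2"
 have R: "R > 0" "ball x0 R \<subseteq> V \<inter> \<Omega>''" using r1 r2 by (auto simp: R_def)
 define K where "K = k x0+1"
 have kK: "k x <= K" if "x \<in> ball x0 R" for x
  using r1(2)[of x] that by (simp add: K_def R_def dist_commute dist_real_def)
 have hC: "Ck_on 2 \<Omega>' h" unfolding h_def by (rule compare_derivs(1)[OF P P2])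
 have RO: "ball x0 R \<subseteq> \<Omega>'" using R s'' by blast
 have "h x = 0" if x: "x \<in> ball x0 (R/4)" for x
 proof (rule strong_maximum[OF Ck_on_subset[OF open_\<Omega>' open_ball RO hC] R(1) _ _ x0(2) _ x])
  show "K >= 0" unfolding K_def k_def by simp
  show "h y <= 0" if "y \<in> ball x0 R" for y using le R that by blast
  fix y assume y: "y \<in> ball x0 R"
  have y': "y \<in> \<Omega>'" "grad u y ~= 0" using y R(2) unfolding \<Omega>''_def by blast+
  have t: "dep y > 0" using dep_bounds[OF y'(1)] by simp
  define \<nu> where "\<nu> = grad u y /\<^sub>R norm (grad u y)"
  have \<nu>: "norm \<nu> = 1" using y'(2) by (simp add: \<nu>_def)
  have lb: "(2*n/(n-1)*(?F 1 (dep y)/2-1)*(?F 1 (dep y)/2-n)-?F 2 (dep y)*?F 0 (dep y))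
   + 2*(- (?F 1 (dep y)/2)-(?F 1 (dep y)/2-n)/(n-1))*pd \<nu> h y/norm (grad u y)-?F 2 (dep y)*h y <= laplacian h y"
   unfolding h_def n_def \<nu>_def by (rule laplacian_lower_bound[OF P P2 y'])
  have bal: "2*n/(n-1)*(?F 1 (dep y)/2-1)*(?F 1 (dep y)/2-n)-?F 2 (dep y)*?F 0 (dep y) = 0"
   unfolding n_def by (simp only: mprofile_balanced[OF dim e \<rho> t] diff_self)
  have "b y/norm (grad u y)*pd \<nu> h y-?F 2 (dep y)*h y <= laplacian h y"
   using lb unfolding bal b_def[symmetric] by simp
  moreover have "\<bar>b y/norm (grad u y)\<bar> <= K" "\<bar>- ?F 2 (dep y)\<bar> <= K" using kK[OF y] unfolding k_def by linarith+
  note real_mult_lower[OF this(1), of "pd \<nu> h y"] real_mult_lower[OF this(2), of "h y"]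
  ultimately have "- K*\<bar>pd \<nu> h y\<bar> + - K*\<bar>h y\<bar> <= laplacian h y" by simp
  then show "\<exists>\<nu>. norm \<nu> = 1 &-K*(\<bar>pd \<nu> h y\<bar>+\<bar>h y\<bar>) <= laplacian h y" using \<nu> by (intro exI[of _ \<nu>]) (simp add: distrib_left)
 qed
 moreover have "ball x0 (R/4) \<subseteq> V" using R by (auto simp: subset_iff)
 ultimately show ?thesis using R(1) by (intro exI[of _ "R/4"]) auto
qed

text \<open>Equality forces the Hessian to be that of a radial function, so that the centre $x + \nabla u / (1 - q)$
 does not depend on $x$.\<close>
lemma equality_imp_radial:
 fixes e \<rho> :: real
 assumes e: "e \<in> {1, -1}" and \<rho>: "\<rho> > 0" and r: "r > 0" and B: "ball x0 r \<subseteq> \<Omega>'"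
 assumes eq: "!!x. x \<in> ball x0 r ==> W x = mprofile DIM('a) e \<rho> 0 (dep x)"
 shows "\<exists>c. \<forall>x\<in>ball x0 r. x ~= c & u x = M-\<rho>^2*mT DIM('a) (norm (x-c)/\<rho>)"
proof -
 define n where "n = real DIM('a)"
 have n: "n >= 3" using dim by (simp add: n_def)
 let ?F = "mprofile DIM('a) e \<rho>"
 note P = mprofile_deriv[OF dim e \<rho>] and P2 = mprofile_continuous(2)[OF dim e \<rho>, of M]
 define h where "h x = W x-?F 0 (dep x)" for x
 have h0: "h x = 0" if "x \<in> ball x0 r" for x using eq[OF that] by (simp add: h_def)
 define \<psi> where "\<psi> x = mpsi DIM('a) e (dep x/\<rho>^2)" for x
 define q where "q x = mq DIM('a) (\<psi> x)" for x
 have bd: "0 < dep x" if "x \<in> ball x0 r" for x using dep_bounds B that by blast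
 have \<psi>: "\<psi> x > 0" "mphi DIM('a) (\<psi> x) ~= 0" "mphi DIM('a) (\<psi> x) = \<psi> x*(1-q x)" "mT DIM('a) (\<psi> x) = dep x/\<rho>^2" if "x \<in> ball x0 r" for x
  unfolding \<psi>_def q_def mphi_def
  using scaled_mpsi_pos[OF dim e \<rho>, of "dep x"] scaled_mphi_nonzero[OF dim e \<rho>, of "dep x"] mpsi(2)[OF dim e, of "dep x/\<rho>^2"] bd[OF that] \<rho>
  by (auto simp: mphi_def)
 have q1: "1-q x ~= 0" if "x \<in> ball x0 r" for x using \<psi>(2,3)[OF that] by auto
 have Wx: "W x = \<rho>^2*(mphi DIM('a) (\<psi> x))^2" if "x \<in> ball x0 r" for x
  using eq[OF that] by (simp add: mprofile_def \<psi>_def Let_def)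
 define \<nu> where "\<nu> x = grad u x /\<^sub>R norm (grad u x)" for x
 have g0: "grad u x ~= 0" if "x \<in> ball x0 r" for x
 proof -
  have "W x > 0" unfolding Wx[OF that] using \<psi>(2)[OF that] \<rho> by simp
  then show ?thesis by auto
 qed
 have g: "grad u x = norm (grad u x) *R \<nu> x" "norm (\<nu> x) = 1" if "x \<in> ball x0 r" for x using g0[OF that] by (simp_all add: \<nu>_def)
 have H: "hess x v = (q x-1) *R v+(- n*q x*(\<nu> x \<bullet> v)) *R \<nu> x" if x: "x \<in> ball x0 r" for x v
 proof -
  have x': "x \<in> \<Omega>'" using x B by blast
  have pdh: "pd v h x = 0" for v
  proof -
   have "frechet_derivative h (at x) = frechet_derivative (%x. 0) (at x)" by (rule frechet_derivative_cong_open[OF open_ball x h0])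
   then show ?thesis by simp
  qed
  have lap: "laplacian h x = 0"
  proof -
   have "laplacian h x = laplacian (%x. 0) x" by (rule laplacian_cong_open[OF open_ball x h0])
   then show ?thesis by (simp add: laplacian_def)
  qed
  define \<mu> where "\<mu> = ?F 1 (dep x)/2"
  define \<alpha> where "\<alpha> = (\<mu>-n)/(n-1)"
  define \<beta> where "\<beta> = - \<mu>-\<alpha>"
  have bal: "2*n/(n-1)*(\<mu>-1)*(\<mu>-n)-?F 2 (dep x)*?F 0 (dep x) = 0"
   unfolding n_def \<mu>_def by (simp only: mprofile_balanced[OF dim e \<rho> bd[OF x]] diff_self)
  have "laplacian h x = 2*(\<Sum>b\<in>Basis. (norm (hess x b-(\<alpha> *R b+(\<beta>*(\<nu> x \<bullet> b)) *R \<nu> x)))^2)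
   + (2*n/(n-1)*(\<mu>-1)*(\<mu>-n)-?F 2 (dep x)*?F 0 (dep x))+2*\<beta>*pd (\<nu> x) h x/norm (grad u x)-?F 2 (dep x)*h x"
   unfolding h_def[abs_def] n_def \<mu>_def \<alpha>_def \<beta>_def \<nu>_def by (rule laplacian_decomposition[OF P P2 x' g0[OF x]])
  then have "(\<Sum>b\<in>Basis. (norm (hess x b-(\<alpha> *R b+(\<beta>*(\<nu> x \<bullet> b)) *R \<nu> x)))^2) = 0"
   unfolding lap bal pdh h0[OF x] by simp
  \<comment> \<open>With h identically zero, every term of the decomposition except the sum of
    squares vanishes, hence each square does too.\<close>
  then have z: "hess x b = \<alpha> *R b+(\<beta>*(\<nu> x \<bullet> b)) *R \<nu> x" if "b \<in> Basis" for b
   using that by (subst (asm) sum_nonneg_eq_0_iff) auto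
  have \<mu>: "\<mu> = 1+(n-1)*q x" by (simp add: \<mu>_def mprofile_def Let_def q_def \<psi>_def n_def)
  then have "\<mu>-n = (n-1)*(q x-1)" by (simp add: algebra_simps)
  then have a: "\<alpha> = q x-1" using n by (simp add: \<alpha>_def)
  then have ab: "\<alpha> = q x-1" "\<beta> = - n*q x" using \<mu> by (simp_all add: \<beta>_def algebra_simps)
  have xO: "x \<in> \<Omega>" using x' by simp
  note l = hess_linear[OF xO]
  have "hess x v = hess x (\<Sum>b\<in>Basis. (v \<bullet> b) *R b)" by (simp add: euclidean_representation)
  also have "... = (\<Sum>b\<in>Basis. (v \<bullet> b) *R hess x b)" by (simp add: linear_sum[OF l] linear_cmul[OF l])
  also have "... = (\<Sum>b\<in>Basis. \<alpha> *R ((v \<bullet> b) *R b)+(\<beta>*((\<nu> x \<bullet> b)*(v \<bullet> b))) *R \<nu> x)"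
   by (intro sum.cong refl) (simp add: z scaleR_add_right mult_ac)
  also have "... = \<alpha> *R v+(\<beta>*(\<nu> x \<bullet> v)) *R \<nu> x"
   by (simp only: sum.distrib scaleR_sum_right[symmetric] scaleR_sum_left[symmetric] sum_distrib_left[symmetric] euclidean_representation euclidean_inner[of "\<nu> x" v, symmetric])
  finally show ?thesis unfolding ab by simp
 qed
 \<comment> \<open>In the model the gradient is -(1-q)(x-c), so this factor turns it into the vector
   from x to the centre.\<close>
 define \<kappa> where "\<kappa> x = 1/(1-q x)" for x
 define Y where "Y x = x+\<kappa> x *R grad u x" for x
 have "\<exists>c. \<forall>x\<in>ball x0 r. Y x = c"
 proof (rule has_derivative_zero_constant[OF convex_ball])
  fix x assume x: "x \<in> ball x0 r"
  have xO: "x \<in> \<Omega>" using x B by blast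
  define D where "D = \<rho>^2*(\<psi> x*mphi DIM('a) (\<psi> x))"
  have D0: "D ~= 0" using \<psi>[OF x] \<rho> by (simp add: D_def)
  have dd: "(dep has_derivative (%v. - (grad u x \<bullet> v))) (at x)"
  proof -
   have "(dep has_derivative (%v. 0-pd v u x)) (at x)" by (intro has_derivative_diff has_derivative_const has_derivative_frechet diffs xO)
   then show ?thesis by (simp add: grad_inner[OF xO])
  qed
  have dq: "(q has_derivative (%v. n*q x/D*(grad u x \<bullet> v))) (at x)"
  proof -
   have "((%t. mq DIM('a) (mpsi DIM('a) e (t/\<rho>^2))) has_derivative (*) (- n*q x/D)) (at (dep x))"
    using scaled_mq_deriv[OF dim e \<rho> bd[OF x]] unfolding has_field_derivative_def by (simp add: q_def \<psi>_def D_def n_def)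
   from has_derivative_compose[OF dd this] show ?thesis by (simp add: q_def[abs_def] \<psi>_def[abs_def])
  qed
  have d\<kappa>: "(\<kappa> has_derivative (%v. n*q x/(D*(1-q x)^2)*(grad u x \<bullet> v))) (at x)"
  proof -
   have "(\<kappa> has_derivative (%v. (0*(1-q x)-1*(0-n*q x/D*(grad u x \<bullet> v)))/((1-q x)*(1-q x)))) (at x)"
    unfolding \<kappa>_def[abs_def] by (intro has_derivative_divide' has_derivative_const has_derivative_diff dq q1 x)
   then show ?thesis by (simp add: power2_eq_square)
  qed
  have "(Y has_derivative (%v. v+(\<kappa> x *R hess x v+(n*q x/(D*(1-q x)^2)*(grad u x \<bullet> v)) *R grad u x))) (at x)"
   unfolding Y_def[abs_def] by (intro has_derivative_add has_derivative_ident has_derivative_scaleR d\<kappa> grad_derivative xO)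
  moreover have "v+(\<kappa> x *R hess x v+(n*q x/(D*(1-q x)^2)*(grad u x \<bullet> v)) *R grad u x) = 0" for v
  proof -
   define w where "w = \<nu> x \<bullet> v"
   have e1: "\<kappa> x *R hess x v = - v-(n*q x*\<kappa> x*w) *R \<nu> x"
   proof -
    have "\<kappa> x*(q x-1) = - 1" using q1[OF x] by (simp add: \<kappa>_def field_simps)
    then have "\<kappa> x *R ((q x-1) *R v) = - v" by simp
    then show ?thesis unfolding H[OF x] scaleR_add_right w_def by (simp add: mult_ac)
   qed
   have e2: "(n*q x/(D*(1-q x)^2)*(grad u x \<bullet> v)) *R grad u x = (n*q x/(D*(1-q x)^2)*W x*w) *R \<nu> x"
    unfolding power2_norm_eq_inner[symmetric] w_def by (subst (1 2) g(1)[OF x]) (simp add: power2_eq_square)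
   have e3: "n*q x/(D*(1-q x)^2)*W x = n*q x*\<kappa> x"
   proof -
    have "W x/(D*(1-q x)^2) = \<kappa> x"
     unfolding Wx[OF x] D_def \<kappa>_def \<psi>(3)[OF x] using \<psi>(1)[OF x] q1[OF x] \<rho> by (simp add: power2_eq_square)
    then show ?thesis by (metis times_divide_eq_left times_divide_eq_right)
   qed
   show ?thesis unfolding e1 e2 e3 by simp
  qed
  ultimately show "(Y has_derivative (%h. 0)) (at x within ball x0 r)" by (simp add: has_derivative_at_withinI)
 qed
 then obtain c where c: "!!x. x \<in> ball x0 r ==> Y x = c" by blast
 have "x ~= c & u x = M-\<rho>^2*mT DIM('a) (norm (x-c)/\<rho>)" if x: "x \<in> ball x0 r" for x
 proof -
  have "x-c = - (\<kappa> x *R grad u x)" using c[OF x] by (auto simp: Y_def)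
  then have "(norm (x-c))^2 = (\<kappa> x)^2*W x" by (simp add: power_mult_distrib power2_norm_eq_inner)
  also have "... = (\<rho>*\<psi> x)^2" unfolding Wx[OF x] \<psi>(3)[OF x] using q1[OF x] by (simp add: \<kappa>_def power_mult_distrib power_divide)
  finally have nx: "norm (x-c) = \<rho>*\<psi> x" using \<psi>(1)[OF x] \<rho> by (simp add: power2_eq_iff_nonneg)
  then have "x ~= c" using \<psi>(1)[OF x] \<rho> by auto
  moreover have "\<rho>^2*mT DIM('a) (norm (x-c)/\<rho>) = dep x" using nx \<psi>(4)[OF x] \<rho> by simp
  ultimately show ?thesis by simp
 qed
 then show ?thesis by blast
qed

text \<open>The radial expression has Laplacian -n off its centre, so its difference from u is
  harmonic on the domain without c, which remains connected, and vanishes on a ball. The centre lies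
  outside, because near it the expression would be negative while u is positive.\<close>

lemma radial_extends:
 fixes \<rho> :: real
 assumes \<rho>: "\<rho> > 0" and r: "r > 0" and B: "ball x0 r \<subseteq> \<Omega>"
  and rad: "!!x. x \<in> ball x0 r ==> x ~= c & u x = M-\<rho>^2*mT DIM('a) (norm (x-c)/\<rho>)"
  and x: "x \<in> \<Omega>"
 shows "x ~= c & u x = M-\<rho>^2*mT DIM('a) (norm (x-c)/\<rho>)"
proof -
 define n where "n = real DIM('a)"
 have n: "n >= 3" using dim by (simp add: n_def)
 \<comment> \<open>In terms of the squared distance s, s^a is the fundamental solution r^(2-n); A
   and K are read off from the scaled \<open>mT\<close>, so that N is the depth of the model minus
   M.\<close>
 define a where "a = (2-n)/2"
 define A where "A = M+n*\<rho>^2/(2*(n-2))"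
 define K where "K = \<rho> ^ DIM('a)/(n-2)"
 define F where "F j s = (if j = 0 then s/2+K * s powr a-A else if j = 1 then 1/2+K*(a * s powr (a-1)) else K*(a*((a-1) * s powr (a-2))))" for j :: nat and s
 have Fd: "DERIV (F j) s :> F (Suc j) s" if "j < 2" "s \<in> {0<..}" for j s
 proof -
  have p: "DERIV (%s. s powr a') s :> a' * s powr (a'-1)" for a' using that has_real_derivative_powr[of s a'] by simp
  show ?thesis
  proof (cases "j = 0")
   case True then show ?thesis unfolding F_def[abs_def] using that(2) by (auto intro!: derivative_eq_intros)
  next
   case False
   then have "j = 1" using that by simp
   then show ?thesis unfolding F_def[abs_def] using DERIV_cmult[OF DERIV_cmult[OF p[of "a-1"], of a], of K] DERIV_add[OF DERIV_const[of "1/2"]]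
    by fastforce
  qed
 qed
 have F2c: "continuous_on {0<..} (F 2)" unfolding F_def[abs_def] by (auto intro!: continuous_intros)
 define N where "N x = F 0 ((x-c) \<bullet> (x-c))" for x
 have Nval: "N x = \<rho>^2*mT DIM('a) (norm (x-c)/\<rho>)-M" if "x ~= c" for x
 proof -
  define y where "y = norm (x-c)"
  have y: "y > 0" using that by (simp add: y_def)
  have s: "(x-c) \<bullet> (x-c) = y^2" by (simp add: y_def power2_norm_eq_inner)
  have "(y^2) powr a = y powr (2-n)"
  proof -
   have "2*a = 2-n" by (simp add: a_def)
   moreover have "(y powr 2) powr a = y powr (2*a)" by (rule powr_powr)
   ultimately show ?thesis using y by simp
  qed
  also have "... = y^2/y ^ DIM('a)" using y by (simp add: powr_diff n_def powr_realpow)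
  finally have p: "(y^2) powr a = y^2/y ^ DIM('a)" .
  have "\<rho>^2*((y/\<rho>)^2*mq DIM('a) (y/\<rho>)) = \<rho> ^ DIM('a)*(y^2/y ^ DIM('a))"
   using \<rho> y by (simp add: mq_def power_divide)
  then have "\<rho>^2*((y/\<rho>)^2*mq DIM('a) (y/\<rho>)/(n-2)) = K*(y^2/y ^ DIM('a))" by (simp add: K_def)
  moreover have "\<rho>^2*((y/\<rho>)^2/2) = y^2/2" using \<rho> by (simp add: power_divide)
  ultimately show ?thesis
   unfolding N_def s F_def p y_def[symmetric] mT_def n_def[symmetric] A_def
   by (simp add: right_diff_distrib distrib_left mult.commute)
 qed
 define S where "S = \<Omega> - {c}"
 have S: "open S" "connected S" unfolding S_def using op connected_open_delete[OF op conn] dim by auto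
 have SO: "S \<subseteq> \<Omega>" by (auto simp: S_def)
 have mem: "(x-c) \<bullet> (x-c) \<in> {0<..}" if "x \<in> S" for x using that by (auto simp: S_def)
 have NC: "Ck_on 2 S N" unfolding N_def
  by (rule Ck_on_compose_real[OF S(1) Ck_on_dist_square[OF S(1)], where T="{0<..}"]) (use mem Fd F2c in auto)
 have lapN: "laplacian N x = n" if "x \<in> S" for x
 proof -
  define s where "s = (x-c) \<bullet> (x-c)"
  have s: "s > 0" using mem[OF that] by (simp add: s_def)
  have "laplacian N x = 2*n*F 1 s+4 * s*F 2 s"
   unfolding N_def s_def n_def by (rule laplacian_radial(2)[where T="{0<..}"]) (use Fd mem[OF that] in auto)
  moreover have "s * s powr (a-2) = s powr (a-1)" using s by (simp add: powr_diff power2_eq_square flip: powr_numeral) (simp add: powr_numeral power2_eq_square)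
  then have "4 * s*F 2 s = 4*K*a*(a-1) * s powr (a-1)" unfolding F_def by simp
  moreover have "2*n*F 1 s = n+2*n*K*a * s powr (a-1)" by (simp add: F_def distrib_left)
  moreover have "2*n*K*a * s powr (a-1)+4*K*a*(a-1) * s powr (a-1) = 2*K*a * s powr (a-1)*(n+2*(a-1))" by (simp add: algebra_simps)
  moreover have "n+2*(a-1) = 0" by (simp add: a_def field_simps)
  ultimately show ?thesis by simp
 qed
 define f where "f x = u x+N x" for x
 have uS: "Ck_on 2 S u" by (rule Ck_on_subset[OF op S(1) SO uC])
 have fC: "Ck_on 2 S f" unfolding f_def by (rule Ck_on_add[OF S(1) uS NC])
 have fl: "laplacian f x = 0" if "x \<in> S" for x
  unfolding f_def laplacian_add[OF S(1) uS NC that] using lapN[OF that] pde[OF subsetD[OF SO that]] by (simp add: n_def)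
 have BS: "ball x0 r \<subseteq> S" using B rad[of c] by (auto simp: S_def)
 have fz: "f x = 0" if "x \<in> ball x0 r" for x using rad[OF that] Nval[of x] by (simp add: f_def)
 have val: "u x = M-\<rho>^2*mT DIM('a) (norm (x-c)/\<rho>)" if "x \<in> \<Omega>" "x ~= c" for x
  using harmonic_identity[OF dim S fC fl BS r fz, of x] Nval[of x] that by (simp add: f_def S_def)
 have "c \<notin> \<Omega>"
 proof
  assume cO: "c \<in> \<Omega>"
  obtain d where d: "d > 0" "ball c d \<subseteq> \<Omega>" using op cO open_contains_ball by blast
  define y0 where "y0 = mpsi DIM('a) (-1) (M/\<rho>^2)"
  have m: "0 <= M/\<rho>^2" using M_pos by simp
  have y0: "0 < y0" "y0 <= 1" "mT DIM('a) y0 = M/\<rho>^2" using mpsi[OF dim _ m, of "-1"] by (auto simp: y0_def branch_def)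
  define y where "y = min (y0/2) (d/\<rho>/2)"
  have "d/\<rho> > 0" using d \<rho> by simp
  then have y: "0 < y" "y < y0" "y < d/\<rho>" using y0 by (auto simp: y_def)
  obtain b :: 'a where b: "b \<in> Basis" using nonempty_Basis by blast
  define z where "z = c+(\<rho>*y) *R b"
  have nz: "norm (z-c) = \<rho>*y" using b \<rho> y by (simp add: z_def)
  have "\<rho>*y < d" using y(3) \<rho> by (simp add: pos_less_divide_eq mult.commute)
  then have "z \<in> ball c d" using nz by (simp add: dist_norm norm_minus_commute)
  then have zO: "z \<in> \<Omega>" using d by blast
  have "z ~= c" using nz \<rho> y by auto
  from val[OF zO this] have "u z = M-\<rho>^2*mT DIM('a) y" using nz \<rho> by simp
  moreover have "M/\<rho>^2 < mT DIM('a) y" using mT_strict(2)[OF dim y(1,2) y0(2)] y0(3) by simp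
  then have "M < \<rho>^2*mT DIM('a) y" using \<rho> by (simp add: pos_divide_less_eq mult.commute)
  ultimately show False using u_pos[OF zO] by simp
 qed
 then show ?thesis using val x by blast
qed

text \<open>The formula for u is positive exactly in an annulus A. The domain is open in A, and
  closed in A because u would be both zero and positive at a boundary point inside A; as A is
  connected, the domain is A.\<close>

lemma radial_imp_equiv:
 fixes \<rho> :: real
 assumes \<rho>: "\<rho> > 0" and rad: "!!x. x \<in> \<Omega> ==> x ~= c & u x = M-\<rho>^2*mT DIM('a) (norm (x-c)/\<rho>)"
  and y: "y > 0" "mT DIM('a) y = M/\<rho>^2"
 shows "equiv_sol (Omega_model DIM('a) (mR DIM('a) y)) (u_model DIM('a) (mR DIM('a) y)) \<Omega> u"
proof -
 let ?n = "DIM('a)"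
 have mp: "0 < M/\<rho>^2" using M_pos \<rho> by simp
 \<comment> \<open>The depth M is reached at one radius on each side of the core. As
   \<open>mR\<close> depends on y only through its depth, both radii belong to the same normalised
   model.\<close>
 define a where "a = mpsi ?n (-1) (M/\<rho>^2)"
 define b where "b = mpsi ?n 1 (M/\<rho>^2)"
 have a: "0 < a" "a < 1" "mT ?n a = M/\<rho>^2" using mpsi_pos[OF dim, of "-1" "M/\<rho>^2"] mpsi_side(1)[OF dim _ mp, of "-1"] mpsi(2)[OF dim, of "-1" "M/\<rho>^2"] mp by (auto simp: a_def)
 have b: "0 < b" "1 < b" "mT ?n b = M/\<rho>^2" using mpsi_pos[OF dim, of 1 "M/\<rho>^2"] mpsi_side(1)[OF dim _ mp, of 1] mpsi(2)[OF dim, of 1 "M/\<rho>^2"] mp by (auto simp: b_def)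
 define R where "R = mR ?n y"
 have R: "R = mR ?n a" "R = mR ?n b" using y a b by (simp_all add: R_def mR_def)
 have R0: "R > 0" using mR_props(1)[OF dim y(1)] by (simp add: R_def)
 have radii: "r1 ?n R = R*a" "r2 ?n R = R*b" using model_radii(1)[OF dim a(1,2)] model_radii(2)[OF dim b(1,2)] R by auto
 define A where "A = {x. \<rho>*a < norm (x-c) & norm (x-c) < \<rho>*b}"
 have less: "mT ?n z < M/\<rho>^2 \<longleftrightarrow> a < z & z < b" if "z > 0" for z
 proof
  show "mT ?n z < M/\<rho>^2 ==> a < z & z < b"
   using mT_strict(1)[OF dim, of b z] mT_strict(2)[OF dim that, of a] a b
   by (metis less_asym' less_eq_real_def linorder_neqE_linordered_idom)
  show "a < z & z < b ==> mT ?n z < M/\<rho>^2"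
   using mT_strict(1)[OF dim, of z b] mT_strict(2)[OF dim, of a z] a b by (cases "z <= 1") auto
 qed
 have posA: "0 < M-\<rho>^2*mT ?n (norm (x-c)/\<rho>) \<longleftrightarrow> x \<in> A" if "x ~= c" for x
 proof -
  have "0 < M-\<rho>^2*mT ?n (norm (x-c)/\<rho>) \<longleftrightarrow> mT ?n (norm (x-c)/\<rho>) < M/\<rho>^2" using \<rho> by (simp add: pos_less_divide_eq mult.commute)
  also have "... \<longleftrightarrow> a < norm (x-c)/\<rho> & norm (x-c)/\<rho> < b" using that \<rho> by (intro less) simp
  finally show ?thesis using \<rho> by (simp add: A_def pos_less_divide_eq pos_divide_less_eq mult.commute)
 qed
 have OA: "\<Omega> \<subseteq> A" using posA rad u_pos by fastforce
 have cA: "c \<notin> A" using a \<rho> by (simp add: A_def mult_less_0_iff not_less)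
 have clA: "x \<in> \<Omega>" if x: "x \<in> A" "x \<in> closure \<Omega>" for x
 proof (rule ccontr)
  assume "x \<notin> \<Omega>"
  then have "u x = 0" using x op bc by (simp add: frontier_def interior_open)
  obtain X where X: "!!i. X i \<in> \<Omega>" "X \<longlonglongrightarrow> x" using x(2) closure_sequential by blast
  have xc: "x ~= c" using x cA by blast
  have "(%i. u (X i)) \<longlonglongrightarrow> u x"
   by (rule continuous_on_tendsto_compose[OF cont X(2) x(2)]) (simp add: X(1) closure_subset[THEN subsetD])
  moreover have "(%i. M-\<rho>^2*mT ?n (norm (X i-c)/\<rho>)) \<longlonglongrightarrow> M-\<rho>^2*mT ?n (norm (x-c)/\<rho>)"
  proof (intro tendsto_intros isCont_tendsto_compose[where g="mT ?n"] X(2))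
   show "isCont (mT ?n) (norm (x-c)/\<rho>)" using mT_deriv[OF dim, of "norm (x-c)/\<rho>"] xc \<rho> DERIV_isCont by auto
  qed (use \<rho> in simp)
  moreover have "(%i. u (X i)) = (%i. M-\<rho>^2*mT ?n (norm (X i-c)/\<rho>))" using rad[OF X(1)] by auto
  ultimately have "u x = M-\<rho>^2*mT ?n (norm (x-c)/\<rho>)" using LIMSEQ_unique by metis
  then show False using \<open>u x = 0\<close> posA[OF xc] x(1) by simp
 qed
 have "\<Omega> = A"
 proof -
  have cn: "connected A"
   unfolding A_def using dim by (intro connected_annulus(1)) simp
  have "\<Omega> \<inter> A = {} \<or> (- closure \<Omega>) \<inter> A = {}"
   by (rule connectedD[OF cn op]) (use clA closure_subset in auto)
  then show ?thesis using OA ne clA by blast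
 qed
 define k where "k = \<rho>/R"
 have k: "k > 0" using \<rho> R0 by (simp add: k_def)
 have img: "\<Omega> = (%x. k *R x+c) ` Omega_model ?n R"
 proof
  have kR: "k * R = \<rho>" using R0 by (simp add: k_def)
  show "(%x. k *R x+c) ` Omega_model ?n R \<subseteq> \<Omega>"
  proof
   fix z assume "z \<in> (%x. k *R x+c) ` Omega_model ?n R"
   then obtain x where x: "z = k *R x+c" "R*a < norm x" "norm x < R*b" by (auto simp: Omega_model_def radii)
   have "k*(R*a) < k*norm x" "k*norm x < k*(R*b)" using x k by simp_all
   then show "z \<in> \<Omega>" unfolding \<open>\<Omega> = A\<close> A_def x(1) using k kR by (simp add: mult.assoc[symmetric])
  qed
  show "\<Omega> \<subseteq> (%x. k *R x+c) ` Omega_model ?n R"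
  proof
   fix z assume "z \<in> \<Omega>"
   then have z: "k*(R*a) < norm (z-c)" "norm (z-c) < k*(R*b)" unfolding \<open>\<Omega> = A\<close> A_def using kR by (simp_all add: mult.assoc[symmetric])
   have "norm ((1/k) *R (z-c)) = norm (z-c)/k" using k by simp
   then have "(1/k) *R (z-c) \<in> Omega_model ?n R" unfolding Omega_model_def radii mem_Collect_eq
    using z k by (simp only: pos_less_divide_eq pos_divide_less_eq mult.commute)
   moreover have "z = k *R ((1/k) *R (z-c))+c" using k by simp
   ultimately show "z \<in> (%x. k *R x+c) ` Omega_model ?n R" by blast
  qed
 qed
 have "u z = k^2*u_model ?n R ((1/k) *R (z-c))" if "z \<in> \<Omega>" for z
 proof -
  define w where "w = norm (z-c)/\<rho>"
  have w: "w > 0" using rad[OF that] \<rho> by (simp add: w_def)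
  have nw: "norm ((1/k) *R (z-c)) = R*w" using k R0 \<rho> by (simp add: w_def k_def)
  have "u_model ?n R ((1/k) *R (z-c)) = R^2*(M/\<rho>^2-mT ?n w)"
   using u_model_scaled[OF dim y(1) w nw[unfolded R_def]] by (simp add: R_def y(2))
  then have "k^2*u_model ?n R ((1/k) *R (z-c)) = \<rho>^2*(M/\<rho>^2-mT ?n w)" using R0 by (simp add: k_def power_divide)
  also have "... = u z" using rad[OF that] \<rho> by (simp add: w_def right_diff_distrib)
  finally show ?thesis by simp
 qed
 then show ?thesis unfolding equiv_sol_def R_def[symmetric] using k img by blast
qed

text \<open>Continuity of G up to the boundary identifies the boundary limits of |grad u| with |G|.
  The last part evaluates the stress when |G| is constant on the component.\<close>

lemma nwss_props:
 assumes G: "continuous_on (closure \<Omega>) G" "!!x. x \<in> \<Omega> ==> G x = grad u x" and \<Gamma>: "\<Gamma> \<in> components (frontier \<Omega>)"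
 shows "x \<in> \<Gamma> ==> u x = 0 & G x \<bullet> G x <= 2*M*(nwss \<Omega> u \<Gamma>)^2" "0 <= nwss \<Omega> u \<Gamma>"
  "(!!x. x \<in> \<Gamma> ==> G x \<bullet> G x = 2*M*K) ==> (nwss \<Omega> u \<Gamma>)^2 = K"
proof -
 have sub: "\<Gamma> \<subseteq> frontier \<Omega>" by (rule in_components_subset[OF \<Gamma>])
 have sub': "\<Gamma> \<subseteq> closure \<Omega>" using sub by (auto simp: frontier_def)
 have ne: "\<Gamma> ~= {}" by (rule in_components_nonempty[OF \<Gamma>])
 have cp: "compact \<Gamma>"
  using closed_components[OF frontier_closed \<Gamma>] bounded_subset[OF bounded_closure[OF bdd] sub'] by (simp add: compact_eq_bounded_closed)
 have b: "bdry_grad_norm \<Omega> u x = norm (G x)" if "x \<in> \<Gamma>" for x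
  unfolding bdry_grad_norm_def
 proof (rule tendsto_Lim)
  have xf: "x \<in> closure \<Omega>" "x \<notin> \<Omega>" using sub that op by (auto simp: frontier_def interior_open)
  then show "at x within \<Omega> ~= bot" by (simp add: trivial_limit_within[unfolded trivial_limit_def, symmetric] closure_def)
    (metis at_within_eq_bot_iff closure_def UnI2 mem_Collect_eq trivial_limit_within)
  have "(G \<longlongrightarrow> G x) (at x within closure \<Omega>)" using G(1) xf by (simp add: continuous_on)
  then have "(G \<longlongrightarrow> G x) (at x within \<Omega>)" by (rule tendsto_within_subset) (rule closure_subset)
  then have "((%y. norm (G y)) \<longlongrightarrow> norm (G x)) (at x within \<Omega>)" by (rule tendsto_norm)
  moreover have "\<forall>\<^sub>F y in at x within \<Omega>. norm (G y) = norm (grad u y)" using G(2) by (simp add: eventually_at_filter)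
  ultimately show "((%y. norm (grad u y)) \<longlongrightarrow> norm (G x)) (at x within \<Omega>)" using tendsto_cong by fastforce
 qed
 define N where "N = Sup ((%x. norm (G x)) ` \<Gamma>)"
 have img: "bdry_grad_norm \<Omega> u ` \<Gamma> = (%x. norm (G x)) ` \<Gamma>" using b by (auto intro!: image_cong)
 have t: "nwss \<Omega> u \<Gamma> = N/sqrt (2*M)" by (simp add: nwss_def N_def img)
 have "compact ((%x. norm (G x)) ` \<Gamma>)"
  by (intro compact_continuous_image continuous_intros continuous_on_subset[OF G(1) sub'] cp)
 then have bd: "bdd_above ((%x. norm (G x)) ` \<Gamma>)" by (intro bounded_imp_bdd_above compact_imp_bounded)
 have le: "norm (G x) <= N" if "x \<in> \<Gamma>" for x unfolding N_def using bd that by (intro cSup_upper) auto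
 obtain z where z: "z \<in> \<Gamma>" using ne by blast
 have N0: "0 <= N" using le[OF z] norm_ge_zero order_trans by blast
 then show "0 <= nwss \<Omega> u \<Gamma>" using M_pos by (simp add: t)
 have t2: "2*M*(nwss \<Omega> u \<Gamma>)^2 = N^2" using M_pos by (simp add: t power_divide)
 show "u x = 0 & G x \<bullet> G x <= 2*M*(nwss \<Omega> u \<Gamma>)^2" if "x \<in> \<Gamma>" for x
 proof -
  have "u x = 0" by (rule bc[OF subsetD[OF sub that]])
  moreover have "(norm (G x))^2 <= N^2" using le[OF that] by (intro power_mono) auto
  ultimately show ?thesis by (simp add: t2 power2_norm_eq_inner)
 qed
 show "(nwss \<Omega> u \<Gamma>)^2 = K" if K: "!!x. x \<in> \<Gamma> ==> G x \<bullet> G x = 2*M*K"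
 proof -
  have "norm (G x) = sqrt (2*M*K)" if "x \<in> \<Gamma>" for x using K[OF that] by (simp add: norm_eq_sqrt_inner)
  then have "(%x. norm (G x)) ` \<Gamma> = {sqrt (2*M*K)}" using z by auto
  then have "N = sqrt (2*M*K)" by (simp add: N_def)
  moreover have "0 <= 2*M*K" using K[OF z] inner_ge_zero[of "G z"] by simp
  ultimately have "2*M*(nwss \<Omega> u \<Gamma>)^2 = 2*M*K" using t2 by simp
  then show ?thesis using M_pos by simp
 qed
qed

text \<open>If equality never occurs away from the core, the comparison is strict on a level set near the core,
 and there a model with smaller \<open>\<rho>\<close> is still a barrier.\<close>
lemma strict_side_improves:
 assumes G: "continuous_on (closure \<Omega>) G" "!!x. x \<in> \<Omega> ==> G x = grad u x"
  and V: "V \<subseteq> \<Omega>" "open V" "frontier V \<subseteq> E \<union> \<Gamma>" and \<Gamma>: "!!x. x \<in> \<Gamma> ==> u x = 0" and \<rho>: "\<rho> > 0"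
  and strict: "!!x. x \<in> V ==> x \<in> \<Omega>' ==> W x < mprofile DIM('a) 1 \<rho> 0 (dep x)"
 shows "\<exists>\<rho>'. 0 < \<rho>' & \<rho>' < \<rho> & (\<forall>x\<in>V. dep x < M/2 --> W x <= mprofile DIM('a) 1 \<rho>' 0 (dep x))"
proof -
 let ?n = "DIM('a)"
 \<comment> \<open>Any level strictly between 0 and M works: it is compact in the open side V,
   because the depth on the frontier of V is 0 or M.\<close>
 define \<delta> where "\<delta> = M/2"
 have \<delta>: "0 < \<delta>" "\<delta> < M" using M_pos by (simp_all add: \<delta>_def)
 define P where "P \<rho> = mprofile ?n 1 \<rho> 0 \<delta>" for \<rho> :: real
 have cl: "closure V \<subseteq> closure \<Omega>" using V by (intro closure_mono)
 define K where "K = {x \<in> closure V. dep x = \<delta>}"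
 have fr: "dep x = 0 \<or> dep x = M" if "x \<in> frontier V" for x
 proof (cases "x \<in> \<Gamma>")
  case False
  then have "x \<in> MX" using V(3) that E_MX by blast
  then show ?thesis by (simp add: MAXset_def)
 qed (simp add: \<Gamma>)
 have KV: "K \<subseteq> V"
 proof
  fix x assume x: "x \<in> K"
  then have "x \<notin> frontier V" using fr[of x] \<delta> by (auto simp: K_def)
  then show "x \<in> V" using x V(2) by (simp add: K_def frontier_def interior_open)
 qed
 have KO: "K \<subseteq> \<Omega>'" using KV V(1) \<delta> by (auto simp: K_def)
 have "closed K" unfolding K_def
  by (rule continuous_closed_preimage_constant) (intro continuous_intros continuous_on_subset[OF cont cl], simp)
 then have "compact (K \<inter> closure \<Omega>)" using closure_compact by (intro closed_Int_compact)
 moreover have "K \<inter> closure \<Omega> = K" using cl by (auto simp: K_def)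
 ultimately have Kc: "compact K" by simp
 obtain m where m: "m < P \<rho>" "!!x. x \<in> K ==> W x <= m"
 proof (cases "K = {}")
  case True then show ?thesis using that[of "P \<rho>-1"] by simp
 next
  case False
  have "continuous_on K W" using KO by (intro continuous_intros continuous_on_subset[OF grad_cont]) auto
  then obtain w where w: "w \<in> K" "!!x. x \<in> K ==> W x <= W w" using continuous_attains_sup[OF Kc False] by blast
  have "W w < P \<rho>" using strict[of w] w(1) KV KO unfolding P_def by (auto simp: K_def)
  then show ?thesis using that w by blast
 qed
 have Pe: "P = (%\<rho>. \<rho>^2*(mphi ?n (mpsi ?n 1 (\<delta>/\<rho>^2)))^2)" by (simp add: P_def mprofile_def Let_def fun_eq_iff)
 have "isCont P \<rho>"
 proof -
  have d: "\<delta>/\<rho>^2 > 0" using \<delta> \<rho> by simp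
  have i1: "isCont (%\<rho>. \<delta>/\<rho>^2) \<rho>" using \<rho> by (intro continuous_intros) auto
  have i2: "isCont (mpsi ?n 1) (\<delta>/\<rho>^2)" by (rule DERIV_isCont[OF mpsi_deriv[OF dim _ d]]) simp
  have i3: "isCont (mphi ?n) (mpsi ?n 1 (\<delta>/\<rho>^2))" by (rule DERIV_isCont[OF mphi_deriv]) (rule mpsi_pos[OF dim]; use d in simp)
  show ?thesis unfolding Pe
   by (intro continuous_intros isCont_o2[OF isCont_o2[OF i1 i2] i3])
 qed
 then obtain d where d: "d > 0" "!!x. dist x \<rho> < d ==> dist (P x) (P \<rho>) < P \<rho>-m"
  using m(1) unfolding continuous_at_eps_delta by (metis diff_gt_0_iff_gt)
 \<comment> \<open>Slightly smaller than \<rho>, yet close enough that the profile at depth \<delta>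
   still exceeds the maximum m of W on the level set.\<close>
 define \<rho>' where "\<rho>' = max (\<rho>/2) (\<rho>-d/2)"
 have \<rho>': "0 < \<rho>'" "\<rho>' < \<rho>" "dist \<rho>' \<rho> < d" using \<rho> d(1) by (auto simp: \<rho>'_def dist_real_def)
 have mP: "m <= P \<rho>'" using d(2)[OF \<rho>'(3)] by (simp add: dist_real_def abs_less_iff)
 define V3 where "V3 = V \<inter> {x \<in> \<Omega>. dep x < \<delta>}"
 have "open {x \<in> \<Omega>. dep x < \<delta>}"
  using continuous_open_preimage[OF _ op open_lessThan[of \<delta>], of dep] continuous_on_subset[OF cont closure_subset]
  by (simp add: vimage_def Int_def continuous_intros)
 then have V3: "V3 \<subseteq> \<Omega>" "open V3" using V unfolding V3_def by blast+
 have fr3: "G x \<bullet> G x <= mprofile ?n 1 \<rho>' 0 (dep x)" if x: "x \<in> frontier V3" for x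
 proof -
  have xc: "x \<in> closure V3" "x \<notin> V3" using x V3(2) by (auto simp: frontier_def interior_open)
  have "closure V3 \<subseteq> closure V" unfolding V3_def by (intro closure_mono) auto
  then have xV: "x \<in> closure V" using xc by blast
  have "V3 \<subseteq> {x \<in> closure V. dep x <= \<delta>}" unfolding V3_def using closure_subset by auto
  moreover have "closed {x \<in> closure V. dep x <= \<delta>}"
   using continuous_closed_preimage[OF _ closed_closure closed_atMost[of \<delta>], of V dep] continuous_on_subset[OF cont cl]
   by (simp add: vimage_def Int_def continuous_intros)
  ultimately have dx: "dep x <= \<delta>" using closure_minimal xc(1) by blast
  show ?thesis
  proof (cases "x \<in> V")
   case True
   then have "\<not> dep x < \<delta>" using xc(2) V(1) by (auto simp: V3_def)
   then have "x \<in> K" using dx xV by (simp add: K_def)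
   then have "W x <= P \<rho>'" "dep x = \<delta>" using m(2) mP by (auto simp: K_def intro: order_trans)
   then show ?thesis using G(2) True V(1) by (auto simp: P_def)
  next
   case False
   then have "x \<in> frontier V" using xV V(2) by (simp add: frontier_def interior_open)
   then have "x \<in> E" using V(3) \<Gamma> dx \<delta> by force
   then have "x \<in> MX" "x \<in> \<Omega>" using E_MX E_Omega by blast+
   then have "G x = 0" using G(2) MX_grad by simp
   then show ?thesis by (simp add: mprofile_nonneg)
  qed
 qed
 have "W x <= mprofile ?n 1 \<rho>' 0 (dep x)" if "x \<in> V" "dep x < \<delta>" for x
  by (rule model_barrier[OF _ \<rho>'(1) G V3 fr3]) (use that V(1) in \<open>auto simp: V3_def\<close>)
 then show ?thesis using \<rho>' unfolding \<delta>_def by blast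
qed

text \<open>Similarity turns u into an explicit radial function on an annulus, and by connectedness
  the component lies on one of the two spheres. Which one is left open; both radii have the same
  depth, and the size of the stress decides later.\<close>

lemma equiv_model_nwss:
 assumes G: "continuous_on (closure \<Omega>) G" "!!x. x \<in> \<Omega> ==> G x = grad u x" and \<Gamma>: "\<Gamma> \<in> components (frontier \<Omega>)"
  and y: "0 < y" "y < 1" and eq: "equiv_sol (Omega_model DIM('a) (mR DIM('a) y)) (u_model DIM('a) (mR DIM('a) y)) \<Omega> u"
 shows "\<exists>z. 0 < z & z ~= 1 & mT DIM('a) z = mT DIM('a) y & (nwss \<Omega> u \<Gamma>)^2 = mratio DIM('a) z"
proof -
 let ?n = "DIM('a)"
 define R where "R = mR ?n y"
 have R: "R > 0" using mR_props(1)[OF dim y(1)] by (simp add: R_def)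
 have Ty: "0 < mT ?n y" using y by (intro mT_pos[OF dim]) auto
 define b where "b = mpsi ?n 1 (mT ?n y)"
 have b: "0 < b" "1 < b" "mT ?n b = mT ?n y" using mpsi_pos[OF dim, of 1 "mT ?n y"] mpsi_side(1)[OF dim _ Ty, of 1] mpsi(2)[OF dim, of 1 "mT ?n y"] Ty by (auto simp: b_def)
 have "R = mR ?n b" using b(3) by (simp add: R_def mR_def)
 then have radii: "r1 ?n R = R*y" "r2 ?n R = R*b" using model_radii(1)[OF dim y] model_radii(2)[OF dim b(1,2)] by (auto simp: R_def)
 obtain k c where k: "k > 0" and img: "\<Omega> = (%x. k *R x+c) ` Omega_model ?n R" and val: "!!x. x \<in> \<Omega> ==> u x = k^2*u_model ?n R ((1/k) *R (x-c))"
  using eq unfolding equiv_sol_def R_def by blast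
 define \<rho> where "\<rho> = k * R"
 have \<rho>: "\<rho> > 0" using k R by (simp add: \<rho>_def)
 have mem: "x \<in> \<Omega> \<longleftrightarrow> \<rho>*y < norm (x-c) & norm (x-c) < \<rho>*b" for x
 proof
  assume "x \<in> \<Omega>"
  then obtain z where z: "x = k *R z+c" "R*y < norm z" "norm z < R*b" unfolding img by (auto simp: Omega_model_def radii)
  have "k*(R*y) < k*norm z" "k*norm z < k*(R*b)" using z k by simp_all
  then show "\<rho>*y < norm (x-c) & norm (x-c) < \<rho>*b" using z(1) k by (simp add: \<rho>_def mult.assoc)
 next
  assume x: "\<rho>*y < norm (x-c) & norm (x-c) < \<rho>*b"
  have "norm ((1/k) *R (x-c)) = norm (x-c)/k" using k by simp
  then have "(1/k) *R (x-c) \<in> Omega_model ?n R"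
   unfolding Omega_model_def radii mem_Collect_eq using x k by (simp only: \<rho>_def pos_less_divide_eq pos_divide_less_eq mult_ac)
  moreover have "x = k *R ((1/k) *R (x-c))+c" using k by simp
  ultimately show "x \<in> \<Omega>" unfolding img by blast
 qed
 have xc: "x ~= c" if "\<rho>*y <= norm (x-c)" for x using that mult_pos_pos[OF \<rho> y(1)] by auto
 have ux: "u x = \<rho>^2*(mT ?n y-mT ?n (norm (x-c)/\<rho>))" if x: "x \<in> \<Omega>" for x
 proof -
  define w where "w = norm (x-c)/\<rho>"
  have w: "w > 0" using xc[of x] mem[of x] x \<rho> by (simp add: w_def)
  have nw: "norm ((1/k) *R (x-c)) = R*w" using k R by (simp add: w_def \<rho>_def)
  show ?thesis unfolding val[OF x] using u_model_scaled[OF dim y(1) w nw[unfolded R_def]]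
   by (simp add: R_def \<rho>_def w_def power_mult_distrib)
 qed
 have M: "M = \<rho>^2*mT ?n y"
 proof (rule antisym)
  obtain x where x: "x \<in> \<Omega>" "u x = M" using max_attained by blast
  have "0 <= mT ?n (norm (x-c)/\<rho>)" using xc[of x] mem[of x] x \<rho> by (intro mT_nonneg[OF dim]) simp
  then have "\<rho>^2*(mT ?n y-mT ?n (norm (x-c)/\<rho>)) <= \<rho>^2*mT ?n y" by (intro mult_left_mono) auto
  then show "M <= \<rho>^2*mT ?n y" using ux[OF x(1)] x(2) by simp
  obtain e :: 'a where e: "e \<in> Basis" using nonempty_Basis by blast
  define z where "z = c+\<rho> *R e"
  have nz: "norm (z-c) = \<rho>" using e \<rho> by (simp add: z_def)
  then have zO: "z \<in> \<Omega>" using mem[of z] \<rho> y b by simp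
  from u_le_M[OF this] show "\<rho>^2*mT ?n y <= M" using ux[OF zO] nz \<rho> mT_1[OF dim] by simp
 qed
 have Wx: "W x = (\<rho>*mphi ?n (norm (x-c)/\<rho>))^2" if x: "x \<in> \<Omega>" for x
 proof -
  have x0: "x-c ~= 0" using xc[of x] mem[of x] x by auto
  define w where "w = norm (x-c)/\<rho>"
  have w: "w > 0" using x0 \<rho> by (simp add: w_def)
  have d1: "((%x. norm (x-c)) has_derivative (%v. sgn (x-c) \<bullet> v)) (at x)"
  proof -
   have "((%x. x-c) has_derivative (%v. v)) (at x)" by (auto intro!: derivative_eq_intros)
   from has_derivative_compose[OF this has_derivative_norm[OF x0]] show ?thesis by (simp add: inner_commute)
  qed
  have d2: "((%x. norm (x-c)/\<rho>) has_derivative (%v. sgn (x-c) \<bullet> v/\<rho>)) (at x)"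
   using has_derivative_mult_left[OF d1, of "1/\<rho>"] by simp
  have "((%x. mT ?n (norm (x-c)/\<rho>)) has_derivative (%v. mphi ?n w*(sgn (x-c) \<bullet> v/\<rho>))) (at x)"
   using has_derivative_compose[OF d2] mT_deriv[OF dim w] unfolding has_field_derivative_def w_def by blast
  then have "((%x. \<rho>^2*(mT ?n y-mT ?n (norm (x-c)/\<rho>))) has_derivative (%v. \<rho>^2*(0-mphi ?n w*(sgn (x-c) \<bullet> v/\<rho>)))) (at x)"
   by (intro has_derivative_mult_right has_derivative_diff has_derivative_const)
  then have "frechet_derivative (%x. \<rho>^2*(mT ?n y-mT ?n (norm (x-c)/\<rho>))) (at x) = (%v. \<rho>^2*(0-mphi ?n w*(sgn (x-c) \<bullet> v/\<rho>)))"
   by (rule frechet_derivative_eqI)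
  then have "frechet_derivative u (at x) = (%v. \<rho>^2*(0-mphi ?n w*(sgn (x-c) \<bullet> v/\<rho>)))"
   using frechet_derivative_cong_open[OF op x ux] by simp
  then have "grad u x \<bullet> v = (- \<rho>*mphi ?n w) *R sgn (x-c) \<bullet> v" for v
   using grad_inner[OF x, of v] \<rho> by (simp add: power2_eq_square)
  then have "grad u x = (- \<rho>*mphi ?n w) *R sgn (x-c)" by (metis vector_eq_rdot)
  moreover have "sgn (x-c) \<bullet> sgn (x-c) = 1" using x0 by (simp add: norm_sgn flip: norm_eq_1)
  ultimately show ?thesis by (simp add: w_def power2_eq_square)
 qed
 have frx: "(norm (x-c) = \<rho>*y \<or> norm (x-c) = \<rho>*b) & G x \<bullet> G x = (\<rho>*mphi ?n (norm (x-c)/\<rho>))^2" if x: "x \<in> frontier \<Omega>" for x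
 proof -
  have xcl: "x \<in> closure \<Omega>" "x \<notin> \<Omega>" using x op by (auto simp: frontier_def interior_open)
  obtain X where X: "!!i. X i \<in> \<Omega>" "X \<longlonglongrightarrow> x" using xcl(1) closure_sequential by blast
  have nl: "(%i. norm (X i-c)) \<longlonglongrightarrow> norm (x-c)" by (intro tendsto_intros X(2))
  have lo: "\<rho>*y <= norm (x-c)" by (rule LIMSEQ_le_const[OF nl]) (use mem X(1) in \<open>auto intro: less_imp_le\<close>)
  moreover have "norm (x-c) <= \<rho>*b" by (rule LIMSEQ_le_const2[OF nl]) (use mem X(1) in \<open>auto intro: less_imp_le\<close>)
  ultimately have n: "norm (x-c) = \<rho>*y \<or> norm (x-c) = \<rho>*b" using mem[of x] xcl(2) by linarith
  have l: "(%i. G (X i) \<bullet> G (X i)) \<longlonglongrightarrow> G x \<bullet> G x"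
   by (intro tendsto_inner continuous_on_tendsto_compose[OF G(1) X(2) xcl(1)]) (simp_all add: X(1) closure_subset[THEN subsetD])
  have l': "(%i. (\<rho>*mphi ?n (norm (X i-c)/\<rho>))^2) \<longlonglongrightarrow> (\<rho>*mphi ?n (norm (x-c)/\<rho>))^2"
  proof -
   have "0 < norm (x-c)/\<rho>" using xc[OF lo] \<rho> by simp
   note isCont_tendsto_compose[OF DERIV_isCont[OF mphi_deriv[OF this]] tendsto_divide[OF nl tendsto_const]]
   then show ?thesis using \<rho> by (intro tendsto_power tendsto_mult_left) simp
  qed
  have "(%i. G (X i) \<bullet> G (X i)) = (%i. (\<rho>*mphi ?n (norm (X i-c)/\<rho>))^2)" using Wx[OF X(1)] G(2)[OF X(1)] by simp
  then have "G x \<bullet> G x = (\<rho>*mphi ?n (norm (x-c)/\<rho>))^2" by (intro LIMSEQ_unique[OF l]) (simp only: l')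
  with n show ?thesis ..
 qed
 have sub: "\<Gamma> \<subseteq> frontier \<Omega>" by (rule in_components_subset[OF \<Gamma>])
 \<comment> \<open>The core radius lies strictly between the two boundary radii, so the sign of
   |x-c| - \<rho> tells the spheres apart.\<close>
 have "(\<forall>x\<in>\<Gamma>. norm (x-c)-\<rho> > 0) \<or> (\<forall>x\<in>\<Gamma>. norm (x-c)-\<rho> < 0)"
 proof (rule connected_sign[OF in_components_connected[OF \<Gamma>]])
  show "continuous_on \<Gamma> (%x. norm (x-c)-\<rho>)" by (intro continuous_intros)
  show "norm (x-c)-\<rho> ~= 0" if "x \<in> \<Gamma>" for x
  proof -
   have "norm (x-c) = \<rho>*y \<or> norm (x-c) = \<rho>*b" using frx[OF subsetD[OF sub that]] by simp
   then show ?thesis using mult_strict_left_mono[OF y(2) \<rho>] mult_strict_left_mono[OF b(2) \<rho>] by linarith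
  qed
 qed
 then have "\<exists>z. (z = y \<or> z = b) & (\<forall>x\<in>\<Gamma>. norm (x-c) = \<rho>*z)"
 proof
  assume h: "\<forall>x\<in>\<Gamma>. norm (x-c)-\<rho> > 0"
  have "norm (x-c) = \<rho>*b" if "x \<in> \<Gamma>" for x
   using frx[of x] sub that h y mult_strict_left_mono[OF y(2) \<rho>] by force
  then show ?thesis by blast
 next
  assume h: "\<forall>x\<in>\<Gamma>. norm (x-c)-\<rho> < 0"
  have "norm (x-c) = \<rho>*y" if "x \<in> \<Gamma>" for x
   using frx[of x] sub that h y mult_strict_left_mono[OF b(2) \<rho>] by force
  then show ?thesis by blast
 qed
 then obtain z where z: "z = y \<or> z = b" "!!x. x \<in> \<Gamma> ==> norm (x-c) = \<rho>*z" by blast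
 have zp: "0 < z" "z ~= 1" "mT ?n z = mT ?n y" using z(1) y b by auto
 have "G x \<bullet> G x = 2*M*mratio ?n z" if "x \<in> \<Gamma>" for x
  using frx[of x] sub that z(2)[OF that] \<rho> Ty by (auto simp: M mratio_def zp(3) power_mult_distrib subset_iff)
 from nwss_props(3)[OF G \<Gamma> this] show ?thesis using zp by blast
qed

end

theorem theorem2p2:
  fixes \<Omega> \<Gamma>1 \<Gamma>2 :: "'a::euclidean_space set" and u :: "'a \<Rightarrow> real"
  assumes dim: "DIM('a) \<ge> 3"
    and ring: "ring_shaped \<Omega> \<Gamma>1 \<Gamma>2"
    and smooth: "smooth_boundary \<Omega>"
    and C2: "Ck_on 2 \<Omega> u"
    and cont: "continuous_on (closure \<Omega>) u"
    and C1bar: "\<exists>G. continuous_on (closure \<Omega>) G \<and> (\<forall>x\<in>\<Omega>. G x = grad u x)"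
    and pde: "\<forall>x\<in>\<Omega>. laplacian u x = - real DIM('a)"
    and bc: "\<forall>x\<in>frontier \<Omega>. u x = 0"
    and hmax: "hausdorff_measure (real DIM('a) - 1) (MAXset \<Omega> u) > 0"
  shows "(\<exists>!R. core_radius_rel DIM('a) (nwss \<Omega> u \<Gamma>1) R)
       \<and> (\<exists>!R. core_radius_rel DIM('a) (nwss \<Omega> u \<Gamma>2) R)
       \<and> (nwss \<Omega> u \<Gamma>2 < sqrt (real DIM('a)) \<longrightarrow>
            (let R1 = core_radius DIM('a) (nwss \<Omega> u \<Gamma>1);
                 R2 = core_radius DIM('a) (nwss \<Omega> u \<Gamma>2)
             in R1 \<le> R2 \<and> 0 < R1 \<and>
                (R1 = R2 \<longleftrightarrow> equiv_sol (Omega_model DIM('a) R1) (u_model DIM('a) R1) \<Omega> u)))"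
proof -
 have comps: "components (frontier \<Omega>) = {\<Gamma>1, \<Gamma>2}" "\<Gamma>1 ~= \<Gamma>2" using ring by (auto simp: ring_shaped_def)
 interpret torsion \<Omega> u
  using dim ring C2 cont pde bc by unfold_locales (auto simp: ring_shaped_def)
 let ?n = "DIM('a)"
 define n where "n = real ?n"
 have n: "n >= 3" using dim by (simp add: n_def)
 obtain G where G: "continuous_on (closure \<Omega>) G" "!!x. x \<in> \<Omega> ==> G x = grad u x" using C1bar by blast
 have g: "\<Gamma>1 \<in> components (frontier \<Omega>)" "\<Gamma>2 \<in> components (frontier \<Omega>)" using comps by auto
 have En: "E ~= {}" by (rule E_nonempty[OF hmax])
 obtain V1 V2 where V1: "open V1" "V1 \<subseteq> \<Omega>" "frontier V1 \<subseteq> E \<union> \<Gamma>1" and V2: "open V2" "V2 \<subseteq> \<Omega>" "frontier V2 \<subseteq> E \<union> \<Gamma>2"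
  and sides: "!!p. p \<in> E ==> \<exists>\<nu>. norm \<nu> = 1 & (\<forall>h. hess p h = (- real DIM('a)*(\<nu> \<bullet> h)) *R \<nu>) &
    (\<exists>s0>0. \<forall>s. 0 < s & s < s0 --> p+s *R \<nu> \<in> V2 & p-s *R \<nu> \<in> V1)"
  by (rule two_sides[OF comps En]) (rule that, assumption+)
 obtain p where pE: "p \<in> E" using En by blast
 then have p: "p \<in> MX" using E_MX by blast
 from sides[OF pE] obtain \<nu> s0 where \<nu>: "norm \<nu> = 1" and "\<forall>h. hess p h = (- real DIM('a)*(\<nu> \<bullet> h)) *R \<nu>"
  and s0: "s0 > 0" "\<forall>s. 0 < s & s < s0 --> p+s *R \<nu> \<in> V2 & p-s *R \<nu> \<in> V1" by (elim exE conjE)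
 then have H: "!!h. hess p h = (- real DIM('a)*(\<nu> \<bullet> h)) *R \<nu>" by blast
 have ev2: "\<forall>\<^sub>F s in at_right 0. p+s *R \<nu> \<in> V2"
  using s0 by (auto simp: eventually_at intro!: exI[of _ s0])
 have ev1: "\<forall>\<^sub>F s in at_left 0. p+s *R \<nu> \<in> V1"
 proof -
  have "p+s *R \<nu> \<in> V1" if "s < 0" "- s < s0" for s using s0(2)[rule_format, of "- s"] that by simp
  then show ?thesis using s0(1) by (auto simp: eventually_at intro!: exI[of _ s0])
 qed
 have side1: "at 0 within {s. 0 < 1 * s} = at_right (0::real)" "at 0 within {s. 0 < - 1 * s} = at_left (0::real)"
  by (simp_all add: greaterThan_def lessThan_def)
 have onE: "G x = 0 & dep x = 0" if "x \<in> E" for x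
 proof -
  have "x \<in> MX" "x \<in> \<Omega>" using that E_MX E_Omega by blast+
  then show ?thesis using G(2) MX_grad by (simp add: MAXset_def)
 qed
 define t1 where "t1 = nwss \<Omega> u \<Gamma>1"
 define t2 where "t2 = nwss \<Omega> u \<Gamma>2"
 note N1 = nwss_props(1)[OF G g(1), folded t1_def] and N2 = nwss_props(1)[OF G g(2), folded t2_def]
 have t0: "0 <= t1" "0 <= t2" using nwss_props(2)[OF G g(1)] nwss_props(2)[OF G g(2)] by (simp_all add: t1_def t2_def)
 have linear: "W x <= 2*\<kappa>*dep x" if \<kappa>: "\<kappa> \<in> {1, n}" and V: "open V" "V \<subseteq> \<Omega>" "frontier V \<subseteq> E \<union> \<Gamma>"
  and N: "!!x. x \<in> \<Gamma> ==> u x = 0 & G x \<bullet> G x <= 2*M*t^2" and t: "t^2 <= \<kappa>" and x: "x \<in> V" for \<kappa> V \<Gamma> t x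
 proof (rule linear_barrier[OF G V(2,1) _ _ x])
  show "\<kappa> \<in> {1, real ?n}" using \<kappa> by (simp add: n_def)
  fix y assume "y \<in> frontier V"
  then have "y \<in> E \<or> y \<in> \<Gamma>" using V(3) by blast
  then show "G y \<bullet> G y <= 2*\<kappa>*dep y"
  proof
   assume "y \<in> E" then show ?thesis using onE by simp
  next
   assume y: "y \<in> \<Gamma>"
   have "2*M*t^2 <= 2*M*\<kappa>" using t M_pos by (intro mult_left_mono) auto
   then show ?thesis using N[OF y] by (simp add: mult_ac)
  qed
 qed
 have sq: "t^2 <= 1" if "t <= 1" "0 <= t" for t :: real using that by (simp add: power_le_one)
 \<comment> \<open>With stress at most 1 the linear barrier of slope 2 would hold on this side up to
   the core, against the second-order expansion.\<close>
 have t1: "1 < t1"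
 proof (rule ccontr)
  assume "\<not> 1 < t1"
  then have "t1^2 <= 1" using sq t0 by simp
  from linear[OF _ V1 N1 this] have "\<forall>\<^sub>F s in at_left 0. W (p+s *R \<nu>) <= 2*dep (p+s *R \<nu>)"
   using ev1 by (simp add: eventually_mono)
  then show False using linear_comparison_at_core(1)[OF p \<nu> H, of "at_left 0"] by (simp add: at_le)
 qed
 have t2: "1 < t2"
 proof (rule ccontr)
  assume "\<not> 1 < t2"
  then have "t2^2 <= 1" using sq t0 by simp
  from linear[OF _ V2 N2 this] have "\<forall>\<^sub>F s in at_right 0. W (p+s *R \<nu>) <= 2*dep (p+s *R \<nu>)"
   using ev2 by (simp add: eventually_mono)
  then show False using linear_comparison_at_core(1)[OF p \<nu> H, of "at_right 0"] by (simp add: at_le)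
 qed
 \<comment> \<open>The radius \<rho> and the parameter y are matched to the maximum M and to the
   stress t, so that at boundary depth M the profile equals 2 M t^2, the largest squared gradient on
   \<Gamma>.\<close>
 have model: "W x <= mprofile ?n e \<rho> 0 (dep x)"
  if e: "e \<in> {1, -1}" and \<rho>: "\<rho> > 0" and y: "y \<in> branch e" "mT ?n y = M/\<rho>^2" "mratio ?n y = t^2"
   and V: "open V" "V \<subseteq> \<Omega>" "frontier V \<subseteq> E \<union> \<Gamma>" and N: "!!x. x \<in> \<Gamma> ==> u x = 0 & G x \<bullet> G x <= 2*M*t^2"
   and x: "x \<in> V" for e \<rho> y V \<Gamma> t x
 proof (rule model_barrier[OF e \<rho> G V(2,1) _ x])
  fix z assume "z \<in> frontier V"
  then have "z \<in> E \<or> z \<in> \<Gamma>" using V(3) by blast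
  then show "G z \<bullet> G z <= mprofile ?n e \<rho> 0 (dep z)"
  proof
   assume "z \<in> E" then show ?thesis using onE by (simp add: mprofile_nonneg)
  next
   assume z: "z \<in> \<Gamma>"
   have "mpsi ?n e (M/\<rho>^2) = y" using mpsi_mT[OF dim e y(1)] y(2) by simp
   moreover have "\<rho>^2*(mphi ?n y)^2 = 2*M*t^2"
    using y(2) M_pos \<rho> by (simp add: y(3)[symmetric] mratio_def)
   ultimately show ?thesis using N[OF z] by (simp add: mprofile_def Let_def)
  qed
 qed
 have main: "(let R1 = core_radius ?n t1; R2 = core_radius ?n t2 in R1 <= R2 & 0 < R1 &
   (R1 = R2 \<longleftrightarrow> equiv_sol (Omega_model ?n R1) (u_model ?n R1) \<Omega> u))" if t2n: "t2 < sqrt (real ?n)"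
 proof -
  obtain y2 where y2: "y2 > 1" "mratio ?n y2 = t2^2" "!!R. core_radius_rel ?n t2 R \<longleftrightarrow> R = mR ?n y2"
   by (rule core_radius_outer[OF dim t2 t2n]) (rule that)
  \<comment> \<open>The actual core radius of the matched model, whose depth at radius \<rho>2 y2 is
    M. The expected core radius is its normalised counterpart; for fixed M both decrease as the
    depth parameter \<open>mT\<close> grows.\<close>
  define \<rho>2 where "\<rho>2 = sqrt (M/mT ?n y2)"
  have T2: "mT ?n y2 > 0" using y2(1) by (intro mT_pos[OF dim]) auto
  have \<rho>2: "\<rho>2 > 0" "mT ?n y2 = M/\<rho>2^2" using T2 M_pos by (simp_all add: \<rho>2_def)
  have W2: "W x <= mprofile ?n 1 \<rho>2 0 (dep x)" if "x \<in> V2" for x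
   by (rule model[OF _ \<rho>2(1) _ \<rho>2(2) y2(2) V2 N2 that]) (use y2(1) in \<open>auto simp: branch_def\<close>)
  have c2: "n*(n-1)/\<rho> <= kap p \<nu>" if \<rho>: "\<rho> > 0"
   and le: "\<forall>\<^sub>F s in at_right 0. W (p+s *R \<nu>) <= mprofile ?n 1 \<rho> 0 (dep (p+s *R \<nu>))" for \<rho>
   using model_comparison_at_core[OF p \<nu> H, of 1 \<rho>] \<rho> le unfolding side1 n_def by simp
  have k2: "n*(n-1)/\<rho>2 <= kap p \<nu>" by (rule c2[OF \<rho>2(1)]) (rule eventually_mono[OF ev2], rule W2)
  have "0 < n*(n-1)/\<rho>2" using n \<rho>2(1) by simp
  then have kpos: "0 < kap p \<nu>" using k2 by simp
  \<comment> \<open>Otherwise the linear barrier of critical slope 2n holds on the inner side and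
    makes \<open>kap\<close> nonpositive, whereas the outer side has just shown it positive.\<close>
  have t1n: "sqrt (real ?n) < t1"
  proof (rule ccontr)
   assume "\<not> sqrt (real ?n) < t1"
   then have "t1^2 <= (sqrt (real ?n))^2" using t0 by (intro power_mono) auto
   then have "t1^2 <= n" by (simp add: n_def)
   from linear[OF _ V1 N1 this] have "\<forall>\<^sub>F s in at_left 0. W (p+s *R \<nu>) <= 2*real ?n*dep (p+s *R \<nu>)"
    using ev1 by (simp add: eventually_mono n_def)
   from linear_comparison_at_core(2)[OF p \<nu> H this] kpos show False by simp
  qed
  obtain y1 where y1: "0 < y1" "y1 < 1" "mratio ?n y1 = t1^2" "!!R. core_radius_rel ?n t1 R \<longleftrightarrow> R = mR ?n y1"
   by (rule core_radius_inner[OF dim t1n]) (rule that)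
  define \<rho>1 where "\<rho>1 = sqrt (M/mT ?n y1)"
  have T1: "mT ?n y1 > 0" using y1(1,2) by (intro mT_pos[OF dim]) auto
  have \<rho>1: "\<rho>1 > 0" "mT ?n y1 = M/\<rho>1^2" using T1 M_pos by (simp_all add: \<rho>1_def)
  have W1: "W x <= mprofile ?n (-1) \<rho>1 0 (dep x)" if "x \<in> V1" for x
   by (rule model[OF _ \<rho>1(1) _ \<rho>1(2) y1(3) V1 N1 that]) (use y1(1,2) in \<open>auto simp: branch_def\<close>)
  have k1: "kap p \<nu> <= n*(n-1)/\<rho>1"
  proof -
   have "\<forall>\<^sub>F s in at_left 0. W (p+s *R \<nu>) <= mprofile ?n (-1) \<rho>1 0 (dep (p+s *R \<nu>))"
    by (rule eventually_mono[OF ev1], rule W1)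
   then show ?thesis using model_comparison_at_core[OF p \<nu> H, of "-1" \<rho>1] \<rho>1(1) unfolding side1 n_def by simp
  qed
  have nn: "0 < n*(n-1)" using n by simp
  have cancel: "b <= a" if "n*(n-1)/a <= n*(n-1)/b" "0 < a" "0 < b" for a b
  proof -
   have "n*(n-1)*b <= n*(n-1)*a" using that by (simp add: divide_le_eq le_divide_eq mult.commute)
   then show ?thesis by (simp only: mult_le_cancel_left_pos[OF nn])
  qed
  have "n*(n-1)/\<rho>2 <= n*(n-1)/\<rho>1" using k1 k2 by linarith
  then have \<rho>12: "\<rho>1 <= \<rho>2" by (rule cancel[OF _ \<rho>2(1) \<rho>1(1)])
  then have "\<rho>1^2 <= \<rho>2^2" using \<rho>1(1) by (intro power_mono) auto
  then have T21: "mT ?n y2 <= mT ?n y1" unfolding \<rho>1(2) \<rho>2(2) using M_pos \<rho>1(1) \<rho>2(1) by (intro divide_left_mono) auto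
  have R1: "core_radius ?n t1 = mR ?n y1" and R2: "core_radius ?n t2 = mR ?n y2" unfolding core_radius_def y1(4) y2(3) by simp_all
  have y20: "0 < y2" using y2(1) by simp
  have le: "mR ?n y1 <= mR ?n y2" using mR_mono[OF dim y1(1) y20] T21 by simp
  have iff: "mR ?n y1 = mR ?n y2 \<longleftrightarrow> mT ?n y1 = mT ?n y2"
   using mR_mono[OF dim y1(1) y20] mR_mono[OF dim y20 y1(1)] by (auto intro: antisym)
  have rigid: "equiv_sol (Omega_model ?n (mR ?n y1)) (u_model ?n (mR ?n y1)) \<Omega> u" if eq: "mR ?n y1 = mR ?n y2"
  proof -
   have \<rho>eq: "\<rho>1 = \<rho>2" using eq iff by (simp add: \<rho>1_def \<rho>2_def)
   \<comment> \<open>With equal radii the third derivative is pinned to n(n-1)/\<rho>2. Strict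
     comparison everywhere would allow a smaller radius near the core and hence a larger lower
     bound, which is impossible.\<close>
   have touch: "\<exists>x0\<in>V2 \<inter> \<Omega>'. W x0 = mprofile ?n 1 \<rho>2 0 (dep x0)"
   proof (rule ccontr)
    assume no: "\<not> ?thesis"
    have "W x < mprofile ?n 1 \<rho>2 0 (dep x)" if "x \<in> V2" "x \<in> \<Omega>'" for x
     using W2[OF that(1)] no that by force
    from strict_side_improves[OF G V2(2,1,3) _ \<rho>2(1) this] N2 obtain \<rho>' where \<rho>': "0 < \<rho>'" "\<rho>' < \<rho>2"
     "!!x. x \<in> V2 ==> dep x < M/2 ==> W x <= mprofile ?n 1 \<rho>' 0 (dep x)" by blast
    have "\<forall>\<^sub>F s in at_right 0. dep (p+s *R \<nu>) < M/2"
    proof -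
     have "p+0 *R \<nu> \<in> \<Omega>" using p MX_sub by auto
     from DERIV_isCont[OF has_real_derivative_along[OF diffs(1)[OF this]]]
     have "((%s. u (p+s *R \<nu>)) \<longlongrightarrow> M) (at 0)" using p by (simp add: isCont_def MAXset_def)
     then have "\<forall>\<^sub>F s in at 0. M/2 < u (p+s *R \<nu>)" using M_pos by (intro order_tendstoD(1)) auto
     then have "\<forall>\<^sub>F s in at_right 0. M/2 < u (p+s *R \<nu>)" using filter_leD[OF at_le[OF subset_UNIV]] by blast
     then show ?thesis by (rule eventually_mono) simp
    qed
    then have "\<forall>\<^sub>F s in at_right 0. W (p+s *R \<nu>) <= mprofile ?n 1 \<rho>' 0 (dep (p+s *R \<nu>))"
     using ev2 by eventually_elim (rule \<rho>'(3))
    from c2[OF \<rho>'(1) this] have "n*(n-1)/\<rho>' <= n*(n-1)/\<rho>2" using k1 \<rho>eq by simp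
    then have "\<rho>2 <= \<rho>'" by (rule cancel[OF _ \<rho>'(1) \<rho>2(1)])
    then show False using \<rho>'(2) by simp
   qed
   then obtain x0 where x0: "x0 \<in> V2 \<inter> \<Omega>'" "W x0 = mprofile ?n 1 \<rho>2 0 (dep x0)" by blast
   have "\<exists>r>0. ball x0 r \<subseteq> V2 \<inter> \<Omega>' & (\<forall>x\<in>ball x0 r. W x-mprofile ?n 1 \<rho>2 0 (dep x) = 0)"
   proof (rule touching_imp_equal[OF _ \<rho>2(1)])
    show "W x-mprofile ?n 1 \<rho>2 0 (dep x) <= 0" if "x \<in> V2 \<inter> \<Omega>'" for x
     using W2[of x] that by simp
   qed (use x0 V2(1) open_\<Omega>' in auto)
   then obtain r where r: "r > 0" "ball x0 r \<subseteq> V2 \<inter> \<Omega>'" "\<forall>x\<in>ball x0 r. W x-mprofile ?n 1 \<rho>2 0 (dep x) = 0" by (elim exE conjE)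
   have "\<exists>c. \<forall>x\<in>ball x0 r. x ~= c & u x = M-\<rho>2^2*mT ?n (norm (x-c)/\<rho>2)"
    by (rule equality_imp_radial[OF _ \<rho>2(1) r(1)]) (use r(2,3) in auto)
   then obtain c where c: "\<forall>x\<in>ball x0 r. x ~= c & u x = M-\<rho>2^2*mT ?n (norm (x-c)/\<rho>2)" by blast
   have B: "ball x0 r \<subseteq> \<Omega>" using r(2) by blast
   have "x ~= c & u x = M-\<rho>2^2*mT ?n (norm (x-c)/\<rho>2)" if "x \<in> \<Omega>" for x
    by (rule radial_extends[OF \<rho>2(1) r(1) B bspec[OF c] that])
   then show ?thesis by (rule radial_imp_equiv[OF \<rho>2(1) _ y1(1)]) (use \<rho>1(2) \<rho>eq in simp_all)
  qed
  have conv: "mR ?n y1 = mR ?n y2" if eq: "equiv_sol (Omega_model ?n (mR ?n y1)) (u_model ?n (mR ?n y1)) \<Omega> u"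
  proof -
   from equiv_model_nwss[OF G g(2) y1(1,2) eq] obtain z where z: "0 < z" "z ~= 1" "mT ?n z = mT ?n y1" "t2^2 = mratio ?n z"
    unfolding t2_def by blast
   have "t2^2 < (sqrt (real ?n))^2" using t2n t0 by (intro power_strict_mono) auto
   then have "mratio ?n z < real ?n" using z(4) by simp
   \<comment> \<open>The hypothesis on the outer stress selects the outer sphere; on that branch the
     stress determines y, so z is y2, and the common depth gives equal radii.\<close>
   then have "1 < z" using mratio_bounds(2)[OF dim z(1)] z(2) by force
   then have "z = y2" using mratio_strict[OF dim z(1), of y2] mratio_strict[OF dim y20, of z] y2(1,2) z(4)
    by (cases z y2 rule: linorder_cases) auto
   then show ?thesis using z(3) iff by simp
  qed
  show ?thesis unfolding R1 R2 Let_def using le mR_props(1)[OF dim y1(1)] rigid conv by blast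
 qed
 show ?thesis
  using core_radius_exists_unique[OF dim t1] core_radius_exists_unique[OF dim t2] main unfolding t1_def t2_def by blast
qed

end
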